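(* The morphism $M_\Omega(n,\mathfrak e)/\Sigma_n\to M_\Omega(n)$ induced by $\pi_n$ is an isomorphism of algebraic varieties, so that $M_\Omega(n,\mathfrak e)/\Sigma_n\cong M_\Omega(n)$. In particular $\pi_n$ is a finite morphism. Furthermore $$F(n,\mathfrak e)^{\Sigma_n}\cong F(n),$$ so that, using this isomorphism as an identification, $F(n,\mathfrak e)$ is a Galois extension of $F(n)$ with Galois group $\Sigma_n$. In addition, identifying $\mathcal O(M_\Omega(n))$ with $\mathcal O(M_\Omega(n,\mathfrak e))^{\Sigma_n}$ by means of the isomorphism above, the integral closure of $\mathcal O(M_\Omega(n))$ in $F(n,\mathfrak e)$ is $\mathcal O(M_\Omega(n,\mathfrak e))$.
   Context: Fix a positive integer $n$; $I_k=\{1,\dots,k\}$, $d(k)=k(k+1)/2$. $M(n)$ is the space of complex $n\times n$ matrices; for $x\in M(n)$ and $m\in I_n$, $x_m$ is the upper left $m\times m$ block of $x$. $M_\Omega(n)$ is the Zariski open set of all $x\in M(n)$ such that $x_m$ has $m$ distinct eigenvalues for every $m\in I_n$, and $x_m,x_{m+1}$ have no common eigenvalue for every $m\in I_{n-1}$. $\mathfrak e_{\Omega(n)}$ is the set of all $\nu=(\nu(1),\dots,\nu(n))$, $\nu(m)=\mathrm{diag}(\nu_{1\,m},\dots,\nu_{m\,m})$, such that for each $m\in I_n$ the numbers $\nu_{1\,m},\dots,\nu_{m\,m}$ are distinct and $\nu_{i\,m}\ne\nu_{j\,m+1}$ for all $m\in I_{n-1}$, $i\in I_m$, $j\in I_{m+1}$;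 it is a Zariski open subset of $\mathbb C^{d(n)}$. Let $$M_\Omega(n,\mathfrak e)=\{(\nu,x)\in\mathfrak e_{\Omega(n)}\times M_\Omega(n)\mid \nu(m)\text{ is } Gl(m)\text{-conjugate to }x_m\ \forall m\in I_n\},$$ with projection $\pi_n:M_\Omega(n,\mathfrak e)\to M_\Omega(n)$, $\pi_n(\nu,x)=x$; it is a nonsingular affine variety of dimension $n^2$. The group $\Sigma_n=S_1\times\cdots\times S_n$ (product of symmetric groups) acts freely on $M_\Omega(n,\mathfrak e)$ by $\sigma\cdot(\nu,x)=(\sigma\cdot\nu,x)$, $(\sigma\cdot\nu)_{i\,m}=\nu_{\sigma_m^{-1}(i)\,m}$ for $\sigma=(\sigma_1,\dots,\sigma_n)$; it acts on functions by $(\sigma\cdot f)(z)=f(\sigma^{-1}\cdot z)$. The orbit set $M_\Omega(n,\mathfrak e)/\Sigma_n$ is the affine variety with affine ring $\mathcal O(M_\Omega(n,\mathfrak e))^{\Sigma_n}$. $F(n,\mathfrak e)$ is the quotient field of $\mathcal O(M_\Omega(n,\mathfrak e))$ and $F(n)$ is the quotient field of $\mathcal O(M(n))$ (equivalently of $\mathcal O(M_\Omega(n))$). Here $\mathcal O(X)$ is the affine ring of an affine variety $X$. *)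

theory Defs
  imports
    Complex_Main
    "HOL-Algebra.Algebra"
    "Jordan_Normal_Form.Spectral_Radius"
begin

section \<open>Affine varieties over the complex numbers\<close>

text \<open>
  An affine variety is a set of points \<open>V\<close> together with its affine ring, realised as a set \<open>A\<close> of
  complex-valued functions on \<open>V\<close> (extensional, i.e. \<open>undefined\<close> outside \<open>V\<close>).
\<close>

inductive_set poly_funs :: "('p \<Rightarrow> complex) set \<Rightarrow> ('p \<Rightarrow> complex) set"
  for C :: "('p \<Rightarrow> complex) set" where
  const: "(\<lambda>_. c) \<in> poly_funs C"
| gen: "f \<in> C \<Longrightarrow> f \<in> poly_funs C"
| add: "f \<in> poly_funs C \<Longrightarrow> g \<in> poly_funs C \<Longrightarrow> (\<lambda>p. f p + g p) \<in> poly_funs C"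
| mult: "f \<in> poly_funs C \<Longrightarrow> g \<in> poly_funs C \<Longrightarrow> (\<lambda>p. f p * g p) \<in> poly_funs C"

definition fun_ring :: "'p set \<Rightarrow> ('p \<Rightarrow> complex) set \<Rightarrow> ('p \<Rightarrow> complex) ring" where
  "fun_ring V A =
    \<lparr>carrier = A,
     monoid.mult = (\<lambda>f g. \<lambda>p\<in>V. f p * g p),
     monoid.one = (\<lambda>p\<in>V. 1),
     ring.zero = (\<lambda>p\<in>V. 0),
     ring.add = (\<lambda>f g. \<lambda>p\<in>V. f p + g p)\<rparr>"

definition alg_hom_to_complex ::
    "'p set \<Rightarrow> ('p \<Rightarrow> complex) set \<Rightarrow> (('p \<Rightarrow> complex) \<Rightarrow> complex) \<Rightarrow> bool" where
  "alg_hom_to_complex V A \<chi> \<longleftrightarrow>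
     (\<forall>c. \<chi> (\<lambda>p\<in>V. c) = c) \<and>
     (\<forall>f\<in>A. \<forall>g\<in>A. \<chi> (\<lambda>p\<in>V. f p + g p) = \<chi> f + \<chi> g \<and> \<chi> (\<lambda>p\<in>V. f p * g p) = \<chi> f * \<chi> g)"

text \<open>
  \<open>A\<close> is a finitely generated algebra of functions on \<open>V\<close>, and \<open>V\<close> is its maximal spectrum:
  every algebra homomorphism from \<open>A\<close> to the complex numbers is evaluation at a unique point.
  Irreducibility is not required.
\<close>
definition affine_variety :: "'p set \<Rightarrow> ('p \<Rightarrow> complex) set \<Rightarrow> bool" where
  "affine_variety V A \<longleftrightarrow>
     (\<exists>G. finite G \<and> A = (\<lambda>f. restrict f V) ` poly_funs G) \<and>
     (\<forall>\<chi>. alg_hom_to_complex V A \<chi> \<longrightarrow> (\<exists>!p. p \<in> V \<and> (\<forall>f\<in>A. \<chi> f = f p)))"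

definition pullback :: "'p set \<Rightarrow> ('p \<Rightarrow> 'q) \<Rightarrow> ('q \<Rightarrow> complex) \<Rightarrow> 'p \<Rightarrow> complex" where
  "pullback V \<phi> g = (\<lambda>p\<in>V. g (\<phi> p))"

definition variety_morphism ::
    "'p set \<Rightarrow> ('p \<Rightarrow> complex) set \<Rightarrow> 'q set \<Rightarrow> ('q \<Rightarrow> complex) set \<Rightarrow> ('p \<Rightarrow> 'q) \<Rightarrow> bool" where
  "variety_morphism V A W B \<phi> \<longleftrightarrow>
     affine_variety V A \<and> affine_variety W B \<and> \<phi> \<in> V \<rightarrow> W \<and> pullback V \<phi> ` B \<subseteq> A"

definition variety_iso ::
    "'p set \<Rightarrow> ('p \<Rightarrow> complex) set \<Rightarrow> 'q set \<Rightarrow> ('q \<Rightarrow> complex) set \<Rightarrow> ('p \<Rightarrow> 'q) \<Rightarrow> bool" where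
  "variety_iso V A W B \<phi> \<longleftrightarrow>
     bij_betw \<phi> V W \<and> variety_morphism V A W B \<phi> \<and> variety_morphism W B V A (inv_into V \<phi>)"

text \<open>\<open>A\<close> is a finitely generated module over the pullback of \<open>B\<close>.\<close>
definition finite_morphism ::
    "'p set \<Rightarrow> ('p \<Rightarrow> complex) set \<Rightarrow> 'q set \<Rightarrow> ('q \<Rightarrow> complex) set \<Rightarrow> ('p \<Rightarrow> 'q) \<Rightarrow> bool" where
  "finite_morphism V A W B \<phi> \<longleftrightarrow>
     variety_morphism V A W B \<phi> \<and>
     (\<exists>G. finite G \<and> G \<subseteq> A \<and>
        (\<forall>f\<in>A. \<exists>c. c \<in> G \<rightarrow> B \<and> f = (\<lambda>p\<in>V. \<Sum>g\<in>G. c g (\<phi> p) * g p)))"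

text \<open>
  Subsets \<open>V\<close> of an affine space: \<open>C\<close> is the set of coordinate functions of the ambient affine
  space, and \<open>regular_funs C V\<close> consists of the functions on \<open>V\<close> that are, locally for the Zariski
  topology, quotients of polynomials.
\<close>
definition zariski_open :: "('p \<Rightarrow> complex) set \<Rightarrow> 'p set \<Rightarrow> 'p set \<Rightarrow> bool" where
  "zariski_open C V U \<longleftrightarrow> (\<exists>S \<subseteq> poly_funs C. U = {p\<in>V. \<exists>s\<in>S. s p \<noteq> 0})"

definition regular_funs :: "('p \<Rightarrow> complex) set \<Rightarrow> 'p set \<Rightarrow> ('p \<Rightarrow> complex) set" where
  "regular_funs C V =
     {f \<in> extensional V. \<forall>p\<in>V. \<exists>U g h.
        zariski_open C V U \<and> p \<in> U \<and> g \<in> poly_funs C \<and> h \<in> poly_funs C \<and>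
        (\<forall>q\<in>U. h q \<noteq> 0 \<and> f q = g q / h q)}"


section \<open>Quotient fields, integral closure and Galois extensions\<close>

definition frac_rel :: "('a, 'c) ring_scheme \<Rightarrow> (('a \<times> 'a) \<times> ('a \<times> 'a)) set" where
  "frac_rel R =
     {((a, b), (c, d)). a \<in> carrier R \<and> b \<in> carrier R - {\<zero>\<^bsub>R\<^esub>} \<and>
        c \<in> carrier R \<and> d \<in> carrier R - {\<zero>\<^bsub>R\<^esub>} \<and> a \<otimes>\<^bsub>R\<^esub> d = c \<otimes>\<^bsub>R\<^esub> b}"

definition fract :: "('a, 'c) ring_scheme \<Rightarrow> 'a \<Rightarrow> 'a \<Rightarrow> ('a \<times> 'a) set" where
  "fract R a b = frac_rel R `` {(a, b)}"

text \<open>The operations are meaningful when \<open>R\<close> is an integral domain.\<close>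
definition quotient_field :: "('a, 'c) ring_scheme \<Rightarrow> ('a \<times> 'a) set ring" where
  "quotient_field R =
    \<lparr>carrier = {fract R a b | a b. a \<in> carrier R \<and> b \<in> carrier R - {\<zero>\<^bsub>R\<^esub>}},
     monoid.mult = (\<lambda>P Q. \<Union>(a, b)\<in>P. \<Union>(c, d)\<in>Q. fract R (a \<otimes>\<^bsub>R\<^esub> c) (b \<otimes>\<^bsub>R\<^esub> d)),
     monoid.one = fract R \<one>\<^bsub>R\<^esub> \<one>\<^bsub>R\<^esub>,
     ring.zero = fract R \<zero>\<^bsub>R\<^esub> \<one>\<^bsub>R\<^esub>,
     ring.add = (\<lambda>P Q. \<Union>(a, b)\<in>P. \<Union>(c, d)\<in>Q.
              fract R ((a \<otimes>\<^bsub>R\<^esub> d) \<oplus>\<^bsub>R\<^esub> (c \<otimes>\<^bsub>R\<^esub> b)) (b \<otimes>\<^bsub>R\<^esub> d))\<rparr>"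

definition fract_embed :: "('a, 'c) ring_scheme \<Rightarrow> 'a \<Rightarrow> ('a \<times> 'a) set" where
  "fract_embed R a = fract R a \<one>\<^bsub>R\<^esub>"

text \<open>The map of quotient fields induced by an injective ring homomorphism \<open>h\<close> from \<open>R\<close> to \<open>S\<close>.\<close>
definition fract_map ::
    "('a, 'c) ring_scheme \<Rightarrow> ('b, 'd) ring_scheme \<Rightarrow> ('a \<Rightarrow> 'b) \<Rightarrow> ('a \<times> 'a) set \<Rightarrow> ('b \<times> 'b) set" where
  "fract_map R S h = (\<lambda>P \<in> carrier (quotient_field R). \<Union>(a, b)\<in>P. fract S (h a) (h b))"

text \<open>The set of elements of \<open>K\<close> that are roots of a monic polynomial with coefficients in \<open>A\<close>.\<close>
definition integral_closure :: "('a, 'c) ring_scheme \<Rightarrow> 'a set \<Rightarrow> 'a set" where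
  "integral_closure K A =
     {y \<in> carrier K. \<exists>p \<in> carrier (univ_poly K A).
        p \<noteq> [] \<and> hd p = \<one>\<^bsub>K\<^esub> \<and> ring.eval K p y = \<zero>\<^bsub>K\<^esub>}"

text \<open>
  Finite, normal and separable: the minimal polynomial over \<open>k\<close> of every element of \<open>L\<close> splits
  over \<open>L\<close> and has no multiple root.
\<close>
definition galois_extension :: "('a, 'c) ring_scheme \<Rightarrow> 'a set \<Rightarrow> bool" where
  "galois_extension L k \<longleftrightarrow>
     field L \<and> subfield k L \<and> ring.finite_dimension L k (carrier L) \<and>
     (\<forall>x \<in> carrier L. ring.splitted L (ring.Irr L k x)) \<and>
     (\<forall>x \<in> carrier L. \<forall>r. ring.alg_mult L (ring.Irr L k x) r \<le> 1)"

definition galois_group :: "('a, 'c) ring_scheme \<Rightarrow> 'a set \<Rightarrow> ('a \<Rightarrow> 'a) monoid" where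
  "galois_group L k =
     (BijGroup (carrier L))
       \<lparr>carrier := {\<phi> \<in> Bij (carrier L). \<phi> \<in> Ring.ring_hom L L \<and> (\<forall>a\<in>k. \<phi> a = a)}\<rparr>"


section \<open>The varieties\<close>

text \<open>
  Matrices are indexed from \<open>0\<close>, the eigenvalue parameters \<open>\<nu>\<close> by pairs \<open>(i, m)\<close> with
  \<open>1 \<le> i \<le> m \<le> n\<close>.
\<close>

definition M_space :: "nat \<Rightarrow> complex mat set" where
  "M_space n = carrier_mat n n"

definition upper_left :: "complex mat \<Rightarrow> nat \<Rightarrow> complex mat" where
  "upper_left x m = mat m m (\<lambda>(i, j). x $$ (i, j))"

definition M_Omega :: "nat \<Rightarrow> complex mat set" where
  "M_Omega n =
     {x \<in> M_space n.
        (\<forall>m\<in>{1..n}. card (spectrum (upper_left x m)) = m) \<and>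
        (\<forall>m\<in>{1..<n}. spectrum (upper_left x m) \<inter> spectrum (upper_left x (Suc m)) = {})}"

definition index_set :: "nat \<Rightarrow> (nat \<times> nat) set" where
  "index_set n = {(i, m). 1 \<le> i \<and> i \<le> m \<and> m \<le> n}"

definition e_Omega :: "nat \<Rightarrow> (nat \<times> nat \<Rightarrow> complex) set" where
  "e_Omega n =
     {\<nu> \<in> index_set n \<rightarrow>\<^sub>E UNIV.
        (\<forall>m\<in>{1..n}. inj_on (\<lambda>i. \<nu> (i, m)) {1..m}) \<and>
        (\<forall>m\<in>{1..<n}. \<forall>i\<in>{1..m}. \<forall>j\<in>{1..Suc m}. \<nu> (i, m) \<noteq> \<nu> (j, Suc m))}"

definition nu_diag :: "(nat \<times> nat \<Rightarrow> complex) \<Rightarrow> nat \<Rightarrow> complex mat" where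
  "nu_diag \<nu> m = mat_diag m (\<lambda>i. \<nu> (Suc i, m))"

definition M_Omega_e :: "nat \<Rightarrow> ((nat \<times> nat \<Rightarrow> complex) \<times> complex mat) set" where
  "M_Omega_e n =
     {(\<nu>, x) \<in> e_Omega n \<times> M_Omega n. \<forall>m\<in>{1..n}. similar_mat (nu_diag \<nu> m) (upper_left x m)}"

definition mat_coords :: "nat \<Rightarrow> (complex mat \<Rightarrow> complex) set" where
  "mat_coords n = {\<lambda>x. x $$ (i, j) | i j. i < n \<and> j < n}"

definition pair_coords :: "nat \<Rightarrow> ((nat \<times> nat \<Rightarrow> complex) \<times> complex mat \<Rightarrow> complex) set" where
  "pair_coords n =
     {\<lambda>z. fst z k | k. k \<in> index_set n} \<union> {\<lambda>z. snd z $$ (i, j) | i j. i < n \<and> j < n}"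

definition O_M :: "nat \<Rightarrow> (complex mat \<Rightarrow> complex) set" where
  "O_M n = regular_funs (mat_coords n) (M_space n)"

definition O_M_Omega :: "nat \<Rightarrow> (complex mat \<Rightarrow> complex) set" where
  "O_M_Omega n = regular_funs (mat_coords n) (M_Omega n)"

definition O_M_Omega_e :: "nat \<Rightarrow> ((nat \<times> nat \<Rightarrow> complex) \<times> complex mat \<Rightarrow> complex) set" where
  "O_M_Omega_e n = regular_funs (pair_coords n) (M_Omega_e n)"


section \<open>The action of the product of symmetric groups\<close>

definition Sigma_grp :: "nat \<Rightarrow> (nat \<Rightarrow> nat \<Rightarrow> nat) monoid" where
  "Sigma_grp n = product_group {1..n} sym_group"

definition nu_act ::
    "nat \<Rightarrow> (nat \<Rightarrow> nat \<Rightarrow> nat) \<Rightarrow> (nat \<times> nat \<Rightarrow> complex) \<Rightarrow> nat \<times> nat \<Rightarrow> complex" where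
  "nu_act n \<sigma> \<nu> = (\<lambda>(i, m) \<in> index_set n. \<nu> (inv_into UNIV (\<sigma> m) i, m))"

definition pt_act ::
    "nat \<Rightarrow> (nat \<Rightarrow> nat \<Rightarrow> nat) \<Rightarrow> (nat \<times> nat \<Rightarrow> complex) \<times> complex mat
      \<Rightarrow> (nat \<times> nat \<Rightarrow> complex) \<times> complex mat" where
  "pt_act n \<sigma> = (\<lambda>(\<nu>, x) \<in> M_Omega_e n. (nu_act n \<sigma> \<nu>, x))"

definition fun_act ::
    "nat \<Rightarrow> (nat \<Rightarrow> nat \<Rightarrow> nat) \<Rightarrow> ((nat \<times> nat \<Rightarrow> complex) \<times> complex mat \<Rightarrow> complex)
      \<Rightarrow> (nat \<times> nat \<Rightarrow> complex) \<times> complex mat \<Rightarrow> complex" where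
  "fun_act n \<sigma> f = (\<lambda>z \<in> M_Omega_e n. f (pt_act n (inv\<^bsub>Sigma_grp n\<^esub> \<sigma>) z))"

definition O_invariants :: "nat \<Rightarrow> ((nat \<times> nat \<Rightarrow> complex) \<times> complex mat \<Rightarrow> complex) set" where
  "O_invariants n =
     {f \<in> O_M_Omega_e n. \<forall>\<sigma> \<in> carrier (Sigma_grp n). fun_act n \<sigma> f = f}"

definition orbit_space :: "nat \<Rightarrow> ((nat \<times> nat \<Rightarrow> complex) \<times> complex mat) set set" where
  "orbit_space n = orbits (Sigma_grp n) (M_Omega_e n) (pt_act n)"

text \<open>
  The ring of invariants, regarded as functions on the orbit set: the functions on orbits whose
  composition with the orbit map is an invariant regular function.
\<close>
definition O_orbit_space ::
    "nat \<Rightarrow> (((nat \<times> nat \<Rightarrow> complex) \<times> complex mat) set \<Rightarrow> complex) set" where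
  "O_orbit_space n =
     {g \<in> extensional (orbit_space n).
        pullback (M_Omega_e n) (orbit (Sigma_grp n) (pt_act n)) g \<in> O_invariants n}"

definition pi_n :: "(nat \<times> nat \<Rightarrow> complex) \<times> complex mat \<Rightarrow> complex mat" where
  "pi_n z = snd z"

text \<open>The map induced by the projection: its value is the common value of \<open>pi_n\<close> on the orbit.\<close>
definition pi_bar :: "((nat \<times> nat \<Rightarrow> complex) \<times> complex mat) set \<Rightarrow> complex mat" where
  "pi_bar \<omega> = the_elem (pi_n ` \<omega>)"


section \<open>The function fields\<close>

abbreviation ring_M :: "nat \<Rightarrow> (complex mat \<Rightarrow> complex) ring" where
  "ring_M n \<equiv> fun_ring (M_space n) (O_M n)"

abbreviation ring_M_Omega_e ::
    "nat \<Rightarrow> ((nat \<times> nat \<Rightarrow> complex) \<times> complex mat \<Rightarrow> complex) ring" where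
  "ring_M_Omega_e n \<equiv> fun_ring (M_Omega_e n) (O_M_Omega_e n)"

definition F_n where
  "F_n n = quotient_field (ring_M n)"

definition F_ne where
  "F_ne n = quotient_field (ring_M_Omega_e n)"

definition field_act where
  "field_act n \<sigma> = fract_map (ring_M_Omega_e n) (ring_M_Omega_e n) (fun_act n \<sigma>)"

definition F_ne_invariants where
  "F_ne_invariants n =
     {y \<in> carrier (F_ne n). \<forall>\<sigma> \<in> carrier (Sigma_grp n). field_act n \<sigma> y = y}"

text \<open>The map from \<open>F_n n\<close> to \<open>F_ne n\<close> induced by \<open>pi_n\<close>.\<close>
definition field_pullback where
  "field_pullback n = fract_map (ring_M n) (ring_M_Omega_e n) (pullback (M_Omega_e n) pi_n)"

end

(*
  Over a fixed nu the matrices x with the prescribed spectra are parametrised by the nonzero last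
  entries of eigenvectors of the upper left blocks: diagonalising x_m turns x_(m+1) into a bordered
  diagonal matrix, whose characteristic polynomial prescribes the products of its border entries.
  Hence M_Omega(n,e) is a basic open subset of an affine space, and its affine ring is an
  integrally closed domain.

  Elements of Sigma_n permute the eigenvalues of each block, so the average over Sigma_n of a
  polynomial in (nu, x) is a polynomial in x: it is expressed by power sums of the nu_(i m), which
  are traces of powers of x_m.  This identifies the invariants with the functions on M_Omega(n).
  Interpolation along the fibres writes every regular function as a combination of finitely many
  monomials in nu with invariant coefficients, which gives finiteness of pi_n and of the field
  extension.  The polynomial with roots the orbit of y has invariant coefficients; it shows that the
  extension is normal and separable, that an automorphism permutes nu_(1 m), ..., nu_(m m) for every
  m, and that O(M_Omega(n,e)) is integral over the invariants.
*)

theory Submission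
  imports Defs "HOL-Library.Function_Algebras" "HOL-Analysis.Continuum_Not_Denumerable"
begin

section \<open>Polynomial functions and the Nullstellensatz\<close>

text \<open>Two definitions shape the foundations: regular functions are only locally quotients, and
  an affine variety must have a point for every character. Both are settled by one Nullstellensatz,
  in the form that works over an uncountable field. The local definition then pays off: a regular
  function without zeros has a regular inverse, which keeps the border entries of the recursive
  parametrisation and their reciprocals regular. All denominators are controlled by a single
  polynomial \<open>disc\<close>, the product of the forbidden differences over ordered pairs. It is
  invariant under the symmetric groups, hence a polynomial in the entries of x; so
  \<open>M_Omega n\<close> is a principal open set, and denominators can be pulled out of averages.
  Symmetrisation has to include coinciding eigenvalues, because this polynomial must be known to
  vanish off \<open>M_Omega n\<close>. As F(n) is built from functions on all matrices, its powers
  must finally be cleared from fractions.\<close>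

lemma poly_funs_mono: "f \<in> poly_funs C \<Longrightarrow> C \<subseteq> D \<Longrightarrow> f \<in> poly_funs D"
  by (induction rule: poly_funs.induct) (auto intro: poly_funs.intros)

lemma poly_funs_uminus: "f \<in> poly_funs C \<Longrightarrow> (\<lambda>p. - f p) \<in> poly_funs C"
  using poly_funs.mult[OF poly_funs.const[of "-1"]] by fastforce

lemma poly_funs_diff: "f \<in> poly_funs C \<Longrightarrow> g \<in> poly_funs C \<Longrightarrow> (\<lambda>p. f p - g p) \<in> poly_funs C"
  using poly_funs.add[OF _ poly_funs_uminus] by fastforce

lemma poly_funs_sum:
  "(\<And>i. i \<in> I \<Longrightarrow> f i \<in> poly_funs C) \<Longrightarrow> (\<lambda>p. \<Sum>i\<in>I. f i p) \<in> poly_funs C"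
  by (induction I rule: infinite_finite_induct) (auto intro: poly_funs.intros)

lemma poly_funs_prod:
  "(\<And>i. i \<in> I \<Longrightarrow> f i \<in> poly_funs C) \<Longrightarrow> (\<lambda>p. \<Prod>i\<in>I. f i p) \<in> poly_funs C"
  by (induction I rule: infinite_finite_induct) (auto intro: poly_funs.intros)

lemma poly_funs_power: "f \<in> poly_funs C \<Longrightarrow> (\<lambda>p. f p ^ k) \<in> poly_funs C"
  by (induction k) (auto intro: poly_funs.intros)

lemmas poly_funs_intros =
  poly_funs.const poly_funs.add poly_funs.mult poly_funs_uminus poly_funs_diff
  poly_funs_sum poly_funs_prod poly_funs_power

lemma poly_funs_subst:
  assumes "f \<in> poly_funs C" "\<And>c. c \<in> C \<Longrightarrow> (\<lambda>q. c (\<phi> q)) \<in> poly_funs D"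
  shows "(\<lambda>q. f (\<phi> q)) \<in> poly_funs D"
  using assms(1) by induction (auto intro: poly_funs.intros assms(2))

lemma poly_funs_cong_on:
  assumes "f \<in> poly_funs C" "\<And>c. c \<in> C \<Longrightarrow> c p = c q"
  shows "f p = f q"
  using assms(1) by induction (auto simp: assms(2))

section \<open>Maximal ideals and characters of finitely generated function rings\<close>

definition proper_ideal :: "('p \<Rightarrow> complex) set \<Rightarrow> ('p \<Rightarrow> complex) set \<Rightarrow> bool" where
  "proper_ideal N I \<longleftrightarrow> I \<subseteq> N \<and> (\<lambda>_. 0) \<in> I \<and> (\<forall>f\<in>I. \<forall>g\<in>I. (\<lambda>p. f p + g p) \<in> I) \<and>
     (\<forall>f\<in>I. \<forall>g\<in>N. (\<lambda>p. g p * f p) \<in> I) \<and> (\<lambda>_. 1) \<notin> I"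

text \<open>Zorn's lemma applies because properness only says that the constant 1 is missing, a
  property that passes to unions of chains.\<close>

lemma exists_maximal_proper_ideal:
  assumes "proper_ideal N I"
  obtains M where "I \<subseteq> M" "proper_ideal N M" "\<And>J. proper_ideal N J \<Longrightarrow> M \<subseteq> J \<Longrightarrow> J = M"
proof -
  define \<A> where "\<A> = {J. proper_ideal N J \<and> I \<subseteq> J}"
  have "\<exists>M\<in>\<A>. \<forall>J\<in>\<A>. M \<subseteq> J \<longrightarrow> J = M"
  proof (rule subset_Zorn_nonempty)
    show "\<A> \<noteq> {}" unfolding \<A>_def using assms by auto
  next
    fix \<C> assume ne: "\<C> \<noteq> {}" and ch: "subset.chain \<A> \<C>"
    have S: "J \<subseteq> N" "(\<lambda>_. 0) \<in> J" "(\<lambda>_. 1) \<notin> J" "I \<subseteq> J"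
       "\<And>f g. f \<in> J \<Longrightarrow> g \<in> J \<Longrightarrow> (\<lambda>p. f p + g p) \<in> J"
       "\<And>f g. f \<in> J \<Longrightarrow> g \<in> N \<Longrightarrow> (\<lambda>p. g p * f p) \<in> J" if "J \<in> \<C>" for J
      using ch that unfolding subset.chain_def proper_ideal_def \<A>_def by auto
    have add: "(\<lambda>p. f p + g p) \<in> \<Union>\<C>" if fg: "f \<in> \<Union>\<C>" "g \<in> \<Union>\<C>" for f g
    proof -
      obtain J J' where J: "J \<in> \<C>" "J' \<in> \<C>" "f \<in> J" "g \<in> J'" using fg by blast
      then have "J \<subseteq> J' \<or> J' \<subseteq> J" using ch unfolding subset_chain_def by blast
      then show ?thesis using J S(5) by blast
    qed
    have mul: "(\<lambda>p. g p * f p) \<in> \<Union>\<C>" if "f \<in> \<Union>\<C>" "g \<in> N" for f g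
      using that S(6) by blast
    have "\<Union>\<C> \<subseteq> N" "(\<lambda>_. 0) \<in> \<Union>\<C>" "(\<lambda>_. 1) \<notin> \<Union>\<C>" "I \<subseteq> \<Union>\<C>"
      using S(1-4) ne by blast+
    then show "\<Union>\<C> \<in> \<A>"
      using add mul unfolding proper_ideal_def \<A>_def by simp
  qed
  then show ?thesis using that unfolding \<A>_def by auto
qed

text \<open>Makes spans and linear independence of functions available for the dimension count in
  the Nullstellensatz.\<close>

interpretation fun_space: vector_space "\<lambda>(c::complex) (f::'p \<Rightarrow> complex) p. c * f p"
  by unfold_locales (auto simp: fun_eq_iff algebra_simps)

lemma uncountable_complex: "uncountable (UNIV :: complex set)"
proof
  assume "countable (UNIV :: complex set)"
  then have "countable (Re ` UNIV)" by blast
  moreover have "Re ` UNIV = (UNIV :: real set)" by (metis Re_complex_of_real surjI)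
  ultimately show False using uncountable_UNIV_real by simp
qed

text \<open>Monomials are indexed by lists over the finite set \<open>G\<close>, hence countable,
  and closed under products, so they span the ring. Enumerating them as \<open>e\<close> exhausts
  the ring by an increasing sequence of finite-dimensional spans.\<close>

lemma poly_funs_countable_filtration:
  assumes "finite G"
  obtains e :: "nat \<Rightarrow> 'p \<Rightarrow> complex"
  where "\<And>f. f \<in> poly_funs G \<Longrightarrow> \<exists>k. f \<in> fun_space.span (e ` {..<k})"
proof -
  define mono :: "('p \<Rightarrow> complex) list \<Rightarrow> 'p \<Rightarrow> complex"
    where "mono xs p = prod_list (map (\<lambda>g. g p) xs)" for xs p
  define B where "B = mono ` lists G"
  have B: "countable B" "B \<noteq> {}" unfolding B_def using assms by (auto intro: countable_finite)
  define e where "e = from_nat_into B"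
  have e: "range e = B" unfolding e_def using B by (simp add: range_from_nat_into)
  have mono_mult: "(\<lambda>p. f p * g p) \<in> B" if fg: "f \<in> B" "g \<in> B" for f g
  proof -
    obtain xs ys where "f = mono xs" "g = mono ys" "xs \<in> lists G" "ys \<in> lists G"
      using fg unfolding B_def by blast
    then have "(\<lambda>p. f p * g p) = mono (xs @ ys)" "xs @ ys \<in> lists G"
      by (auto simp: mono_def fun_eq_iff)
    then show ?thesis unfolding B_def by auto
  qed
  have mult_base: "(\<lambda>p. f p * g p) \<in> fun_space.span B"
    if "f \<in> B" "g \<in> fun_space.span B" for f g
    using that(2)
  proof (induction rule: fun_space.span_induct_alt)
    case base
    have "(\<lambda>p. f p * (0::'p \<Rightarrow> complex) p) = 0" by (auto simp: fun_eq_iff)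
    then show ?case using fun_space.span_zero by simp
  next
    case (step c x y)
    have "(\<lambda>p. f p * ((\<lambda>p. c * x p) + y) p) = (\<lambda>p. c * (\<lambda>p. f p * x p) p) + (\<lambda>p. f p * y p)"
      by (auto simp: fun_eq_iff algebra_simps)
    moreover have "(\<lambda>p. c * (\<lambda>p. f p * x p) p) + (\<lambda>p. f p * y p) \<in> fun_space.span B"
      by (rule fun_space.span_add[OF fun_space.span_scale[OF fun_space.span_base[OF mono_mult[OF that(1) step(1)]]] step(2)])
    ultimately show ?case by simp
  qed
  have span_mult: "(\<lambda>p. f p * g p) \<in> fun_space.span B"
    if "f \<in> fun_space.span B" "g \<in> fun_space.span B" for f g
    using that(1)
  proof (induction rule: fun_space.span_induct_alt)
    case base
    have "(\<lambda>p. (0::'p \<Rightarrow> complex) p * g p) = 0" by (auto simp: fun_eq_iff)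
    then show ?case using fun_space.span_zero by simp
  next
    case (step c x y)
    have "(\<lambda>p. ((\<lambda>p. c * x p) + y) p * g p) = (\<lambda>p. c * (\<lambda>p. x p * g p) p) + (\<lambda>p. y p * g p)"
      by (auto simp: fun_eq_iff algebra_simps)
    moreover have "(\<lambda>p. c * (\<lambda>p. x p * g p) p) + (\<lambda>p. y p * g p) \<in> fun_space.span B"
      by (rule fun_space.span_add[OF fun_space.span_scale[OF mult_base[OF step(1) that(2)]] step(2)])
    ultimately show ?case by simp
  qed
  have span: "f \<in> fun_space.span B" if "f \<in> poly_funs G" for f
    using that
  proof induction
    case (const c)
    have "mono [] \<in> B" unfolding B_def by auto
    then have "(\<lambda>p. c * mono [] p) \<in> fun_space.span B"
      by (intro fun_space.span_scale fun_space.span_base)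
    then show ?case by (simp add: mono_def)
  next
    case (gen f)
    then have "mono [f] \<in> B" unfolding B_def by auto
    then have "mono [f] \<in> fun_space.span B" by (rule fun_space.span_base)
    moreover have "mono [f] = f" by (simp add: mono_def fun_eq_iff)
    ultimately show ?case by simp
  next
    case (add f g)
    then have "f + g \<in> fun_space.span B" by (simp add: fun_space.span_add)
    then show ?case by (simp add: plus_fun_def)
  next
    case (mult f g)
    then show ?case using span_mult by blast
  qed
  have "\<exists>k. f \<in> fun_space.span (e ` {..<k})" if f: "f \<in> poly_funs G" for f
  proof -
    obtain t r where t: "finite t" "t \<subseteq> B" "f = (\<Sum>a\<in>t. (\<lambda>p. r a * a p))"
      using span[OF f] unfolding fun_space.span_explicit by auto
    obtain T where T: "finite T" "t = e ` T"
      using finite_subset_image[OF t(1), of e UNIV] t(2) e by blast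
    obtain k where "T \<subseteq> {..<k}" using T(1) by (meson finite_nat_iff_bounded)
    then have "t \<subseteq> e ` {..<k}" using T by auto
    then have "(\<Sum>a\<in>t. (\<lambda>p. r a * a p)) \<in> fun_space.span (e ` {..<k})"
      by (intro fun_space.span_sum fun_space.span_scale) (blast intro: fun_space.span_base)
    then have "f \<in> fun_space.span (e ` {..<k})" using t(3) by simp
    then show ?thesis by blast
  qed
  then show ?thesis using that by blast
qed

text \<open>Pigeonhole: uncountably many members fall into countably many finite-dimensional spans,
  so one span contains infinitely many of them. Injectivity of \<open>s\<close> lets the relation be
  indexed by the parameters instead of the functions.\<close>

lemma uncountable_family_in_spans_dependent:
  fixes s :: "complex \<Rightarrow> 'p \<Rightarrow> complex" and e :: "nat \<Rightarrow> 'p \<Rightarrow> complex"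
  assumes inj: "inj s" and span: "\<And>a. \<exists>k. s a \<in> fun_space.span (e ` {..<k})"
  obtains B u a0 where "finite B" "a0 \<in> B" "u a0 \<noteq> (0::complex)" "\<And>p. (\<Sum>a\<in>B. u a * s a p) = 0"
proof -
  obtain k where k: "\<And>a. s a \<in> fun_space.span (e ` {..<k a})" using span by metis
  have "\<exists>m. infinite {a. k a = m}"
  proof (rule ccontr)
    assume "\<not> ?thesis"
    then have "countable (\<Union>m. {a. k a = m})" by (intro countable_UN) (auto intro: countable_finite)
    moreover have "(\<Union>m. {a. k a = m}) = UNIV" by auto
    ultimately show False using uncountable_complex by simp
  qed
  then obtain m where m: "infinite {a. k a = m}" by blast
  let ?S = "s ` {a. k a = m}"
  have "infinite ?S" using m inj by (meson finite_imageD inj_on_subset subset_UNIV)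
  moreover have "?S \<subseteq> fun_space.span (e ` {..<m})" using k by auto
  ultimately have "fun_space.dependent ?S"
    using fun_space.independent_span_bound[of "e ` {..<m}" ?S] by auto
  then obtain T w v where T: "finite T" "T \<subseteq> ?S" "(\<Sum>v\<in>T. (\<lambda>p. w v * v p)) = 0" "v \<in> T" "w v \<noteq> (0::complex)"
    unfolding fun_space.dependent_explicit by auto
  define B where "B = {a. s a \<in> T}"
  have sB: "s ` B = T" using T(2) unfolding B_def by auto
  then have fB: "finite B" using T(1) inj by (metis finite_imageD inj_on_subset subset_UNIV)
  obtain a0 where a0: "a0 \<in> B" "s a0 = v" using T(4) sB by auto
  have "(\<Sum>a\<in>B. w (s a) * s a p) = 0" for p
  proof -
    have "(\<Sum>a\<in>B. w (s a) * s a p) = (\<Sum>v\<in>T. w v * v p)"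
      unfolding sB[symmetric] using inj by (subst sum.reindex) (auto intro: inj_on_subset)
    also have "\<dots> = (\<Sum>v\<in>T. (\<lambda>p. w v * v p)) p"
      using T(1) by (induction T rule: finite_induct) auto
    finally show ?thesis using T(3) by simp
  qed
  then show ?thesis using that[of B a0 "\<lambda>a. w (s a)"] fB a0 T(5) by auto
qed

text \<open>The counterpart of \<open>alg_hom_to_complex\<close> for functions on the whole type,
  without restriction to a set of points.\<close>

definition poly_hom :: "('p \<Rightarrow> complex) set \<Rightarrow> (('p \<Rightarrow> complex) \<Rightarrow> complex) \<Rightarrow> bool" where
  "poly_hom G \<chi> \<longleftrightarrow> (\<forall>c. \<chi> (\<lambda>_. c) = c) \<and>
     (\<forall>f\<in>poly_funs G. \<forall>g\<in>poly_funs G.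
        \<chi> (\<lambda>p. f p + g p) = \<chi> f + \<chi> g \<and> \<chi> (\<lambda>p. f p * g p) = \<chi> f * \<chi> g)"

lemma poly_homD:
  assumes "poly_hom G \<chi>"
  shows "\<chi> (\<lambda>_. c) = c"
    "f \<in> poly_funs G \<Longrightarrow> g \<in> poly_funs G \<Longrightarrow> \<chi> (\<lambda>p. f p + g p) = \<chi> f + \<chi> g"
    "f \<in> poly_funs G \<Longrightarrow> g \<in> poly_funs G \<Longrightarrow> \<chi> (\<lambda>p. f p * g p) = \<chi> f * \<chi> g"
  using assms unfolding poly_hom_def by auto

text \<open>
  If \<open>t\<close> were transcendental modulo the maximal ideal, the inverses of the uncountably many
  \<open>t - a\<close> would be linearly independent in a space of countable dimension.
\<close>
theorem weak_Nullstellensatz: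
  fixes G :: "('p \<Rightarrow> complex) set"
  assumes fin: "finite G" and I: "proper_ideal (poly_funs G) I"
  obtains \<chi> where "poly_hom G \<chi>" "\<And>f. f \<in> I \<Longrightarrow> \<chi> f = 0"
proof -
  let ?N = "poly_funs G"
  obtain M where IM: "I \<subseteq> M" and M: "proper_ideal ?N M"
    and max: "\<And>J. proper_ideal ?N J \<Longrightarrow> M \<subseteq> J \<Longrightarrow> J = M"
    using exists_maximal_proper_ideal[OF I] by metis
  have MN: "\<And>f. f \<in> M \<Longrightarrow> f \<in> ?N" and M0: "(\<lambda>_. 0) \<in> M"
    and Madd: "\<And>f g. f \<in> M \<Longrightarrow> g \<in> M \<Longrightarrow> (\<lambda>p. f p + g p) \<in> M"
    and Mmul: "\<And>f g. f \<in> M \<Longrightarrow> g \<in> ?N \<Longrightarrow> (\<lambda>p. g p * f p) \<in> M" and M1: "(\<lambda>_. 1) \<notin> M"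
    using M unfolding proper_ideal_def by auto
  have Mcong: "g \<in> M" if "f \<in> M" "\<And>p. g p = f p" for f g
    using that by (metis ext)
  have Mdiff: "(\<lambda>p. f p - g p) \<in> M" if "f \<in> M" "g \<in> M" for f g
    by (rule Mcong[OF Madd[OF that(1) Mmul[OF that(2) poly_funs.const[of "-1"]]]]) simp
  have Msum: "(\<lambda>p. \<Sum>i\<in>J. f i p) \<in> M" if "\<And>i. i \<in> J \<Longrightarrow> f i \<in> M" for J :: "complex set" and f
    using that by (induction J rule: infinite_finite_induct) (auto simp: M0 Madd)
  have inverse: "\<exists>s\<in>?N. (\<lambda>p. 1 - s p * g p) \<in> M" if g: "g \<in> ?N" "g \<notin> M" for g
  proof -
    \<comment> \<open>The ideal generated by \<open>M\<close> and \<open>g\<close>. By maximality it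
      is not proper, so 1 lies in it, which makes \<open>g\<close> invertible modulo
      \<open>M\<close>.\<close>
    define J where "J = {f. \<exists>m\<in>M. \<exists>s\<in>?N. f = (\<lambda>p. m p + s p * g p)}"
    have JI: "f \<in> J" if "m \<in> M" "s \<in> ?N" "\<And>p. f p = m p + s p * g p" for f m s
      using that unfolding J_def by (auto simp: fun_eq_iff)
    have "M \<subseteq> J" using JI[OF _ poly_funs.const[of 0]] by auto
    moreover have "g \<in> J" using JI[OF M0 poly_funs.const[of 1]] by auto
    ultimately have "\<not> proper_ideal ?N J" using max g(2) by blast
    moreover have "J \<subseteq> ?N" using MN g(1) unfolding J_def by (auto intro!: poly_funs_intros)
    moreover have "(\<lambda>_. 0) \<in> J" using \<open>M \<subseteq> J\<close> M0 by auto
    moreover have "(\<lambda>p. f p + h p) \<in> J" if fh: "f \<in> J" "h \<in> J" for f h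
    proof -
      obtain m s m' s' where *: "m \<in> M" "s \<in> ?N" "m' \<in> M" "s' \<in> ?N"
        "f = (\<lambda>p. m p + s p * g p)" "h = (\<lambda>p. m' p + s' p * g p)"
        using fh unfolding J_def by blast
      show ?thesis
        by (rule JI[OF Madd[OF *(1,3)] poly_funs.add[OF *(2,4)]]) (simp add: * algebra_simps)
    qed
    moreover have "(\<lambda>p. h p * f p) \<in> J" if fh: "f \<in> J" "h \<in> ?N" for f h
    proof -
      obtain m s where *: "m \<in> M" "s \<in> ?N" "f = (\<lambda>p. m p + s p * g p)"
        using fh unfolding J_def by blast
      show ?thesis
        by (rule JI[OF Mmul[OF *(1) fh(2)] poly_funs.mult[OF fh(2) *(2)]]) (simp add: * algebra_simps)
    qed
    ultimately have "(\<lambda>_. 1) \<in> J" unfolding proper_ideal_def by blast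
    then obtain m s where *: "m \<in> M" "s \<in> ?N" "(\<lambda>_. 1) = (\<lambda>p. m p + s p * g p)"
      unfolding J_def by blast
    have "1 - s p * g p = m p" for p using fun_cong[OF *(3), of p] by (simp add: algebra_simps)
    then show ?thesis using Mcong[OF *(1), of "\<lambda>p. 1 - s p * g p"] *(2) by blast
  qed
  have prime: "g \<in> M" if fg: "(\<lambda>p. f p * g p) \<in> M" "f \<notin> M" "f \<in> ?N" "g \<in> ?N" for f g
  proof -
    obtain s where s: "s \<in> ?N" "(\<lambda>p. 1 - s p * f p) \<in> M" using inverse fg by blast
    show ?thesis
      by (rule Mcong[OF Madd[OF Mmul[OF s(2) fg(4)] Mmul[OF fg(1) s(1)]]]) (simp add: algebra_simps)
  qed
  have poly_in: "(\<lambda>p. poly q (t p)) \<in> ?N" if "t \<in> ?N" for q t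
    using that by (induction q) (auto intro!: poly_funs_intros)
  \<comment> \<open>A nonzero polynomial in \<open>t\<close> splits into linear factors over the
    complex numbers; as \<open>M\<close> is prime and contains no \<open>t - a\<close>, it cannot
    contain their product.\<close>
  have no_poly: "(\<lambda>p. poly q (t p)) \<notin> M" if t: "t \<in> ?N" "\<And>a. (\<lambda>p. t p - a) \<notin> M" and "q \<noteq> 0" for q t
    using \<open>q \<noteq> 0\<close>
  proof (induction "Polynomial.degree q" arbitrary: q)
    case 0
    then obtain c where c: "q = [:c:]" "c \<noteq> 0" by (metis degree_eq_zeroE pCons_0_0)
    show ?case
    proof
      assume *: "(\<lambda>p. poly q (t p)) \<in> M"
      have "(\<lambda>_. 1) \<in> M"
        by (rule Mcong[OF Mmul[OF * poly_funs.const[of "inverse c"]]]) (use c in simp)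
      then show False using M1 by simp
    qed
  next
    case (Suc d)
    then have "\<not> constant (poly q)" by (simp add: constant_degree)
    then obtain r where "poly q r = 0" using fundamental_theorem_of_algebra by blast
    then obtain q' where q': "q = [:-r, 1:] * q'" by (metis dvdE poly_eq_0_iff_dvd)
    then have q'0: "q' \<noteq> 0" using Suc.prems by auto
    then have "Polynomial.degree q = Suc (Polynomial.degree q')"
      unfolding q' by (subst degree_mult_eq) auto
    then have IH: "(\<lambda>p. poly q' (t p)) \<notin> M" using Suc.hyps q'0 by auto
    show ?case
    proof
      assume *: "(\<lambda>p. poly q (t p)) \<in> M"
      have "(\<lambda>p. (t p - r) * poly q' (t p)) \<in> M"
        by (rule Mcong[OF *]) (simp add: q' algebra_simps)
      then have "(\<lambda>p. poly q' (t p)) \<in> M"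
        by (rule prime[OF _ t(2) poly_funs_diff[OF t(1) poly_funs.const] poly_in[OF t(1)]])
      then show False using IH by simp
    qed
  qed
  have ex: "\<exists>a. (\<lambda>p. t p - a) \<in> M" if t: "t \<in> ?N" for t
  proof (rule ccontr)
    assume "\<not> ?thesis"
    then have nM: "\<And>a. (\<lambda>p. t p - a) \<notin> M" by blast
    have tN: "\<And>a. (\<lambda>p. t p - a) \<in> ?N" using t by (intro poly_funs_intros)
    have "\<forall>a. \<exists>s\<in>?N. (\<lambda>p. 1 - s p * (t p - a)) \<in> M" using inverse[OF tN nM] by blast
    then obtain s where s: "\<And>a. s a \<in> ?N" "\<And>a. (\<lambda>p. 1 - s a p * (t p - a)) \<in> M" by metis
    have "inj s"
    proof (rule injI, rule ccontr)
      fix a b assume ab: "s a = s b" "a \<noteq> b"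
      have 1: "(\<lambda>p. s a p * (a - b)) \<in> M"
        by (rule Mcong[OF Mdiff[OF s(2)[of a] s(2)[of b]]]) (simp add: ab algebra_simps)
      have "s a \<in> M"
        by (rule Mcong[OF Mmul[OF 1 poly_funs.const[of "inverse (a - b)"]]]) (use ab in simp)
      then have "(\<lambda>p. (t p - a) * s a p) \<in> M" using Mmul tN by blast
      have "(\<lambda>_. 1) \<in> M"
        by (rule Mcong[OF Madd[OF s(2)[of a] Mmul[OF \<open>s a \<in> M\<close> tN[of a]]]]) (simp add: algebra_simps)
      then show False using M1 by simp
    qed
    obtain e where e: "\<And>f. f \<in> ?N \<Longrightarrow> \<exists>k. f \<in> fun_space.span ((e :: nat \<Rightarrow> _) ` {..<k})"
      using poly_funs_countable_filtration[OF fin] by metis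
    obtain B u a0 where B: "finite B" "a0 \<in> B" "u a0 \<noteq> 0" "\<And>p. (\<Sum>a\<in>B. u a * s a p) = 0"
      using uncountable_family_in_spans_dependent[OF \<open>inj s\<close> e[OF s(1)]] by metis
    \<comment> \<open>Clearing denominators: multiplying the relation between the inverses of
      \<open>t - a\<close> by all the \<open>t - b\<close> turns it into a polynomial
      \<open>q\<close> in \<open>t\<close>. At \<open>a0\<close> only the term of \<open>a0\<close>
      survives, so \<open>q\<close> is nonzero.\<close>
    define L where "L a = (\<Prod>b\<in>B - {a}. [:- b, 1:])" for a
    define q where "q = (\<Sum>a\<in>B. Polynomial.smult (u a) (L a))"
    have "poly q a0 = (\<Sum>a\<in>B. u a * poly (L a) a0)"
      unfolding q_def by (simp add: poly_sum)
    also have "\<dots> = u a0 * poly (L a0) a0"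
    proof -
      have "poly (L a) a0 = 0" if "a \<in> B - {a0}" for a
        unfolding L_def poly_prod using B that by (intro prod_zero) auto
      then show ?thesis using B(1,2) by (simp add: sum.remove)
    qed
    also have "\<dots> \<noteq> 0" unfolding L_def poly_prod using B by (simp add: prod_zero_iff)
    finally have "q \<noteq> 0" by auto
    have LN: "(\<lambda>p. u a * poly (L a) (t p)) \<in> ?N" for a
      by (intro poly_funs_intros poly_in t)
    have *: "(\<lambda>p. \<Sum>a\<in>B. u a * poly (L a) (t p) * (1 - s a p * (t p - a))) \<in> M"
      by (intro Msum Mmul[OF s(2) LN])
    have "(\<lambda>p. poly q (t p)) \<in> M"
    proof (rule Mcong[OF *])
      fix p
      have "(\<Sum>a\<in>B. u a * poly (L a) (t p) * (s a p * (t p - a))) =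
            (\<Sum>a\<in>B. u a * s a p * (\<Prod>b\<in>B. t p - b))"
        by (intro sum.cong refl) (use B(1) in \<open>simp add: L_def poly_prod prod.remove[of B]\<close>)
      also have "\<dots> = 0" using B(4) by (simp flip: sum_distrib_right)
      finally show "poly q (t p) = (\<Sum>a\<in>B. u a * poly (L a) (t p) * (1 - s a p * (t p - a)))"
        by (simp add: q_def poly_sum right_diff_distrib sum_subtractf)
    qed
    then show False using no_poly[OF t nM \<open>q \<noteq> 0\<close>] by simp
  qed
  have uniq: "a = b" if "(\<lambda>p. t p - a) \<in> M" "(\<lambda>p. t p - b) \<in> M" for t a b
  proof (rule ccontr)
    assume "a \<noteq> b"
    have "(\<lambda>_. 1) \<in> M"
      by (rule Mcong[OF Mmul[OF Mdiff[OF that] poly_funs.const[of "inverse (b - a)"]]])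
         (use \<open>a \<noteq> b\<close> in simp)
    then show False using M1 by simp
  qed
  \<comment> \<open>The residue field modulo \<open>M\<close> is the field of complex numbers, and
    \<chi> is the residue map.\<close>
  define \<chi> where "\<chi> t = (THE a. (\<lambda>p. t p - a) \<in> M)" for t
  have \<chi>I: "\<chi> t = a" if "(\<lambda>p. t p - a) \<in> M" for t a
    unfolding \<chi>_def by (rule the_equality) (rule that, rule uniq[OF _ that])
  have \<chi>: "(\<lambda>p. t p - \<chi> t) \<in> M" if t: "t \<in> ?N" for t
  proof -
    obtain a where a: "(\<lambda>p. t p - a) \<in> M" using ex[OF t] by blast
    show ?thesis unfolding \<chi>I[OF a] by (rule a)
  qed
  show ?thesis
  proof (rule that[of \<chi>])
    show "\<chi> f = 0" if "f \<in> I" for f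
    proof (rule \<chi>I)
      show "(\<lambda>p. f p - 0) \<in> M" using subsetD[OF IM that] by simp
    qed
    show "poly_hom G \<chi>" unfolding poly_hom_def
    proof (intro conjI allI ballI)
      show "\<chi> (\<lambda>_. c) = c" for c by (rule \<chi>I) (simp add: M0)
      fix f g assume fg: "f \<in> ?N" "g \<in> ?N"
      show "\<chi> (\<lambda>p. f p + g p) = \<chi> f + \<chi> g"
        by (intro \<chi>I Mcong[OF Madd[OF \<chi>[OF fg(1)] \<chi>[OF fg(2)]]]) (simp only: add_diff_add)
      show "\<chi> (\<lambda>p. f p * g p) = \<chi> f * \<chi> g"
        by (rule \<chi>I, rule Mcong[OF Madd[OF Mmul[OF \<chi>[OF fg(1)] fg(2)]
              Mmul[OF \<chi>[OF fg(2)] poly_funs.const[of "\<chi> f"]]]]) (simp add: algebra_simps)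
    qed
  qed
qed

text \<open>The denominators of \<open>f\<close> form an ideal. Were it proper, a character would
  kill it; by \<open>hom\<close> this character is evaluation at a point of \<open>V\<close>, but
  near that point \<open>f\<close> is a quotient whose denominator does not vanish there.\<close>

lemma regular_funs_subset:
  assumes hom: "\<And>\<chi>. poly_hom G \<chi> \<Longrightarrow>
      (\<And>f. f \<in> poly_funs G \<Longrightarrow> \<forall>p\<in>V. f p = 0 \<Longrightarrow> \<chi> f = 0) \<Longrightarrow>
      \<exists>p\<in>V. \<forall>f\<in>poly_funs G. \<chi> f = f p"
    and "finite G" "C \<subseteq> poly_funs G"
  shows "regular_funs C V \<subseteq> (\<lambda>f. restrict f V) ` poly_funs G"
proof
  fix f assume f: "f \<in> regular_funs C V"
  let ?N = "poly_funs G"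
  have CN: "h \<in> ?N" if "h \<in> poly_funs C" for h
    using that by induction (use assms(3) in \<open>auto intro: poly_funs.intros\<close>)
  \<comment> \<open>The ideal of denominators: those \<open>a\<close> for which \<open>a * f\<close>
    is polynomial on \<open>V\<close>. It contains 1 exactly when \<open>f\<close> itself is
    polynomial on \<open>V\<close>.\<close>
  define I where "I = {a \<in> ?N. \<exists>b\<in>?N. \<forall>p\<in>V. a p * f p = b p}"
  have II: "a \<in> I" if "a \<in> ?N" "b \<in> ?N" "\<And>p. p \<in> V \<Longrightarrow> a p * f p = b p" for a b
    using that unfolding I_def by blast
  have ID: "\<exists>b\<in>?N. \<forall>p\<in>V. a p * f p = b p" "a \<in> ?N" if "a \<in> I" for a
    using that unfolding I_def by blast+
  have "(\<lambda>_. 1) \<in> I"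
  proof (rule ccontr)
    assume n1: "(\<lambda>_. 1) \<notin> I"
    have add: "(\<lambda>p. a p + b p) \<in> I" if ab: "a \<in> I" "b \<in> I" for a b
    proof -
      obtain a' b' where *: "a' \<in> ?N" "b' \<in> ?N" "\<forall>p\<in>V. a p * f p = a' p" "\<forall>p\<in>V. b p * f p = b' p"
        using ID(1)[OF ab(1)] ID(1)[OF ab(2)] by metis
      show ?thesis
        by (rule II[OF poly_funs.add[OF ID(2)[OF ab(1)] ID(2)[OF ab(2)]] poly_funs.add[OF *(1,2)]])
           (use *(3,4) in \<open>simp add: algebra_simps\<close>)
    qed
    have mul: "(\<lambda>p. b p * a p) \<in> I" if ab: "a \<in> I" "b \<in> ?N" for a b
    proof -
      obtain a' where *: "a' \<in> ?N" "\<forall>p\<in>V. a p * f p = a' p"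
        using ID(1)[OF ab(1)] by metis
      show ?thesis
        by (rule II[OF poly_funs.mult[OF ab(2) ID(2)[OF ab(1)]] poly_funs.mult[OF ab(2) *(1)]])
           (use *(2) in \<open>simp add: algebra_simps\<close>)
    qed
    have "(\<lambda>_. 0) \<in> I" by (rule II[OF poly_funs.const poly_funs.const[of 0]]) simp
    moreover have "I \<subseteq> ?N" unfolding I_def by blast
    ultimately have "proper_ideal ?N I"
      using add mul n1 unfolding proper_ideal_def by blast
    then obtain \<chi> where \<chi>: "poly_hom G \<chi>" "\<And>f. f \<in> I \<Longrightarrow> \<chi> f = 0"
      using weak_Nullstellensatz[OF assms(2)] by metis
    have "\<exists>p\<in>V. \<forall>f\<in>?N. \<chi> f = f p"
    proof (rule hom[OF \<chi>(1)])
      fix h assume "h \<in> ?N" "\<forall>p\<in>V. h p = 0"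
      then have "h \<in> I" by (intro II[OF _ poly_funs.const[of 0]]) simp_all
      then show "\<chi> h = 0" using \<chi>(2) by blast
    qed
    then obtain p where p: "p \<in> V" "\<And>h. h \<in> ?N \<Longrightarrow> \<chi> h = h p" by blast
    obtain U g h where U: "zariski_open C V U" "p \<in> U" "g \<in> poly_funs C" "h \<in> poly_funs C"
        "\<forall>q\<in>U. h q \<noteq> 0 \<and> f q = g q / h q"
      using f[unfolded regular_funs_def, THEN CollectD, THEN conjunct2, THEN bspec, OF p(1)] by metis
    obtain S where S: "S \<subseteq> poly_funs C" "U = {p \<in> V. \<exists>s\<in>S. s p \<noteq> 0}"
      using U(1) unfolding zariski_open_def by blast
    obtain s where s: "s \<in> S" "s p \<noteq> 0" using U(2) S(2) by blast
    \<comment> \<open>Multiplying by \<open>s\<close> makes the local identity global: outside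
      \<open>U\<close> both sides are zero because \<open>s\<close> vanishes there.\<close>
    have "s q * h q * f q = s q * g q" if "q \<in> V" for q
    proof (cases "s q = 0")
      case False
      then have "q \<in> U" using that s S by auto
      then show ?thesis using U(5) by auto
    qed auto
    moreover have N: "(\<lambda>q. s q * g q) \<in> ?N" "(\<lambda>q. s q * h q) \<in> ?N"
      using U s S by (auto intro!: CN poly_funs.mult)
    ultimately have "(\<lambda>q. s q * h q) \<in> I" by (intro II[OF N(2,1)]) simp
    then have "s p * h p = 0" using \<chi>(2) p(2)[OF N(2)] by simp
    then show False using s U(2,5) by auto
  qed
  then obtain b where b: "b \<in> ?N" "\<forall>p\<in>V. f p = b p" using ID(1) by fastforce
  have "f \<in> extensional V" using f unfolding regular_funs_def by blast
  then have "f = restrict b V" using b(2) by (auto simp: fun_eq_iff extensional_def)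
  then show "f \<in> (\<lambda>f. restrict f V) ` ?N" using b(1) by blast
qed

text \<open>
  The set \<open>V\<close> is the locally closed subset \<open>e = 0\<close> (for \<open>e \<in> Eq\<close>), \<open>d \<noteq> 0\<close> of the affine space
  \<open>S\<close> with coordinate functions \<open>C\<close>.
\<close>
locale affine_locus =
  fixes S :: "'p set" and C Eq :: "('p \<Rightarrow> complex) set" and d :: "'p \<Rightarrow> complex" and V :: "'p set"
  assumes coords: "\<And>v :: ('p \<Rightarrow> complex) \<Rightarrow> complex. \<exists>p\<in>S. \<forall>c\<in>C. c p = v c"
    and coords_inj: "\<And>p q. p \<in> S \<Longrightarrow> q \<in> S \<Longrightarrow> (\<And>c. c \<in> C \<Longrightarrow> c p = c q) \<Longrightarrow> p = q"
    and finite_coords: "finite C"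
    and Eq: "Eq \<subseteq> poly_funs C" and d: "d \<in> poly_funs C"
    and V: "V = {p\<in>S. (\<forall>e\<in>Eq. e p = 0) \<and> d p \<noteq> 0}"
begin

text \<open>Adjoining the reciprocal of \<open>d\<close> is the Rabinowitsch device for a principal
  open set. At zeros of \<open>d\<close> this generator takes the value 0, so functions are only
  compared on \<open>V\<close>.\<close>

abbreviation "gens \<equiv> insert (\<lambda>p. 1 / d p) C"

text \<open>The values of the character on the coordinates are the coordinates of the point sought.
  That it lies in \<open>V\<close> follows because \<open>e\<close> and
  \<open>d * (1 / d) - 1\<close> vanish on \<open>V\<close> and are therefore killed.\<close>

lemma hom_is_evaluation:
  assumes \<chi>: "poly_hom gens \<chi>"
    and vanish: "\<And>f. f \<in> poly_funs gens \<Longrightarrow> \<forall>p\<in>V. f p = 0 \<Longrightarrow> \<chi> f = (0::complex)"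
  shows "\<exists>p\<in>V. \<forall>f\<in>poly_funs gens. \<chi> f = f p"
proof -
  note const = poly_homD(1)[OF \<chi>] and add = poly_homD(2)[OF \<chi>] and mul = poly_homD(3)[OF \<chi>]
  obtain p where p: "p \<in> S" "\<And>c. c \<in> C \<Longrightarrow> c p = \<chi> c" using coords by metis
  have sub: "f \<in> poly_funs gens" if "f \<in> poly_funs C" for f
    using that by (rule poly_funs_mono) auto
  have C: "\<chi> f = f p" if "f \<in> poly_funs C" for f
    using that by induction (auto simp: const add mul sub p(2))
  have "e p = 0" if "e \<in> Eq" for e
    using vanish[of e] that C[of e] Eq V sub[of e] by auto
  moreover have inv: "d p * \<chi> (\<lambda>p. 1 / d p) = 1"
  proof -
    have gN: "(\<lambda>p. 1 / d p) \<in> poly_funs gens" by (intro poly_funs.gen) auto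
    have dg: "(\<lambda>p. d p * (1 / d p)) \<in> poly_funs gens" using poly_funs.mult[OF sub[OF d] gN] .
    \<comment> \<open>This function is zero on \<open>V\<close> only: where \<open>d\<close>
      vanishes it equals -1.\<close>
    have "\<chi> (\<lambda>q. d q * (1 / d q) + (-1)) = 0"
      by (rule vanish) (use poly_funs.add[OF dg poly_funs.const[of "-1"]] V in auto)
    moreover have "\<chi> (\<lambda>q. d q * (1 / d q) + (-1)) = \<chi> d * \<chi> (\<lambda>p. 1 / d p) + (-1)"
      using add[OF dg poly_funs.const[of "-1"]] mul[OF sub[OF d] gN] const by simp
    ultimately show ?thesis using C[OF d] by simp
  qed
  ultimately have pV: "p \<in> V" using p(1) V by auto
  have "\<chi> f = f p" if "f \<in> poly_funs gens" for f
    using that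
  proof induction
    case (gen f)
    moreover have "\<chi> (\<lambda>p. 1 / d p) = 1 / d p"
      using inv by (cases "d p = 0") (auto simp: eq_divide_eq mult.commute)
    ultimately show ?case using C[OF poly_funs.gen] by auto
  qed (auto simp: const add mul)
  then show ?thesis using pV by blast
qed

lemma gens_quotient:
  assumes "f \<in> poly_funs gens"
  shows "\<exists>g\<in>poly_funs C. \<exists>k. \<forall>p\<in>V. f p = g p / d p ^ k"
  using assms
proof induction
  case (const c)
  show ?case by (intro bexI[of _ "\<lambda>_. c"] exI[of _ 0]) (simp_all add: poly_funs.const)
next
  case (gen f)
  then consider "f = (\<lambda>p. 1 / d p)" | "f \<in> C" by auto
  then show ?case
  proof cases
    case 1
    then show ?thesis by (intro bexI[of _ "\<lambda>_. 1"] exI[of _ 1]) (simp_all add: poly_funs.const)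
  next
    case 2
    then show ?thesis by (intro bexI[of _ f] exI[of _ 0]) (simp_all add: poly_funs.gen)
  qed
next
  case (add f g)
  then obtain f' k g' l where *: "f' \<in> poly_funs C" "\<forall>p\<in>V. f p = f' p / d p ^ k"
    "g' \<in> poly_funs C" "\<forall>p\<in>V. g p = g' p / d p ^ l" by blast
  have "f p + g p = (f' p * d p ^ l + g' p * d p ^ k) / d p ^ (k + l)" if "p \<in> V" for p
  proof -
    have "d p \<noteq> 0" using that V by auto
    then show ?thesis using * that by (simp add: add_frac_eq power_add)
  qed
  then show ?case
    by (intro bexI[of _ "\<lambda>p. f' p * d p ^ l + g' p * d p ^ k"] exI[of _ "k + l"])
       (use * in \<open>simp_all add: poly_funs_intros d\<close>)
next
  case (mult f g)
  then obtain f' k g' l where *: "f' \<in> poly_funs C" "\<forall>p\<in>V. f p = f' p / d p ^ k"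
    "g' \<in> poly_funs C" "\<forall>p\<in>V. g p = g' p / d p ^ l" by blast
  then show ?case
    by (intro bexI[of _ "\<lambda>p. f' p * g' p"] exI[of _ "k + l"])
       (simp_all add: poly_funs_intros power_add)
qed

text \<open>The deep inclusion is the Nullstellensatz. Conversely, a polynomial in the generators is
  one quotient by a power of \<open>d\<close> on all of \<open>V\<close>, so \<open>V\<close> itself
  serves as neighbourhood of every point.\<close>

lemma regular_funs_eq: "regular_funs C V = (\<lambda>f. restrict f V) ` poly_funs gens"
proof
  show "regular_funs C V \<subseteq> (\<lambda>f. restrict f V) ` poly_funs gens"
    by (rule regular_funs_subset[OF hom_is_evaluation])
       (use finite_coords in \<open>auto intro: poly_funs.gen\<close>)
next
  show "(\<lambda>f. restrict f V) ` poly_funs gens \<subseteq> regular_funs C V"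
  proof clarify
    fix f assume "f \<in> poly_funs gens"
    then obtain g k where g: "g \<in> poly_funs C" "\<forall>p\<in>V. f p = g p / d p ^ k" using gens_quotient by blast
    have "zariski_open C V V" unfolding zariski_open_def
      by (rule exI[of _ "{\<lambda>_. 1}"]) (auto intro: poly_funs.const)
    moreover have "\<forall>q\<in>V. d q ^ k \<noteq> 0 \<and> restrict f V q = g q / d q ^ k" using g(2) V by simp
    ultimately have "zariski_open C V V \<and> p \<in> V \<and> g \<in> poly_funs C \<and> (\<lambda>p. d p ^ k) \<in> poly_funs C \<and>
        (\<forall>q\<in>V. d q ^ k \<noteq> 0 \<and> restrict f V q = g q / d q ^ k)" if "p \<in> V" for p
      using g(1) poly_funs_power[OF d, of k] that by simp
    then show "restrict f V \<in> regular_funs C V"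
      unfolding regular_funs_def
      by (intro CollectI conjI ballI exI[of _ V] exI[of _ g] exI[of _ "\<lambda>p. d p ^ k"]) simp_all
  qed
qed

lemma affine: "affine_variety V (regular_funs C V)"
  unfolding affine_variety_def
proof (intro conjI allI impI)
  show "\<exists>G. finite G \<and> regular_funs C V = (\<lambda>f. restrict f V) ` poly_funs G"
    by (intro exI[of _ gens] conjI regular_funs_eq) (simp add: finite_coords)
next
  fix \<chi> assume \<chi>: "alg_hom_to_complex V (regular_funs C V) \<chi>"
  \<comment> \<open>Composing with restriction turns a character of the restricted functions into
    one of the ring of total functions, where evaluation is already established.\<close>
  define \<chi>' where "\<chi>' f = \<chi> (restrict f V)" for f
  have R: "restrict f V \<in> regular_funs C V" if "f \<in> poly_funs gens" for f
    unfolding regular_funs_eq using that by blast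
  have \<chi>1: "\<chi> (\<lambda>p\<in>V. f p + g p) = \<chi> f + \<chi> g" "\<chi> (\<lambda>p\<in>V. f p * g p) = \<chi> f * \<chi> g"
    if "f \<in> regular_funs C V" "g \<in> regular_funs C V" for f g
    using \<chi> that unfolding alg_hom_to_complex_def by blast+
  have \<chi>2: "\<chi> (\<lambda>p\<in>V. c) = c" for c using \<chi> unfolding alg_hom_to_complex_def by auto
  have "\<exists>p\<in>V. \<forall>f\<in>poly_funs gens. \<chi>' f = f p"
  proof (rule hom_is_evaluation)
    show "poly_hom gens \<chi>'" unfolding poly_hom_def
    proof (intro conjI allI ballI)
      show "\<chi>' (\<lambda>_. c) = c" for c using \<chi>2 by (simp add: \<chi>'_def)
      fix f g assume fg: "f \<in> poly_funs gens" "g \<in> poly_funs gens"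
      have e: "(\<lambda>p\<in>V. restrict f V p + restrict g V p) = restrict (\<lambda>p. f p + g p) V"
         "(\<lambda>p\<in>V. restrict f V p * restrict g V p) = restrict (\<lambda>p. f p * g p) V"
        by (auto simp: restrict_def fun_eq_iff)
      show "\<chi>' (\<lambda>p. f p + g p) = \<chi>' f + \<chi>' g" "\<chi>' (\<lambda>p. f p * g p) = \<chi>' f * \<chi>' g"
        using \<chi>1[OF R[OF fg(1)] R[OF fg(2)]] unfolding e \<chi>'_def by simp_all
    qed
  next
    fix f assume "\<forall>p\<in>V. f p = (0::complex)"
    then have "restrict f V = restrict (\<lambda>_. 0) V" by (auto simp: restrict_def fun_eq_iff)
    then show "\<chi>' f = 0" using \<chi>2[of 0] by (simp add: \<chi>'_def)
  qed
  then obtain p where p: "p \<in> V" "\<And>f. f \<in> poly_funs gens \<Longrightarrow> \<chi>' f = f p" by blast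
  have ev: "\<forall>f\<in>regular_funs C V. \<chi> f = f p"
    using p unfolding regular_funs_eq \<chi>'_def by simp
  show "\<exists>!p. p \<in> V \<and> (\<forall>f\<in>regular_funs C V. \<chi> f = f p)"
  proof (intro ex1I[of _ p] conjI p(1) ev)
    fix q assume q: "q \<in> V \<and> (\<forall>f\<in>regular_funs C V. \<chi> f = f q)"
    show "q = p"
    proof (rule coords_inj)
      show "q \<in> S" "p \<in> S" using q p(1) V by auto
      fix c assume "c \<in> C"
      then have "restrict c V \<in> regular_funs C V" by (intro R poly_funs.gen) auto
      then have "restrict c V q = restrict c V p" using q ev by metis
      then show "c q = c p" using q p(1) by simp
    qed
  qed
qed

end

section \<open>Polynomial functions on an affine space\<close>

text \<open>Points are arbitrary functions on the index type; \<open>K\<close> selects the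
  coordinates that polynomials may use, so the number of variables can vary while the type of points
  stays fixed.\<close>

definition coord_funs :: "'k set \<Rightarrow> (('k \<Rightarrow> complex) \<Rightarrow> complex) set" where
  "coord_funs K = (\<lambda>k q. q k) ` K"

lemma coord_in: "k \<in> K \<Longrightarrow> (\<lambda>q. q k) \<in> poly_funs (coord_funs K)"
  by (rule poly_funs.gen) (auto simp: coord_funs_def)

lemma poly_funs_on_line:
  assumes "F \<in> poly_funs (coord_funs K)"
  obtains P where "\<And>t. F (\<lambda>k. a k + t * b k) = poly P t"
proof -
  have "\<exists>P. \<forall>t. F (\<lambda>k. a k + t * b k) = poly P t"
    using assms
  proof induction
    case (const c)
    show ?case by (rule exI[of _ "[:c:]"]) simp
  next
    case (gen f)
    then obtain k where "f = (\<lambda>q. q k)" unfolding coord_funs_def by blast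
    then show ?case by (intro exI[of _ "[:a k, b k:]"]) simp
  next
    case (add f g)
    then obtain P Q where "\<forall>t. f (\<lambda>k. a k + t * b k) = poly P t" "\<forall>t. g (\<lambda>k. a k + t * b k) = poly Q t"
      by blast
    then show ?case by (intro exI[of _ "P + Q"]) simp
  next
    case (mult f g)
    then obtain P Q where "\<forall>t. f (\<lambda>k. a k + t * b k) = poly P t" "\<forall>t. g (\<lambda>k. a k + t * b k) = poly Q t"
      by blast
    then show ?case by (intro exI[of _ "P * Q"]) simp
  qed
  then show ?thesis using that by blast
qed

text \<open>On the line through \<open>a\<close> and \<open>b\<close> both factors become
  polynomials in one complex variable, whose ring has no zero divisors.\<close>

lemma poly_funs_domain:
  assumes F: "F \<in> poly_funs (coord_funs K)" and G: "G \<in> poly_funs (coord_funs K)"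
    and FG: "\<And>q. F q * G q = 0" and "F a \<noteq> 0"
  shows "G b = 0"
proof -
  obtain P where P: "\<And>t. F (\<lambda>k. a k + t * (b k - a k)) = poly P t"
    using poly_funs_on_line[OF F, of a "\<lambda>k. b k - a k"] by blast
  obtain Q where Q: "\<And>t. G (\<lambda>k. a k + t * (b k - a k)) = poly Q t"
    using poly_funs_on_line[OF G, of a "\<lambda>k. b k - a k"] by blast
  have "poly (P * Q) t = 0" for t using FG[of "\<lambda>k. a k + t * (b k - a k)"] P Q by simp
  then have "P * Q = 0" using poly_all_0_iff_0 by blast
  moreover have "poly P 0 \<noteq> 0" using P[of 0] assms(4) by simp
  ultimately have "Q = 0" by auto
  then show ?thesis using Q[of 1] by simp
qed

text \<open>The point is that \<open>D\<close> does not depend on the other variables: one fixed set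
  of \<open>D + 1\<close> nodes then serves for interpolation on all parallel lines.\<close>

lemma poly_funs_degree_in_variable:
  assumes "F \<in> poly_funs (coord_funs K)"
  obtains D where "\<And>q. \<exists>P. Polynomial.degree P \<le> D \<and> (\<forall>t. F (q(k := t)) = poly P t)"
proof -
  have "\<exists>D. \<forall>q. \<exists>P. Polynomial.degree P \<le> D \<and> (\<forall>t. F (q(k := t)) = poly P t)"
    using assms
  proof induction
    case (const c)
    have "\<exists>P. Polynomial.degree P \<le> 0 \<and> (\<forall>t. c = poly P t)" by (rule exI[of _ "[:c:]"]) simp
    then show ?case by (intro exI[of _ 0]) simp
  next
    case (gen f)
    then obtain l where f: "f = (\<lambda>q. q l)" unfolding coord_funs_def by blast
    have "\<exists>P. Polynomial.degree P \<le> 1 \<and> (\<forall>t. f (q(k := t)) = poly P t)" for q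
      by (rule exI[of _ "if l = k then [:0, 1:] else [:q l:]"]) (simp add: f)
    then show ?case by blast
  next
    case (add f g)
    then obtain D E where D: "\<forall>q. \<exists>P. Polynomial.degree P \<le> D \<and> (\<forall>t. f (q(k := t)) = poly P t)"
      and E: "\<forall>q. \<exists>P. Polynomial.degree P \<le> E \<and> (\<forall>t. g (q(k := t)) = poly P t)" by blast
    have "\<exists>P. Polynomial.degree P \<le> max D E \<and> (\<forall>t. f (q(k := t)) + g (q(k := t)) = poly P t)" for q
    proof -
      obtain P Q where "Polynomial.degree P \<le> D" "\<forall>t. f (q(k := t)) = poly P t"
        "Polynomial.degree Q \<le> E" "\<forall>t. g (q(k := t)) = poly Q t" using D E by blast
      then show ?thesis by (intro exI[of _ "P + Q"]) (simp add: degree_add_le)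
    qed
    then show ?case by blast
  next
    case (mult f g)
    then obtain D E where D: "\<forall>q. \<exists>P. Polynomial.degree P \<le> D \<and> (\<forall>t. f (q(k := t)) = poly P t)"
      and E: "\<forall>q. \<exists>P. Polynomial.degree P \<le> E \<and> (\<forall>t. g (q(k := t)) = poly P t)" by blast
    have "\<exists>P. Polynomial.degree P \<le> D + E \<and> (\<forall>t. f (q(k := t)) * g (q(k := t)) = poly P t)" for q
    proof -
      obtain P Q where PQ: "Polynomial.degree P \<le> D" "\<forall>t. f (q(k := t)) = poly P t"
        "Polynomial.degree Q \<le> E" "\<forall>t. g (q(k := t)) = poly Q t" using D E by blast
      have "Polynomial.degree (P * Q) \<le> D + E"
        using degree_mult_le[of P Q] PQ(1,3) by linarith
      then show ?thesis using PQ by (intro exI[of _ "P * Q"]) simp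
    qed
    then show ?case by blast
  qed
  then show ?thesis using that by blast
qed

text \<open>The equation is homogeneous in \<open>a\<close> and \<open>b\<close>, so a root of
  \<open>b\<close> is a root of \<open>a\<close>, and the common linear factor can be cancelled from
  both. Induction on the degree of \<open>b\<close> ends with a unit.\<close>

lemma integral_quotient_dvd:
  fixes a b :: "complex poly"
  assumes "b \<noteq> 0" "a ^ d + (\<Sum>j<d. c j * a ^ j * b ^ (d - j)) = 0"
  shows "b dvd a"
  using assms
proof (induction "Polynomial.degree b" arbitrary: a b)
  case 0
  then have "is_unit b" using is_unit_iff_degree[of b] by simp
  then show ?case by (rule unit_imp_dvd)
next
  case (Suc n)
  then have "\<not> constant (poly b)" by (simp add: constant_degree)
  then obtain r where r: "poly b r = 0" using fundamental_theorem_of_algebra by blast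
  \<comment> \<open>For \<open>d = 0\<close> the equation would read 1 = 0.\<close>
  have d: "d \<noteq> 0" using Suc.prems(2) by (intro notI) simp
  have "poly (a ^ d + (\<Sum>j<d. c j * a ^ j * b ^ (d - j))) r = 0" using Suc.prems(2) by simp
  moreover have "(\<Sum>j<d. poly (c j * a ^ j * b ^ (d - j)) r) = 0"
    using r by (intro sum.neutral) simp
  ultimately have "poly a r ^ d = 0" by (simp only: poly_add poly_sum poly_power) simp
  then have "poly a r = 0" using d by simp
  then obtain a' where a': "a = [:-r, 1:] * a'" by (metis dvdE poly_eq_0_iff_dvd)
  obtain b' where b': "b = [:-r, 1:] * b'" using r by (metis dvdE poly_eq_0_iff_dvd)
  have b0: "b' \<noteq> 0" using Suc.prems(1) b' by auto
  then have deg: "Polynomial.degree b = Suc (Polynomial.degree b')"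
    unfolding b' by (subst degree_mult_eq) auto
  have "[:-r, 1:] ^ d * (a' ^ d + (\<Sum>j<d. c j * a' ^ j * b' ^ (d - j))) =
      a ^ d + (\<Sum>j<d. c j * a ^ j * b ^ (d - j))"
  proof -
    have "[:-r, 1:] ^ d * (c j * a' ^ j * b' ^ (d - j)) = c j * a ^ j * b ^ (d - j)" if "j < d" for j
    proof -
      have "[:-r, 1:] ^ d = [:-r, 1:] ^ j * [:-r, 1:] ^ (d - j)"
        using that by (simp flip: power_add)
      then show ?thesis unfolding a' b' power_mult_distrib by (simp only: mult_ac)
    qed
    then have "(\<Sum>j<d. [:-r, 1:] ^ d * (c j * a' ^ j * b' ^ (d - j))) = (\<Sum>j<d. c j * a ^ j * b ^ (d - j))"
      by (intro sum.cong refl) (simp only: lessThan_iff)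
    moreover have "[:-r, 1:] ^ d * a' ^ d = a ^ d" unfolding a' by (simp only: power_mult_distrib)
    ultimately show ?thesis unfolding distrib_left sum_distrib_left by simp
  qed
  then have "[:-r, 1:] ^ d * (a' ^ d + (\<Sum>j<d. c j * a' ^ j * b' ^ (d - j))) = 0"
    using Suc.prems(2) by simp
  then have "a' ^ d + (\<Sum>j<d. c j * a' ^ j * b' ^ (d - j)) = 0" by (simp only: mult_eq_0_iff power_eq_0_iff) simp
  then have "b' dvd a'" using Suc.hyps(1)[of b' a'] Suc.hyps(2) deg b0 by simp
  then show ?case unfolding a' b' by (rule mult_dvd_mono[OF dvd_refl])
qed

text \<open>
  Induction on the number of variables: on generic lines parallel to the last axis \<open>a / b\<close> is a
  polynomial of bounded degree, so it is recovered by Lagrange interpolation from its values on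
  finitely many hyperplanes.
\<close>
theorem poly_funs_integrally_closed:
  fixes K :: "'k set"
  assumes "finite K" "a \<in> poly_funs (coord_funs K)" "b \<in> poly_funs (coord_funs K)"
    "\<And>j. c j \<in> poly_funs (coord_funs K)" "b q0 \<noteq> 0"
    "\<And>q. a q ^ d + (\<Sum>j<d. c j q * a q ^ j * b q ^ (d - j)) = 0"
  obtains Y where "Y \<in> poly_funs (coord_funs K)" "\<And>q. a q = Y q * b q"
proof -
  have "\<exists>Y\<in>poly_funs (coord_funs K). \<forall>q. a q = Y q * b q"
    using assms
  proof (induction K arbitrary: a b c q0 rule: finite_induct)
    case empty
    have "a q = a q0" "b q = b q0" for q
      by (rule poly_funs_cong_on[OF empty.prems(1)], simp add: coord_funs_def)
         (rule poly_funs_cong_on[OF empty.prems(2)], simp add: coord_funs_def)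
    then have "a q = a q0 / b q0 * b q" for q using empty.prems(4) by (metis nonzero_eq_divide_eq)
    then show ?case by (intro bexI[of _ "\<lambda>_. a q0 / b q0"] poly_funs.const allI)
  next
    case (insert k K)
    have sub: "(\<lambda>q. f (q(k := t))) \<in> poly_funs (coord_funs K)" if "f \<in> poly_funs (coord_funs (insert k K))" for f t
      using that
    proof (rule poly_funs_subst)
      fix c assume "c \<in> coord_funs (insert k K)"
      then obtain l where l: "c = (\<lambda>q. q l)" "l = k \<or> l \<in> K" unfolding coord_funs_def by blast
      show "(\<lambda>q. c (q(k := t))) \<in> poly_funs (coord_funs K)"
        using l by (cases "l = k") (simp_all add: poly_funs.const coord_in)
    qed
    have mono: "f \<in> poly_funs (coord_funs (insert k K))" if "f \<in> poly_funs (coord_funs K)" for f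
      using that by (rule poly_funs_mono) (auto simp: coord_funs_def)
    obtain D where D: "\<And>q. \<exists>P. Polynomial.degree P \<le> D \<and> (\<forall>t. a (q(k := t)) = poly P t)"
      using poly_funs_degree_in_variable[OF insert.prems(1)] by metis
    have pol: "\<exists>P. \<forall>t. f (q(k := t)) = poly P t" if "f \<in> poly_funs (coord_funs (insert k K))" for f q
      using poly_funs_degree_in_variable[OF that] by metis
    obtain P0 where P0: "\<And>t. b (q0(k := t)) = poly P0 t" using pol[OF insert.prems(2)] by blast
    have "poly P0 (q0 k) \<noteq> 0" using P0[of "q0 k"] insert.prems(4) by simp
    then have "finite {t. poly P0 t = 0}" by (intro poly_roots_finite) auto
    then have "infinite (UNIV - {t. poly P0 t = 0})"
      using infinite_UNIV_char_0 by (rule Diff_infinite_finite)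
    \<comment> \<open>These are \<open>D + 1\<close> interpolation nodes, chosen so that
      \<open>b\<close> does not vanish identically on any of the hyperplanes given by a node; this
      is what the induction hypothesis needs.\<close>
    then obtain T where T: "finite T" "card T = Suc D" "T \<subseteq> UNIV - {t. poly P0 t = 0}"
      by (meson infinite_arbitrarily_large)
    have bT: "b (q0(k := t)) \<noteq> 0" if "t \<in> T" for t using T(3) P0 that by auto
    have "\<exists>Y\<in>poly_funs (coord_funs K). \<forall>q. a (q(k := t)) = Y q * b (q(k := t))" if "t \<in> T" for t
    proof (rule insert.IH[where ?c = "\<lambda>j q. c j (q(k := t))" and ?q0.0 = q0])
      show "(\<lambda>q. a (q(k := t))) \<in> poly_funs (coord_funs K)" "(\<lambda>q. b (q(k := t))) \<in> poly_funs (coord_funs K)"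
        "\<And>j. (\<lambda>q. c j (q(k := t))) \<in> poly_funs (coord_funs K)"
        using insert.prems(1,2,3) by (intro sub; simp)+
      show "b (q0(k := t)) \<noteq> 0" using bT[OF that] .
      show "a (q(k := t)) ^ d + (\<Sum>j<d. c j (q(k := t)) * a (q(k := t)) ^ j * b (q(k := t)) ^ (d - j)) = 0" for q
        using insert.prems(5)[of "q(k := t)"] .
    qed
    then obtain Y where Y: "\<And>t. t \<in> T \<Longrightarrow> Y t \<in> poly_funs (coord_funs K)"
      "\<And>t q. t \<in> T \<Longrightarrow> a (q(k := t)) = Y t q * b (q(k := t))" by metis
    \<comment> \<open>Lagrange interpolation in the variable \<open>k\<close> of the quotients
      \<open>Y t\<close> found on the hyperplanes; the \<open>Y t\<close> do not involve that
      variable.\<close>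
    define Z where "Z q = (\<Sum>t\<in>T. Y t q * (\<Prod>s\<in>T - {t}. (q k - s) * inverse (t - s)))" for q
    have Zp: "Z \<in> poly_funs (coord_funs (insert k K))"
      unfolding Z_def by (intro poly_funs_intros mono[OF Y(1)] coord_in) auto
    \<comment> \<open>On a line that meets no zero of \<open>b\<close> at the nodes,
      \<open>a / b\<close> is a polynomial \<open>W\<close> of degree at most \<open>D\<close>. It
      agrees with the interpolant at \<open>D + 1\<close> nodes, so the two are equal.\<close>
    have gen: "a q = Z q * b q" if nz: "\<And>t. t \<in> T \<Longrightarrow> b (q(k := t)) \<noteq> 0" for q
    proof -
      obtain A where A: "Polynomial.degree A \<le> D" "\<And>t. a (q(k := t)) = poly A t" using D by blast
      obtain B where B: "\<And>t. b (q(k := t)) = poly B t" using pol[OF insert.prems(2)] by blast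
      have "\<exists>P. \<forall>t. c j (q(k := t)) = poly P t" for j by (rule pol[OF insert.prems(3)])
      then obtain C where C: "\<And>j t. c j (q(k := t)) = poly (C j) t" by metis
      have "poly (A ^ d + (\<Sum>j<d. C j * A ^ j * B ^ (d - j))) t = 0" for t
        using insert.prems(5)[of "q(k := t)"]
        by (simp only: poly_sum poly_add poly_mult poly_power A(2) B C)
      then have eq: "A ^ d + (\<Sum>j<d. C j * A ^ j * B ^ (d - j)) = 0" using poly_all_0_iff_0 by blast
      have "T \<noteq> {}" using T(2) by auto
      then have B0: "B \<noteq> 0" using nz B by force
      then obtain W where W: "A = B * W" using integral_quotient_dvd[OF _ eq] by (auto elim: dvdE)
      have degW: "Polynomial.degree W \<le> D"
      proof (cases "W = 0")
        case False
        then show ?thesis using A(1) B0 unfolding W by (simp add: degree_mult_eq)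
      qed simp
      define L where "L = (\<Sum>t\<in>T. Polynomial.smult (Y t q) (\<Prod>s\<in>T - {t}. Polynomial.smult (inverse (t - s)) [:-s, 1:]))"
      have "Polynomial.degree (\<Prod>s\<in>T - {t}. Polynomial.smult (inverse (t - s)) [:-s, 1:]) \<le> D" if "t \<in> T" for t
      proof -
        have "Polynomial.degree (\<Prod>s\<in>T - {t}. Polynomial.smult (inverse (t - s)) [:-s, 1:])
          \<le> (\<Sum>s\<in>T - {t}. Polynomial.degree (Polynomial.smult (inverse (t - s)) [:-s, 1:]))"
          by (rule degree_prod_sum_le[unfolded comp_def]) (use T in simp)
        also have "\<dots> \<le> (\<Sum>s\<in>T - {t}. 1)" by (intro sum_mono) simp
        also have "\<dots> = D" using T that by simp
        finally show ?thesis .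
      qed
      then have degL: "Polynomial.degree L \<le> D" unfolding L_def
        by (intro degree_sum_le T(1) order_trans[OF degree_smult_le])
      have L: "poly L x = (\<Sum>t\<in>T. Y t q * (\<Prod>s\<in>T - {t}. (x - s) * inverse (t - s)))" for x
      proof -
        have "poly (Polynomial.smult (inverse (t - s)) [:-s, 1:]) x = (x - s) * inverse (t - s)" for t s
          by (simp add: algebra_simps)
        then show ?thesis unfolding L_def poly_sum by (simp only: poly_smult poly_prod)
      qed
      have "poly L t = Y t q" if "t \<in> T" for t
      proof -
        have "(\<Prod>s\<in>T - {u}. (t - s) * inverse (u - s)) = (if u = t then 1 else 0)" if "u \<in> T" for u
        proof (cases "u = t")
          case False
          then have "t \<in> T - {u}" using \<open>t \<in> T\<close> by simp
          then have "(\<Prod>s\<in>T - {u}. (t - s) * inverse (u - s)) = 0"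
            using T(1) by (intro prod_zero) auto
          then show ?thesis using False by simp
        next
          case True
          have "(\<Prod>s\<in>T - {t}. (t - s) * inverse (t - s)) = 1"
            by (intro prod.neutral ballI right_inverse) auto
          then show ?thesis using True by simp
        qed
        then have "poly L t = (\<Sum>u\<in>T. Y u q * (if u = t then 1 else 0))"
          unfolding L by (intro sum.cong) auto
        also have "\<dots> = Y t q" using that T(1) by (simp add: sum.remove[of T t])
        finally show ?thesis .
      qed
      moreover have "poly W t = Y t q" if "t \<in> T" for t
        using Y(2)[OF that, of q] nz[OF that] A(2)[of t] B[of t] W by simp
      ultimately have "L = W"
        by (intro poly_eqI_degree[of T]) (use degL degW T(2) in auto)
      then have "Z q = poly W (q k)" using L[of "q k"] unfolding Z_def by simp
      moreover have "a q = poly A (q k)" "b q = poly B (q k)" using A(2)[of "q k"] B[of "q k"] by simp_all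
      ultimately show ?thesis using W by simp
    qed
    \<comment> \<open>The exceptional lines are the zeros of this product, which is a nonzero
      polynomial; it cancels because there are no zero divisors.\<close>
    have "(\<Prod>t\<in>T. b (q(k := t))) * (a q - Z q * b q) = 0" for q
    proof (cases "\<forall>t\<in>T. b (q(k := t)) \<noteq> 0")
      case False
      then have "(\<Prod>t\<in>T. b (q(k := t))) = 0" using T(1) by (intro prod_zero) auto
      then show ?thesis by simp
    next
      case True
      then have "a q = Z q * b q" by (intro gen) blast
      then show ?thesis by simp
    qed
    moreover have "(\<lambda>q. \<Prod>t\<in>T. b (q(k := t))) \<in> poly_funs (coord_funs (insert k K))"
      by (intro poly_funs_intros mono sub insert.prems(2))
    moreover have "(\<lambda>q. a q - Z q * b q) \<in> poly_funs (coord_funs (insert k K))"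
      by (intro poly_funs_intros insert.prems(1,2) Zp)
    moreover have "(\<Prod>t\<in>T. b (q0(k := t))) \<noteq> 0" using bT T(1) by simp
    ultimately have "a q - Z q * b q = 0" for q
      using poly_funs_domain[of "\<lambda>q. \<Prod>t\<in>T. b (q(k := t))" "insert k K" "\<lambda>q. a q - Z q * b q"] by blast
    then show ?case by (intro bexI[OF _ Zp]) simp
  qed
  then show ?thesis using that by blast
qed

section \<open>Secular equations\<close>

text \<open>Keeps the index 1 and the range \<open>{1..Suc m}\<close> intact; the arguments below
  treat such a range as a whole set of nodes.\<close>

declare One_nat_def [simp del] prod.cl_ivl_Suc [simp del]

lemma prod_linear_monic:
  fixes f :: "'i \<Rightarrow> complex"
  shows "Polynomial.degree (\<Prod>i\<in>I. [:- f i, 1:]) = card I" 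
    "poly.coeff (\<Prod>i\<in>I. [:- f i, 1:]) (card I) = 1"
proof -
  show 1: "Polynomial.degree (\<Prod>i\<in>I. [:- f i, 1:]) = card I"
    by (subst degree_prod_eq_sum_degree) auto
  have "lead_coeff (\<Prod>i\<in>I. [:- f i, 1:]) = 1" by (simp add: lead_coeff_prod)
  then show "poly.coeff (\<Prod>i\<in>I. [:- f i, 1:]) (card I) = 1" unfolding 1 .
qed

text \<open>Forced by evaluating the bordered characteristic polynomial at \<open>v l\<close>, where
  only the term with the \<open>l\<close>-th coefficient survives, and comparing with the product of
  the linear factors of \<open>w\<close>.\<close>

definition secular_coef :: "(nat \<Rightarrow> complex) \<Rightarrow> (nat \<Rightarrow> complex) \<Rightarrow> nat \<Rightarrow> nat \<Rightarrow> complex" where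
  "secular_coef v w m l = - (\<Prod>j\<in>{1..Suc m}. v l - w j) / (\<Prod>j\<in>{1..m} - {l}. v l - v j)"

text \<open>The secular equation at \<open>w 1\<close> solved for the corner entry.\<close>

definition secular_corner :: "(nat \<Rightarrow> complex) \<Rightarrow> (nat \<Rightarrow> complex) \<Rightarrow> nat \<Rightarrow> complex" where
  "secular_corner v w m = w 1 - (\<Sum>l\<in>{1..m}. secular_coef v w m l / (w 1 - v l))"

text \<open>
  The eigenvalues of the bordered diagonal matrix with diagonal \<open>v 1, ..., v m, u\<close>, last column
  \<open>a\<close> and last row \<open>b\<close> are \<open>w 1, ..., w (m + 1)\<close> iff \<open>secular (\<lambda>l. a l * b l) u j\<close> for all \<open>j\<close>.
\<close>
locale secular =
  fixes v w :: "nat \<Rightarrow> complex" and m :: nat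
  assumes v: "inj_on v {1..m}" and w: "inj_on w {1..Suc m}"
    and vw: "\<And>i j. i \<in> {1..m} \<Longrightarrow> j \<in> {1..Suc m} \<Longrightarrow> v i \<noteq> w j"
begin

definition secular :: "(nat \<Rightarrow> complex) \<Rightarrow> complex \<Rightarrow> nat \<Rightarrow> bool" where
  "secular c u j \<longleftrightarrow> (\<Sum>l\<in>{1..m}. c l / (w j - v l)) + u = w j"

abbreviation "coef \<equiv> secular_coef v w m"
abbreviation "corner \<equiv> secular_corner v w m"

text \<open>The characteristic polynomial of the bordered diagonal matrix, expanded along its
  border; \<open>c l\<close> stands for \<open>a l * b l\<close>.\<close>

definition bordered_poly :: "(nat \<Rightarrow> complex) \<Rightarrow> complex \<Rightarrow> complex poly" where
  "bordered_poly c u = [:- u, 1:] * (\<Prod>l\<in>{1..m}. [:- v l, 1:])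
     - (\<Sum>l\<in>{1..m}. Polynomial.smult (c l) (\<Prod>k\<in>{1..m} - {l}. [:- v k, 1:]))"

lemma bordered_poly_monic:
  "poly.coeff (bordered_poly c u) (Suc m) = 1" "Polynomial.degree (bordered_poly c u) \<le> Suc m"
proof -
  have d1: "Polynomial.degree ([:- u, 1:] * (\<Prod>l\<in>{1..m}. [:- v l, 1:])) = Suc m"
    using prod_linear_monic(1)[of v "{1..m}"] by (subst degree_mult_eq) auto
  have c1: "poly.coeff ([:- u, 1:] * (\<Prod>l\<in>{1..m}. [:- v l, 1:])) (Suc m) = 1"
    using prod_linear_monic[of v "{1..m}"]
    by (simp add: coeff_eq_0)
  have d2: "Polynomial.degree (\<Sum>l\<in>{1..m}. Polynomial.smult (c l) (\<Prod>k\<in>{1..m} - {l}. [:- v k, 1:])) \<le> m"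
  proof (intro degree_sum_le order_trans[OF degree_smult_le])
    fix l assume "l \<in> {1..m}"
    then show "Polynomial.degree (\<Prod>k\<in>{1..m} - {l}. [:- v k, 1:]) \<le> m"
      unfolding prod_linear_monic(1) by simp
  qed auto
  show "poly.coeff (bordered_poly c u) (Suc m) = 1"
    unfolding bordered_poly_def using c1 d2 by (simp only: coeff_diff) (simp add: coeff_eq_0)
  show "Polynomial.degree (bordered_poly c u) \<le> Suc m"
    unfolding bordered_poly_def using d1 d2 by (intro degree_diff_le) auto
qed

lemma bordered_poly_v:
  assumes "l \<in> {1..m}"
  shows "poly (bordered_poly c u) (v l) = - c l * (\<Prod>k\<in>{1..m} - {l}. v l - v k)"
proof -
  have "(\<Prod>k\<in>{1..m}. v l - v k) = 0" using assms by (intro prod_zero) auto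
  moreover have "(\<Sum>i\<in>{1..m}. c i * (\<Prod>k\<in>{1..m} - {i}. v l - v k)) =
      (\<Sum>i\<in>{1..m}. if i = l then c l * (\<Prod>k\<in>{1..m} - {l}. v l - v k) else 0)"
    using assms by (intro sum.cong refl) (auto intro!: prod_zero)
  ultimately show ?thesis using assms
    unfolding bordered_poly_def by (simp add: poly_sum poly_prod)
qed

lemma diff_nonzero: "l \<in> {1..m} \<Longrightarrow> j \<in> {1..Suc m} \<Longrightarrow> w j - v l \<noteq> 0"
  using vw[of l j] by (metis right_minus_eq)

lemma prod_vw_nonzero: "j \<in> {1..Suc m} \<Longrightarrow> (\<Prod>l\<in>{1..m}. w j - v l) \<noteq> 0"
  using diff_nonzero[of _ j] by (simp add: prod_zero_iff)

lemma bordered_poly_w: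
  assumes "j \<in> {1..Suc m}"
  shows "poly (bordered_poly c u) (w j) =
    (\<Prod>l\<in>{1..m}. w j - v l) * (w j - u - (\<Sum>l\<in>{1..m}. c l / (w j - v l)))"
proof -
  have "(\<Prod>k\<in>{1..m}. w j - v k) * (c l / (w j - v l)) = c l * (\<Prod>k\<in>{1..m} - {l}. w j - v k)"
    if "l \<in> {1..m}" for l
    using that diff_nonzero[OF that assms] by (simp add: prod.remove[of "{1..m}" l])
  then have "(\<Prod>k\<in>{1..m}. w j - v k) * (\<Sum>l\<in>{1..m}. c l / (w j - v l)) =
     (\<Sum>l\<in>{1..m}. c l * (\<Prod>k\<in>{1..m} - {l}. w j - v k))"
    unfolding sum_distrib_left by (intro sum.cong refl)
  then show ?thesis unfolding bordered_poly_def
    by (simp add: poly_sum poly_prod algebra_simps)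
qed

lemma secular_iff:
  assumes "j \<in> {1..Suc m}"
  shows "secular c u j \<longleftrightarrow> poly (bordered_poly c u) (w j) = 0"
  unfolding bordered_poly_w[OF assms] secular_def 
  by (simp only: mult_eq_0_iff prod_vw_nonzero[OF assms] HOL.simp_thms) (auto simp: algebra_simps)

lemma prod_vv_nonzero: "l \<in> {1..m} \<Longrightarrow> (\<Prod>k\<in>{1..m} - {l}. v l - v k) \<noteq> 0"
proof -
  assume l: "l \<in> {1..m}"
  have "v l - v k \<noteq> 0" if "k \<in> {1..m} - {l}" for k
    using inj_onD[OF v, of l k] l that by auto
  then show ?thesis by (simp add: prod_zero_iff)
qed

lemma coef_nonzero: "l \<in> {1..m} \<Longrightarrow> coef l \<noteq> 0"
proof -
  assume l: "l \<in> {1..m}"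
  have "v l - w j \<noteq> 0" if "j \<in> {1..Suc m}" for j using vw[OF l that] by simp
  then have "(\<Prod>j\<in>{1..Suc m}. v l - w j) \<noteq> 0" by (simp add: prod_zero_iff)
  then show ?thesis unfolding secular_coef_def using prod_vv_nonzero[OF l] by (metis divide_eq_0_iff neg_equal_0_iff_equal)
qed

lemma poly_prod_w: "poly (\<Prod>j\<in>{1..Suc m}. [:- w j, 1:]) t = (\<Prod>j\<in>{1..Suc m}. t - w j)"
  unfolding poly_prod by (intro prod.cong refl) simp

text \<open>The bordered polynomial and the product of the linear factors of \<open>w\<close> are
  monic of degree \<open>m + 1\<close> and agree at the \<open>m + 1\<close> points
  \<open>v l\<close> and \<open>w 1\<close>; hence they are equal, and every \<open>w j\<close> is a
  root.\<close>

lemma secular_coef_corner: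
  assumes "j \<in> {1..Suc m}"
  shows "secular coef corner j"
proof -
  have nin: "w 1 \<notin> v ` {1..m}" using vw[of _ 1] by force
  have zero: "poly (bordered_poly coef corner) (w 1) = 0"
    using bordered_poly_w[of 1 coef corner] unfolding secular_corner_def by simp
  have pw: "(\<Prod>j\<in>{1..Suc m}. w i - w j) = 0" if "i \<in> {1..Suc m}" for i
    using that by (intro prod_zero) auto
  have "bordered_poly coef corner = (\<Prod>j\<in>{1..Suc m}. [:- w j, 1:])"
  proof (rule poly_eqI_degree_lead_coeff[where n = "Suc m" and A = "insert (w 1) (v ` {1..m})"])
    show "poly.coeff (bordered_poly coef corner) (Suc m) = poly.coeff (\<Prod>j\<in>{1..Suc m}. [:- w j, 1:]) (Suc m)"
      using bordered_poly_monic(1)[of coef corner] prod_linear_monic(2)[of w "{1..Suc m}"] by simp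
    show "Suc m \<le> card (insert (w 1) (v ` {1..m}))" using nin card_image[OF v] by simp
    show "Polynomial.degree (\<Prod>j\<in>{1..Suc m}. [:- w j, 1:]) \<le> Suc m"
      unfolding prod_linear_monic(1) by simp
    fix z assume "z \<in> insert (w 1) (v ` {1..m})"
    then consider "z = w 1" | l where "l \<in> {1..m}" "z = v l" by blast
    then show "poly (bordered_poly coef corner) z = poly (\<Prod>j\<in>{1..Suc m}. [:- w j, 1:]) z"
    proof cases
      case 1
      then show ?thesis unfolding poly_prod_w using zero pw[of 1] by simp
    next
      case 2
      then show ?thesis unfolding poly_prod_w
        using bordered_poly_v[of l] prod_vv_nonzero[of l] by (simp add: secular_coef_def)
    qed
  qed (rule bordered_poly_monic)
  then have "poly (bordered_poly coef corner) (w j) = 0" using pw[OF assms] poly_prod_w by simp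
  then show ?thesis using secular_iff[OF assms] by simp
qed

text \<open>The same comparison with the nodes \<open>w j\<close>; once the polynomials are equal,
  evaluation at the \<open>v l\<close> recovers the coefficients.\<close>

lemma secular_unique:
  assumes "\<And>j. j \<in> {1..Suc m} \<Longrightarrow> secular c u j"
  shows "l \<in> {1..m} \<Longrightarrow> c l = coef l" "u = corner"
proof -
  have pw: "(\<Prod>j\<in>{1..Suc m}. w i - w j) = 0" if "i \<in> {1..Suc m}" for i
    using that by (intro prod_zero) auto
  have "bordered_poly c u = (\<Prod>j\<in>{1..Suc m}. [:- w j, 1:])"
  proof (rule poly_eqI_degree_lead_coeff[where n = "Suc m" and A = "w ` {1..Suc m}"])
    show "poly.coeff (bordered_poly c u) (Suc m) = poly.coeff (\<Prod>j\<in>{1..Suc m}. [:- w j, 1:]) (Suc m)"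
      using bordered_poly_monic(1)[of c u] prod_linear_monic(2)[of w "{1..Suc m}"] by simp
    show "Suc m \<le> card (w ` {1..Suc m})" using card_image[OF w] by simp
    show "Polynomial.degree (\<Prod>j\<in>{1..Suc m}. [:- w j, 1:]) \<le> Suc m"
      unfolding prod_linear_monic(1) by simp
    fix z assume "z \<in> w ` {1..Suc m}"
    then obtain j where j: "j \<in> {1..Suc m}" "z = w j" by blast
    then show "poly (bordered_poly c u) z = poly (\<Prod>j\<in>{1..Suc m}. [:- w j, 1:]) z"
      unfolding poly_prod_w using assms[OF j(1)] secular_iff[OF j(1)] pw[OF j(1)] by simp
  qed (rule bordered_poly_monic)
  then have eq: "- c l * (\<Prod>k\<in>{1..m} - {l}. v l - v k) = (\<Prod>j\<in>{1..Suc m}. v l - w j)"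
    if "l \<in> {1..m}" for l using bordered_poly_v[OF that] poly_prod_w by metis
  show c: "c l = coef l" if "l \<in> {1..m}" for l
    using eq[OF that] prod_vv_nonzero[OF that] unfolding secular_coef_def by (metis minus_mult_left nonzero_mult_div_cancel_right minus_minus)
  have "(\<Sum>l\<in>{1..m}. c l / (w 1 - v l)) = (\<Sum>l\<in>{1..m}. coef l / (w 1 - v l))"
    using c by (intro sum.cong refl) simp
  then show "u = corner" using assms[of 1] unfolding secular_def secular_corner_def by (simp add: algebra_simps)
qed

text \<open>Left and right eigenvectors for different eigenvalues are orthogonal. By partial
  fractions the sum is the difference of two secular equations divided by
  \<open>w j - w k\<close>.\<close>

lemma secular_orthogonal:
  assumes jk: "j \<in> {1..Suc m}" "k \<in> {1..Suc m}" "j \<noteq> k"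
  shows "(\<Sum>l\<in>{1..m}. coef l / ((w j - v l) * (w k - v l))) + 1 = 0"
proof -
  have wjk: "w j - w k \<noteq> 0" using w jk by (auto simp: inj_on_def)
  have "(w j - w k) * (coef l / ((w j - v l) * (w k - v l))) = coef l / (w k - v l) - coef l / (w j - v l)"
    if "l \<in> {1..m}" for l
  proof -
    have nz: "w j - v l \<noteq> 0" "w k - v l \<noteq> 0" using diff_nonzero[OF that] jk by blast+
    have frac: "(x - y) * (c / (x * y)) = c / y - c / x" if "x \<noteq> 0" "y \<noteq> 0" for x y c :: complex
      using that by (simp add: field_simps)
    have "w j - w k = (w j - v l) - (w k - v l)" by simp
    then show ?thesis using frac[OF nz, of "coef l"] by (simp only:)
  qed
  then have "(w j - w k) * (\<Sum>l\<in>{1..m}. coef l / ((w j - v l) * (w k - v l)))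
      = (\<Sum>l\<in>{1..m}. coef l / (w k - v l)) - (\<Sum>l\<in>{1..m}. coef l / (w j - v l))"
    unfolding sum_distrib_left sum_subtractf[symmetric] by (intro sum.cong refl)
  also have "\<dots> = - (w j - w k)"
    using secular_coef_corner[OF jk(1), unfolded secular_def, folded eq_diff_eq]
      secular_coef_corner[OF jk(2), unfolded secular_def, folded eq_diff_eq] by simp
  finally have "(w j - w k) * ((\<Sum>l\<in>{1..m}. coef l / ((w j - v l) * (w k - v l))) + 1) = 0"
    by (simp add: algebra_simps)
  then show ?thesis using wjk by (simp only: mult_eq_0_iff) simp
qed

text \<open>The pairing of the left and the right eigenvector for the same \<open>w j\<close>, in
  closed form. Its reciprocal is the normalising factor of the inverse eigenbasis.\<close>

lemma secular_norm:
  assumes j: "j \<in> {1..Suc m}"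
  shows "(\<Prod>l\<in>{1..m}. w j - v l) * ((\<Sum>l\<in>{1..m}. coef l / ((w j - v l) * (w j - v l))) + 1)
    = (\<Prod>k\<in>{1..Suc m} - {j}. w j - w k)"
proof -
  \<comment> \<open>The bordered polynomial divided by the linear factor of \<open>w j\<close>; its
    zeros are the remaining \<open>w k\<close>, by orthogonality.\<close>
  define R where "R = (\<Prod>l\<in>{1..m}. [:- v l, 1:])
     + (\<Sum>l\<in>{1..m}. Polynomial.smult (coef l / (w j - v l)) (\<Prod>k\<in>{1..m} - {l}. [:- v k, 1:]))"
  have Rw: "poly R (w i) = (\<Prod>l\<in>{1..m}. w i - v l) * ((\<Sum>l\<in>{1..m}. coef l / ((w j - v l) * (w i - v l))) + 1)"
    if i: "i \<in> {1..Suc m}" for i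
  proof -
    have "(\<Prod>k\<in>{1..m}. w i - v k) * (coef l / ((w j - v l) * (w i - v l)))
        = coef l / (w j - v l) * (\<Prod>k\<in>{1..m} - {l}. w i - v k)" if "l \<in> {1..m}" for l
      using that diff_nonzero[OF that i] diff_nonzero[OF that j] by (simp add: prod.remove[of "{1..m}" l])
    then have "(\<Prod>k\<in>{1..m}. w i - v k) * (\<Sum>l\<in>{1..m}. coef l / ((w j - v l) * (w i - v l))) =
       (\<Sum>l\<in>{1..m}. coef l / (w j - v l) * (\<Prod>k\<in>{1..m} - {l}. w i - v k))"
      unfolding sum_distrib_left by (intro sum.cong refl)
    then show ?thesis unfolding R_def by (simp add: poly_sum poly_prod algebra_simps)
  qed
  have "R = (\<Prod>k\<in>{1..Suc m} - {j}. [:- w k, 1:])"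
  \<comment> \<open>The degree bound \<open>m - 1\<close> on the second summand of \<open>R\<close>
    is strict only for positive \<open>m\<close>; for \<open>m = 0\<close> both sides are 1.\<close>
  proof (cases "m = 0")
    case True
    then have "{1..Suc m} - {j} = {}" using j by auto
    then have "(\<Prod>k\<in>{1..Suc m} - {j}. [:- w k, 1:]) = 1" by (simp only: prod.empty)
    moreover have "R = 1" unfolding R_def using True by simp
    ultimately show ?thesis by simp
  next
    case False
    have dl: "Polynomial.degree (\<Prod>k\<in>{1..m} - {l}. [:- v k, 1:]) < m" if "l \<in> {1..m}" for l
      using that unfolding prod_linear_monic(1) by simp
    have "Polynomial.degree (\<Sum>l\<in>{1..m}. Polynomial.smult (coef l / (w j - v l)) (\<Prod>k\<in>{1..m} - {l}. [:- v k, 1:])) \<le> m - 1"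
    proof (intro degree_sum_le order_trans[OF degree_smult_le])
      fix l assume "l \<in> {1..m}"
      then show "Polynomial.degree (\<Prod>k\<in>{1..m} - {l}. [:- v k, 1:]) \<le> m - 1" using dl[of l] by linarith
    qed auto
    then have d2: "Polynomial.degree (\<Sum>l\<in>{1..m}. Polynomial.smult (coef l / (w j - v l)) (\<Prod>k\<in>{1..m} - {l}. [:- v k, 1:])) < m"
      using False by linarith
    have cardj: "card ({1..Suc m} - {j}) = m" using j by simp
    show ?thesis
    proof (rule poly_eqI_degree_lead_coeff[where n = m and A = "w ` ({1..Suc m} - {j})"])
      show "poly.coeff R m = poly.coeff (\<Prod>k\<in>{1..Suc m} - {j}. [:- w k, 1:]) m"
        unfolding R_def using prod_linear_monic(2)[of v "{1..m}"] coeff_eq_0[OF d2]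
          prod_linear_monic(2)[of w "{1..Suc m} - {j}"] cardj by simp
      show "m \<le> card (w ` ({1..Suc m} - {j}))"
        using card_image[OF inj_on_subset[OF w Diff_subset]] cardj by simp
      show "Polynomial.degree R \<le> m" unfolding R_def using d2
        by (intro degree_add_le) (simp_all add: prod_linear_monic(1))
      show "Polynomial.degree (\<Prod>k\<in>{1..Suc m} - {j}. [:- w k, 1:]) \<le> m"
        unfolding prod_linear_monic(1) cardj by simp
      fix z assume "z \<in> w ` ({1..Suc m} - {j})"
      then obtain k where k: "k \<in> {1..Suc m}" "k \<noteq> j" "z = w k" by blast
      have "poly (\<Prod>k\<in>{1..Suc m} - {j}. [:- w k, 1:]) (w k) = 0"
        unfolding poly_prod using k by (intro prod_zero) auto
      then show "poly R z = poly (\<Prod>k\<in>{1..Suc m} - {j}. [:- w k, 1:]) z"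
        using Rw[OF k(1)] secular_orthogonal[OF j k(1)] k by simp
    qed
  qed
  then have "poly R (w j) = (\<Prod>k\<in>{1..Suc m} - {j}. w j - w k)" by (simp add: poly_prod)
  then show ?thesis using Rw[OF j] by simp
qed

end

text \<open>The columns of \<open>g\<close> are eigenvectors, and \<open>h\<close> is a left inverse
  of \<open>g\<close>. All are total functions, so blocks of different size share the same
  \<open>x\<close>. Matrix indices start at 0, eigenvalue indices at 1.\<close>

definition diagonalised ::
    "nat \<Rightarrow> (nat \<Rightarrow> nat \<Rightarrow> complex) \<Rightarrow> (nat \<Rightarrow> complex) \<Rightarrow> (nat \<Rightarrow> nat \<Rightarrow> complex) \<Rightarrow> (nat \<Rightarrow> nat \<Rightarrow> complex) \<Rightarrow> bool"
  where "diagonalised m x v g h \<longleftrightarrow>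
    (\<forall>i<m. \<forall>j\<in>{1..m}. (\<Sum>k<m. x i k * g k j) = g i j * v j) \<and>
    (\<forall>i\<in>{1..m}. \<forall>j\<in>{1..m}. (\<Sum>k<m. h i k * g k j) = of_bool (i = j))"

lemma diagonalisedD:
  assumes "diagonalised m x v g h"
  shows "i < m \<Longrightarrow> j \<in> {1..m} \<Longrightarrow> (\<Sum>k<m. x i k * g k j) = g i j * v j"
    and "i \<in> {1..m} \<Longrightarrow> j \<in> {1..m} \<Longrightarrow> (\<Sum>k<m. h i k * g k j) = of_bool (i = j)"
  using assms unfolding diagonalised_def by blast+

lemma sum_atLeast1: "(\<Sum>l\<in>{1..m}. f l) = (\<Sum>l<m. f (Suc l))"
proof -
  have "{1..m} = Suc ` {..<m}" by (simp add: image_Suc_lessThan)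
  then show ?thesis by (simp add: sum.reindex)
qed

text \<open>For square matrices a left inverse is a right inverse; the passage to \<open>mat\<close>
  is made only to use this.\<close>

lemma diagonalised_right_inverse:
  assumes "diagonalised m x v g h" "i < m" "k < m"
  shows "(\<Sum>l\<in>{1..m}. g i l * h l k) = of_bool (i = k)"
proof -
  define A where "A = mat m m (\<lambda>(i, j). h (Suc i) j)"
  define B where "B = mat m m (\<lambda>(i, j). g i (Suc j))"
  have AB: "A \<in> carrier_mat m m" "B \<in> carrier_mat m m" unfolding A_def B_def by auto
  have "A * B = 1\<^sub>m m"
  proof (rule eq_matI)
    fix i j assume "i < dim_row (1\<^sub>m m :: complex mat)" "j < dim_col (1\<^sub>m m :: complex mat)"
    then show "(A * B) $$ (i, j) = 1\<^sub>m m $$ (i, j)"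
      using diagonalisedD(2)[OF assms(1), of "Suc i" "Suc j"]
      by (simp add: A_def B_def scalar_prod_def atLeast0LessThan)
  qed (auto simp: A_def B_def)
  then have "B * A = 1\<^sub>m m" by (rule mat_mult_left_right_inverse[OF AB])
  then have "(B * A) $$ (i, k) = 1\<^sub>m m $$ (i, k)" by simp
  then have "(\<Sum>l<m. g i (Suc l) * h (Suc l) k) = of_bool (i = k)"
    using assms(2,3) by (simp add: A_def B_def scalar_prod_def atLeast0LessThan)
  then show ?thesis by (simp add: sum_atLeast1)
qed

lemma sum_delta_index:
  fixes f :: "nat \<Rightarrow> complex"
  assumes "finite I" "j \<in> I"
  shows "(\<Sum>l\<in>I. f l * of_bool (l = j)) = f j" "(\<Sum>l\<in>I. f l * of_bool (j = l)) = f j"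
    "(\<Sum>l\<in>I. of_bool (l = j) * f l) = f j" "(\<Sum>l\<in>I. of_bool (j = l) * f l) = f j"
proof -
  have *: "f l * of_bool P = (if P then f l else 0)" "of_bool P * f l = (if P then f l else 0)" for l P
    by simp_all
  show "(\<Sum>l\<in>I. f l * of_bool (l = j)) = f j" "(\<Sum>l\<in>I. f l * of_bool (j = l)) = f j"
    "(\<Sum>l\<in>I. of_bool (l = j) * f l) = f j" "(\<Sum>l\<in>I. of_bool (j = l) * f l) = f j"
    unfolding * using assms by simp_all
qed

lemma sum_sum_prod:
  fixes f :: "'a \<Rightarrow> complex"
  shows "(\<Sum>k\<in>K. (\<Sum>l\<in>L. f l * p l k) * q k) = (\<Sum>l\<in>L. f l * (\<Sum>k\<in>K. p l k * q k))"
    "(\<Sum>k\<in>K. q k * (\<Sum>l\<in>L. p l k * f l)) = (\<Sum>l\<in>L. (\<Sum>k\<in>K. q k * p l k) * f l)"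
proof -
  have "(\<Sum>k\<in>K. (\<Sum>l\<in>L. f l * p l k) * q k) = (\<Sum>k\<in>K. \<Sum>l\<in>L. f l * (p l k * q k))"
    by (simp add: sum_distrib_right mult.assoc)
  then show "(\<Sum>k\<in>K. (\<Sum>l\<in>L. f l * p l k) * q k) = (\<Sum>l\<in>L. f l * (\<Sum>k\<in>K. p l k * q k))"
    by (simp add: sum_distrib_left sum.swap[of _ L])
  have "(\<Sum>k\<in>K. q k * (\<Sum>l\<in>L. p l k * f l)) = (\<Sum>k\<in>K. \<Sum>l\<in>L. q k * p l k * f l)"
    by (simp add: sum_distrib_left mult.assoc)
  then show "(\<Sum>k\<in>K. q k * (\<Sum>l\<in>L. p l k * f l)) = (\<Sum>l\<in>L. (\<Sum>k\<in>K. q k * p l k) * f l)"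
    by (simp add: sum_distrib_right sum.swap[of _ L])
qed

text \<open>In the eigenbasis of the smaller block the eigenvector for \<open>w j\<close> has the
  entries \<open>a l / (w j - v l)\<close>, scaled so that its last entry is 1.\<close>

definition extend_g :: "(nat \<Rightarrow> complex) \<Rightarrow> (nat \<Rightarrow> complex) \<Rightarrow> nat \<Rightarrow>
    (nat \<Rightarrow> nat \<Rightarrow> complex) \<Rightarrow> (nat \<Rightarrow> complex) \<Rightarrow> nat \<Rightarrow> nat \<Rightarrow> complex" where
  "extend_g v w m g a i j = (if i < m then \<Sum>l\<in>{1..m}. g i l * (a l / (w j - v l)) else 1)"

text \<open>The left eigenvector for \<open>w j\<close>, built from the bottom border
  \<open>b\<close>, divided by its pairing with the right one; the quotient of products is the
  reciprocal given by \<open>secular_norm\<close>.\<close>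

definition extend_h :: "(nat \<Rightarrow> complex) \<Rightarrow> (nat \<Rightarrow> complex) \<Rightarrow> nat \<Rightarrow>
    (nat \<Rightarrow> nat \<Rightarrow> complex) \<Rightarrow> (nat \<Rightarrow> complex) \<Rightarrow> nat \<Rightarrow> nat \<Rightarrow> complex" where
  "extend_h v w m h b j i = (\<Prod>l\<in>{1..m}. w j - v l) / (\<Prod>k\<in>{1..Suc m} - {j}. w j - w k) *
     (if i < m then \<Sum>l\<in>{1..m}. (b l / (w j - v l)) * h l i else 1)"

context secular
begin

abbreviation "new_g \<equiv> extend_g v w m"
abbreviation "new_h \<equiv> extend_h v w m"

text \<open>As \<open>h\<close> and \<open>g\<close> are inverse to each other, rows and columns may
  be paired in eigenbasis coordinates.\<close>

lemma pairing:
  assumes dg: "diagonalised m x v g h"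
  shows "(\<Sum>k<m. (\<Sum>l\<in>{1..m}. p l * h l k) * (\<Sum>l\<in>{1..m}. g k l * q l)) = (\<Sum>l\<in>{1..m}. p l * q l)"
proof -
  have "(\<Sum>k<m. (\<Sum>l\<in>{1..m}. p l * h l k) * (\<Sum>l\<in>{1..m}. g k l * q l))
    = (\<Sum>l\<in>{1..m}. p l * (\<Sum>k<m. h l k * (\<Sum>l\<in>{1..m}. g k l * q l)))"
    by (rule sum_sum_prod(1))
  also have "\<dots> = (\<Sum>l\<in>{1..m}. p l * q l)"
  proof (intro sum.cong refl)
    fix l assume l: "l \<in> {1..m}"
    have "(\<Sum>k<m. h l k * (\<Sum>l\<in>{1..m}. g k l * q l)) = (\<Sum>l'\<in>{1..m}. (\<Sum>k<m. h l k * g k l') * q l')"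
      by (rule sum_sum_prod(2))
    also have "\<dots> = (\<Sum>l'\<in>{1..m}. of_bool (l = l') * q l')"
      using diagonalisedD(2)[OF dg l] by (intro sum.cong refl) simp
    also have "\<dots> = q l" using l by (intro sum_delta_index) auto
    finally show "p l * (\<Sum>k<m. h l k * (\<Sum>l\<in>{1..m}. g k l * q l)) = p l * q l" by simp
  qed
  finally show ?thesis .
qed

text \<open>In the eigenbasis of the smaller block, the larger one is bordered diagonal with borders
  \<open>a\<close>, \<open>b\<close> and the secular corner. The eigenvector equations become the
  secular equation, and biorthogonality becomes \<open>secular_orthogonal\<close> and
  \<open>secular_norm\<close>.\<close>

lemma diagonalised_extend:
  assumes dg: "diagonalised m x v g h" and a: "\<And>l. l \<in> {1..m} \<Longrightarrow> a l \<noteq> 0"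
    and b: "\<And>l. l \<in> {1..m} \<Longrightarrow> b l = coef l / a l"
    and col: "\<And>i. i < m \<Longrightarrow> x i m = (\<Sum>l\<in>{1..m}. g i l * a l)"
    and row: "\<And>i. i < m \<Longrightarrow> x m i = (\<Sum>l\<in>{1..m}. b l * h l i)"
    and cor: "x m m = corner"
  shows "diagonalised (Suc m) x w (new_g g a) (new_h h b)"
proof -
  have ab: "b l * a l = coef l" if "l \<in> {1..m}" for l using a[OF that] b[OF that] by simp
  have 1: "(\<Sum>k<Suc m. x i k * new_g g a k j) = new_g g a i j * w j"
    if i: "i < Suc m" and j: "j \<in> {1..Suc m}" for i j
  proof (cases "i < m")
    case True
    have "(\<Sum>k<m. x i k * (\<Sum>l\<in>{1..m}. g k l * (a l / (w j - v l)))) =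
       (\<Sum>l\<in>{1..m}. (\<Sum>k<m. x i k * g k l) * (a l / (w j - v l)))" by (rule sum_sum_prod(2))
    also have "\<dots> = (\<Sum>l\<in>{1..m}. g i l * v l * (a l / (w j - v l)))"
      using diagonalisedD(1)[OF dg True] by (intro sum.cong refl) simp
    finally have "(\<Sum>k<Suc m. x i k * new_g g a k j) =
       (\<Sum>l\<in>{1..m}. g i l * v l * (a l / (w j - v l))) + (\<Sum>l\<in>{1..m}. g i l * a l)"
      using col[OF True] by (simp add: extend_g_def)
    also have "\<dots> = (\<Sum>l\<in>{1..m}. g i l * (a l / (w j - v l)) * w j)"
      unfolding sum.distrib[symmetric]
    proof (intro sum.cong refl)
      fix l assume l: "l \<in> {1..m}"
      have "G * V * (A / (W - V)) + G * A = G * (A / (W - V)) * W" if "W - V \<noteq> 0" for G V A W :: complex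
        using that by (simp add: divide_simps) (simp add: algebra_simps)
      then show "g i l * v l * (a l / (w j - v l)) + g i l * a l = g i l * (a l / (w j - v l)) * w j"
        using diff_nonzero[OF l j] by blast
    qed
    also have "\<dots> = new_g g a i j * w j" using True by (simp add: extend_g_def sum_distrib_right)
    finally show ?thesis .
  next
    case False
    then have im: "i = m" using i by simp
    have "(\<Sum>k<m. x m k * (\<Sum>l\<in>{1..m}. g k l * (a l / (w j - v l)))) =
      (\<Sum>k<m. (\<Sum>l\<in>{1..m}. b l * h l k) * (\<Sum>l\<in>{1..m}. g k l * (a l / (w j - v l))))"
      using row by (intro sum.cong refl) simp
    also have "\<dots> = (\<Sum>l\<in>{1..m}. b l * (a l / (w j - v l)))" by (rule pairing[OF dg])
    also have "\<dots> = (\<Sum>l\<in>{1..m}. coef l / (w j - v l))"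
      using ab by (intro sum.cong refl) (metis times_divide_eq_right)
    finally have "(\<Sum>k<Suc m. x i k * new_g g a k j) = (\<Sum>l\<in>{1..m}. coef l / (w j - v l)) + corner"
      unfolding im using cor by (simp add: extend_g_def)
    also have "\<dots> = w j" using secular_coef_corner[OF j] unfolding secular_def .
    finally show ?thesis unfolding im by (simp add: extend_g_def)
  qed
  have 2: "(\<Sum>k<Suc m. new_h h b i k * new_g g a k j) = of_bool (i = j)"
    if i: "i \<in> {1..Suc m}" and j: "j \<in> {1..Suc m}" for i j
  proof -
    define N where "N = (\<Prod>l\<in>{1..m}. w i - v l) / (\<Prod>k\<in>{1..Suc m} - {i}. w i - w k)"
    have wnz: "(\<Prod>k\<in>{1..Suc m} - {i}. w i - w k) \<noteq> 0"
    proof -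
      have "w i - w k \<noteq> 0" if "k \<in> {1..Suc m} - {i}" for k
        using inj_onD[OF w, of i k] i that by auto
      then show ?thesis by (simp add: prod_zero_iff)
    qed
    have "(\<Sum>k<m. new_h h b i k * new_g g a k j) =
      N * (\<Sum>k<m. (\<Sum>l\<in>{1..m}. b l / (w i - v l) * h l k) * (\<Sum>l\<in>{1..m}. g k l * (a l / (w j - v l))))"
    proof (subst sum_distrib_left, intro sum.cong refl)
      fix k assume "k \<in> {..<m}"
      then have "new_h h b i k = N * (\<Sum>l\<in>{1..m}. b l / (w i - v l) * h l k)"
        "new_g g a k j = (\<Sum>l\<in>{1..m}. g k l * (a l / (w j - v l)))"
        by (simp_all add: extend_h_def extend_g_def N_def)
      then show "new_h h b i k * new_g g a k j =
        N * ((\<Sum>l\<in>{1..m}. b l / (w i - v l) * h l k) * (\<Sum>l\<in>{1..m}. g k l * (a l / (w j - v l))))"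
        by (simp only: mult.assoc)
    qed
    also have "\<dots> = N * (\<Sum>l\<in>{1..m}. b l / (w i - v l) * (a l / (w j - v l)))"
      unfolding pairing[OF dg] ..
    also have "(\<Sum>l\<in>{1..m}. b l / (w i - v l) * (a l / (w j - v l))) = (\<Sum>l\<in>{1..m}. coef l / ((w i - v l) * (w j - v l)))"
      using ab by (intro sum.cong refl) (metis times_divide_times_eq)
    finally have "(\<Sum>k<Suc m. new_h h b i k * new_g g a k j) =
       N * ((\<Sum>l\<in>{1..m}. coef l / ((w i - v l) * (w j - v l))) + 1)"
      by (simp add: extend_h_def extend_g_def N_def algebra_simps)
    also have "\<dots> = of_bool (i = j)"
    proof (cases "i = j")
      case False
      then show ?thesis using secular_orthogonal[OF i j] by simp
    next
      case True
      have "(\<Prod>l\<in>{1..m}. w i - v l) * ((\<Sum>l\<in>{1..m}. coef l / ((w i - v l) * (w j - v l))) + 1)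
        = (\<Prod>k\<in>{1..Suc m} - {i}. w i - w k)" using secular_norm[OF i] True by simp
      then show ?thesis using wnz True unfolding N_def times_divide_eq_left by simp
    qed
    finally show ?thesis .
  qed
  show ?thesis unfolding diagonalised_def using 1 2 by blast
qed

text \<open>Converse direction: eigenvectors of the larger block for all \<open>w j\<close> yield
  the secular equations for the products of border entries, and these equations have a unique
  solution. As its coefficients are nonzero, no border entry vanishes.\<close>

lemma diagonalised_restrict:
  fixes x :: "nat \<Rightarrow> nat \<Rightarrow> complex"
  assumes dg: "diagonalised m x v g h"
    and eig: "\<forall>j\<in>{1..Suc m}. \<exists>y. (\<exists>i<Suc m. y i \<noteq> 0) \<and>
      (\<forall>i<Suc m. (\<Sum>k<Suc m. x i k * y k) = w j * y i)"
  defines "a \<equiv> \<lambda>l. \<Sum>k<m. h l k * x k m" and "b \<equiv> \<lambda>l. \<Sum>k<m. x m k * g k l"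
  shows "l \<in> {1..m} \<Longrightarrow> a l \<noteq> 0" "l \<in> {1..m} \<Longrightarrow> b l = coef l / a l" "x m m = corner"
    "i < m \<Longrightarrow> x i m = (\<Sum>l\<in>{1..m}. g i l * a l)"
    "i < m \<Longrightarrow> x m i = (\<Sum>l\<in>{1..m}. b l * h l i)"
proof -
  have gh: "(\<Sum>l\<in>{1..m}. g i l * (\<Sum>k<m. h l k * y k)) = y i" if i: "i < m" for i and y :: "nat \<Rightarrow> complex"
  proof -
    have "(\<Sum>l\<in>{1..m}. g i l * (\<Sum>k<m. h l k * y k)) = (\<Sum>k<m. (\<Sum>l\<in>{1..m}. g i l * h l k) * y k)"
      by (rule sum_sum_prod(1)[symmetric])
    also have "\<dots> = (\<Sum>k<m. of_bool (i = k) * y k)"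
      using diagonalised_right_inverse[OF dg i] by (intro sum.cong refl) simp
    also have "\<dots> = y i" using i by (intro sum_delta_index) auto
    finally show ?thesis .
  qed
  show col: "x i m = (\<Sum>l\<in>{1..m}. g i l * a l)" if "i < m" for i
    unfolding a_def using gh[OF that, of "\<lambda>k. x k m"] by simp
  show row: "x m i = (\<Sum>l\<in>{1..m}. b l * h l i)" if i: "i < m" for i
  proof -
    have "(\<Sum>l\<in>{1..m}. b l * h l i) = (\<Sum>k<m. x m k * (\<Sum>l\<in>{1..m}. g k l * h l i))"
      unfolding b_def by (rule sum_sum_prod(2)[symmetric])
    also have "\<dots> = (\<Sum>k<m. x m k * of_bool (k = i))"
      using diagonalised_right_inverse[OF dg _ i] by (intro sum.cong refl) simp
    also have "\<dots> = x m i" using i by (intro sum_delta_index) auto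
    finally show ?thesis by simp
  qed
  have sec: "secular (\<lambda>l. b l * a l) (x m m) j" if j: "j \<in> {1..Suc m}" for j
  proof -
    obtain y i0 where y: "i0 < Suc m" "y i0 \<noteq> 0" "\<And>i. i < Suc m \<Longrightarrow> (\<Sum>k<Suc m. x i k * y k) = w j * y i"
      using eig j by blast
    define z where "z l = (\<Sum>k<m. h l k * y k)" for l
    have yz: "y i = (\<Sum>l\<in>{1..m}. g i l * z l)" if "i < m" for i
      unfolding z_def using gh[OF that] by simp
    \<comment> \<open>The first \<open>m\<close> rows of the eigenvector equation, transformed to
      the eigenbasis by \<open>h\<close>.\<close>
    have zl: "(w j - v l) * z l = y m * a l" if l: "l \<in> {1..m}" for l
    proof -
      have "(\<Sum>k<m. h l k * (\<Sum>i<m. x k i * y i)) = v l * z l"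
      proof -
        have "(\<Sum>k<m. h l k * (\<Sum>i<m. x k i * y i)) = (\<Sum>k<m. h l k * (\<Sum>l'\<in>{1..m}. g k l' * (v l' * z l')))"
        proof (intro sum.cong refl)
          fix k assume "k \<in> {..<m}"
          then have k: "k < m" by simp
          have "(\<Sum>i<m. x k i * y i) = (\<Sum>i<m. x k i * (\<Sum>l\<in>{1..m}. g i l * z l))"
            using yz by (intro sum.cong refl) simp
          also have "\<dots> = (\<Sum>l\<in>{1..m}. (\<Sum>i<m. x k i * g i l) * z l)" by (rule sum_sum_prod(2))
          also have "\<dots> = (\<Sum>l\<in>{1..m}. g k l * (v l * z l))"
            using diagonalisedD(1)[OF dg k] by (intro sum.cong refl) (simp add: mult.assoc)
          finally show "h l k * (\<Sum>i<m. x k i * y i) = h l k * (\<Sum>l\<in>{1..m}. g k l * (v l * z l))" by (rule arg_cong)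
        qed
        also have "\<dots> = (\<Sum>l'\<in>{1..m}. (\<Sum>k<m. h l k * g k l') * (v l' * z l'))" by (rule sum_sum_prod(2))
        also have "\<dots> = (\<Sum>l'\<in>{1..m}. of_bool (l = l') * (v l' * z l'))"
          using diagonalisedD(2)[OF dg l] by (intro sum.cong refl) simp
        also have "\<dots> = v l * z l" using l by (intro sum_delta_index) auto
        finally show ?thesis .
      qed
      moreover have "(\<Sum>k<m. h l k * (\<Sum>i<m. x k i * y i)) = (\<Sum>k<m. h l k * (w j * y k - x k m * y m))"
      proof (intro sum.cong refl)
        fix k assume "k \<in> {..<m}"
        then have "(\<Sum>i<m. x k i * y i) = w j * y k - x k m * y m" using y(3)[of k] by (simp add: eq_diff_eq)
        then show "h l k * (\<Sum>i<m. x k i * y i) = h l k * (w j * y k - x k m * y m)" by (rule arg_cong)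
      qed
      moreover have "\<dots> = w j * z l - y m * a l"
        unfolding z_def a_def sum_distrib_left sum_subtractf[symmetric]
        by (intro sum.cong refl) (simp add: algebra_simps)
      ultimately show ?thesis by (simp add: algebra_simps)
    qed
    \<comment> \<open>With last entry 0 the vector would be an eigenvector of the smaller block for
      \<open>w j\<close>, which is not among its eigenvalues.\<close>
    have ym: "y m \<noteq> 0"
    proof
      assume "y m = 0"
      then have "z l = 0" if "l \<in> {1..m}" for l using zl[OF that] diff_nonzero[OF that j] by simp
      then have "y i = 0" if "i < m" for i using yz[OF that] by simp
      then show False using y(1,2) \<open>y m = 0\<close> by (metis less_SucE)
    qed
    have "(\<Sum>k<m. x m k * y k) = (\<Sum>l\<in>{1..m}. b l * z l)"
    proof -
      have "(\<Sum>k<m. x m k * y k) = (\<Sum>k<m. x m k * (\<Sum>l\<in>{1..m}. g k l * z l))"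
        using yz by (intro sum.cong refl) simp
      also have "\<dots> = (\<Sum>l\<in>{1..m}. b l * z l)" unfolding b_def by (rule sum_sum_prod(2))
      finally show ?thesis .
    qed
    also have "\<dots> = (\<Sum>l\<in>{1..m}. y m * (b l * a l / (w j - v l)))"
    proof (intro sum.cong refl)
      fix l assume l: "l \<in> {1..m}"
      have "z l = y m * a l / (w j - v l)" using zl[OF l] diff_nonzero[OF l j] by (metis nonzero_mult_div_cancel_left)
      then show "b l * z l = y m * (b l * a l / (w j - v l))" by simp
    qed
    also have "\<dots> = y m * (\<Sum>l\<in>{1..m}. b l * a l / (w j - v l))" by (simp add: sum_distrib_left)
    finally have "y m * ((\<Sum>l\<in>{1..m}. b l * a l / (w j - v l)) + x m m) = y m * w j"
      using y(3)[of m] by (simp add: algebra_simps)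
    then show ?thesis unfolding secular_def using ym by simp
  qed
  show "x m m = corner" using secular_unique(2)[OF sec] .
  have ba: "b l * a l = coef l" if "l \<in> {1..m}" for l using secular_unique(1)[OF sec that] .
  show a0: "a l \<noteq> 0" if "l \<in> {1..m}" for l using ba[OF that] coef_nonzero[OF that] by auto
  show "b l = coef l / a l" if "l \<in> {1..m}" for l
    using ba[OF that] a0[OF that] by (metis nonzero_mult_div_cancel_right)
qed

end

section \<open>Parametrisation by eigenvalues and borders\<close>

text \<open>Closure arguments are made once and reused for polynomial functions, regular functions,
  a localised polynomial ring, and auxiliary sets of functions for which some property is to be
  propagated.\<close>

locale fun_alg =
  fixes R :: "('z \<Rightarrow> complex) set"
  assumes const: "(\<lambda>_. c) \<in> R"
    and add: "f \<in> R \<Longrightarrow> g \<in> R \<Longrightarrow> (\<lambda>z. f z + g z) \<in> R"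
    and mult: "f \<in> R \<Longrightarrow> g \<in> R \<Longrightarrow> (\<lambda>z. f z * g z) \<in> R"
begin

lemma uminus: "f \<in> R \<Longrightarrow> (\<lambda>z. - f z) \<in> R"
  using mult[OF const[of "-1"]] by fastforce

lemma diff: "f \<in> R \<Longrightarrow> g \<in> R \<Longrightarrow> (\<lambda>z. f z - g z) \<in> R"
  using add[OF _ uminus] by fastforce

lemma sum: "(\<And>i. i \<in> I \<Longrightarrow> f i \<in> R) \<Longrightarrow> (\<lambda>z. \<Sum>i\<in>I. f i z) \<in> R"
  by (induction I rule: infinite_finite_induct) (simp_all add: const add)

lemma prod: "(\<And>i. i \<in> I \<Longrightarrow> f i \<in> R) \<Longrightarrow> (\<lambda>z. \<Prod>i\<in>I. f i z) \<in> R"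
  by (induction I rule: infinite_finite_induct) (simp_all add: const mult)

lemma power: "f \<in> R \<Longrightarrow> (\<lambda>z. f z ^ k) \<in> R"
  by (induction k) (simp_all add: const mult)

lemma divide: "f \<in> R \<Longrightarrow> (\<lambda>z. inverse (g z)) \<in> R \<Longrightarrow> (\<lambda>z. f z / g z) \<in> R"
  unfolding divide_inverse by (rule mult)

lemma poly_funs_comp:
  assumes "f \<in> poly_funs C" "\<And>c. c \<in> C \<Longrightarrow> (\<lambda>z. c (\<phi> z)) \<in> R"
  shows "(\<lambda>z. f (\<phi> z)) \<in> R"
  using assms(1) by induction (auto intro: const add mult assms(2))

end

lemma fun_alg_poly_funs: "fun_alg (poly_funs C)"
  by unfold_locales (rule poly_funs.intros; assumption)+

text \<open>All pairs of labels whose eigenvalues must differ, in both orders. The relation is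
  symmetric and stable under level-preserving permutations, so the product of differences over it is
  invariant without any sign.\<close>

definition adjacent :: "nat \<Rightarrow> ((nat \<times> nat) \<times> (nat \<times> nat)) set" where
  "adjacent n = {(k, k') \<in> index_set n \<times> index_set n.
     snd k = snd k' \<and> fst k \<noteq> fst k' \<or> snd k' = Suc (snd k) \<or> snd k = Suc (snd k')}"

definition disc :: "nat \<Rightarrow> (nat \<times> nat \<Rightarrow> complex) \<Rightarrow> complex" where
  "disc n \<nu> = (\<Prod>p\<in>adjacent n. \<nu> (fst p) - \<nu> (snd p))"

lemma index_set_iff: "(i, m) \<in> index_set n \<longleftrightarrow> i \<in> {1..m} \<and> m \<in> {1..n}"
  unfolding index_set_def by auto

lemma index_set_mono: "m \<le> n \<Longrightarrow> index_set m \<subseteq> index_set n"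
  unfolding index_set_def by auto

lemma finite_index_set: "finite (index_set n)"
  by (rule finite_subset[of _ "{..n} \<times> {..n}"]) (auto simp: index_set_def)

lemma finite_adjacent: "finite (adjacent n)"
  by (rule finite_subset[of _ "index_set n \<times> index_set n"]) (auto simp: adjacent_def finite_index_set)

lemma disc_nonzero_iff: "disc n \<nu> \<noteq> 0 \<longleftrightarrow> (\<forall>p\<in>adjacent n. \<nu> (fst p) \<noteq> \<nu> (snd p))"
  unfolding disc_def using finite_adjacent by (simp add: prod_zero_iff)

lemma adjacent_same: "m \<in> {1..n} \<Longrightarrow> i \<in> {1..m} \<Longrightarrow> j \<in> {1..m} \<Longrightarrow> i \<noteq> j \<Longrightarrow> ((i, m), (j, m)) \<in> adjacent n"
  unfolding adjacent_def by (auto simp: index_set_iff)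

lemma adjacent_next:
  "m < n \<Longrightarrow> i \<in> {1..m} \<Longrightarrow> j \<in> {1..Suc m} \<Longrightarrow> ((i, m), (j, Suc m)) \<in> adjacent n"
  "m < n \<Longrightarrow> i \<in> {1..m} \<Longrightarrow> j \<in> {1..Suc m} \<Longrightarrow> ((j, Suc m), (i, m)) \<in> adjacent n"
  unfolding adjacent_def by (auto simp: index_set_iff)

lemma disc_secular:
  assumes "disc n \<nu> \<noteq> 0" "m < n"
  shows "secular (\<lambda>l. \<nu> (l, m)) (\<lambda>j. \<nu> (j, Suc m)) m"
proof
  note ne = assms(1)[unfolded disc_nonzero_iff, rule_format]
  show "inj_on (\<lambda>l. \<nu> (l, m)) {1..m}"
  proof (rule inj_onI, rule ccontr)
    fix i j assume ij: "i \<in> {1..m}" "j \<in> {1..m}" "\<nu> (i, m) = \<nu> (j, m)" "i \<noteq> j"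
    then have "m \<in> {1..n}" using assms(2) by auto
    then show False using ne[OF adjacent_same[OF _ ij(1,2,4)]] ij(3) by simp
  qed
  show "inj_on (\<lambda>j. \<nu> (j, Suc m)) {1..Suc m}"
  proof (rule inj_onI, rule ccontr)
    fix i j assume ij: "i \<in> {1..Suc m}" "j \<in> {1..Suc m}" "\<nu> (i, Suc m) = \<nu> (j, Suc m)" "i \<noteq> j"
    have "Suc m \<in> {1..n}" using assms(2) by auto
    then show False using ne[OF adjacent_same[OF _ ij(1,2,4)]] ij(3) by simp
  qed
  show "\<nu> (i, m) \<noteq> \<nu> (j, Suc m)" if "i \<in> {1..m}" "j \<in> {1..Suc m}" for i j
    using ne[OF adjacent_next(1)[OF assms(2) that]] by simp
qed

text \<open>Eigenbasis and inverse for every block. \<open>a (l, m)\<close> is the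
  \<open>l\<close>-th eigenbasis coordinate of the column added to block \<open>m\<close>; the
  coordinates of the added row are then forced. The value at 0 is arbitrary, as the empty block has
  no entries.\<close>

primrec param_gh :: "(nat \<times> nat \<Rightarrow> complex) \<Rightarrow> (nat \<times> nat \<Rightarrow> complex) \<Rightarrow> nat \<Rightarrow>
    (nat \<Rightarrow> nat \<Rightarrow> complex) \<times> (nat \<Rightarrow> nat \<Rightarrow> complex)" where
  "param_gh \<nu> a 0 = (\<lambda>_ _. 0, \<lambda>_ _. 0)"
| "param_gh \<nu> a (Suc m) =
    (extend_g (\<lambda>l. \<nu> (l, m)) (\<lambda>j. \<nu> (j, Suc m)) m (fst (param_gh \<nu> a m)) (\<lambda>l. a (l, m)),
     extend_h (\<lambda>l. \<nu> (l, m)) (\<lambda>j. \<nu> (j, Suc m)) m (snd (param_gh \<nu> a m))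
       (\<lambda>l. secular_coef (\<lambda>l. \<nu> (l, m)) (\<lambda>j. \<nu> (j, Suc m)) m l / a (l, m)))"

text \<open>An entry is fixed at the stage when its row or column is added: stage \<open>j\<close>
  above the diagonal, stage \<open>i\<close> below it, and the corner of stage \<open>i\<close> on
  it. Hence the blocks are nested and no matrix size enters.\<close>

definition param_x :: "(nat \<times> nat \<Rightarrow> complex) \<Rightarrow> (nat \<times> nat \<Rightarrow> complex) \<Rightarrow> nat \<Rightarrow> nat \<Rightarrow> complex" where
  "param_x \<nu> a i j =
    (if i < j then \<Sum>l\<in>{1..j}. fst (param_gh \<nu> a j) i l * a (l, j)
     else if j < i then \<Sum>l\<in>{1..i}.
       secular_coef (\<lambda>l. \<nu> (l, i)) (\<lambda>j. \<nu> (j, Suc i)) i l / a (l, i) * snd (param_gh \<nu> a i) l j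
     else secular_corner (\<lambda>l. \<nu> (l, i)) (\<lambda>j. \<nu> (j, Suc i)) i)"

text \<open>The border leading from block \<open>m\<close> to block \<open>m + 1\<close> carries the
  index \<open>m\<close>; block \<open>m\<close> therefore involves only parameters of level at most
  \<open>m - 1\<close>.\<close>

lemma param_diagonalised:
  assumes disc: "disc n \<nu> \<noteq> 0" and "m \<le> n" and "\<And>k. k \<in> index_set (m - 1) \<Longrightarrow> a k \<noteq> 0"
  shows "diagonalised m (param_x \<nu> a) (\<lambda>l. \<nu> (l, m)) (fst (param_gh \<nu> a m)) (snd (param_gh \<nu> a m))"
  using assms(2,3)
proof (induction m)
  case 0
  then show ?case by (simp add: diagonalised_def)
next
  case (Suc m)
  interpret secular "\<lambda>l. \<nu> (l, m)" "\<lambda>j. \<nu> (j, Suc m)" m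
    using disc_secular[OF disc] Suc.prems by simp
  have a: "a k \<noteq> 0" if "k \<in> index_set m" for k using Suc.prems(2) that by simp
  have "index_set (m - 1) \<subseteq> index_set m" by (rule index_set_mono) simp
  then have IH: "diagonalised m (param_x \<nu> a) (\<lambda>l. \<nu> (l, m)) (fst (param_gh \<nu> a m)) (snd (param_gh \<nu> a m))"
    using Suc.IH Suc.prems(1) a by auto
  have am: "a (l, m) \<noteq> 0" if "l \<in> {1..m}" for l
    using a that by (auto simp: index_set_iff)
  show ?case unfolding param_gh.simps fst_conv snd_conv
    by (rule diagonalised_extend[OF IH am]) (simp_all add: param_x_def)
qed

text \<open>The eigenbasis of block \<open>m\<close> ignores the parameters of level
  \<open>m\<close>, so these can be read off from a given matrix after the lower levels are
  known.\<close>

lemma param_gh_cong: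
  assumes "\<And>l k. k < m \<Longrightarrow> l \<in> {1..k} \<Longrightarrow> a (l, k) = a' (l, k)" "disc n \<nu> \<noteq> 0" "m \<le> n"
  shows "param_gh \<nu> a m = param_gh \<nu> a' m"
  using assms(1,3)
proof (induction m)
  case (Suc m)
  interpret secular "\<lambda>l. \<nu> (l, m)" "\<lambda>j. \<nu> (j, Suc m)" m
    using disc_secular[OF assms(2)] Suc.prems by simp
  have IH: "param_gh \<nu> a m = param_gh \<nu> a' m" using Suc by simp
  have am: "a (l, m) = a' (l, m)" if "l \<in> {1..m}" for l using Suc.prems(1)[OF _ that] by simp
  have 1: "new_g g (\<lambda>l. a (l, m)) = new_g g (\<lambda>l. a' (l, m))" for g
  proof (intro ext)
    fix i j
    have "(\<Sum>l\<in>{1..m}. g i l * (a (l, m) / (\<nu> (j, Suc m) - \<nu> (l, m)))) =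
        (\<Sum>l\<in>{1..m}. g i l * (a' (l, m) / (\<nu> (j, Suc m) - \<nu> (l, m))))"
      using am by (intro sum.cong refl) simp
    then show "new_g g (\<lambda>l. a (l, m)) i j = new_g g (\<lambda>l. a' (l, m)) i j" unfolding extend_g_def by simp
  qed
  have 2: "new_h h (\<lambda>l. coef l / a (l, m)) = new_h h (\<lambda>l. coef l / a' (l, m))" for h
  proof (intro ext)
    fix j i
    have "(\<Sum>l\<in>{1..m}. coef l / a (l, m) / (\<nu> (j, Suc m) - \<nu> (l, m)) * h l i) =
        (\<Sum>l\<in>{1..m}. coef l / a' (l, m) / (\<nu> (j, Suc m) - \<nu> (l, m)) * h l i)"
      using am by (intro sum.cong refl) simp
    then show "new_h h (\<lambda>l. coef l / a (l, m)) j i = new_h h (\<lambda>l. coef l / a' (l, m)) j i"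
      unfolding extend_h_def by simp
  qed
  show ?case unfolding param_gh.simps IH 1 2 ..
qed simp

lemma param_x_cong:
  assumes "\<And>l k. k < m \<Longrightarrow> l \<in> {1..k} \<Longrightarrow> a (l, k) = a' (l, k)" "disc n \<nu> \<noteq> 0" "m \<le> n" "i < m" "j < m"
  shows "param_x \<nu> a i j = param_x \<nu> a' i j"
proof -
  have gh: "param_gh \<nu> a k = param_gh \<nu> a' k" if "k < m" for k
  proof (rule param_gh_cong)
    show "a (l, k') = a' (l, k')" if "k' < k" "l \<in> {1..k'}" for l k'
      using assms(1)[of k' l] that \<open>k < m\<close> by simp
    show "k \<le> n" using that assms(3) by linarith
  qed (rule assms(2))
  have "(\<Sum>l\<in>{1..j}. fst (param_gh \<nu> a j) i l * a (l, j)) = (\<Sum>l\<in>{1..j}. fst (param_gh \<nu> a' j) i l * a' (l, j))"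
    using assms(1,5) gh by (intro sum.cong refl) simp
  moreover have "(\<Sum>l\<in>{1..i}. c l / a (l, i) * snd (param_gh \<nu> a i) l j)
      = (\<Sum>l\<in>{1..i}. c l / a' (l, i) * snd (param_gh \<nu> a' i) l j)" for c
    using assms(1,4) gh by (intro sum.cong refl) simp
  ultimately show ?thesis unfolding param_x_def by presburger
qed

context fun_alg
begin

context
  fixes N A :: "'z \<Rightarrow> nat \<times> nat \<Rightarrow> complex" and n
  assumes N: "\<And>k. k \<in> index_set n \<Longrightarrow> (\<lambda>z. N z k) \<in> R"
    and inv: "\<And>p. p \<in> adjacent n \<Longrightarrow> (\<lambda>z. inverse (N z (fst p) - N z (snd p))) \<in> R"
begin

lemma inv_same: "m \<in> {1..n} \<Longrightarrow> i \<in> {1..m} \<Longrightarrow> j \<in> {1..m} \<Longrightarrow> i \<noteq> j \<Longrightarrow>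
    (\<lambda>z. inverse (N z (i, m) - N z (j, m))) \<in> R"
  using inv[OF adjacent_same[of m n i j]] by simp

lemma inv_next: "m < n \<Longrightarrow> i \<in> {1..m} \<Longrightarrow> j \<in> {1..Suc m} \<Longrightarrow>
    (\<lambda>z. inverse (N z (j, Suc m) - N z (i, m))) \<in> R"
  using inv[OF adjacent_next(2)[of m n i j]] by simp

lemma disc_inverse: "(\<lambda>z. inverse (disc n (N z))) \<in> R"
  unfolding disc_def prod_inversef[symmetric] comp_def by (intro prod inv)

lemma secular_coef_closed:
  assumes "m < n" "l \<in> {1..m}"
  shows "(\<lambda>z. secular_coef (\<lambda>l. N z (l, m)) (\<lambda>j. N z (j, Suc m)) m l) \<in> R"
proof -
  have m: "m \<in> {1..n}" using assms by auto
  have mem: "(l, m) \<in> index_set n" "\<And>j. j \<in> {1..Suc m} \<Longrightarrow> (j, Suc m) \<in> index_set n"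
    using assms by (auto simp: index_set_iff)
  have eq: "secular_coef v w m l = - (\<Prod>j\<in>{1..Suc m}. v l - w j) * (\<Prod>j\<in>{1..m} - {l}. inverse (v l - v j))"
    for v w :: "nat \<Rightarrow> complex"
    unfolding secular_coef_def divide_inverse prod_inversef[unfolded comp_def] ..
  show ?thesis unfolding eq
    by (intro mult uminus prod diff N mem inv_same m assms(2)) auto
qed

lemma secular_corner_closed:
  assumes "m < n"
  shows "(\<lambda>z. secular_corner (\<lambda>l. N z (l, m)) (\<lambda>j. N z (j, Suc m)) m) \<in> R"
proof -
  have mem: "(1, Suc m) \<in> index_set n" using assms by (auto simp: index_set_iff)
  show ?thesis unfolding secular_corner_def
    by (intro diff sum divide N mem inv_next assms secular_coef_closed) auto
qed

text \<open>Only ring operations and reciprocals of adjacent differences and of border parameters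
  occur. The closure results serve both directions: for regular functions on the cover and for
  rational functions of the parameters.\<close>

lemma param_gh_closed:
  assumes "m \<le> n"
    and "\<And>k. k \<in> index_set (m - 1) \<Longrightarrow> (\<lambda>z. A z k) \<in> R"
    and "\<And>k. k \<in> index_set (m - 1) \<Longrightarrow> (\<lambda>z. inverse (A z k)) \<in> R"
  shows "\<forall>j\<in>{1..m}. \<forall>i. (\<lambda>z. fst (param_gh (N z) (A z) m) i j) \<in> R \<and> (\<lambda>z. snd (param_gh (N z) (A z) m) j i) \<in> R"
  using assms
proof (induction m)
  case (Suc m)
  have m: "m < n" "Suc m \<in> {1..n}" using Suc.prems(1) by auto
  have A: "(\<lambda>z. A z (l, m)) \<in> R" "(\<lambda>z. inverse (A z (l, m))) \<in> R" if "l \<in> {1..m}" for l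
    using Suc.prems(2,3)[of "(l, m)"] that by (simp_all add: index_set_iff)
  have sub: "index_set (m - 1) \<subseteq> index_set (Suc m - 1)" by (rule index_set_mono) simp
  have "\<forall>j\<in>{1..m}. \<forall>i. (\<lambda>z. fst (param_gh (N z) (A z) m) i j) \<in> R \<and> (\<lambda>z. snd (param_gh (N z) (A z) m) j i) \<in> R"
    by (rule Suc.IH[OF _ Suc.prems(2,3)[OF subsetD[OF sub]]]) (use m in simp)
  then have IH: "(\<lambda>z. fst (param_gh (N z) (A z) m) i j) \<in> R" "(\<lambda>z. snd (param_gh (N z) (A z) m) j i) \<in> R"
    if "j \<in> {1..m}" for i j
    using that by blast+
  show ?case
  proof (intro ballI allI conjI)
    fix i j assume j: "j \<in> {1..Suc m}"
    have mem: "(j, Suc m) \<in> index_set n" "\<And>l. l \<in> {1..m} \<Longrightarrow> (l, m) \<in> index_set n"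
      "\<And>k. k \<in> {1..Suc m} - {j} \<Longrightarrow> (k, Suc m) \<in> index_set n"
      using m j by (auto simp: index_set_iff)
    show "(\<lambda>z. fst (param_gh (N z) (A z) (Suc m)) i j) \<in> R"
    proof (cases "i < m")
      case True
      have "(\<lambda>z. \<Sum>l\<in>{1..m}. fst (param_gh (N z) (A z) m) i l * (A z (l, m) / (N z (j, Suc m) - N z (l, m)))) \<in> R"
        by (intro sum mult IH divide A inv_next m(1) j)
      then show ?thesis using True by (simp add: extend_g_def)
    qed (simp add: extend_g_def const)
    have P: "(\<lambda>z. (\<Prod>l\<in>{1..m}. N z (j, Suc m) - N z (l, m)) / (\<Prod>k\<in>{1..Suc m} - {j}. N z (j, Suc m) - N z (k, Suc m))) \<in> R"
      unfolding divide_inverse prod_inversef[symmetric] comp_def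
      by (intro mult prod diff N mem inv_same m(2) j) auto
    have Q: "(\<lambda>z. \<Sum>l\<in>{1..m}. secular_coef (\<lambda>l. N z (l, m)) (\<lambda>j. N z (j, Suc m)) m l / A z (l, m)
         / (N z (j, Suc m) - N z (l, m)) * snd (param_gh (N z) (A z) m) l i) \<in> R"
      by (intro sum mult IH divide A inv_next m(1) j secular_coef_closed)
    show "(\<lambda>z. snd (param_gh (N z) (A z) (Suc m)) j i) \<in> R"
    proof (cases "i < m")
      case True
      then show ?thesis using mult[OF P Q] by (simp add: extend_h_def)
    qed (use P in \<open>simp add: extend_h_def\<close>)
  qed
qed simp

lemma param_x_closed:
  assumes "m \<le> n" "i < m" "j < m"
    and A: "\<And>k. k \<in> index_set (m - 1) \<Longrightarrow> (\<lambda>z. A z k) \<in> R"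
    and A': "\<And>k. k \<in> index_set (m - 1) \<Longrightarrow> (\<lambda>z. inverse (A z k)) \<in> R"
  shows "(\<lambda>z. param_x (N z) (A z) i j) \<in> R"
proof -
  have gh: "(\<lambda>z. fst (param_gh (N z) (A z) k) r l) \<in> R" "(\<lambda>z. snd (param_gh (N z) (A z) k) l r) \<in> R"
    if "k < m" "l \<in> {1..k}" for k l r
  proof -
    have sub: "index_set (k - 1) \<subseteq> index_set (m - 1)" by (rule index_set_mono) (use that(1) in simp)
    have "k \<le> n" using that(1) assms(1) by linarith
    then show "(\<lambda>z. fst (param_gh (N z) (A z) k) r l) \<in> R" "(\<lambda>z. snd (param_gh (N z) (A z) k) l r) \<in> R"
      using param_gh_closed[OF _ A[OF subsetD[OF sub]] A'[OF subsetD[OF sub]]] that(2) by blast+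
  qed
  have mem: "(l, k) \<in> index_set (m - 1)" if "k < m" "l \<in> {1..k}" for k l
    using that by (auto simp: index_set_iff)
  consider "i < j" | "j < i" | "i = j" by linarith
  then show ?thesis
  proof cases
    case 1
    have "(\<lambda>z. \<Sum>l\<in>{1..j}. fst (param_gh (N z) (A z) j) i l * A z (l, j)) \<in> R"
      by (intro sum mult gh A mem assms)
    then show ?thesis using 1 by (simp add: param_x_def)
  next
    case 2
    have "(\<lambda>z. \<Sum>l\<in>{1..i}. secular_coef (\<lambda>l. N z (l, i)) (\<lambda>j. N z (j, Suc i)) i l / A z (l, i) *
        snd (param_gh (N z) (A z) i) l j) \<in> R"
      by (intro sum mult gh A' divide mem secular_coef_closed assms) (use assms in simp)
    then show ?thesis using 2 by (simp add: param_x_def)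
  next
    case 3
    have "i < n" using assms by simp
    then show ?thesis using 3 secular_corner_closed[of i] by (simp add: param_x_def)
  qed
qed

end

end

text \<open>Similarity replaced by equality of characteristic polynomials, which is a polynomial
  condition on the pair. The two agree where \<open>disc\<close> is nonzero; this form also makes
  sense for multiple eigenvalues.\<close>

definition has_spectra :: "nat \<Rightarrow> (nat \<times> nat \<Rightarrow> complex) \<Rightarrow> complex mat \<Rightarrow> bool" where
  "has_spectra n \<nu> x \<longleftrightarrow>
    (\<forall>m\<in>{1..n}. char_poly (upper_left x m) = (\<Prod>i\<in>{1..m}. [:- \<nu> (i, m), 1:]))"

lemma upper_left_carrier [simp]: "upper_left x m \<in> carrier_mat m m"
  unfolding upper_left_def by simp

lemma nu_diag_carrier [simp]: "nu_diag \<nu> m \<in> carrier_mat m m"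
  unfolding nu_diag_def by simp

lemma diagonalised_cong:
  assumes "diagonalised m x v g h" "\<And>i j. i < m \<Longrightarrow> j < m \<Longrightarrow> x i j = y i j"
  shows "diagonalised m y v g h"
proof -
  have "(\<Sum>k<m. y i k * g k j) = (\<Sum>k<m. x i k * g k j)" if "i < m" for i j
    using assms(2)[OF that] by (intro sum.cong refl) simp
  then show ?thesis using assms(1) unfolding diagonalised_def by simp
qed

lemma diagonalised_similar:
  assumes dg: "diagonalised m (\<lambda>i j. x $$ (i, j)) (\<lambda>l. \<nu> (l, m)) g h"
  shows "similar_mat (nu_diag \<nu> m) (upper_left x m)"
proof -
  define H where "H = mat m m (\<lambda>(i, j). h (Suc i) j)"
  define G where "G = mat m m (\<lambda>(i, j). g i (Suc j))"
  have HG: "H \<in> carrier_mat m m" "G \<in> carrier_mat m m" unfolding H_def G_def by auto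
  have 1: "H * G = 1\<^sub>m m"
  proof (rule eq_matI)
    fix i j assume "i < dim_row (1\<^sub>m m :: complex mat)" "j < dim_col (1\<^sub>m m :: complex mat)"
    then show "(H * G) $$ (i, j) = 1\<^sub>m m $$ (i, j)"
      using diagonalisedD(2)[OF dg, of "Suc i" "Suc j"]
      by (simp add: H_def G_def scalar_prod_def atLeast0LessThan)
  qed (auto simp: H_def G_def)
  then have 2: "G * H = 1\<^sub>m m" by (rule mat_mult_left_right_inverse[OF HG])
  have 3: "upper_left x m * G = G * nu_diag \<nu> m"
  proof (rule eq_matI)
    fix i j assume "i < dim_row (G * nu_diag \<nu> m)" "j < dim_col (G * nu_diag \<nu> m)"
    then have ij: "i < m" "j < m" using HG carrier_matD[OF nu_diag_carrier[of \<nu> m]] by auto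
    have "(G * nu_diag \<nu> m) $$ (i, j) = g i (Suc j) * \<nu> (Suc j, m)"
      unfolding nu_diag_def mat_diag_mult_right[OF HG(2)] using ij by (simp add: G_def)
    moreover have "(upper_left x m * G) $$ (i, j) = (\<Sum>k<m. x $$ (i, k) * g k (Suc j))"
      using ij by (simp add: G_def upper_left_def scalar_prod_def atLeast0LessThan)
    ultimately show "(upper_left x m * G) $$ (i, j) = (G * nu_diag \<nu> m) $$ (i, j)"
      using diagonalisedD(1)[OF dg ij(1), of "Suc j"] ij by simp
  qed (use HG carrier_matD[OF nu_diag_carrier[of \<nu> m]] in \<open>auto simp: upper_left_def\<close>)
  have "H * upper_left x m * G = H * (upper_left x m * G)"
    by (rule assoc_mult_mat[OF HG(1) upper_left_carrier HG(2)])
  also have "\<dots> = (H * G) * nu_diag \<nu> m"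
    unfolding 3 by (rule assoc_mult_mat[OF HG nu_diag_carrier, symmetric])
  also have "\<dots> = nu_diag \<nu> m" unfolding 1 by (rule left_mult_one_mat[OF nu_diag_carrier])
  finally have "similar_mat_wit (nu_diag \<nu> m) (upper_left x m) H G"
    using 1 2 HG by (intro similar_mat_witI[of _ _ m]) simp_all
  then show ?thesis unfolding similar_mat_def by blast
qed

lemma char_poly_nu_diag: "char_poly (nu_diag \<nu> m) = (\<Prod>i\<in>{1..m}. [:- \<nu> (i, m), 1:])"
proof -
  have "char_poly (nu_diag \<nu> m) = (\<Prod>a\<leftarrow>diag_mat (nu_diag \<nu> m). [:- a, 1:])"
    by (rule char_poly_upper_triangular[OF nu_diag_carrier]) (auto simp: nu_diag_def mat_diag_def)
  also have "diag_mat (nu_diag \<nu> m) = map (\<lambda>i. \<nu> (Suc i, m)) [0..<m]"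
    by (auto simp: diag_mat_def nu_diag_def mat_diag_def)
  also have "(\<Prod>a\<leftarrow>map (\<lambda>i. \<nu> (Suc i, m)) [0..<m]. [:- a, 1:]) = (\<Prod>i\<in>{0..<m}. [:- \<nu> (Suc i, m), 1:])"
    by (simp add: prod.distinct_set_conv_list[symmetric] comp_def)
  also have "\<dots> = (\<Prod>i\<in>{1..m}. [:- \<nu> (i, m), 1:])"
    by (rule prod.reindex_bij_witness[of _ "\<lambda>i. i - 1" Suc]) auto
  finally show ?thesis .
qed

lemma similar_has_spectra:
  assumes "\<And>m. m \<in> {1..n} \<Longrightarrow> similar_mat (nu_diag \<nu> m) (upper_left x m)"
  shows "has_spectra n \<nu> x"
  unfolding has_spectra_def using assms char_poly_similar char_poly_nu_diag by metis

lemma has_spectra_spectrum: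
  assumes "has_spectra n \<nu> x" "m \<in> {1..n}"
  shows "spectrum (upper_left x m) = (\<lambda>i. \<nu> (i, m)) ` {1..m}"
proof -
  have "spectrum (upper_left x m) = {t. poly (\<Prod>i\<in>{1..m}. [:- \<nu> (i, m), 1:]) t = 0}"
    using spectrum_root_char_poly[OF upper_left_carrier, of x m] assms unfolding has_spectra_def by simp
  also have "\<dots> = (\<lambda>i. \<nu> (i, m)) ` {1..m}"
    by (auto simp: poly_prod prod_zero_iff)
  finally show ?thesis .
qed

lemma has_spectra_eigenvector:
  assumes "has_spectra n \<nu> x" "m \<in> {1..n}" "j \<in> {1..m}"
  shows "\<exists>y. (\<exists>i<m. y i \<noteq> 0) \<and> (\<forall>i<m. (\<Sum>k<m. x $$ (i, k) * y k) = \<nu> (j, m) * y i)"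
proof -
  have "\<nu> (j, m) \<in> spectrum (upper_left x m)" using has_spectra_spectrum[OF assms(1,2)] assms(3) by blast
  then obtain y where y: "y \<in> carrier_vec m" "y \<noteq> 0\<^sub>v m" "upper_left x m *\<^sub>v y = \<nu> (j, m) \<cdot>\<^sub>v y"
    using carrier_matD[OF upper_left_carrier[of x m]]
    unfolding spectrum_def eigenvalue_def eigenvector_def by auto
  have "\<exists>i<m. y $ i \<noteq> 0"
  proof (rule ccontr)
    assume "\<not> ?thesis"
    then have "y = 0\<^sub>v m" using y(1) by (intro eq_vecI) auto
    then show False using y(2) by simp
  qed
  moreover have "(\<Sum>k<m. x $$ (i, k) * y $ k) = \<nu> (j, m) * y $ i" if "i < m" for i
  proof -
    have "(upper_left x m *\<^sub>v y) $ i = (\<Sum>k<m. x $$ (i, k) * y $ k)"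
      using that y(1) by (simp add: scalar_prod_def upper_left_def atLeast0LessThan)
    then show ?thesis using y that by simp
  qed
  ultimately show ?thesis by blast
qed

text \<open>The missing parameters of level \<open>m\<close> are the coordinates of the next column
  of \<open>x\<close> in the eigenbasis of block \<open>m\<close>; the border lemma shows that they
  are nonzero and determine block \<open>m + 1\<close>.\<close>

lemma has_spectra_step:
  assumes disc: "disc n \<nu> \<noteq> 0" and sp: "has_spectra n \<nu> x" and m: "m < n"
    and a: "\<And>k. k \<in> index_set (m - 1) \<Longrightarrow> a k \<noteq> 0"
    and x: "\<And>i j. i < m \<Longrightarrow> j < m \<Longrightarrow> x $$ (i, j) = param_x \<nu> a i j"
    and a': "\<And>l. l \<in> {1..m} \<Longrightarrow> a' (l, m) = (\<Sum>k<m. snd (param_gh \<nu> a m) l k * x $$ (k, m))"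
      "\<And>l k. k < m \<Longrightarrow> a' (l, k) = a (l, k)"
  shows "l \<in> {1..m} \<Longrightarrow> a' (l, m) \<noteq> 0"
    and "i < Suc m \<Longrightarrow> j < Suc m \<Longrightarrow> x $$ (i, j) = param_x \<nu> a' i j"
proof -
  interpret secular "\<lambda>l. \<nu> (l, m)" "\<lambda>j. \<nu> (j, Suc m)" m using disc_secular[OF disc m] .
  have mn: "m \<le> n" "Suc m \<in> {1..n}" using m by auto
  have dg: "diagonalised m (\<lambda>i j. x $$ (i, j)) (\<lambda>l. \<nu> (l, m)) (fst (param_gh \<nu> a m)) (snd (param_gh \<nu> a m))"
    by (rule diagonalised_cong[OF param_diagonalised[OF disc mn(1) a]]) (simp_all add: x)
  have gh: "param_gh \<nu> a m = param_gh \<nu> a' m"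
    by (rule param_gh_cong[OF _ disc mn(1)]) (simp add: a'(2))
  have "\<forall>j\<in>{1..Suc m}. \<exists>y. (\<exists>i<Suc m. y i \<noteq> 0) \<and>
      (\<forall>i<Suc m. (\<Sum>k<Suc m. x $$ (i, k) * y k) = \<nu> (j, Suc m) * y i)"
    by (intro ballI has_spectra_eigenvector[OF sp mn(2)])
  note step = diagonalised_restrict[OF dg this]
  show nz: "a' (l, m) \<noteq> 0" if "l \<in> {1..m}" for l using step(1)[OF that] a'(1)[OF that] by simp
  show "x $$ (i, j) = param_x \<nu> a' i j" if ij: "i < Suc m" "j < Suc m" for i j
  proof -
    consider "i < m" "j < m" | "i < m" "j = m" | "i = m" "j < m" | "i = m" "j = m"
      using ij by linarith
    then show ?thesis
    proof cases
      case 1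
      have "param_x \<nu> a i j = param_x \<nu> a' i j"
        by (rule param_x_cong[OF _ disc mn(1) 1]) (simp add: a'(2))
      then show ?thesis using x[OF 1] by simp
    next
      case 2
      have "x $$ (i, m) = (\<Sum>l\<in>{1..m}. fst (param_gh \<nu> a m) i l * a' (l, m))"
        unfolding step(4)[OF 2(1)] using a'(1) by (intro sum.cong refl) simp
      then show ?thesis using 2 by (simp add: param_x_def gh)
    next
      case 3
      have "x $$ (m, j) = (\<Sum>l\<in>{1..m}. coef l / a' (l, m) * snd (param_gh \<nu> a m) l j)"
        unfolding step(5)[OF 3(2)] using a'(1) step(2) by (intro sum.cong refl) simp
      then show ?thesis using 3 by (simp add: param_x_def gh)
    next
      case 4
      then show ?thesis using step(3) by (simp add: param_x_def)
    qed
  qed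
qed

text \<open>The functions \<open>a\<close> are obtained recursively as the last columns in the eigenbases.\<close>
lemma has_spectra_param:
  fixes R :: "((nat \<times> nat \<Rightarrow> complex) \<times> complex mat \<Rightarrow> complex) set"
  assumes R: "fun_alg R"
    and V: "\<And>z. z \<in> V \<Longrightarrow> disc n (fst z) \<noteq> 0 \<and> has_spectra n (fst z) (snd z)"
    and nu: "\<And>k. k \<in> index_set n \<Longrightarrow> (\<lambda>z. fst z k) \<in> R"
    and x: "\<And>i j. i < n \<Longrightarrow> j < n \<Longrightarrow> (\<lambda>z. snd z $$ (i, j)) \<in> R"
    and inverse: "\<And>f. f \<in> R \<Longrightarrow> (\<And>z. z \<in> V \<Longrightarrow> f z \<noteq> 0) \<Longrightarrow> (\<lambda>z. inverse (f z)) \<in> R"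
    and "m \<le> n"
  shows "\<exists>a. (\<forall>k\<in>index_set (m - 1). a k \<in> R \<and> (\<forall>z\<in>V. a k z \<noteq> 0)) \<and>
    (\<forall>z\<in>V. \<forall>i<m. \<forall>j<m. snd z $$ (i, j) = param_x (fst z) (\<lambda>k. a k z) i j)"
  using \<open>m \<le> n\<close>
proof (induction m)
  case 0
  have "index_set 0 = {}" by (auto simp: index_set_def)
  then show ?case by simp
next
  interpret fun_alg R by (rule R)
  case (Suc m)
  then obtain a where a: "\<And>k. k \<in> index_set (m - 1) \<Longrightarrow> a k \<in> R"
    "\<And>k z. k \<in> index_set (m - 1) \<Longrightarrow> z \<in> V \<Longrightarrow> a k z \<noteq> 0"
    "\<And>z i j. z \<in> V \<Longrightarrow> i < m \<Longrightarrow> j < m \<Longrightarrow> snd z $$ (i, j) = param_x (fst z) (\<lambda>k. a k z) i j"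
    by (metis Suc_leD)
  \<comment> \<open>Computed by ring operations from functions in \<open>R\<close>. Since the new
    values vanish nowhere on \<open>V\<close>, the assumption \<open>inverse\<close> supplies the
    reciprocals required at the next level.\<close>
  define a' where "a' k z = (if snd k = m
    then \<Sum>i<m. snd (param_gh (fst z) (\<lambda>k. a k z) m) (fst k) i * snd z $$ (i, m) else a k z)" for k z
  have m: "m < n" "m \<le> n" using Suc.prems by auto
  have inv_nu: "(\<lambda>z. inverse (fst z (fst p) - fst z (snd p))) \<in> R" if p: "p \<in> adjacent n" for p
  proof (rule inverse)
    show "(\<lambda>z. fst z (fst p) - fst z (snd p)) \<in> R"
      using p by (intro diff nu) (auto simp: adjacent_def)
    show "fst z (fst p) - fst z (snd p) \<noteq> 0" if "z \<in> V" for z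
      using V[OF that] p unfolding disc_nonzero_iff by auto
  qed
  have gh: "\<forall>j\<in>{1..m}. \<forall>i. (\<lambda>z. fst (param_gh (fst z) (\<lambda>k. a k z) m) i j) \<in> R \<and>
      (\<lambda>z. snd (param_gh (fst z) (\<lambda>k. a k z) m) j i) \<in> R"
    by (rule param_gh_closed[OF nu inv_nu m(2) a(1) inverse[OF a(1,2)]])
  have stepA: "a' (l, m) z \<noteq> 0" if "z \<in> V" "l \<in> {1..m}" for z l
    by (rule has_spectra_step(1)[where a' = "\<lambda>k. a' k z" and \<nu> = "fst z" and x = "snd z" and a = "\<lambda>k. a k z" and n = n])
       (use V[OF that(1)] m a that in \<open>simp_all add: a'_def\<close>)
  have stepB: "snd z $$ (i, j) = param_x (fst z) (\<lambda>k. a' k z) i j" if "z \<in> V" "i < Suc m" "j < Suc m" for z i j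
    by (rule has_spectra_step(2)[where n = n and m = m and a = "\<lambda>k. a k z"])
       (use V[OF that(1)] m a that in \<open>simp_all add: a'_def\<close>)
  have a'R: "a' k \<in> R \<and> (\<forall>z\<in>V. a' k z \<noteq> 0)" if k: "k \<in> index_set m" for k
  proof (cases "snd k = m")
    case True
    then obtain l where l: "k = (l, m)" "l \<in> {1..m}" using k by (cases k) (auto simp: index_set_iff)
    have "(\<lambda>z. \<Sum>i<m. snd (param_gh (fst z) (\<lambda>k. a k z) m) l i * snd z $$ (i, m)) \<in> R"
      by (intro sum mult x) (use gh l(2) m in auto)
    then have "a' k \<in> R" using l(1) by (simp add: a'_def[abs_def])
    then show ?thesis using stepA l by blast
  next
    case False
    then have k': "k \<in> index_set (m - 1)" using k by (cases k) (auto simp: index_set_iff)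
    have "a' k = a k" using False by (simp add: a'_def fun_eq_iff)
    then show ?thesis using a(1,2)[OF k'] by simp
  qed
  show ?case using a'R stepB by (intro exI[of _ a']) simp
qed

lemma inj_onD_nu: "inj_on (\<lambda>i. \<nu> (i, m)) {1..m} \<Longrightarrow> i \<in> {1..m} \<Longrightarrow> j \<in> {1..m} \<Longrightarrow> i \<noteq> j \<Longrightarrow> \<nu> (i, m) \<noteq> \<nu> (j, m)"
  by (auto dest: inj_onD)

lemma disc_generic:
  "disc n \<nu> \<noteq> 0 \<longleftrightarrow> (\<forall>m\<in>{1..n}. inj_on (\<lambda>i. \<nu> (i, m)) {1..m}) \<and>
    (\<forall>m\<in>{1..<n}. \<forall>i\<in>{1..m}. \<forall>j\<in>{1..Suc m}. \<nu> (i, m) \<noteq> \<nu> (j, Suc m))" (is "_ \<longleftrightarrow> ?A \<and> ?B")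
proof
  assume d: "disc n \<nu> \<noteq> 0"
  note ne = d[unfolded disc_nonzero_iff, rule_format]
  have ?B using disc_secular[OF d] unfolding secular_def by force
  moreover have ?A
  proof (intro ballI inj_onI, rule ccontr)
    fix m i j assume *: "m \<in> {1..n}" "i \<in> {1..m}" "j \<in> {1..m}" "\<nu> (i, m) = \<nu> (j, m)" "i \<noteq> j"
    then show False using ne[OF adjacent_same[OF *(1,2,3,5)]] by simp
  qed
  ultimately show "?A \<and> ?B" by simp
next
  assume AB: "?A \<and> ?B"
  have B': "\<nu> (i, m) \<noteq> \<nu> (j, Suc m)" if "(i, m) \<in> index_set n" "(j, Suc m) \<in> index_set n" for i j m
    using AB that by (auto simp: index_set_iff)
  show "disc n \<nu> \<noteq> 0" unfolding disc_nonzero_iff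
  proof
    fix p assume p: "p \<in> adjacent n"
    obtain i m j m' where pe: "p = ((i, m), (j, m'))" by (cases p) auto
    have mem: "(i, m) \<in> index_set n" "(j, m') \<in> index_set n" using p unfolding pe adjacent_def by auto
    consider "m' = m" "i \<noteq> j" | "m' = Suc m" | "m = Suc m'"
      using p unfolding pe adjacent_def by auto
    then show "\<nu> (fst p) \<noteq> \<nu> (snd p)"
    proof cases
      case 1
      then have "m \<in> {1..n}" "i \<in> {1..m}" "j \<in> {1..m}" using mem by (auto simp: index_set_iff)
      then show ?thesis using inj_onD_nu[of \<nu> m i j] AB 1 unfolding pe by simp
    next
      case 2
      then show ?thesis using B'[of i m j] mem unfolding pe by simp
    next
      case 3
      then show ?thesis using B'[of j m' i] mem unfolding pe by (metis fst_conv snd_conv)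
    qed
  qed
qed

lemma e_Omega_eq: "e_Omega n = {\<nu> \<in> index_set n \<rightarrow>\<^sub>E UNIV. disc n \<nu> \<noteq> 0}"
  unfolding e_Omega_def disc_generic by simp

lemma M_Omega_iff:
  assumes "has_spectra n \<nu> x"
  shows "x \<in> M_Omega n \<longleftrightarrow> x \<in> carrier_mat n n \<and> disc n \<nu> \<noteq> 0"
proof -
  have 1: "card (spectrum (upper_left x m)) = m \<longleftrightarrow> inj_on (\<lambda>i. \<nu> (i, m)) {1..m}" if "m \<in> {1..n}" for m
    unfolding has_spectra_spectrum[OF assms that] inj_on_iff_eq_card[OF finite_atLeastAtMost] by simp
  have 2: "spectrum (upper_left x m) \<inter> spectrum (upper_left x (Suc m)) = {} \<longleftrightarrow>
     (\<forall>i\<in>{1..m}. \<forall>j\<in>{1..Suc m}. \<nu> (i, m) \<noteq> \<nu> (j, Suc m))" if "m \<in> {1..<n}" for m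
  proof -
    have "m \<in> {1..n}" "Suc m \<in> {1..n}" using that by auto
    then show ?thesis unfolding has_spectra_spectrum[OF assms \<open>m \<in> {1..n}\<close>] has_spectra_spectrum[OF assms \<open>Suc m \<in> {1..n}\<close>]
      by blast
  qed
  show ?thesis unfolding M_Omega_def M_space_def disc_generic using 1 2 by simp
qed

lemma has_spectra_similar:
  assumes "disc n \<nu> \<noteq> 0" "has_spectra n \<nu> x" "m \<in> {1..n}"
  shows "similar_mat (nu_diag \<nu> m) (upper_left x m)"
proof -
  have U: "fun_alg (UNIV :: ((nat \<times> nat \<Rightarrow> complex) \<times> complex mat \<Rightarrow> complex) set)" by unfold_locales auto
  have "m \<le> n" using assms(3) by simp
  then obtain a where a: "\<And>k. k \<in> index_set (m - 1) \<Longrightarrow> a k (\<nu>, x) \<noteq> 0"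
    "\<And>i j. i < m \<Longrightarrow> j < m \<Longrightarrow> x $$ (i, j) = param_x \<nu> (\<lambda>k. a k (\<nu>, x)) i j"
    using has_spectra_param[OF U, of "{(\<nu>, x)}" n m] assms by auto
  show ?thesis
    by (rule diagonalised_similar[OF diagonalised_cong[OF param_diagonalised[OF assms(1) \<open>m \<le> n\<close> a(1)]]])
       (simp_all add: a(2))
qed

text \<open>Rewrites the cover as polynomial equations together with one nonvanishing condition, the
  shape required of an affine locus.\<close>

lemma M_Omega_e_eq:
  "M_Omega_e n = {(\<nu>, x). \<nu> \<in> index_set n \<rightarrow>\<^sub>E UNIV \<and> x \<in> carrier_mat n n \<and> disc n \<nu> \<noteq> 0 \<and> has_spectra n \<nu> x}"
proof (intro equalityI subsetI)
  fix z assume "z \<in> M_Omega_e n"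
  then obtain \<nu> x where z: "z = (\<nu>, x)" "\<nu> \<in> e_Omega n" "x \<in> M_Omega n"
    "\<And>m. m \<in> {1..n} \<Longrightarrow> similar_mat (nu_diag \<nu> m) (upper_left x m)"
    unfolding M_Omega_e_def by auto
  then show "z \<in> {(\<nu>, x). \<nu> \<in> index_set n \<rightarrow>\<^sub>E UNIV \<and> x \<in> carrier_mat n n \<and> disc n \<nu> \<noteq> 0 \<and> has_spectra n \<nu> x}"
    using similar_has_spectra[OF z(4)] M_Omega_iff[OF similar_has_spectra[OF z(4)]] unfolding e_Omega_eq by simp
next
  fix z assume "z \<in> {(\<nu>, x). \<nu> \<in> index_set n \<rightarrow>\<^sub>E UNIV \<and> x \<in> carrier_mat n n \<and> disc n \<nu> \<noteq> 0 \<and> has_spectra n \<nu> x}"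
  then obtain \<nu> x where z: "z = (\<nu>, x)" "\<nu> \<in> index_set n \<rightarrow>\<^sub>E UNIV" "x \<in> carrier_mat n n" "disc n \<nu> \<noteq> 0" "has_spectra n \<nu> x"
    by auto
  then show "z \<in> M_Omega_e n"
    using has_spectra_similar[OF z(4,5)] M_Omega_iff[OF z(5)] unfolding M_Omega_e_def e_Omega_eq by auto
qed

lemma param_in_M_Omega_e:
  assumes "\<nu> \<in> index_set n \<rightarrow>\<^sub>E UNIV" "disc n \<nu> \<noteq> 0" "\<And>k. k \<in> index_set (n - 1) \<Longrightarrow> a k \<noteq> 0"
  shows "(\<nu>, mat n n (\<lambda>(i, j). param_x \<nu> a i j)) \<in> M_Omega_e n"
proof -
  have "similar_mat (nu_diag \<nu> m) (upper_left (mat n n (\<lambda>(i, j). param_x \<nu> a i j)) m)" if m: "m \<in> {1..n}" for m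
  proof -
    have mn: "m \<le> n" using m by simp
    have a: "a k \<noteq> 0" if "k \<in> index_set (m - 1)" for k
    proof (rule assms(3))
      have "m - 1 \<le> n - 1" using mn by linarith
      then show "k \<in> index_set (n - 1)" using index_set_mono that by blast
    qed
    show ?thesis
      by (rule diagonalised_similar[OF diagonalised_cong[OF param_diagonalised[OF assms(2) mn a]]])
         (use mn in simp_all)
  qed
  then show ?thesis using similar_has_spectra assms unfolding M_Omega_e_eq by simp
qed

context affine_locus
begin

text \<open>Total functions whose values on \<open>V\<close> are regular; computing with these
  avoids a restriction at every ring operation.\<close>

definition regular :: "('p \<Rightarrow> complex) set" where
  "regular = {f. restrict f V \<in> regular_funs C V}"

lemma regular_iff: "f \<in> regular \<longleftrightarrow> (\<exists>F\<in>poly_funs gens. \<forall>p\<in>V. f p = F p)"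
proof
  assume "f \<in> regular"
  then obtain F where F: "F \<in> poly_funs gens" "restrict f V = restrict F V"
    unfolding regular_def regular_funs_eq by auto
  then have "\<forall>p\<in>V. f p = F p" by (metis restrict_apply')
  then show "\<exists>F\<in>poly_funs gens. \<forall>p\<in>V. f p = F p" using F(1) by blast
next
  assume "\<exists>F\<in>poly_funs gens. \<forall>p\<in>V. f p = F p"
  then obtain F where F: "F \<in> poly_funs gens" "\<forall>p\<in>V. f p = F p" by blast
  then have "restrict f V = restrict F V" by (auto simp: restrict_def fun_eq_iff)
  then show "f \<in> regular" using F(1) unfolding regular_def regular_funs_eq by blast
qed

lemma regular_cong: "f \<in> regular \<Longrightarrow> (\<And>p. p \<in> V \<Longrightarrow> g p = f p) \<Longrightarrow> g \<in> regular"
  unfolding regular_iff by metis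

lemma regular_fun_alg: "fun_alg regular"
proof
  show "(\<lambda>_. c) \<in> regular" for c unfolding regular_iff by (rule bexI[OF _ poly_funs.const[of c]]) simp
next
  fix f g assume "f \<in> regular" "g \<in> regular"
  then obtain F G where *: "F \<in> poly_funs gens" "\<forall>p\<in>V. f p = F p" "G \<in> poly_funs gens" "\<forall>p\<in>V. g p = G p"
    unfolding regular_iff by blast
  show "(\<lambda>z. f z + g z) \<in> regular" unfolding regular_iff
    by (rule bexI[OF _ poly_funs.add[OF *(1,3)]]) (use * in simp)
  show "(\<lambda>z. f z * g z) \<in> regular" unfolding regular_iff
    by (rule bexI[OF _ poly_funs.mult[OF *(1,3)]]) (use * in simp)
qed

lemma regular_coord: "c \<in> C \<Longrightarrow> c \<in> regular"
  unfolding regular_iff by (rule bexI[of _ c]) (auto intro: poly_funs.gen)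

lemma regular_poly: "f \<in> poly_funs C \<Longrightarrow> f \<in> regular"
  unfolding regular_iff by (rule bexI[OF _ poly_funs_mono[of f C]]) auto

text \<open>If \<open>f\<close> is locally \<open>g / h\<close> and has no zero, then
  \<open>g\<close> has none on the same open set, and \<open>h / g\<close> represents the inverse
  there. Here the local definition of regularity is used directly.\<close>

lemma regular_inverse:
  assumes f: "f \<in> regular" and nz: "\<And>p. p \<in> V \<Longrightarrow> f p \<noteq> 0"
  shows "(\<lambda>p. inverse (f p)) \<in> regular"
proof -
  have "\<exists>U g h. zariski_open C V U \<and> p \<in> U \<and> g \<in> poly_funs C \<and> h \<in> poly_funs C \<and>
     (\<forall>q\<in>U. h q \<noteq> 0 \<and> (\<lambda>p\<in>V. inverse (f p)) q = g q / h q)" if p: "p \<in> V" for p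
  proof -
    have "\<exists>U g h. zariski_open C V U \<and> p \<in> U \<and> g \<in> poly_funs C \<and> h \<in> poly_funs C \<and>
     (\<forall>q\<in>U. h q \<noteq> 0 \<and> restrict f V q = g q / h q)"
      using f p unfolding regular_def regular_funs_def by blast
    then obtain U g h where U: "zariski_open C V U" "p \<in> U" "g \<in> poly_funs C" "h \<in> poly_funs C"
     "\<forall>q\<in>U. h q \<noteq> 0 \<and> restrict f V q = g q / h q" by metis
    have UV: "U \<subseteq> V" using U(1) unfolding zariski_open_def by blast
    have "\<forall>q\<in>U. g q \<noteq> 0 \<and> (\<lambda>p\<in>V. inverse (f p)) q = h q / g q"
    proof
      fix q assume q: "q \<in> U"
      then have "q \<in> V" using UV by blast
      then have "f q = g q / h q" "f q \<noteq> 0" using U(5) q nz by auto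
      then show "g q \<noteq> 0 \<and> (\<lambda>p\<in>V. inverse (f p)) q = h q / g q" using \<open>q \<in> V\<close> by auto
    qed
    then show ?thesis using U(1-4) by metis
  qed
  then show ?thesis unfolding regular_def regular_funs_def by simp
qed

end

section \<open>The matrix space and the eigenvalue cover as affine loci\<close>

lemma finite_mat_coords: "finite (mat_coords n)"
proof -
  have "mat_coords n = (\<lambda>(i, j) x. x $$ (i, j)) ` ({..<n} \<times> {..<n})"
    unfolding mat_coords_def by (auto simp: image_iff)
  then show ?thesis by simp
qed

lemma mat_coord_in: "i < n \<Longrightarrow> j < n \<Longrightarrow> (\<lambda>x. x $$ (i, j)) \<in> poly_funs (mat_coords n)"
  by (rule poly_funs.gen) (auto simp: mat_coords_def)

lemma affine_locus_mat:
  assumes "d \<in> poly_funs (mat_coords n)"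
  shows "affine_locus (carrier_mat n n) (mat_coords n) {} d {x \<in> carrier_mat n n. d x \<noteq> 0}"
proof
  show "\<exists>p\<in>carrier_mat n n. \<forall>c\<in>mat_coords n. c p = v c" for v
    by (rule bexI[of _ "mat n n (\<lambda>(i, j). v (\<lambda>x. x $$ (i, j)))"]) (auto simp: mat_coords_def)
  show "p = q" if "p \<in> carrier_mat n n" "q \<in> carrier_mat n n" "\<And>c. c \<in> mat_coords n \<Longrightarrow> c p = c q" for p q
  proof (rule eq_matI)
    fix i j assume "i < dim_row q" "j < dim_col q"
    then have "(\<lambda>x. x $$ (i, j)) \<in> mat_coords n" using that by (auto simp: mat_coords_def)
    then show "p $$ (i, j) = q $$ (i, j)" using that(3)[of "\<lambda>x. x $$ (i, j)"] by simp
  qed (use that in auto)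
qed (use assms finite_mat_coords in auto)

lemma pair_coords_eq: "pair_coords n = (\<lambda>k z. fst z k) ` index_set n \<union> (\<lambda>c z. c (snd z)) ` mat_coords n"
proof -
  have "(\<lambda>z. snd z $$ (i, j)) \<in> (\<lambda>c z. c (snd z)) ` mat_coords n" if "i < n" "j < n" for i j
    by (rule image_eqI[of _ _ "\<lambda>x. x $$ (i, j)"]) (use that in \<open>auto simp: mat_coords_def\<close>)
  then show ?thesis unfolding pair_coords_def by (auto simp: mat_coords_def)
qed

lemma nu_coord: "k \<in> index_set n \<Longrightarrow> (\<lambda>z. fst z k) \<in> pair_coords n"
  unfolding pair_coords_def by blast

lemma x_coord: "i < n \<Longrightarrow> j < n \<Longrightarrow> (\<lambda>z. snd z $$ (i, j)) \<in> pair_coords n"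
  unfolding pair_coords_def by blast

lemmas nu_coord_in = poly_funs.gen[OF nu_coord] and x_coord_in = poly_funs.gen[OF x_coord]

lemma snd_pair_coords: "f \<in> poly_funs (mat_coords n) \<Longrightarrow> (\<lambda>z. f (snd z)) \<in> poly_funs (pair_coords n)"
  by (rule poly_funs_subst, assumption) (auto simp: mat_coords_def intro: x_coord_in)

lemma disc_poly: "(\<And>k. k \<in> index_set n \<Longrightarrow> (\<lambda>z. N z k) \<in> poly_funs C) \<Longrightarrow> (\<lambda>z. disc n (N z)) \<in> poly_funs C"
  unfolding disc_def by (intro poly_funs_intros) (auto simp: adjacent_def)

text \<open>Leibniz expansion, which exhibits each value of the characteristic polynomial as a
  polynomial in the matrix entries.\<close>

lemma char_poly_value:
  "poly (char_poly (upper_left x m)) t =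
    (\<Sum>p\<in>{p. p permutes {0..<m}}. signof p * (\<Prod>i=0..<m. of_bool (i = p i) * t - x $$ (i, p i)))"
proof -
  define B where "B = mat m m (\<lambda>(i, j). of_bool (i = j) * t - x $$ (i, j))"
  have B: "B \<in> carrier_mat m m" unfolding B_def by simp
  have "poly (char_poly (upper_left x m)) t = det B"
    unfolding char_poly_def
    by (rule poly_det_cong[OF B char_poly_matrix_closed[OF upper_left_carrier]])
       (auto simp: B_def char_poly_matrix_def upper_left_def)
  also have "\<dots> = (\<Sum>p\<in>{p. p permutes {0..<m}}. signof p * (\<Prod>i=0..<m. of_bool (i = p i) * t - x $$ (i, p i)))"
    unfolding det_def'[OF B]
  proof (intro sum.cong refl arg_cong2[where f = "(*)"] prod.cong)
    fix p i assume "p \<in> {p. p permutes {0..<m}}" "i \<in> {0..<m}"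
    then have "p i < m" "i < m" using permutes_in_image[of p "{0..<m}" i] by auto
    then show "B $$ (i, p i) = of_bool (i = p i) * t - x $$ (i, p i)" by (simp add: B_def)
  qed
  finally show ?thesis .
qed

lemma char_poly_value_poly:
  assumes "m \<le> n"
  shows "(\<lambda>x. poly (char_poly (upper_left x m)) t) \<in> poly_funs (mat_coords n)"
  unfolding char_poly_value
proof (intro poly_funs_intros mat_coord_in)
  fix p i assume "p \<in> {p. p permutes {0..<m}}" "i \<in> {0..<m}"
  then have "p i < m" "i < m" using permutes_in_image[of p "{0..<m}" i] by auto
  then show "i < n" "p i < n" using assms by auto
qed

text \<open>One equation for every value of the variable instead of one for every coefficient; the
  family is infinite, but each member is plainly a polynomial.\<close>

definition spectra_eqs :: "nat \<Rightarrow> ((nat \<times> nat \<Rightarrow> complex) \<times> complex mat \<Rightarrow> complex) set" where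
  "spectra_eqs n = {\<lambda>z. poly (char_poly (upper_left (snd z) m)) t - (\<Prod>i\<in>{1..m}. t - fst z (i, m)) | m t. m \<in> {1..n}}"

lemma spectra_eqs_iff: "has_spectra n (fst z) (snd z) \<longleftrightarrow> (\<forall>e\<in>spectra_eqs n. e z = 0)"
proof -
  have p: "poly (\<Prod>i\<in>{1..m}. [:- fst z (i, m), 1:]) t = (\<Prod>i\<in>{1..m}. t - fst z (i, m))" for m t
    unfolding poly_prod by (intro prod.cong refl) simp
  have "has_spectra n (fst z) (snd z) \<longleftrightarrow>
    (\<forall>m\<in>{1..n}. \<forall>t. poly (char_poly (upper_left (snd z) m)) t = (\<Prod>i\<in>{1..m}. t - fst z (i, m)))"
    unfolding has_spectra_def p[symmetric] poly_eq_poly_eq_iff[symmetric] fun_eq_iff by blast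
  then show ?thesis unfolding spectra_eqs_def by fastforce
qed

lemma affine_locus_M_Omega_e:
  "affine_locus ((index_set n \<rightarrow>\<^sub>E UNIV) \<times> carrier_mat n n) (pair_coords n) (spectra_eqs n)
     (\<lambda>z. disc n (fst z)) (M_Omega_e n)"
proof
  show "finite (pair_coords n)" unfolding pair_coords_eq by (simp add: finite_index_set finite_mat_coords)
  show "\<exists>p\<in>(index_set n \<rightarrow>\<^sub>E UNIV) \<times> carrier_mat n n. \<forall>c\<in>pair_coords n. c p = v c" for v
    by (rule bexI[of _ "(\<lambda>k\<in>index_set n. v (\<lambda>z. fst z k), mat n n (\<lambda>(i, j). v (\<lambda>z. snd z $$ (i, j))))"])
       (auto simp: pair_coords_def)
  show "p = q" if pq: "p \<in> (index_set n \<rightarrow>\<^sub>E UNIV) \<times> carrier_mat n n"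
      "q \<in> (index_set n \<rightarrow>\<^sub>E UNIV) \<times> carrier_mat n n" "\<And>c. c \<in> pair_coords n \<Longrightarrow> c p = c q" for p q
  proof (rule prod_eqI)
    show "fst p = fst q"
    proof (rule PiE_ext[of _ "index_set n" "\<lambda>_. UNIV"])
      fix k assume "k \<in> index_set n"
      then have "(\<lambda>z. fst z k) \<in> pair_coords n" by (rule nu_coord)
      then show "fst p k = fst q k" using pq(3)[of "\<lambda>z. fst z k"] by simp
    qed (use pq in auto)
    show "snd p = snd q"
    proof (rule eq_matI)
      fix i j assume "i < dim_row (snd q)" "j < dim_col (snd q)"
      then have "i < n" "j < n" using pq by auto
      then have "(\<lambda>z. snd z $$ (i, j)) \<in> pair_coords n" by (rule x_coord)
      then show "snd p $$ (i, j) = snd q $$ (i, j)" using pq(3)[of "\<lambda>z. snd z $$ (i, j)"] by simp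
    qed (use pq in auto)
  qed
  show "spectra_eqs n \<subseteq> poly_funs (pair_coords n)"
  proof
    fix e assume "e \<in> spectra_eqs n"
    then obtain m t where e: "m \<in> {1..n}"
      "e = (\<lambda>z. poly (char_poly (upper_left (snd z) m)) t - (\<Prod>i\<in>{1..m}. t - fst z (i, m)))"
      unfolding spectra_eqs_def by blast
    have "(i, m) \<in> index_set n" if "i \<in> {1..m}" for i using that e(1) by (simp add: index_set_iff)
    then show "e \<in> poly_funs (pair_coords n)" unfolding e(2)
      using e(1) by (intro poly_funs_intros snd_pair_coords char_poly_value_poly nu_coord_in) auto
  qed
  show "(\<lambda>z. disc n (fst z)) \<in> poly_funs (pair_coords n)"
    by (intro disc_poly nu_coord_in)
  show "M_Omega_e n = {p \<in> (index_set n \<rightarrow>\<^sub>E UNIV) \<times> carrier_mat n n. (\<forall>e\<in>spectra_eqs n. e p = 0) \<and> disc n (fst p) \<noteq> 0}"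
    unfolding M_Omega_e_eq spectra_eqs_iff[symmetric] by auto
qed

section \<open>Regular functions on the eigenvalue cover\<close>

definition R_e :: "nat \<Rightarrow> ((nat \<times> nat \<Rightarrow> complex) \<times> complex mat \<Rightarrow> complex) set" where
  "R_e n = {f. restrict f (M_Omega_e n) \<in> O_M_Omega_e n}"

interpretation Me: affine_locus "(index_set n \<rightarrow>\<^sub>E UNIV) \<times> carrier_mat n n" "pair_coords n" "spectra_eqs n"
  "\<lambda>z. disc n (fst z)" "M_Omega_e n" for n
  by (rule affine_locus_M_Omega_e)

lemma R_e_eq: "R_e n = affine_locus.regular (pair_coords n) (M_Omega_e n)"
  unfolding R_e_def Me.regular_def O_M_Omega_e_def ..

interpretation R_e: fun_alg "R_e n" for n
  unfolding R_e_eq by (rule Me.regular_fun_alg)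

lemmas R_e_cong = Me.regular_cong[folded R_e_eq]
lemmas R_e_iff = Me.regular_iff[folded R_e_eq]
lemmas R_e_poly = Me.regular_poly[folded R_e_eq]
lemmas R_e_inverse = Me.regular_inverse[folded R_e_eq]
lemmas R_e_nu = Me.regular_coord[folded R_e_eq, OF nu_coord]
lemmas R_e_x = Me.regular_coord[folded R_e_eq, OF x_coord]

lemma M_Omega_eD:
  assumes "z \<in> M_Omega_e n"
  shows "fst z \<in> index_set n \<rightarrow>\<^sub>E UNIV" "snd z \<in> carrier_mat n n" "disc n (fst z) \<noteq> 0"
    "has_spectra n (fst z) (snd z)" "snd z \<in> M_Omega n"
  using assms M_Omega_iff unfolding M_Omega_e_eq by auto

section \<open>The open set of parameters that models the cover\<close>

type_synonym param = "(nat \<times> nat) + (nat \<times> nat) \<Rightarrow> complex"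

text \<open>Left labels are eigenvalues, right labels are border coordinates. Their numbers n(n+1)/2
  and (n-1)n/2 add up to n^2, the dimension of the cover.\<close>

definition params :: "nat \<Rightarrow> ((nat \<times> nat) + (nat \<times> nat)) set" where
  "params n = Inl ` index_set n \<union> Inr ` index_set (n - 1)"

definition param_nu :: "nat \<Rightarrow> param \<Rightarrow> nat \<times> nat \<Rightarrow> complex" where
  "param_nu n q = (\<lambda>k\<in>index_set n. q (Inl k))"

text \<open>Nonzero exactly when all forbidden eigenvalue differences and all border coordinates are
  nonzero, so that the recursion divides by nothing that vanishes.\<close>

definition param_denom :: "nat \<Rightarrow> param \<Rightarrow> complex" where
  "param_denom n q = disc n (param_nu n q) * (\<Prod>k\<in>index_set (n - 1). q (Inr k))"

definition param_pt :: "nat \<Rightarrow> param \<Rightarrow> (nat \<times> nat \<Rightarrow> complex) \<times> complex mat" where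
  "param_pt n q = (param_nu n q, mat n n (\<lambda>(i, j). param_x (param_nu n q) (\<lambda>k. q (Inr k)) i j))"

lemma finite_params: "finite (params n)"
  unfolding params_def by (simp add: finite_index_set)

lemma param_coord_Inl: "k \<in> index_set n \<Longrightarrow> (\<lambda>q. q (Inl k)) \<in> poly_funs (coord_funs (params n))"
  by (rule coord_in) (simp add: params_def)

lemma param_coord_Inr: "k \<in> index_set (n - 1) \<Longrightarrow> (\<lambda>q. q (Inr k)) \<in> poly_funs (coord_funs (params n))"
  by (rule coord_in) (simp add: params_def)

lemma param_nu_poly: "k \<in> index_set n \<Longrightarrow> (\<lambda>q. param_nu n q k) \<in> poly_funs (coord_funs (params n))"
  unfolding param_nu_def by (simp add: param_coord_Inl)

lemma param_denom_poly: "param_denom n \<in> poly_funs (coord_funs (params n))"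
  unfolding param_denom_def[abs_def]
  by (intro poly_funs_intros disc_poly param_nu_poly param_coord_Inr)

lemma param_pt_in: "param_denom n q \<noteq> 0 \<Longrightarrow> param_pt n q \<in> M_Omega_e n"
  unfolding param_pt_def param_denom_def
  by (rule param_in_M_Omega_e) (auto simp: param_nu_def prod_zero_iff finite_index_set)

lemma param_denom_nonzero_ex: "\<exists>q. param_denom n q \<noteq> 0"
proof -
  \<comment> \<open>An injective numbering of the labels gives pairwise distinct eigenvalues, and
    all border coordinates are 1.\<close>
  define q :: param where "q = case_sum (\<lambda>k. of_nat (prod_encode k)) (\<lambda>_. 1)"
  have "disc n (param_nu n q) \<noteq> 0" unfolding disc_nonzero_iff
  proof
    fix p assume "p \<in> adjacent n"
    then have p: "fst p \<in> index_set n" "snd p \<in> index_set n" "fst p \<noteq> snd p" unfolding adjacent_def by auto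
    then have "prod_encode (fst p) \<noteq> prod_encode (snd p)" by simp
    then show "param_nu n q (fst p) \<noteq> param_nu n q (snd p)"
      using p(1,2) unfolding param_nu_def q_def by (simp only: restrict_apply sum.case if_True of_nat_eq_iff) simp
  qed
  moreover have "(\<Prod>k\<in>index_set (n - 1). q (Inr k)) = 1" unfolding q_def by simp
  ultimately show ?thesis unfolding param_denom_def by (intro exI[of _ q]) simp
qed

lemma M_Omega_e_nonempty: "M_Omega_e n \<noteq> {}"
  using param_denom_nonzero_ex[of n] param_pt_in by blast

lemma param_poly_denom_cancel:
  assumes "f \<in> poly_funs (coord_funs (params n))" "\<And>q. param_denom n q \<noteq> 0 \<Longrightarrow> f q = 0"
  shows "f q = 0"
proof -
  obtain q0 where "param_denom n q0 \<noteq> 0" using param_denom_nonzero_ex by blast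
  moreover have "param_denom n q * f q = 0" for q using assms(2)[of q] by auto
  ultimately show ?thesis using poly_funs_domain[OF param_denom_poly assms(1)] by blast
qed

text \<open>The localisation of the polynomial ring at \<open>param_denom\<close>, described by
  values on the set where the denominator is nonzero.\<close>

definition param_loc :: "nat \<Rightarrow> (param \<Rightarrow> complex) set" where
  "param_loc n = {F. \<exists>N. \<exists>P\<in>poly_funs (coord_funs (params n)).
     \<forall>q. param_denom n q \<noteq> 0 \<longrightarrow> F q * param_denom n q ^ N = P q}"

lemma param_locI: "P \<in> poly_funs (coord_funs (params n)) \<Longrightarrow>
    (\<And>q. param_denom n q \<noteq> 0 \<Longrightarrow> F q * param_denom n q ^ N = P q) \<Longrightarrow> F \<in> param_loc n"
  unfolding param_loc_def by blast

lemma param_loc_common: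
  assumes "finite J" "J \<subseteq> param_loc n"
  shows "\<exists>N. \<forall>F\<in>J. \<exists>P\<in>poly_funs (coord_funs (params n)).
    \<forall>q. param_denom n q \<noteq> 0 \<longrightarrow> F q * param_denom n q ^ N = P q"
  using assms
proof (induction J rule: finite_induct)
  case (insert F J)
  obtain N where N: "\<And>G. G \<in> J \<Longrightarrow> \<exists>P\<in>poly_funs (coord_funs (params n)).
    \<forall>q. param_denom n q \<noteq> 0 \<longrightarrow> G q * param_denom n q ^ N = P q" using insert by auto
  obtain M Q where M: "Q \<in> poly_funs (coord_funs (params n))"
    "\<And>q. param_denom n q \<noteq> 0 \<Longrightarrow> F q * param_denom n q ^ M = Q q"
    using insert.prems unfolding param_loc_def by auto
  have "\<exists>P\<in>poly_funs (coord_funs (params n)). \<forall>q. param_denom n q \<noteq> 0 \<longrightarrow> G q * param_denom n q ^ (N + M) = P q"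
    if G: "G \<in> insert F J" for G
  proof (cases "G = F")
    case True
    show ?thesis
      by (rule bexI[OF _ poly_funs.mult[OF M(1) poly_funs_power[OF param_denom_poly, where k = N]]])
         (simp add: True power_add flip: M(2))
  next
    case False
    then obtain P where P: "P \<in> poly_funs (coord_funs (params n))"
      "\<And>q. param_denom n q \<noteq> 0 \<Longrightarrow> G q * param_denom n q ^ N = P q" using N G by blast
    show ?thesis
      by (rule bexI[OF _ poly_funs.mult[OF P(1) poly_funs_power[OF param_denom_poly, where k = M]]])
         (simp add: power_add flip: P(2))
  qed
  then show ?case by blast
qed simp

lemma param_loc_fun_alg: "fun_alg (param_loc n)"
proof
  show "(\<lambda>_. c) \<in> param_loc n" for c by (rule param_locI[OF poly_funs.const[of c], where N = 0]) simp
next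
  fix F G assume "F \<in> param_loc n" "G \<in> param_loc n"
  then obtain N where N: "\<forall>H\<in>{F, G}. \<exists>P\<in>poly_funs (coord_funs (params n)).
    \<forall>q. param_denom n q \<noteq> 0 \<longrightarrow> H q * param_denom n q ^ N = P q"
    using param_loc_common[of "{F, G}" n] by auto
  then obtain P Q where P: "P \<in> poly_funs (coord_funs (params n))"
    "\<And>q. param_denom n q \<noteq> 0 \<Longrightarrow> F q * param_denom n q ^ N = P q"
    and Q: "Q \<in> poly_funs (coord_funs (params n))"
    "\<And>q. param_denom n q \<noteq> 0 \<Longrightarrow> G q * param_denom n q ^ N = Q q" by auto
  show "(\<lambda>q. F q + G q) \<in> param_loc n"
    by (rule param_locI[OF poly_funs.add[OF P(1) Q(1)], where N = N])
       (simp add: distrib_right P(2) Q(2))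
  show "(\<lambda>q. F q * G q) \<in> param_loc n"
  proof (rule param_locI[OF poly_funs.mult[OF P(1) Q(1)], where N = "N + N"])
    fix q assume q: "param_denom n q \<noteq> 0"
    have "F q * G q * param_denom n q ^ (N + N) = (F q * param_denom n q ^ N) * (G q * param_denom n q ^ N)"
      by (simp add: power_add)
    then show "F q * G q * param_denom n q ^ (N + N) = P q * Q q" unfolding P(2)[OF q] Q(2)[OF q] .
  qed
qed

lemma param_loc_poly: "P \<in> poly_funs (coord_funs (params n)) \<Longrightarrow> P \<in> param_loc n"
  by (rule param_locI[where N = 0]) simp_all

lemma param_loc_inverse_factor:
  assumes "g \<in> poly_funs (coord_funs (params n))" "\<And>q. param_denom n q = f q * g q"
  shows "(\<lambda>q. inverse (f q)) \<in> param_loc n"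
  by (rule param_locI[OF assms(1), where N = 1]) (auto simp: assms(2))

text \<open>Every reciprocal occurring in the recursion, and that of \<open>disc\<close>, inverts a
  factor of \<open>param_denom\<close>.\<close>

lemma regular_param_pt:
  assumes "f \<in> R_e n"
  shows "(\<lambda>q. f (param_pt n q)) \<in> param_loc n"
proof -
  interpret L: fun_alg "param_loc n" by (rule param_loc_fun_alg)
  let ?K = "coord_funs (params n)"
  obtain F where F: "F \<in> poly_funs (insert (\<lambda>p. 1 / disc n (fst p)) (pair_coords n))"
    "\<forall>p\<in>M_Omega_e n. f p = F p" using assms unfolding R_e_iff by blast
  have nu: "(\<lambda>q. param_nu n q k) \<in> param_loc n" if "k \<in> index_set n" for k
    by (rule param_loc_poly[OF param_nu_poly[OF that]])
  have inv_nu: "(\<lambda>q. inverse (param_nu n q (fst p) - param_nu n q (snd p))) \<in> param_loc n"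
    if p: "p \<in> adjacent n" for p
  proof (rule param_loc_inverse_factor)
    show "(\<lambda>q. (\<Prod>p\<in>adjacent n - {p}. param_nu n q (fst p) - param_nu n q (snd p)) *
        (\<Prod>k\<in>index_set (n - 1). q (Inr k))) \<in> poly_funs ?K"
      by (intro poly_funs_intros param_nu_poly param_coord_Inr) (auto simp: adjacent_def)
    show "param_denom n q = (param_nu n q (fst p) - param_nu n q (snd p)) *
      ((\<Prod>p\<in>adjacent n - {p}. param_nu n q (fst p) - param_nu n q (snd p)) *
        (\<Prod>k\<in>index_set (n - 1). q (Inr k)))" for q
      unfolding param_denom_def disc_def by (subst prod.remove[OF finite_adjacent p]) simp
  qed
  have a: "(\<lambda>q. q (Inr k)) \<in> param_loc n" if "k \<in> index_set (n - 1)" for k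
    by (rule param_loc_poly[OF param_coord_Inr[OF that]])
  have inv_a: "(\<lambda>q. inverse (q (Inr k))) \<in> param_loc n" if k: "k \<in> index_set (n - 1)" for k
  proof (rule param_loc_inverse_factor)
    show "(\<lambda>q. disc n (param_nu n q) * (\<Prod>k\<in>index_set (n - 1) - {k}. q (Inr k))) \<in> poly_funs ?K"
      by (intro poly_funs_intros disc_poly param_nu_poly param_coord_Inr) auto
    show "param_denom n q = q (Inr k) * (disc n (param_nu n q) * (\<Prod>k\<in>index_set (n - 1) - {k}. q (Inr k)))" for q
      unfolding param_denom_def by (subst prod.remove[OF finite_index_set k]) simp
  qed
  have "(\<lambda>q. F (param_pt n q)) \<in> param_loc n"
  proof (rule L.poly_funs_comp[OF F(1)])
    fix c assume "c \<in> insert (\<lambda>p. 1 / disc n (fst p)) (pair_coords n)"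
    then consider "c = (\<lambda>p. 1 / disc n (fst p))" | k where "k \<in> index_set n" "c = (\<lambda>z. fst z k)"
      | i j where "i < n" "j < n" "c = (\<lambda>z. snd z $$ (i, j))"
      unfolding pair_coords_def by blast
    then show "(\<lambda>z. c (param_pt n z)) \<in> param_loc n"
    proof cases
      case 1
      then show ?thesis using L.disc_inverse[OF nu inv_nu] by (simp add: param_pt_def divide_inverse)
    next
      case 2
      then show ?thesis using nu by (simp add: param_pt_def)
    next
      case 3
      then show ?thesis using L.param_x_closed[OF nu inv_nu order_refl 3(1,2) a inv_a] by (simp add: param_pt_def)
    qed
  qed
  then obtain N P where "P \<in> poly_funs ?K" "\<And>q. param_denom n q \<noteq> 0 \<Longrightarrow> F (param_pt n q) * param_denom n q ^ N = P q"
    unfolding param_loc_def by blast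
  then show ?thesis using F(2) param_pt_in by (intro param_locI[where N = N]) simp_all
qed

text \<open>The border coordinates of a point are themselves regular functions of it. Identities
  solved for polynomials in the parameters are thereby carried back to the cover along
  \<alpha>.\<close>

lemma param_section:
  obtains \<alpha> where "\<And>P. P \<in> poly_funs (coord_funs (params n)) \<Longrightarrow> (\<lambda>z. P (\<alpha> z)) \<in> R_e n"
    "\<And>z. z \<in> M_Omega_e n \<Longrightarrow> param_pt n (\<alpha> z) = z" "\<And>z. z \<in> M_Omega_e n \<Longrightarrow> param_denom n (\<alpha> z) \<noteq> 0"
proof -
  have "\<exists>a. (\<forall>k\<in>index_set (n - 1). a k \<in> R_e n \<and> (\<forall>z\<in>M_Omega_e n. a k z \<noteq> 0)) \<and>
    (\<forall>z\<in>M_Omega_e n. \<forall>i<n. \<forall>j<n. snd z $$ (i, j) = param_x (fst z) (\<lambda>k. a k z) i j)"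
    by (rule has_spectra_param[OF R_e.fun_alg_axioms _ R_e_nu R_e_x R_e_inverse order_refl])
       (auto dest: M_Omega_eD)
  then obtain a where a: "\<And>k. k \<in> index_set (n - 1) \<Longrightarrow> a k \<in> R_e n"
    "\<And>k z. k \<in> index_set (n - 1) \<Longrightarrow> z \<in> M_Omega_e n \<Longrightarrow> a k z \<noteq> 0"
    "\<And>z i j. z \<in> M_Omega_e n \<Longrightarrow> i < n \<Longrightarrow> j < n \<Longrightarrow> snd z $$ (i, j) = param_x (fst z) (\<lambda>k. a k z) i j"
    by metis
  define \<alpha> :: "_ \<Rightarrow> param" where "\<alpha> z = case_sum (fst z) (\<lambda>k. a k z)" for z
  have nu: "param_nu n (\<alpha> z) = fst z" if "z \<in> M_Omega_e n" for z
    using M_Omega_eD(1)[OF that] unfolding param_nu_def \<alpha>_def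
    by (auto simp: fun_eq_iff PiE_def extensional_def restrict_def)
  show ?thesis
  proof (rule that[of \<alpha>])
    show "(\<lambda>z. P (\<alpha> z)) \<in> R_e n" if "P \<in> poly_funs (coord_funs (params n))" for P
      using that
    proof (rule R_e.poly_funs_comp)
      fix c assume "c \<in> coord_funs (params n)"
      then obtain k where "k \<in> params n" "c = (\<lambda>q. q k)" unfolding coord_funs_def by blast
      then show "(\<lambda>z. c (\<alpha> z)) \<in> R_e n" unfolding params_def \<alpha>_def using a(1) R_e_nu by auto
    qed
    fix z assume z: "z \<in> M_Omega_e n"
    show "param_pt n (\<alpha> z) = z"
    proof (rule prod_eqI)
      show "fst (param_pt n (\<alpha> z)) = fst z" unfolding param_pt_def using nu[OF z] by simp
      show "snd (param_pt n (\<alpha> z)) = snd z"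
        unfolding param_pt_def using nu[OF z] a(3)[OF z] M_Omega_eD(2)[OF z]
        by (intro eq_matI) (auto simp: \<alpha>_def)
    qed
    show "param_denom n (\<alpha> z) \<noteq> 0"
      unfolding param_denom_def nu[OF z] using M_Omega_eD(3)[OF z] a(2)[OF _ z]
      by (simp add: prod_zero_iff finite_index_set \<alpha>_def)
  qed
qed

text \<open>Both functions become polynomials in the parameters after clearing denominators, and
  polynomials have no zero divisors.\<close>

theorem R_e_domain:
  assumes f: "f \<in> R_e n" and g: "g \<in> R_e n" and fg: "\<And>z. z \<in> M_Omega_e n \<Longrightarrow> f z * g z = 0"
    and z0: "z0 \<in> M_Omega_e n" "f z0 \<noteq> 0" and z: "z \<in> M_Omega_e n"
  shows "g z = 0"
proof -
  obtain N P where P: "P \<in> poly_funs (coord_funs (params n))"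
    "\<And>q. param_denom n q \<noteq> 0 \<Longrightarrow> f (param_pt n q) * param_denom n q ^ N = P q"
    using regular_param_pt[OF f] unfolding param_loc_def by blast
  obtain M Q where Q: "Q \<in> poly_funs (coord_funs (params n))"
    "\<And>q. param_denom n q \<noteq> 0 \<Longrightarrow> g (param_pt n q) * param_denom n q ^ M = Q q"
    using regular_param_pt[OF g] unfolding param_loc_def by blast
  obtain \<alpha> where \<alpha>: "\<And>z. z \<in> M_Omega_e n \<Longrightarrow> param_pt n (\<alpha> z) = z"
    "\<And>z. z \<in> M_Omega_e n \<Longrightarrow> param_denom n (\<alpha> z) \<noteq> 0" using param_section by metis
  have "P q * Q q = 0" if "param_denom n q \<noteq> 0" for q
    using fg[OF param_pt_in[OF that]] P(2)[OF that] Q(2)[OF that] by auto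
  then have PQ: "P q * Q q = 0" for q
    by (rule param_poly_denom_cancel[OF poly_funs.mult[OF P(1) Q(1)]])
  have "P (\<alpha> z0) \<noteq> 0" using P(2)[OF \<alpha>(2)[OF z0(1)]] \<alpha>(1,2)[OF z0(1)] z0(2) by auto
  then have "Q (\<alpha> z) = 0" using poly_funs_domain[OF P(1) Q(1) PQ] by blast
  then show ?thesis using Q(2)[OF \<alpha>(2)[OF z]] \<alpha>(1,2)[OF z] by auto
qed

theorem R_e_integrally_closed:
  assumes f: "f \<in> R_e n" and g: "g \<in> R_e n" and c: "\<And>j. j < d \<Longrightarrow> c j \<in> R_e n"
    and z0: "z0 \<in> M_Omega_e n" "g z0 \<noteq> 0"
    and eq: "\<And>z. z \<in> M_Omega_e n \<Longrightarrow> f z ^ d + (\<Sum>j<d. c j z * f z ^ j * g z ^ (d - j)) = 0"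
  obtains h where "h \<in> R_e n" "\<And>z. z \<in> M_Omega_e n \<Longrightarrow> f z = h z * g z"
proof -
  let ?K = "coord_funs (params n)"
  let ?E = "param_denom n"
  let ?J = "insert (\<lambda>q. f (param_pt n q)) (insert (\<lambda>q. g (param_pt n q)) ((\<lambda>j q. c j (param_pt n q)) ` {..<d}))"
  obtain \<alpha> where \<alpha>: "\<And>P. P \<in> poly_funs ?K \<Longrightarrow> (\<lambda>z. P (\<alpha> z)) \<in> R_e n"
    "\<And>z. z \<in> M_Omega_e n \<Longrightarrow> param_pt n (\<alpha> z) = z"
    "\<And>z. z \<in> M_Omega_e n \<Longrightarrow> ?E (\<alpha> z) \<noteq> 0" using param_section by metis
  have "?J \<subseteq> param_loc n" using regular_param_pt f g c by auto
  then obtain N where N: "\<forall>F\<in>?J. \<exists>P\<in>poly_funs ?K. \<forall>q. ?E q \<noteq> 0 \<longrightarrow> F q * ?E q ^ N = P q"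
    using param_loc_common[of ?J n] by auto
  obtain P where P: "P \<in> poly_funs ?K" "\<And>q. ?E q \<noteq> 0 \<Longrightarrow> f (param_pt n q) * ?E q ^ N = P q" using N by auto
  obtain Q where Q: "Q \<in> poly_funs ?K" "\<And>q. ?E q \<noteq> 0 \<Longrightarrow> g (param_pt n q) * ?E q ^ N = Q q" using N by auto
  have "\<forall>j. \<exists>R. R \<in> poly_funs ?K \<and> (j < d \<longrightarrow> (\<forall>q. ?E q \<noteq> 0 \<longrightarrow> c j (param_pt n q) * ?E q ^ N = R q))"
  proof
    fix j
    show "\<exists>R. R \<in> poly_funs ?K \<and> (j < d \<longrightarrow> (\<forall>q. ?E q \<noteq> 0 \<longrightarrow> c j (param_pt n q) * ?E q ^ N = R q))"
    proof (cases "j < d")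
      case True
      then have "(\<lambda>q. c j (param_pt n q)) \<in> ?J" by auto
      from bspec[OF N this] show ?thesis by blast
    next
      case False
      then show ?thesis by (intro exI[of _ "\<lambda>_. 0"]) (simp add: poly_funs.const)
    qed
  qed
  then obtain R where R: "\<And>j. R j \<in> poly_funs ?K"
    "\<And>j q. j < d \<Longrightarrow> ?E q \<noteq> 0 \<Longrightarrow> c j (param_pt n q) * ?E q ^ N = R j q" by metis
  \<comment> \<open>The scaling is chosen to keep the equation homogeneous and polynomial: with
    \<open>E\<close> the denominator, \<open>f\<close>, \<open>g\<close> and \<open>c j\<close> are
    multiplied by \<open>E^(2N)\<close>, \<open>E^N\<close> and \<open>E^(N(d-j))\<close>, so every
    term gains the same factor \<open>E^(2Nd)\<close>.\<close>
  define a where "a q = ?E q ^ N * P q" for q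
  define C where "C j q = R j q * ?E q ^ (N * (d - 1 - j))" for j q
  have aK: "a \<in> poly_funs ?K" unfolding a_def[abs_def] by (intro poly_funs_intros param_denom_poly P(1))
  have CK: "C j \<in> poly_funs ?K" for j unfolding C_def[abs_def] by (intro poly_funs_intros param_denom_poly R(1))
  have eqE: "a q ^ d + (\<Sum>j<d. C j q * a q ^ j * Q q ^ (d - j)) = 0" if q: "?E q \<noteq> 0" for q
  proof -
    let ?z = "param_pt n q"
    have aq: "a q = f ?z * ?E q ^ (2 * N)" unfolding a_def P(2)[OF q, symmetric] by (simp add: mult_2 power_add)
    have "C j q * a q ^ j * Q q ^ (d - j) = c j ?z * f ?z ^ j * g ?z ^ (d - j) * ?E q ^ (2 * N * d)" if "j < d" for j
    proof -
      obtain i where d: "d = Suc (j + i)" using \<open>j < d\<close> by (metis add_Suc_right less_iff_Suc_add)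
      have "C j q = c j ?z * ?E q ^ N * ?E q ^ (N * i)"
        unfolding C_def R(2)[OF that q, symmetric] d by simp
      moreover have "a q ^ j = f ?z ^ j * ?E q ^ (2 * N * j)" unfolding aq by (simp only: power_mult_distrib power_mult)
      moreover have "Q q ^ (d - j) = g ?z ^ Suc i * ?E q ^ (N * Suc i)"
      proof -
        have "d - j = Suc i" unfolding d by simp
        then show ?thesis unfolding Q(2)[OF q, symmetric] by (simp only: power_mult_distrib power_mult)
      qed
      ultimately have "C j q * a q ^ j * Q q ^ (d - j) =
        (c j ?z * ?E q ^ N * ?E q ^ (N * i)) * (f ?z ^ j * ?E q ^ (2 * N * j)) * (g ?z ^ Suc i * ?E q ^ (N * Suc i))"
        by (simp only:)
      also have "\<dots> = c j ?z * f ?z ^ j * g ?z ^ Suc i * ?E q ^ (N + N * i + 2 * N * j + N * Suc i)"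
        by (simp only: power_add mult_ac)
      also have "N + N * i + 2 * N * j + N * Suc i = 2 * N * d" unfolding d by (simp add: algebra_simps)
      also have "Suc i = d - j" unfolding d by simp
      finally show ?thesis .
    qed
    then have "(\<Sum>j<d. C j q * a q ^ j * Q q ^ (d - j)) = (\<Sum>j<d. c j ?z * f ?z ^ j * g ?z ^ (d - j)) * ?E q ^ (2 * N * d)"
      unfolding sum_distrib_right by (intro sum.cong refl) simp
    moreover have "a q ^ d = f ?z ^ d * ?E q ^ (2 * N * d)" unfolding aq by (simp only: power_mult_distrib power_mult)
    ultimately have "a q ^ d + (\<Sum>j<d. C j q * a q ^ j * Q q ^ (d - j)) =
       (f ?z ^ d + (\<Sum>j<d. c j ?z * f ?z ^ j * g ?z ^ (d - j))) * ?E q ^ (2 * N * d)"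
      by (simp add: distrib_right)
    then show ?thesis using eq[OF param_pt_in[OF q]] by simp
  qed
  have poly: "(\<lambda>q. a q ^ d + (\<Sum>j<d. C j q * a q ^ j * Q q ^ (d - j))) \<in> poly_funs ?K"
    by (intro poly_funs_intros aK CK Q(1))
  have eq0: "a q ^ d + (\<Sum>j<d. C j q * a q ^ j * Q q ^ (d - j)) = 0" for q
    by (rule param_poly_denom_cancel[OF poly]) (rule eqE)
  have "Q (\<alpha> z0) \<noteq> 0" using Q(2)[OF \<alpha>(3)[OF z0(1)]] \<alpha>(2,3)[OF z0(1)] z0(2) by auto
  then obtain Y where Y: "Y \<in> poly_funs ?K" "\<And>q. a q = Y q * Q q"
    using poly_funs_integrally_closed[OF finite_params aK Q(1) CK _ eq0] by metis
  show ?thesis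
  proof (rule that)
    \<comment> \<open>Undoes the unequal scaling: \<open>f E^(2N) = Y g E^N\<close> means
      \<open>f = (Y / E^N) g\<close>.\<close>
    show "(\<lambda>z. Y (\<alpha> z) * inverse (?E (\<alpha> z) ^ N)) \<in> R_e n"
      by (intro R_e.mult \<alpha>(1) Y(1) R_e_inverse R_e.power param_denom_poly) (simp add: \<alpha>(3))
    fix z assume z: "z \<in> M_Omega_e n"
    have E: "?E (\<alpha> z) \<noteq> 0" using \<alpha>(3)[OF z] .
    have "?E (\<alpha> z) ^ N * (f z * ?E (\<alpha> z) ^ N) = Y (\<alpha> z) * (g z * ?E (\<alpha> z) ^ N)"
      using Y(2)[of "\<alpha> z"] P(2)[OF E] Q(2)[OF E] unfolding a_def \<alpha>(2)[OF z] by simp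
    then have "f z * ?E (\<alpha> z) ^ N = Y (\<alpha> z) * g z" using E by simp
    then show "f z = Y (\<alpha> z) * inverse (?E (\<alpha> z) ^ N) * g z" using E by (simp add: field_simps)
  qed
qed

section \<open>Symmetrisation\<close>

lemma upper_triangular_pow:
  fixes B :: "complex mat"
  assumes B: "B \<in> carrier_mat m m" and u: "upper_triangular B"
  shows "i < m \<Longrightarrow> j < m \<Longrightarrow> j \<le> i \<Longrightarrow> (B ^\<^sub>m r) $$ (i, j) = of_bool (i = j) * B $$ (i, i) ^ r"
proof (induction r arbitrary: i j)
  case 0
  then show ?case using B by simp
next
  case (Suc r)
  have p: "B ^\<^sub>m r \<in> carrier_mat m m" using B by simp
  have "(B ^\<^sub>m Suc r) $$ (i, j) = (\<Sum>k<m. (B ^\<^sub>m r) $$ (i, k) * B $$ (k, j))"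
    using Suc.prems B p by (simp add: scalar_prod_def atLeast0LessThan)
  also have "\<dots> = (\<Sum>k<m. if k = i then of_bool (i = j) * B $$ (i, i) ^ Suc r else 0)"
  proof (intro sum.cong refl)
    fix k assume "k \<in> {..<m}"
    then have k: "k < m" by simp
    consider "k < i" | "k = i" | "i < k" by linarith
    then show "(B ^\<^sub>m r) $$ (i, k) * B $$ (k, j) = (if k = i then of_bool (i = j) * B $$ (i, i) ^ Suc r else 0)"
    proof cases
      case 1
      then show ?thesis using Suc.IH[OF Suc.prems(1) k] by simp
    next
      case 2
      have "B $$ (i, j) = of_bool (i = j) * B $$ (i, i)"
        using upper_triangularD[OF u, of j i] Suc.prems B by (cases "i = j") auto
      then show ?thesis using 2 Suc.IH[OF Suc.prems(1) k] by simp
    next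
      case 3
      then have "B $$ (k, j) = 0" using upper_triangularD[OF u, of j k] Suc.prems B k by simp
      then show ?thesis using 3 by simp
    qed
  qed
  also have "\<dots> = of_bool (i = j) * B $$ (i, i) ^ Suc r" using Suc.prems by simp
  finally show ?case .
qed

lemma diagonal_sum_comm:
  fixes A B :: "complex mat"
  assumes "A \<in> carrier_mat m m" "B \<in> carrier_mat m m"
  shows "(\<Sum>i<m. (A * B) $$ (i, i)) = (\<Sum>i<m. (B * A) $$ (i, i))"
proof -
  have "(\<Sum>i<m. (A * B) $$ (i, i)) = (\<Sum>i<m. \<Sum>k<m. A $$ (i, k) * B $$ (k, i))"
    using assms by (intro sum.cong refl) (simp add: scalar_prod_def atLeast0LessThan)
  also have "\<dots> = (\<Sum>k<m. \<Sum>i<m. B $$ (k, i) * A $$ (i, k))"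
    by (subst sum.swap) (simp add: mult.commute)
  also have "\<dots> = (\<Sum>i<m. (B * A) $$ (i, i))"
    using assms by (intro sum.cong refl) (simp add: scalar_prod_def atLeast0LessThan)
  finally show ?thesis .
qed

lemma prod_linear_list: "(\<Prod>i\<in>{1..m}. [:- \<nu> (i, m), 1:]) = (\<Prod>a\<leftarrow>map (\<lambda>i. \<nu> (Suc i, m)) [0..<m]. [:- a, 1::complex:])"
proof -
  have "(\<Prod>a\<leftarrow>map (\<lambda>i. \<nu> (Suc i, m)) [0..<m]. [:- a, 1:]) = (\<Prod>i\<in>{0..<m}. [:- \<nu> (Suc i, m), 1::complex:])"
    by (simp add: prod.distinct_set_conv_list[symmetric] comp_def)
  also have "\<dots> = (\<Prod>i\<in>{1..m}. [:- \<nu> (i, m), 1:])"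
    by (rule prod.reindex_bij_witness[of _ "\<lambda>i. i - 1" Suc]) auto
  finally show ?thesis ..
qed

definition power_trace :: "nat \<Rightarrow> nat \<Rightarrow> complex mat \<Rightarrow> complex" where
  "power_trace m r x = (\<Sum>i<m. (upper_left x m ^\<^sub>m r) $$ (i, i))"

text \<open>Schur form is used instead of an eigenbasis because eigenvalues may coincide here; a
  power of a triangular matrix still has the powers of the eigenvalues on its diagonal.\<close>

lemma has_spectra_power_sum:
  assumes "has_spectra n \<nu> x" "m \<in> {1..n}"
  shows "(\<Sum>i\<in>{1..m}. \<nu> (i, m) ^ r) = power_trace m r x"
proof -
  let ?A = "upper_left x m"
  let ?es = "map (\<lambda>i. \<nu> (Suc i, m)) [0..<m]"
  obtain B P Q where BPQ: "schur_decomposition ?A ?es = (B, P, Q)" by (cases "schur_decomposition ?A ?es") auto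
  have "char_poly ?A = (\<Prod>e\<leftarrow>?es. [:- e, 1:])"
    using assms unfolding has_spectra_def prod_linear_list by simp
  from schur_decomposition[OF upper_left_carrier this BPQ]
  have sim: "similar_mat_wit ?A B P Q" and u: "upper_triangular B" and dg: "diag_mat B = ?es" by auto
  have car: "B \<in> carrier_mat m m" "P \<in> carrier_mat m m" "Q \<in> carrier_mat m m" "Q * P = 1\<^sub>m m"
    using similar_mat_witD2[OF upper_left_carrier sim] by auto
  have Br: "B ^\<^sub>m r \<in> carrier_mat m m" using car by simp
  have "power_trace m r x = (\<Sum>i<m. (P * (B ^\<^sub>m r * Q)) $$ (i, i))"
    unfolding power_trace_def similar_mat_wit_pow_id[OF sim] using assoc_mult_mat[OF car(2) Br car(3)] by simp
  also have "\<dots> = (\<Sum>i<m. (B ^\<^sub>m r * Q * P) $$ (i, i))"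
    using diagonal_sum_comm[OF car(2), of "B ^\<^sub>m r * Q"] car(3) Br by simp
  also have "B ^\<^sub>m r * Q * P = B ^\<^sub>m r"
    using assoc_mult_mat[OF Br car(3,2)] car(4) right_mult_one_mat[OF Br] by simp
  also have "(\<Sum>i<m. (B ^\<^sub>m r) $$ (i, i)) = (\<Sum>i<m. \<nu> (Suc i, m) ^ r)"
  proof (intro sum.cong refl)
    fix i assume "i \<in> {..<m}"
    then have i: "i < m" by simp
    have "B $$ (i, i) = diag_mat B ! i" using i car(1) by (simp add: diag_mat_def)
    then have "B $$ (i, i) = \<nu> (Suc i, m)" unfolding dg using i by simp
    then show "(B ^\<^sub>m r) $$ (i, i) = \<nu> (Suc i, m) ^ r"
      using upper_triangular_pow[OF car(1) u i i order_refl] by simp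
  qed
  finally show ?thesis by (simp add: sum_atLeast1)
qed

lemma power_trace_poly:
  assumes "m \<le> n"
  shows "power_trace m r \<in> poly_funs (mat_coords n)"
proof -
  have "(\<lambda>x. (upper_left x m ^\<^sub>m r) $$ (i, j)) \<in> poly_funs (mat_coords n)" if "i < m" "j < m" for i j
    using that
  proof (induction r arbitrary: i j)
    case 0
    then have "(\<lambda>x. (upper_left x m ^\<^sub>m 0) $$ (i, j)) = (\<lambda>_. of_bool (i = j))"
      by (auto simp: upper_left_def)
    then show ?case by (simp only: poly_funs.const)
  next
    case (Suc r)
    have "(upper_left x m ^\<^sub>m Suc r) $$ (i, j) = (\<Sum>k<m. (upper_left x m ^\<^sub>m r) $$ (i, k) * x $$ (k, j))" for x
    proof -
      have "upper_left x m ^\<^sub>m r \<in> carrier_mat m m" by simp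
      then show ?thesis using Suc.prems
        by (simp add: scalar_prod_def atLeast0LessThan upper_left_def)
    qed
    moreover have "(\<lambda>x. \<Sum>k<m. (upper_left x m ^\<^sub>m r) $$ (i, k) * x $$ (k, j)) \<in> poly_funs (mat_coords n)"
      using Suc assms by (intro poly_funs_intros mat_coord_in Suc.IH) auto
    ultimately show ?case by (simp only:)
  qed
  then show ?thesis unfolding power_trace_def[abs_def] by (intro poly_funs_intros) auto
qed

text \<open>Injective maps into \<open>A\<close> instead of permutations of \<open>A\<close>: their
  domain can shrink, which permits an induction.\<close>

definition inj_maps :: "'j set \<Rightarrow> 'i set \<Rightarrow> ('j \<Rightarrow> 'i) set" where
  "inj_maps J A = {f \<in> J \<rightarrow>\<^sub>E A. inj_on f J}"

lemma finite_inj_maps: "finite J \<Longrightarrow> finite A \<Longrightarrow> finite (inj_maps J A)"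
  unfolding inj_maps_def by (rule finite_subset[of _ "J \<rightarrow>\<^sub>E A"]) (auto intro: finite_PiE)

lemma inj_maps_insert:
  assumes "b \<notin> J"
  shows "bij_betw (\<lambda>(f, y). f(b := y)) (SIGMA f:inj_maps J A. A - f ` J) (inj_maps (insert b J) A)"
  unfolding bij_betw_def
proof
  show "inj_on (\<lambda>(f, y). f(b := y)) (SIGMA f:inj_maps J A. A - f ` J)"
  proof (rule inj_onI, clarify)
    fix f y g z assume *: "f \<in> inj_maps J A" "g \<in> inj_maps J A" "f(b := y) = g(b := z)"
    have "f = g"
    proof (rule PiE_ext[of f J "\<lambda>_. A"])
      fix j assume "j \<in> J"
      then show "f j = g j" using fun_cong[OF *(3), of j] assms by (auto split: if_splits)
    qed (use * in \<open>auto simp: inj_maps_def\<close>)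
    then show "f = g \<and> y = z" using fun_cong[OF *(3), of b] by simp
  qed
  show "(\<lambda>(f, y). f(b := y)) ` (SIGMA f:inj_maps J A. A - f ` J) = inj_maps (insert b J) A"
  proof (intro equalityI subsetI)
    fix g assume "g \<in> (\<lambda>(f, y). f(b := y)) ` (SIGMA f:inj_maps J A. A - f ` J)"
    then obtain f y where g: "g = f(b := y)" "f \<in> inj_maps J A" "y \<in> A" "y \<notin> f ` J" by auto
    have "g \<in> insert b J \<rightarrow>\<^sub>E A" using g unfolding inj_maps_def by (auto simp: PiE_def extensional_def)
    moreover have "inj_on g (insert b J)"
      using g assms unfolding inj_maps_def inj_on_def by auto
    ultimately show "g \<in> inj_maps (insert b J) A" unfolding inj_maps_def by simp
  next
    fix g assume g: "g \<in> inj_maps (insert b J) A"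
    define f where "f = restrict g J"
    have "f \<in> inj_maps J A" using g unfolding inj_maps_def f_def by (auto simp: inj_on_def)
    moreover have "g b \<in> A - f ` J" using g assms unfolding inj_maps_def f_def by (auto simp: inj_on_def)
    moreover have "g = f(b := g b)"
    proof
      fix j show "g j = (f(b := g b)) j"
        using g unfolding inj_maps_def f_def by (auto simp: PiE_def extensional_def)
    qed
    ultimately show "g \<in> (\<lambda>(f, y). f(b := y)) ` (SIGMA f:inj_maps J A. A - f ` J)" by (intro image_eqI[of _ _ "(f, g b)"]) auto
  qed
qed

text \<open>
  Removing one index at a time: summing over its values without the injectivity constraint gives
  a power sum, and the coincidences with another index merge two exponents.
\<close>
lemma (in fun_alg) inj_maps_monomial_sum:
  assumes "finite A" and power_sum: "\<And>r. (\<lambda>z. \<Sum>i\<in>A. v z i ^ r) \<in> R" and "finite J"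
  shows "(\<lambda>z. \<Sum>f\<in>inj_maps J A. \<Prod>j\<in>J. v z (f j) ^ \<alpha> j) \<in> R"
  using \<open>finite J\<close>
proof (induction J arbitrary: \<alpha> rule: finite_induct)
  case empty
  have "inj_maps {} A = {\<lambda>_. undefined}" unfolding inj_maps_def by auto
  then show ?case by (simp add: const)
next
  case (insert b J)
  have eq: "(\<Sum>f\<in>inj_maps (insert b J) A. \<Prod>j\<in>insert b J. v z (f j) ^ \<alpha> j) =
      (\<Sum>f\<in>inj_maps J A. \<Prod>j\<in>J. v z (f j) ^ \<alpha> j) * (\<Sum>i\<in>A. v z i ^ \<alpha> b)
      - (\<Sum>j0\<in>J. \<Sum>f\<in>inj_maps J A. \<Prod>j\<in>J. v z (f j) ^ (\<alpha>(j0 := \<alpha> j0 + \<alpha> b)) j)" for z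
  proof -
    have m: "(\<Prod>j\<in>insert b J. v z ((f(b := y)) j) ^ \<alpha> j) = v z y ^ \<alpha> b * (\<Prod>j\<in>J. v z (f j) ^ \<alpha> j)" for f y
    proof -
      have "(\<Prod>j\<in>J. v z ((f(b := y)) j) ^ \<alpha> j) = (\<Prod>j\<in>J. v z (f j) ^ \<alpha> j)"
        using insert.hyps(2) by (intro prod.cong refl) auto
      then show ?thesis using insert.hyps by simp
    qed
    have merge: "(\<Prod>j\<in>J. v z (f j) ^ (\<alpha>(j0 := \<alpha> j0 + \<alpha> b)) j) = v z (f j0) ^ \<alpha> b * (\<Prod>j\<in>J. v z (f j) ^ \<alpha> j)"
      if "j0 \<in> J" for f j0
    proof -
      have "(\<Prod>j\<in>J - {j0}. v z (f j) ^ (\<alpha>(j0 := \<alpha> j0 + \<alpha> b)) j) = (\<Prod>j\<in>J - {j0}. v z (f j) ^ \<alpha> j)"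
        by (intro prod.cong refl) auto
      then show ?thesis using that insert.hyps(1) by (simp add: prod.remove[of J j0] power_add)
    qed
    have "(\<Sum>f\<in>inj_maps (insert b J) A. \<Prod>j\<in>insert b J. v z (f j) ^ \<alpha> j) =
       (\<Sum>(f, y)\<in>(SIGMA f:inj_maps J A. A - f ` J). \<Prod>j\<in>insert b J. v z ((f(b := y)) j) ^ \<alpha> j)"
      by (subst sum.reindex_bij_betw[OF inj_maps_insert[OF insert.hyps(2)], symmetric]) (simp add: case_prod_unfold)
    also have "\<dots> = (\<Sum>f\<in>inj_maps J A. \<Sum>y\<in>A - f ` J. v z y ^ \<alpha> b * (\<Prod>j\<in>J. v z (f j) ^ \<alpha> j))"
      unfolding m using finite_inj_maps[OF insert.hyps(1) assms(1)] assms(1) by (subst sum.Sigma) auto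
    also have "\<dots> = (\<Sum>f\<in>inj_maps J A. (\<Prod>j\<in>J. v z (f j) ^ \<alpha> j) * (\<Sum>i\<in>A. v z i ^ \<alpha> b)
       - (\<Sum>j0\<in>J. v z (f j0) ^ \<alpha> b * (\<Prod>j\<in>J. v z (f j) ^ \<alpha> j)))"
    proof (intro sum.cong refl)
      fix f assume "f \<in> inj_maps J A"
      then have f: "inj_on f J" "f ` J \<subseteq> A" unfolding inj_maps_def by auto
      have D: "(\<Sum>y\<in>A - f ` J. v z y ^ \<alpha> b) = (\<Sum>i\<in>A. v z i ^ \<alpha> b) - (\<Sum>j\<in>J. v z (f j) ^ \<alpha> b)"
        using sum_diff[OF assms(1) f(2), of "\<lambda>y. v z y ^ \<alpha> b"] by (simp add: sum.reindex[OF f(1)])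
      show "(\<Sum>y\<in>A - f ` J. v z y ^ \<alpha> b * (\<Prod>j\<in>J. v z (f j) ^ \<alpha> j)) =
        (\<Prod>j\<in>J. v z (f j) ^ \<alpha> j) * (\<Sum>i\<in>A. v z i ^ \<alpha> b) - (\<Sum>j0\<in>J. v z (f j0) ^ \<alpha> b * (\<Prod>j\<in>J. v z (f j) ^ \<alpha> j))"
        unfolding sum_distrib_right[symmetric] D left_diff_distrib by (simp add: mult.commute)
    qed
    also have "\<dots> = (\<Sum>f\<in>inj_maps J A. \<Prod>j\<in>J. v z (f j) ^ \<alpha> j) * (\<Sum>i\<in>A. v z i ^ \<alpha> b)
      - (\<Sum>f\<in>inj_maps J A. \<Sum>j0\<in>J. v z (f j0) ^ \<alpha> b * (\<Prod>j\<in>J. v z (f j) ^ \<alpha> j))"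
      by (simp only: sum_subtractf sum_distrib_right)
    also have "(\<Sum>f\<in>inj_maps J A. \<Sum>j0\<in>J. v z (f j0) ^ \<alpha> b * (\<Prod>j\<in>J. v z (f j) ^ \<alpha> j)) =
       (\<Sum>j0\<in>J. \<Sum>f\<in>inj_maps J A. \<Prod>j\<in>J. v z (f j) ^ (\<alpha>(j0 := \<alpha> j0 + \<alpha> b)) j)"
      by (subst sum.swap) (intro sum.cong refl merge[symmetric])
    finally show ?thesis .
  qed
  show ?case unfolding eq by (intro diff mult sum insert.IH power_sum)
qed

text \<open>An injective self-map of a finite set is bijective; extending it by the identity gives
  the permutation.\<close>

lemma sum_permutations_eq_inj_maps:
  fixes h :: "('i \<Rightarrow> 'i) \<Rightarrow> complex"
  assumes "finite A"
  shows "(\<Sum>p\<in>{p. p permutes A}. h (restrict p A)) = (\<Sum>f\<in>inj_maps A A. h f)"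
proof (rule sum.reindex_bij_witness[of _ "\<lambda>f i. if i \<in> A then f i else i" "\<lambda>p. restrict p A"])
  fix f assume f: "f \<in> inj_maps A A"
  then have "inj_on f A" "f ` A \<subseteq> A" unfolding inj_maps_def by auto
  then have "bij_betw f A A" using assms by (simp add: bij_betw_def endo_inj_surj)
  then have "bij_betw (\<lambda>i. if i \<in> A then f i else i) A A" by (rule bij_betw_cong[THEN iffD1, rotated]) simp
  then show "(\<lambda>i. if i \<in> A then f i else i) \<in> {p. p permutes A}"
    by (auto intro: bij_imp_permutes)
  show "restrict (\<lambda>i. if i \<in> A then f i else i) A = f"
    using f unfolding inj_maps_def by (auto simp: fun_eq_iff PiE_def extensional_def)
next
  fix p assume "p \<in> {p. p permutes A}"
  then have p: "p permutes A" by simp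
  show "(\<lambda>i. if i \<in> A then restrict p A i else i) = p"
    using permutes_not_in[OF p] by (auto simp: fun_eq_iff)
  show "restrict p A \<in> inj_maps A A"
    unfolding inj_maps_def using permutes_in_image[OF p] permutes_inj_on[OF p, of A] by (auto simp: inj_on_def)
qed auto

text \<open>Closure under sums alone is enough for the intended generators, whose polynomial factor
  in x absorbs all scalars.\<close>

inductive_set add_span :: "('z \<Rightarrow> complex) set \<Rightarrow> ('z \<Rightarrow> complex) set" for M where
  base: "m \<in> M \<Longrightarrow> m \<in> add_span M"
| plus: "f \<in> add_span M \<Longrightarrow> g \<in> add_span M \<Longrightarrow> (\<lambda>z. f z + g z) \<in> add_span M"

lemma add_span_mult:
  assumes M: "\<And>f g. f \<in> M \<Longrightarrow> g \<in> M \<Longrightarrow> (\<lambda>z. f z * g z) \<in> M"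
    and "f \<in> add_span M" "g \<in> add_span M"
  shows "(\<lambda>z. f z * g z) \<in> add_span M"
  using assms(2)
proof induction
  case (base f)
  show ?case using assms(3)
  proof induction
    case (base g)
    then show ?case using M[OF \<open>f \<in> M\<close>] by (intro add_span.base)
  next
    case (plus g h)
    then show ?case using add_span.plus[OF plus.IH] by (simp add: distrib_left)
  qed
next
  case (plus f h)
  then show ?case using add_span.plus[OF plus.IH] by (simp add: distrib_right)
qed

definition nu_monomial :: "nat \<Rightarrow> (nat \<times> nat \<Rightarrow> nat) \<Rightarrow> (nat \<times> nat \<Rightarrow> complex) \<Rightarrow> complex" where
  "nu_monomial n \<alpha> \<nu> = (\<Prod>k\<in>index_set n. \<nu> k ^ \<alpha> k)"

lemma poly_funs_pair_coords_add_span: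
  assumes "f \<in> poly_funs (pair_coords n)"
  shows "f \<in> add_span {\<lambda>z. h (snd z) * nu_monomial n \<alpha> (fst z) | h \<alpha>. h \<in> poly_funs (mat_coords n)}"
    (is "_ \<in> add_span ?M")
proof -
  have M: "(\<lambda>z. h (snd z) * nu_monomial n \<alpha> (fst z)) \<in> ?M" if "h \<in> poly_funs (mat_coords n)" for h \<alpha>
    using that by blast
  have mult: "(\<lambda>z. f z * g z) \<in> ?M" if fg: "f \<in> ?M" "g \<in> ?M" for f g
  proof -
    obtain h \<alpha> k \<beta> where *: "h \<in> poly_funs (mat_coords n)" "k \<in> poly_funs (mat_coords n)"
      "f = (\<lambda>z. h (snd z) * nu_monomial n \<alpha> (fst z))" "g = (\<lambda>z. k (snd z) * nu_monomial n \<beta> (fst z))"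
      using fg by blast
    have "(\<lambda>z. f z * g z) = (\<lambda>z. (\<lambda>x. h x * k x) (snd z) * nu_monomial n (\<lambda>i. \<alpha> i + \<beta> i) (fst z))"
      unfolding * nu_monomial_def by (simp add: power_add prod.distrib mult_ac)
    then show ?thesis using M[OF poly_funs.mult[OF *(1,2)]] by simp
  qed
  have one: "nu_monomial n (\<lambda>_. 0) \<nu> = 1" for \<nu> unfolding nu_monomial_def by simp
  show ?thesis using assms
  proof induction
    case (const c)
    have "(\<lambda>z. (\<lambda>_. c) (snd z) * nu_monomial n (\<lambda>_. 0) (fst z)) \<in> ?M" by (rule M[OF poly_funs.const])
    then show ?case unfolding one by (intro add_span.base) simp
  next
    case (gen f)
    then consider k where "k \<in> index_set n" "f = (\<lambda>z. fst z k)"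
      | i j where "i < n" "j < n" "f = (\<lambda>z. snd z $$ (i, j))" unfolding pair_coords_def by blast
    then show ?case
    proof cases
      case 1
      have "nu_monomial n (\<lambda>l. if l = k then 1 else 0) \<nu> = \<nu> k" for \<nu>
      proof -
        have "nu_monomial n (\<lambda>l. if l = k then 1 else 0) \<nu> = (\<Prod>l\<in>index_set n. if l = k then \<nu> l else 1)"
          unfolding nu_monomial_def by (intro prod.cong refl) simp
        then show ?thesis using 1(1) finite_index_set by simp
      qed
      then show ?thesis using M[OF poly_funs.const[of 1], of "\<lambda>l. if l = k then 1 else 0"] 1(2)
        by (intro add_span.base) simp
    next
      case 2
      then show ?thesis using M[OF mat_coord_in[OF 2(1,2)], of "\<lambda>_. 0"] unfolding one
        by (intro add_span.base) simp
    qed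
  next
    case (add f g)
    then show ?case by (intro add_span.plus)
  next
    case (mult f g)
    then show ?case by (intro add_span_mult[OF \<open>\<And>f g. f \<in> ?M \<Longrightarrow> g \<in> ?M \<Longrightarrow> (\<lambda>z. f z * g z) \<in> ?M\<close>])
  qed
qed

section \<open>Permutations of the eigenvalue labels\<close>

lemma carrier_Sigma_grp: "carrier (Sigma_grp n) = (\<Pi>\<^sub>E m\<in>{1..n}. {p. p permutes {1..m}})"
  unfolding Sigma_grp_def by (simp add: sym_group_def)

lemma finite_Sigma_grp: "finite (carrier (Sigma_grp n))"
  unfolding carrier_Sigma_grp by (intro finite_PiE) (auto simp: finite_permutations)

lemma group_Sigma_grp: "group (Sigma_grp n)"
  unfolding Sigma_grp_def by (intro product_group sym_group_is_group)

lemma Sigma_grp_permutes: "\<sigma> \<in> carrier (Sigma_grp n) \<Longrightarrow> m \<in> {1..n} \<Longrightarrow> \<sigma> m permutes {1..m}"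
  unfolding carrier_Sigma_grp by auto

lemma inv_Sigma_grp:
  assumes "\<sigma> \<in> carrier (Sigma_grp n)"
  shows "inv\<^bsub>Sigma_grp n\<^esub> \<sigma> = (\<lambda>m\<in>{1..n}. inv_into UNIV (\<sigma> m))"
proof -
  have "inv\<^bsub>sym_group m\<^esub> (\<sigma> m) = inv_into UNIV (\<sigma> m)" if "m \<in> {1..n}" for m
    using Sigma_grp_permutes[OF assms that] sym_group_inv_equality[of "\<sigma> m" m] by (simp add: sym_group_carrier)
  then show ?thesis using assms unfolding Sigma_grp_def
    by (subst inv_product_group) (auto simp: sym_group_is_group restrict_def fun_eq_iff)
qed

lemma mult_Sigma_grp: "\<sigma> \<otimes>\<^bsub>Sigma_grp n\<^esub> \<tau> = (\<lambda>m\<in>{1..n}. \<sigma> m \<circ> \<tau> m)"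
  unfolding Sigma_grp_def by (simp add: sym_group_mult)

lemma one_Sigma_grp: "\<one>\<^bsub>Sigma_grp n\<^esub> = (\<lambda>m\<in>{1..n}. id)"
  unfolding Sigma_grp_def by (simp add: sym_group_one)

text \<open>The label is moved by the permutation itself, whereas \<open>nu_act\<close> uses its
  inverse. Sums over the group do not distinguish the two.\<close>

definition nu_perm :: "nat \<Rightarrow> (nat \<Rightarrow> nat \<Rightarrow> nat) \<Rightarrow> (nat \<times> nat \<Rightarrow> complex) \<Rightarrow> nat \<times> nat \<Rightarrow> complex" where
  "nu_perm n \<sigma> \<nu> = (\<lambda>k\<in>index_set n. \<nu> (\<sigma> (snd k) (fst k), snd k))"

lemma nu_act_eq_perm:
  assumes "\<sigma> \<in> carrier (Sigma_grp n)"
  shows "nu_act n (inv\<^bsub>Sigma_grp n\<^esub> \<sigma>) \<nu> = nu_perm n \<sigma> \<nu>" "nu_act n \<sigma> \<nu> = nu_perm n (inv\<^bsub>Sigma_grp n\<^esub> \<sigma>) \<nu>"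
proof -
  have "inv_into UNIV (inv_into UNIV (\<sigma> m)) = \<sigma> m" if "m \<in> {1..n}" for m
    using permutes_inv_inv[OF Sigma_grp_permutes[OF assms that]] .
  then show "nu_act n (inv\<^bsub>Sigma_grp n\<^esub> \<sigma>) \<nu> = nu_perm n \<sigma> \<nu>"
    unfolding nu_act_def nu_perm_def inv_Sigma_grp[OF assms] by (auto simp: fun_eq_iff index_set_iff)
  show "nu_act n \<sigma> \<nu> = nu_perm n (inv\<^bsub>Sigma_grp n\<^esub> \<sigma>) \<nu>"
    unfolding nu_act_def nu_perm_def inv_Sigma_grp[OF assms] by (auto simp: fun_eq_iff index_set_iff)
qed

lemma sum_nu_act_eq_perm:
  "(\<Sum>\<sigma>\<in>carrier (Sigma_grp n). F (nu_act n \<sigma> \<nu>)) = (\<Sum>\<sigma>\<in>carrier (Sigma_grp n). F (nu_perm n \<sigma> \<nu>))"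
proof -
  interpret group "Sigma_grp n" by (rule group_Sigma_grp)
  show ?thesis
    by (rule sum.reindex_bij_witness[of _ "\<lambda>\<sigma>. inv\<^bsub>Sigma_grp n\<^esub> \<sigma>" "\<lambda>\<sigma>. inv\<^bsub>Sigma_grp n\<^esub> \<sigma>"])
       (simp_all add: nu_act_eq_perm)
qed

text \<open>The group is a product over the levels and a monomial is a product of its parts on the
  levels, so the orbit sum factorises.\<close>

lemma nu_monomial_sum:
  "(\<Sum>\<sigma>\<in>carrier (Sigma_grp n). nu_monomial n \<alpha> (nu_perm n \<sigma> \<nu>)) =
    (\<Prod>m\<in>{1..n}. \<Sum>f\<in>inj_maps {1..m} {1..m}. \<Prod>i\<in>{1..m}. \<nu> (f i, m) ^ \<alpha> (i, m))"
proof -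
  have mon: "nu_monomial n \<alpha> (nu_perm n \<sigma> \<nu>) = (\<Prod>m\<in>{1..n}. \<Prod>i\<in>{1..m}. \<nu> (\<sigma> m i, m) ^ \<alpha> (i, m))" for \<sigma>
  proof -
    have "(\<Prod>m\<in>{1..n}. \<Prod>i\<in>{1..m}. \<nu> (\<sigma> m i, m) ^ \<alpha> (i, m)) =
        (\<Prod>(m, i)\<in>(SIGMA m:{1..n}. {1..m}). \<nu> (\<sigma> m i, m) ^ \<alpha> (i, m))"
      by (rule prod.Sigma) auto
    also have "\<dots> = (\<Prod>k\<in>index_set n. \<nu> (\<sigma> (snd k) (fst k), snd k) ^ \<alpha> k)"
      by (rule prod.reindex_bij_witness[of _ "\<lambda>(i, m). (m, i)" "\<lambda>(m, i). (i, m)"]) (auto simp: index_set_iff)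
    also have "\<dots> = nu_monomial n \<alpha> (nu_perm n \<sigma> \<nu>)"
      unfolding nu_monomial_def nu_perm_def by (intro prod.cong refl) simp
    finally show ?thesis ..
  qed
  have "(\<Sum>\<sigma>\<in>carrier (Sigma_grp n). nu_monomial n \<alpha> (nu_perm n \<sigma> \<nu>)) =
      (\<Prod>m\<in>{1..n}. \<Sum>p\<in>{p. p permutes {1..m}}. \<Prod>i\<in>{1..m}. \<nu> (p i, m) ^ \<alpha> (i, m))"
    unfolding mon carrier_Sigma_grp by (rule prod_sum_PiE[symmetric]) (auto simp: finite_permutations)
  also have "\<dots> = (\<Prod>m\<in>{1..n}. \<Sum>f\<in>inj_maps {1..m} {1..m}. \<Prod>i\<in>{1..m}. \<nu> (f i, m) ^ \<alpha> (i, m))"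
  proof (intro prod.cong refl)
    fix m
    show "(\<Sum>p\<in>{p. p permutes {1..m}}. \<Prod>i\<in>{1..m}. \<nu> (p i, m) ^ \<alpha> (i, m)) =
      (\<Sum>f\<in>inj_maps {1..m} {1..m}. \<Prod>i\<in>{1..m}. \<nu> (f i, m) ^ \<alpha> (i, m))"
      using sum_permutations_eq_inj_maps[of "{1..m}" "\<lambda>f. \<Prod>i\<in>{1..m}. \<nu> (f i, m) ^ \<alpha> (i, m)"]
      by simp
  qed
  finally show ?thesis .
qed

text \<open>By linearity a product of a polynomial in x and a monomial in the eigenvalues suffices;
  its orbit sum is a polynomial in power sums, hence in traces. Distinct eigenvalues are not
  assumed.\<close>

theorem symmetrization:
  assumes "f \<in> poly_funs (pair_coords n)"
  obtains Q where "Q \<in> poly_funs (mat_coords n)"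
    "\<And>\<nu> x. has_spectra n \<nu> x \<Longrightarrow> (\<Sum>\<sigma>\<in>carrier (Sigma_grp n). f (nu_act n \<sigma> \<nu>, x)) = Q x"
proof -
  \<comment> \<open>Functions that on pairs with the prescribed spectra are polynomials in x alone.
    They form an algebra containing the power sums, to which the sum over injective maps
    applies.\<close>
  define R :: "((nat \<times> nat \<Rightarrow> complex) \<times> complex mat \<Rightarrow> complex) set"
    where "R = {g. \<exists>Q\<in>poly_funs (mat_coords n). \<forall>z. has_spectra n (fst z) (snd z) \<longrightarrow> g z = Q (snd z)}"
  have RI: "g \<in> R" if "Q \<in> poly_funs (mat_coords n)" "\<And>z. has_spectra n (fst z) (snd z) \<Longrightarrow> g z = Q (snd z)" for g Q
    using that unfolding R_def by blast
  have "fun_alg R"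
  proof
    show "(\<lambda>_. c) \<in> R" for c by (rule RI[OF poly_funs.const]) simp
    fix g h assume "g \<in> R" "h \<in> R"
    then obtain P Q where *: "P \<in> poly_funs (mat_coords n)" "Q \<in> poly_funs (mat_coords n)"
      "\<And>z. has_spectra n (fst z) (snd z) \<Longrightarrow> g z = P (snd z)" "\<And>z. has_spectra n (fst z) (snd z) \<Longrightarrow> h z = Q (snd z)"
      unfolding R_def by blast
    show "(\<lambda>z. g z + h z) \<in> R" by (rule RI[OF poly_funs.add[OF *(1,2)]]) (simp add: *)
    show "(\<lambda>z. g z * h z) \<in> R" by (rule RI[OF poly_funs.mult[OF *(1,2)]]) (simp add: *)
  qed
  then interpret R: fun_alg R .
  have "(\<lambda>z. \<Sum>\<sigma>\<in>carrier (Sigma_grp n). f (nu_perm n \<sigma> (fst z), snd z)) \<in> R"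
    using poly_funs_pair_coords_add_span[OF assms]
  proof induction
    case (base f)
    then obtain h \<alpha> where f: "h \<in> poly_funs (mat_coords n)" "f = (\<lambda>z. h (snd z) * nu_monomial n \<alpha> (fst z))"
      by blast
    have "(\<lambda>z. \<Prod>m\<in>{1..n}. \<Sum>f\<in>inj_maps {1..m} {1..m}. \<Prod>i\<in>{1..m}. fst z (f i, m) ^ \<alpha> (i, m)) \<in> R"
    proof (intro R.prod R.inj_maps_monomial_sum finite_atLeastAtMost)
      fix m r assume m: "m \<in> {1..n}"
      then have "m \<le> n" by simp
      show "(\<lambda>z. \<Sum>i\<in>{1..m}. fst z (i, m) ^ r) \<in> R"
        by (rule RI[OF power_trace_poly[OF \<open>m \<le> n\<close>, of r]]) (rule has_spectra_power_sum[OF _ m])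
    qed
    moreover have "(\<lambda>z. h (snd z)) \<in> R" by (rule RI[OF f(1)]) simp
    ultimately have "(\<lambda>z. h (snd z) *
      (\<Prod>m\<in>{1..n}. \<Sum>f\<in>inj_maps {1..m} {1..m}. \<Prod>i\<in>{1..m}. fst z (f i, m) ^ \<alpha> (i, m))) \<in> R" by (intro R.mult)
    then show ?case unfolding f(2) by (simp only: fst_conv snd_conv sum_distrib_left[symmetric] nu_monomial_sum)
  next
    case (plus f g)
    then show ?case using R.add[OF plus.IH] by (simp add: sum.distrib)
  qed
  then obtain Q where Q: "Q \<in> poly_funs (mat_coords n)"
    "\<And>z. has_spectra n (fst z) (snd z) \<Longrightarrow> (\<Sum>\<sigma>\<in>carrier (Sigma_grp n). f (nu_perm n \<sigma> (fst z), snd z)) = Q (snd z)"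
    unfolding R_def by blast
  show ?thesis
  proof (rule that[OF Q(1)])
    fix \<nu> x assume "has_spectra n \<nu> x"
    then show "(\<Sum>\<sigma>\<in>carrier (Sigma_grp n). f (nu_act n \<sigma> \<nu>, x)) = Q x"
      using Q(2)[of "(\<nu>, x)"] sum_nu_act_eq_perm[of "\<lambda>\<nu>. f (\<nu>, x)"] by simp
  qed
qed

definition index_perm :: "nat \<Rightarrow> (nat \<Rightarrow> nat \<Rightarrow> nat) \<Rightarrow> nat \<times> nat \<Rightarrow> nat \<times> nat" where
  "index_perm n \<sigma> k = (\<sigma> (snd k) (fst k), snd k)"

lemma index_perm_in:
  assumes "\<sigma> \<in> carrier (Sigma_grp n)" "k \<in> index_set n"
  shows "index_perm n \<sigma> k \<in> index_set n"
proof -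
  obtain i m where k: "k = (i, m)" "i \<in> {1..m}" "m \<in> {1..n}" using assms(2) by (cases k) (auto simp: index_set_iff)
  then have "\<sigma> m i \<in> {1..m}" using permutes_in_image[OF Sigma_grp_permutes[OF assms(1) k(3)]] by blast
  then show ?thesis using k unfolding index_perm_def by (simp add: index_set_iff)
qed

lemma index_perm_inj:
  assumes "\<sigma> \<in> carrier (Sigma_grp n)"
  shows "inj_on (index_perm n \<sigma>) (index_set n)"
proof (rule inj_onI)
  fix k l assume *: "k \<in> index_set n" "l \<in> index_set n" "index_perm n \<sigma> k = index_perm n \<sigma> l"
  then have m: "snd k = snd l" "\<sigma> (snd k) (fst k) = \<sigma> (snd k) (fst l)" unfolding index_perm_def by auto
  have "snd k \<in> {1..n}" using *(1) by (cases k) (auto simp: index_set_iff)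
  then have "inj (\<sigma> (snd k))" using permutes_inj[OF Sigma_grp_permutes[OF assms]] by blast
  then show "k = l" using m by (auto dest: injD intro: prod_eqI)
qed

text \<open>Applying the permutation to both members maps the finite set of adjacent pairs
  injectively into itself, so it only reorders the factors.\<close>

lemma disc_nu_perm:
  assumes \<sigma>: "\<sigma> \<in> carrier (Sigma_grp n)"
  shows "disc n (nu_perm n \<sigma> \<nu>) = disc n \<nu>"
proof -
  let ?g = "map_prod (index_perm n \<sigma>) (index_perm n \<sigma>)"
  have sub: "adjacent n \<subseteq> index_set n \<times> index_set n" unfolding adjacent_def by auto
  have inj: "inj_on ?g (adjacent n)"
    by (rule inj_on_subset[OF map_prod_inj_on[OF index_perm_inj[OF \<sigma>] index_perm_inj[OF \<sigma>]] sub])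
  have "?g ` adjacent n \<subseteq> adjacent n"
  proof
    fix p assume "p \<in> ?g ` adjacent n"
    then obtain k l where kl: "(k, l) \<in> adjacent n" "p = (index_perm n \<sigma> k, index_perm n \<sigma> l)" by auto
    then have mem: "k \<in> index_set n" "l \<in> index_set n" using sub by auto
    have "fst (index_perm n \<sigma> k) \<noteq> fst (index_perm n \<sigma> l)" if "snd k = snd l" "fst k \<noteq> fst l"
    proof
      assume "fst (index_perm n \<sigma> k) = fst (index_perm n \<sigma> l)"
      then have "index_perm n \<sigma> k = index_perm n \<sigma> l" using that(1) by (intro prod_eqI) (simp_all add: index_perm_def)
      then have "k = l" by (rule inj_onD[OF index_perm_inj[OF \<sigma>] _ mem])
      then show False using that(2) by simp
    qed
    then show "p \<in> adjacent n"
      using kl index_perm_in[OF \<sigma> mem(1)] index_perm_in[OF \<sigma> mem(2)]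
      unfolding adjacent_def by (auto simp: index_perm_def)
  qed
  then have "bij_betw ?g (adjacent n) (adjacent n)"
    using inj endo_inj_surj[OF finite_adjacent] by (simp add: bij_betw_def)
  then have "(\<Prod>p\<in>adjacent n. \<nu> (fst (?g p)) - \<nu> (snd (?g p))) = disc n \<nu>"
    unfolding disc_def by (rule prod.reindex_bij_betw)
  moreover have "(\<Prod>p\<in>adjacent n. \<nu> (fst (?g p)) - \<nu> (snd (?g p))) = disc n (nu_perm n \<sigma> \<nu>)"
    unfolding disc_def by (intro prod.cong refl) (use sub in \<open>auto simp: nu_perm_def index_perm_def\<close>)
  ultimately show ?thesis by simp
qed

lemma disc_nu_act: "\<sigma> \<in> carrier (Sigma_grp n) \<Longrightarrow> disc n (nu_act n \<sigma> \<nu>) = disc n \<nu>"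
  using nu_act_eq_perm(2) disc_nu_perm group.inv_closed[OF group_Sigma_grp] by metis

lemma card_Sigma_grp: "card (carrier (Sigma_grp n)) \<noteq> 0"
  using finite_Sigma_grp group.is_monoid[OF group_Sigma_grp] monoid.one_closed by (metis card_0_eq empty_iff)

text \<open>An invariant function is its own average, so symmetrisation makes \<open>disc\<close> a
  polynomial in x, also where it vanishes.\<close>

lemma disc_on_matrices:
  obtains \<delta> where "\<delta> \<in> poly_funs (mat_coords n)" "\<And>\<nu> x. has_spectra n \<nu> x \<Longrightarrow> \<delta> x = disc n \<nu>"
proof -
  have "(\<lambda>z. disc n (fst z)) \<in> poly_funs (pair_coords n)" by (intro disc_poly nu_coord_in)
  then obtain Q where Q: "Q \<in> poly_funs (mat_coords n)"
    "\<And>\<nu> x. has_spectra n \<nu> x \<Longrightarrow> (\<Sum>\<sigma>\<in>carrier (Sigma_grp n). disc n (fst (nu_act n \<sigma> \<nu>, x))) = Q x"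
    using symmetrization by blast
  show ?thesis
  proof (rule that)
    show "(\<lambda>x. inverse (of_nat (card (carrier (Sigma_grp n)))) * Q x) \<in> poly_funs (mat_coords n)"
      by (intro poly_funs_intros Q(1))
    fix \<nu> x assume "has_spectra n \<nu> x"
    then have "Q x = of_nat (card (carrier (Sigma_grp n))) * disc n \<nu>"
      using Q(2)[of \<nu> x] by (simp add: disc_nu_act)
    then show "inverse (of_nat (card (carrier (Sigma_grp n)))) * Q x = disc n \<nu>"
      using card_Sigma_grp[of n] by simp
  qed
qed

text \<open>The eigenvalues of each block are listed with multiplicity in an arbitrary
  order.\<close>

lemma has_spectra_ex:
  obtains \<nu> where "\<nu> \<in> index_set n \<rightarrow>\<^sub>E UNIV" "has_spectra n \<nu> x"
proof -
  have "\<exists>as. char_poly (upper_left x m) = (\<Prod>a\<leftarrow>as. [:- a, 1:]) \<and> length as = m" for m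
    by (rule char_poly_factorized[OF upper_left_carrier])
  then obtain as where as: "\<And>m. char_poly (upper_left x m) = (\<Prod>a\<leftarrow>as m. [:- a, 1:])" "\<And>m. length (as m) = m"
    by metis
  define \<nu> where "\<nu> = (\<lambda>k\<in>index_set n. as (snd k) ! (fst k - 1))"
  have "char_poly (upper_left x m) = (\<Prod>i\<in>{1..m}. [:- \<nu> (i, m), 1:])" if m: "m \<in> {1..n}" for m
  proof -
    have "map (\<lambda>i. \<nu> (Suc i, m)) [0..<m] = as m"
      using m as(2)[of m] by (intro nth_equalityI) (auto simp: \<nu>_def index_set_iff)
    then show ?thesis unfolding prod_linear_list using as(1) by simp
  qed
  then show ?thesis using that[of \<nu>] unfolding has_spectra_def by (auto simp: \<nu>_def)
qed

section \<open>Descent to \<open>M_Omega\<close>\<close>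

text \<open>Its values are determined although the polynomial is chosen: every matrix admits some
  family of eigenvalues, and \<open>disc\<close> of any such family is the value.\<close>

definition delta :: "nat \<Rightarrow> complex mat \<Rightarrow> complex" where
  "delta n = (SOME \<delta>. \<delta> \<in> poly_funs (mat_coords n) \<and> (\<forall>\<nu> x. has_spectra n \<nu> x \<longrightarrow> \<delta> x = disc n \<nu>))"

lemma delta: "delta n \<in> poly_funs (mat_coords n)" "has_spectra n \<nu> x \<Longrightarrow> delta n x = disc n \<nu>"
proof -
  have "\<exists>\<delta>. \<delta> \<in> poly_funs (mat_coords n) \<and> (\<forall>\<nu> x. has_spectra n \<nu> x \<longrightarrow> \<delta> x = disc n \<nu>)"
    using disc_on_matrices[of n] by metis
  from someI_ex[OF this, folded delta_def]
  show "delta n \<in> poly_funs (mat_coords n)" "has_spectra n \<nu> x \<Longrightarrow> delta n x = disc n \<nu>" by auto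
qed

lemma M_Omega_eq: "M_Omega n = {x \<in> carrier_mat n n. delta n x \<noteq> 0}"
proof (intro equalityI subsetI)
  fix x assume "x \<in> M_Omega n"
  moreover obtain \<nu> where "has_spectra n \<nu> x" using has_spectra_ex by blast
  ultimately show "x \<in> {x \<in> carrier_mat n n. delta n x \<noteq> 0}" using M_Omega_iff delta(2) by auto
next
  fix x assume "x \<in> {x \<in> carrier_mat n n. delta n x \<noteq> 0}"
  moreover obtain \<nu> where "has_spectra n \<nu> x" using has_spectra_ex by blast
  ultimately show "x \<in> M_Omega n" using M_Omega_iff delta(2) by auto
qed

interpretation Mo: affine_locus "carrier_mat n n" "mat_coords n" "{}" "delta n" "M_Omega n" for n
  unfolding M_Omega_eq by (rule affine_locus_mat[OF delta(1)])

definition R_o :: "nat \<Rightarrow> (complex mat \<Rightarrow> complex) set" where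
  "R_o n = {f. restrict f (M_Omega n) \<in> O_M_Omega n}"

lemma R_o_eq: "R_o n = affine_locus.regular (mat_coords n) (M_Omega n)"
  unfolding R_o_def Mo.regular_def O_M_Omega_def ..

interpretation R_o: fun_alg "R_o n" for n
  unfolding R_o_eq by (rule Mo.regular_fun_alg)

lemmas R_o_iff = Mo.regular_iff[folded R_o_eq]
lemmas R_o_poly = Mo.regular_poly[folded R_o_eq]
lemmas R_o_inverse = Mo.regular_inverse[folded R_o_eq]

lemma R_o_pullback:
  assumes "g \<in> R_o n"
  shows "(\<lambda>z. g (snd z)) \<in> R_e n"
proof -
  obtain G where G: "G \<in> poly_funs (insert (\<lambda>x. 1 / delta n x) (mat_coords n))" "\<forall>x\<in>M_Omega n. g x = G x"
    using assms unfolding R_o_iff by blast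
  have "(\<lambda>z. G (snd z)) \<in> R_e n"
  proof (rule R_e.poly_funs_comp[OF G(1)])
    fix c assume "c \<in> insert (\<lambda>x. 1 / delta n x) (mat_coords n)"
    then consider "c = (\<lambda>x. 1 / delta n x)" | i j where "i < n" "j < n" "c = (\<lambda>x. x $$ (i, j))"
      unfolding mat_coords_def by blast
    then show "(\<lambda>z. c (snd z)) \<in> R_e n"
    proof cases
      case 1
      have "(\<lambda>z. inverse (delta n (snd z))) \<in> R_e n"
      proof (rule R_e_inverse[OF R_e_poly[OF snd_pair_coords[OF delta(1)]]])
        fix z assume "z \<in> M_Omega_e n"
        then show "delta n (snd z) \<noteq> 0" using M_Omega_eD(3,4) delta(2) by metis
      qed
      then show ?thesis unfolding 1 by (simp add: divide_inverse)
    next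
      case 2
      show ?thesis unfolding 2(3) by (rule R_e_x[OF 2(1,2)])
    qed
  qed
  then show ?thesis using G(2) M_Omega_eD(5) by (elim R_e_cong) auto
qed

section \<open>The action on the points of the cover\<close>

lemma nu_act_has_spectra:
  assumes \<sigma>: "\<sigma> \<in> carrier (Sigma_grp n)" and "has_spectra n \<nu> x"
  shows "has_spectra n (nu_act n \<sigma> \<nu>) x"
  unfolding has_spectra_def
proof
  fix m assume m: "m \<in> {1..n}"
  interpret group "Sigma_grp n" by (rule group_Sigma_grp)
  let ?\<tau> = "inv\<^bsub>Sigma_grp n\<^esub> \<sigma>"
  have p: "?\<tau> m permutes {1..m}" by (rule Sigma_grp_permutes[OF inv_closed[OF \<sigma>] m])
  have "(\<Prod>i\<in>{1..m}. [:- nu_act n \<sigma> \<nu> (i, m), 1:]) = (\<Prod>i\<in>{1..m}. [:- \<nu> (?\<tau> m i, m), 1:])"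
    unfolding nu_act_eq_perm(2)[OF \<sigma>] nu_perm_def using m by (intro prod.cong refl) (simp add: index_set_iff)
  also have "\<dots> = (\<Prod>i\<in>{1..m}. [:- \<nu> (i, m), 1:])"
    using prod.permute[OF p, of "\<lambda>i. [:- \<nu> (i, m), 1:]"] by (simp add: comp_def)
  also have "\<dots> = char_poly (upper_left x m)" using assms(2) m unfolding has_spectra_def by simp
  finally show "char_poly (upper_left x m) = (\<Prod>i\<in>{1..m}. [:- nu_act n \<sigma> \<nu> (i, m), 1:])" ..
qed

definition act :: "nat \<Rightarrow> (nat \<Rightarrow> nat \<Rightarrow> nat) \<Rightarrow> (nat \<times> nat \<Rightarrow> complex) \<times> complex mat \<Rightarrow> (nat \<times> nat \<Rightarrow> complex) \<times> complex mat"
  where "act n \<sigma> z = (nu_act n \<sigma> (fst z), snd z)"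

lemma snd_act [simp]: "snd (act n \<sigma> z) = snd z"
  unfolding act_def by simp

lemma pt_act_eq: "z \<in> M_Omega_e n \<Longrightarrow> pt_act n \<sigma> z = act n \<sigma> z"
  unfolding pt_act_def act_def by (simp add: case_prod_unfold)

lemma act_in:
  assumes "\<sigma> \<in> carrier (Sigma_grp n)" "z \<in> M_Omega_e n"
  shows "act n \<sigma> z \<in> M_Omega_e n"
  using M_Omega_eD[OF assms(2)] nu_act_has_spectra[OF assms(1)] disc_nu_act[OF assms(1)]
  unfolding M_Omega_e_eq act_def by (auto simp: nu_act_def)

lemma act_act:
  assumes "\<sigma> \<in> carrier (Sigma_grp n)" "\<tau> \<in> carrier (Sigma_grp n)"
  shows "act n \<sigma> (act n \<tau> z) = act n (\<sigma> \<otimes>\<^bsub>Sigma_grp n\<^esub> \<tau>) z"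
proof -
  interpret group "Sigma_grp n" by (rule group_Sigma_grp)
  have s: "inv\<^bsub>Sigma_grp n\<^esub> (\<sigma> \<otimes>\<^bsub>Sigma_grp n\<^esub> \<tau>) = inv\<^bsub>Sigma_grp n\<^esub> \<tau> \<otimes>\<^bsub>Sigma_grp n\<^esub> inv\<^bsub>Sigma_grp n\<^esub> \<sigma>"
    by (rule inv_mult_group[OF assms])
  have "nu_perm n (inv\<^bsub>Sigma_grp n\<^esub> \<sigma>) (nu_perm n (inv\<^bsub>Sigma_grp n\<^esub> \<tau>) \<nu>) =
     nu_perm n (inv\<^bsub>Sigma_grp n\<^esub> \<tau> \<otimes>\<^bsub>Sigma_grp n\<^esub> inv\<^bsub>Sigma_grp n\<^esub> \<sigma>) \<nu>" for \<nu>
  proof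
    fix k
    show "nu_perm n (inv\<^bsub>Sigma_grp n\<^esub> \<sigma>) (nu_perm n (inv\<^bsub>Sigma_grp n\<^esub> \<tau>) \<nu>) k =
       nu_perm n (inv\<^bsub>Sigma_grp n\<^esub> \<tau> \<otimes>\<^bsub>Sigma_grp n\<^esub> inv\<^bsub>Sigma_grp n\<^esub> \<sigma>) \<nu> k"
    proof (cases "k \<in> index_set n")
      case True
      then have m: "snd k \<in> {1..n}" by (cases k) (auto simp: index_set_iff)
      have "((inv\<^bsub>Sigma_grp n\<^esub> \<sigma>) (snd k) (fst k), snd k) \<in> index_set n"
        using index_perm_in[OF inv_closed[OF assms(1)] True] by (simp add: index_perm_def)
      then show ?thesis using True m unfolding nu_perm_def mult_Sigma_grp by simp
    qed (simp add: nu_perm_def)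
  qed
  then show ?thesis unfolding act_def
    by (simp add: nu_act_eq_perm(2)[OF assms(1)] nu_act_eq_perm(2)[OF assms(2)] nu_act_eq_perm(2)[OF m_closed[OF assms]] s)
qed

lemma act_one:
  assumes "z \<in> M_Omega_e n"
  shows "act n \<one>\<^bsub>Sigma_grp n\<^esub> z = z"
proof -
  interpret group "Sigma_grp n" by (rule group_Sigma_grp)
  have "nu_act n \<one>\<^bsub>Sigma_grp n\<^esub> (fst z) = nu_perm n \<one>\<^bsub>Sigma_grp n\<^esub> (fst z)"
    using nu_act_eq_perm(2)[OF one_closed] by simp
  also have "\<dots> = fst z"
    using M_Omega_eD(1)[OF assms] unfolding nu_perm_def one_Sigma_grp
    by (auto simp: fun_eq_iff index_set_iff PiE_def extensional_def)
  finally show ?thesis unfolding act_def by simp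
qed

lemma disc_inj:
  assumes "disc n \<nu> \<noteq> 0" "m \<in> {1..n}"
  shows "inj_on (\<lambda>i. \<nu> (i, m)) {1..m}"
  using assms unfolding disc_generic by blast

text \<open>Eigenvalues on one level are distinct, so a permutation that fixes all of them fixes
  every label.\<close>

lemma act_free:
  assumes \<sigma>: "\<sigma> \<in> carrier (Sigma_grp n)" and z: "z \<in> M_Omega_e n" and eq: "act n \<sigma> z = z"
  shows "\<sigma> = \<one>\<^bsub>Sigma_grp n\<^esub>"
proof -
  interpret group "Sigma_grp n" by (rule group_Sigma_grp)
  let ?\<tau> = "inv\<^bsub>Sigma_grp n\<^esub> \<sigma>"
  have eq': "nu_perm n ?\<tau> (fst z) = fst z"
    using eq nu_act_eq_perm(2)[OF \<sigma>] unfolding act_def by (metis fst_conv)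
  have "?\<tau> = \<one>\<^bsub>Sigma_grp n\<^esub>"
  proof (rule PiE_ext[of _ "{1..n}" "\<lambda>m. {p. p permutes {1..m}}"])
    show "?\<tau> \<in> (\<Pi>\<^sub>E m\<in>{1..n}. {p. p permutes {1..m}})" "\<one>\<^bsub>Sigma_grp n\<^esub> \<in> (\<Pi>\<^sub>E m\<in>{1..n}. {p. p permutes {1..m}})"
      using inv_closed[OF \<sigma>] one_closed unfolding carrier_Sigma_grp by simp_all
    fix m assume m: "m \<in> {1..n}"
    have p: "?\<tau> m permutes {1..m}" by (rule Sigma_grp_permutes[OF inv_closed[OF \<sigma>] m])
    have "?\<tau> m i = i" for i
    proof (cases "i \<in> {1..m}")
      case True
      then have "(i, m) \<in> index_set n" using m by (simp add: index_set_iff)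
      then have "fst z (?\<tau> m i, m) = fst z (i, m)" using fun_cong[OF eq', of "(i, m)"] by (simp add: nu_perm_def)
      moreover have "?\<tau> m i \<in> {1..m}" using permutes_in_image[OF p] True by blast
      ultimately show ?thesis using inj_onD[OF disc_inj[OF M_Omega_eD(3)[OF z] m]] True by blast
    qed (use permutes_not_in[OF p] in blast)
    then show "?\<tau> m = \<one>\<^bsub>Sigma_grp n\<^esub> m" using m unfolding one_Sigma_grp by auto
  qed
  then show ?thesis using \<sigma> by (metis inv_inv inv_one)
qed

text \<open>Over the same matrix, two points enumerate the same spectra injectively; comparing the
  enumerations on each level gives the permutation.\<close>

lemma act_transitive:
  assumes z: "z \<in> M_Omega_e n" and z': "z' \<in> M_Omega_e n" and "snd z = snd z'"
  obtains \<sigma> where "\<sigma> \<in> carrier (Sigma_grp n)" "z' = act n \<sigma> z"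
proof -
  interpret group "Sigma_grp n" by (rule group_Sigma_grp)
  have bij: "bij_betw (\<lambda>i. fst z (i, m)) {1..m} (spectrum (upper_left (snd z) m))" if "m \<in> {1..n}" for m
    unfolding bij_betw_def using disc_inj[OF M_Omega_eD(3)[OF z] that] has_spectra_spectrum[OF M_Omega_eD(4)[OF z] that] by simp
  have bij': "bij_betw (\<lambda>i. fst z' (i, m)) {1..m} (spectrum (upper_left (snd z) m))" if "m \<in> {1..n}" for m
    unfolding bij_betw_def assms(3)
    using disc_inj[OF M_Omega_eD(3)[OF z'] that] has_spectra_spectrum[OF M_Omega_eD(4)[OF z'] that] by simp
  define t where "t m = inv_into {1..m} (\<lambda>i. fst z (i, m)) \<circ> (\<lambda>i. fst z' (i, m))" for m
  have t: "bij_betw (t m) {1..m} {1..m}" if "m \<in> {1..n}" for m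
    unfolding t_def by (rule bij_betw_trans[OF bij'[OF that] bij_betw_inv_into[OF bij[OF that]]])
  define \<tau> where "\<tau> = (\<lambda>m\<in>{1..n}. \<lambda>i. if i \<in> {1..m} then t m i else i)"
  have "\<tau> m permutes {1..m}" if "m \<in> {1..n}" for m
  proof -
    have "bij_betw (\<lambda>i. if i \<in> {1..m} then t m i else i) {1..m} {1..m}"
      using t[OF that] by (rule bij_betw_cong[THEN iffD1, rotated]) simp
    then show ?thesis unfolding \<tau>_def using that by (auto intro: bij_imp_permutes)
  qed
  then have \<tau>: "\<tau> \<in> carrier (Sigma_grp n)" unfolding carrier_Sigma_grp by (auto simp: \<tau>_def)
  have "fst z' = nu_perm n \<tau> (fst z)"
  proof (rule PiE_ext[of _ "index_set n" "\<lambda>_. UNIV"])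
    show "fst z' \<in> index_set n \<rightarrow>\<^sub>E UNIV" by (rule M_Omega_eD(1)[OF z'])
    show "nu_perm n \<tau> (fst z) \<in> index_set n \<rightarrow>\<^sub>E UNIV" by (auto simp: nu_perm_def)
    fix k assume k: "k \<in> index_set n"
    then obtain i m where im: "k = (i, m)" "i \<in> {1..m}" "m \<in> {1..n}" by (cases k) (auto simp: index_set_iff)
    have "fst z' (i, m) \<in> (\<lambda>i. fst z (i, m)) ` {1..m}"
      using bij_betw_imp_surj_on[OF bij[OF im(3)]] bij_betwE[OF bij'[OF im(3)]] im(2) by blast
    then have "fst z (t m i, m) = fst z' (i, m)" unfolding t_def comp_def by (rule f_inv_into_f)
    then show "fst z' k = nu_perm n \<tau> (fst z) k" using k im unfolding nu_perm_def \<tau>_def by simp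
  qed
  then have "z' = act n (inv\<^bsub>Sigma_grp n\<^esub> \<tau>) z"
    unfolding act_def nu_act_eq_perm(1)[OF \<tau>] using assms(3) by (intro prod_eqI) simp_all
  then show ?thesis using that \<tau> by blast
qed

lemma fiber_nonempty:
  assumes "x \<in> M_Omega n"
  obtains z where "z \<in> M_Omega_e n" "snd z = x"
proof -
  obtain \<nu> where "\<nu> \<in> index_set n \<rightarrow>\<^sub>E UNIV" "has_spectra n \<nu> x" using has_spectra_ex .
  then have "(\<nu>, x) \<in> M_Omega_e n" using assms M_Omega_iff unfolding M_Omega_e_eq by auto
  then show ?thesis using that by simp
qed

lemma R_e_act:
  assumes "f \<in> R_e n" "\<sigma> \<in> carrier (Sigma_grp n)"
  shows "(\<lambda>z. f (act n \<sigma> z)) \<in> R_e n"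
proof -
  interpret group "Sigma_grp n" by (rule group_Sigma_grp)
  obtain F where F: "F \<in> poly_funs (insert (\<lambda>p. 1 / disc n (fst p)) (pair_coords n))"
    "\<forall>p\<in>M_Omega_e n. f p = F p" using assms(1) unfolding R_e_iff by blast
  have "(\<lambda>z. F (act n \<sigma> z)) \<in> R_e n"
  proof (rule R_e.poly_funs_comp[OF F(1)])
    fix c assume "c \<in> insert (\<lambda>p. 1 / disc n (fst p)) (pair_coords n)"
    then consider "c = (\<lambda>p. 1 / disc n (fst p))" | k where "k \<in> index_set n" "c = (\<lambda>z. fst z k)"
      | i j where "i < n" "j < n" "c = (\<lambda>z. snd z $$ (i, j))" unfolding pair_coords_def by blast
    then show "(\<lambda>z. c (act n \<sigma> z)) \<in> R_e n"
    proof cases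
      case 1
      have "(\<lambda>z. inverse (disc n (fst z))) \<in> R_e n"
        by (rule R_e_inverse[OF R_e_poly[OF disc_poly[OF nu_coord_in]] M_Omega_eD(3)])
      then show ?thesis unfolding 1 act_def by (simp add: disc_nu_act[OF assms(2)] divide_inverse)
    next
      case 2
      have "index_perm n (inv\<^bsub>Sigma_grp n\<^esub> \<sigma>) k \<in> index_set n" by (rule index_perm_in[OF inv_closed[OF assms(2)] 2(1)])
      then show ?thesis unfolding 2(2) act_def nu_act_eq_perm(2)[OF assms(2)] nu_perm_def
        using R_e_nu 2(1) by (simp add: index_perm_def)
    next
      case 3
      show ?thesis unfolding 3(3) using R_e_x[OF 3(1,2)] by simp
    qed
  qed
  then show ?thesis using F(2) act_in[OF assms(2)] by (elim R_e_cong) simp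
qed

text \<open>A regular function is a polynomial over a power of \<open>disc\<close>. That power is
  constant on orbits, so only the numerator is symmetrised, and the denominator becomes a power of
  \<open>delta\<close>.\<close>

theorem orbit_sum_descends:
  assumes "f \<in> R_e n"
  obtains g where "g \<in> R_o n" "\<And>z. z \<in> M_Omega_e n \<Longrightarrow> (\<Sum>\<sigma>\<in>carrier (Sigma_grp n). f (act n \<sigma> z)) = g (snd z)"
proof -
  obtain F where F: "F \<in> poly_funs (insert (\<lambda>p. 1 / disc n (fst p)) (pair_coords n))"
    "\<forall>p\<in>M_Omega_e n. f p = F p" using assms unfolding R_e_iff by blast
  then obtain P k where P: "P \<in> poly_funs (pair_coords n)" "\<forall>p\<in>M_Omega_e n. f p = P p / disc n (fst p) ^ k"
    using Me.gens_quotient[OF F(1)] by auto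
  obtain Q where Q: "Q \<in> poly_funs (mat_coords n)"
    "\<And>\<nu> x. has_spectra n \<nu> x \<Longrightarrow> (\<Sum>\<sigma>\<in>carrier (Sigma_grp n). P (nu_act n \<sigma> \<nu>, x)) = Q x"
    using symmetrization[OF P(1)] by blast
  show ?thesis
  proof (rule that)
    show "(\<lambda>x. Q x * inverse (delta n x) ^ k) \<in> R_o n"
      by (intro R_o.mult R_o_poly Q(1) R_o.power R_o_inverse delta(1)) (simp add: M_Omega_eq)
    fix z assume z: "z \<in> M_Omega_e n"
    have "(\<Sum>\<sigma>\<in>carrier (Sigma_grp n). f (act n \<sigma> z)) = (\<Sum>\<sigma>\<in>carrier (Sigma_grp n). P (act n \<sigma> z) / disc n (fst z) ^ k)"
      using P(2) act_in[OF _ z] by (intro sum.cong refl) (simp add: act_def disc_nu_act)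
    also have "\<dots> = (\<Sum>\<sigma>\<in>carrier (Sigma_grp n). P (nu_act n \<sigma> (fst z), snd z)) / disc n (fst z) ^ k"
      by (simp add: sum_divide_distrib act_def)
    also have "\<dots> = Q (snd z) * inverse (delta n (snd z)) ^ k"
      using Q(2)[OF M_Omega_eD(4)[OF z]] delta(2)[OF M_Omega_eD(4)[OF z]] by (simp add: divide_inverse power_inverse)
    finally show "(\<Sum>\<sigma>\<in>carrier (Sigma_grp n). f (act n \<sigma> z)) = Q (snd z) * inverse (delta n (snd z)) ^ k" .
  qed
qed

text \<open>The orbit sum of an invariant function is the group order times the function, and the
  order is invertible.\<close>

corollary invariant_descends:
  assumes f: "f \<in> R_e n" and inv: "\<And>\<sigma> z. \<sigma> \<in> carrier (Sigma_grp n) \<Longrightarrow> z \<in> M_Omega_e n \<Longrightarrow> f (act n \<sigma> z) = f z"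
  obtains g where "g \<in> R_o n" "\<And>z. z \<in> M_Omega_e n \<Longrightarrow> f z = g (snd z)"
proof -
  obtain g where g: "g \<in> R_o n" "\<And>z. z \<in> M_Omega_e n \<Longrightarrow> (\<Sum>\<sigma>\<in>carrier (Sigma_grp n). f (act n \<sigma> z)) = g (snd z)"
    using orbit_sum_descends[OF f] by metis
  show ?thesis
  proof (rule that)
    show "(\<lambda>x. inverse (of_nat (card (carrier (Sigma_grp n)))) * g x) \<in> R_o n" by (intro R_o.mult R_o.const g(1))
    fix z assume z: "z \<in> M_Omega_e n"
    have "of_nat (card (carrier (Sigma_grp n))) * f z = g (snd z)" using g(2)[OF z] inv[OF _ z] by simp
    then show "f z = inverse (of_nat (card (carrier (Sigma_grp n)))) * g (snd z)"
      using card_Sigma_grp[of n] by (metis inverse_eq_divide nonzero_mult_div_cancel_left of_nat_eq_0_iff times_divide_eq_left mult_1)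
  qed
qed

section \<open>The orbit space and finiteness\<close>

lemma pullback_restrict_poly_funs:
  assumes "\<phi> \<in> V \<rightarrow> W"
  shows "pullback V \<phi> ` (\<lambda>f. restrict f W) ` poly_funs G = (\<lambda>f. restrict f V) ` poly_funs ((\<lambda>g p. g (\<phi> p)) ` G)"
proof (intro equalityI subsetI)
  have pb: "pullback V \<phi> (restrict f W) = restrict (\<lambda>p. f (\<phi> p)) V" for f
    using assms by (auto simp: pullback_def restrict_def fun_eq_iff)
  {
    fix h assume "h \<in> pullback V \<phi> ` (\<lambda>f. restrict f W) ` poly_funs G"
    then obtain f where f: "f \<in> poly_funs G" "h = restrict (\<lambda>p. f (\<phi> p)) V" using pb by auto
    have "(\<lambda>p. f (\<phi> p)) \<in> poly_funs ((\<lambda>g p. g (\<phi> p)) ` G)"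
      using f(1) by (rule poly_funs_subst) (rule poly_funs.gen, blast)
    then show "h \<in> (\<lambda>f. restrict f V) ` poly_funs ((\<lambda>g p. g (\<phi> p)) ` G)" using f(2) by blast
  next
    fix h assume "h \<in> (\<lambda>f. restrict f V) ` poly_funs ((\<lambda>g p. g (\<phi> p)) ` G)"
    then obtain k where k: "k \<in> poly_funs ((\<lambda>g p. g (\<phi> p)) ` G)" "h = restrict k V" by blast
    have "\<exists>f\<in>poly_funs G. k = (\<lambda>p. f (\<phi> p))" using k(1)
    proof induction
      case (const c)
      show ?case by (rule bexI[OF _ poly_funs.const[of c]]) simp
    next
      case (gen f)
      then obtain g where "g \<in> G" "f = (\<lambda>p. g (\<phi> p))" by blast
      then show ?case by (intro bexI[OF _ poly_funs.gen[of g]])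
    next
      case (add f g)
      then obtain f' g' where *: "f' \<in> poly_funs G" "g' \<in> poly_funs G" "f = (\<lambda>p. f' (\<phi> p))" "g = (\<lambda>p. g' (\<phi> p))" by blast
      show ?case by (rule bexI[OF _ poly_funs.add[OF *(1,2)]]) (simp add: *)
    next
      case (mult f g)
      then obtain f' g' where *: "f' \<in> poly_funs G" "g' \<in> poly_funs G" "f = (\<lambda>p. f' (\<phi> p))" "g = (\<lambda>p. g' (\<phi> p))" by blast
      show ?case by (rule bexI[OF _ poly_funs.mult[OF *(1,2)]]) (simp add: *)
    qed
    then obtain f where f: "f \<in> poly_funs G" "k = (\<lambda>p. f (\<phi> p))" by blast
    have "h = pullback V \<phi> (restrict f W)" unfolding pb k(2) f(2) ..
    then show "h \<in> pullback V \<phi> ` (\<lambda>f. restrict f W) ` poly_funs G" using f(1) by blast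
  }
qed

text \<open>With the pulled-back ring on the source, characters, generators and points correspond
  under the bijection, so affineness is inherited.\<close>

lemma variety_iso_pullback:
  assumes bij: "bij_betw \<phi> V W" and W: "affine_variety W B"
  shows "variety_iso V (pullback V \<phi> ` B) W B \<phi>"
proof -
  have \<phi>: "\<phi> \<in> V \<rightarrow> W" using bij by (auto simp: bij_betw_def)
  have inv: "inv_into V \<phi> \<in> W \<rightarrow> V" using bij by (auto simp: bij_betw_def intro: inv_into_into)
  obtain G where G: "finite G" "B = (\<lambda>f. restrict f W) ` poly_funs G"
    using W unfolding affine_variety_def by blast
  have W': "\<exists>!q. q \<in> W \<and> (\<forall>f\<in>B. \<chi> f = f q)" if "alg_hom_to_complex W B \<chi>" for \<chi>
    using W that unfolding affine_variety_def by blast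
  have inj_pb: "f = g" if "f \<in> B" "g \<in> B" "pullback V \<phi> f = pullback V \<phi> g" for f g
  proof (rule extensionalityI[of _ W])
    show "f \<in> extensional W" "g \<in> extensional W" using that(1,2) unfolding G(2) by auto
    fix q assume "q \<in> W"
    then obtain p where "p \<in> V" "q = \<phi> p" using bij by (auto simp: bij_betw_def)
    then show "f q = g q" using fun_cong[OF that(3), of p] by (simp add: pullback_def)
  qed
  have affV: "affine_variety V (pullback V \<phi> ` B)"
    unfolding affine_variety_def
  proof (intro conjI allI impI)
    show "\<exists>G. finite G \<and> pullback V \<phi> ` B = (\<lambda>f. restrict f V) ` poly_funs G"
      by (rule exI[of _ "(\<lambda>g p. g (\<phi> p)) ` G"]) (simp only: G(2) pullback_restrict_poly_funs[OF \<phi>], use G(1) in simp)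
  next
    fix \<chi> assume \<chi>: "alg_hom_to_complex V (pullback V \<phi> ` B) \<chi>"
    define \<chi>' where "\<chi>' g = \<chi> (pullback V \<phi> g)" for g
    have "alg_hom_to_complex W B \<chi>'"
      unfolding alg_hom_to_complex_def
    proof (intro conjI allI ballI)
      have "pullback V \<phi> (\<lambda>q\<in>W. c) = (\<lambda>p\<in>V. c)" for c
        using \<phi> by (auto simp: pullback_def restrict_def fun_eq_iff)
      then show "\<chi>' (\<lambda>q\<in>W. c) = c" for c using \<chi> unfolding \<chi>'_def alg_hom_to_complex_def by simp
      fix f g assume fg: "f \<in> B" "g \<in> B"
      have "pullback V \<phi> (\<lambda>q\<in>W. f q + g q) = (\<lambda>p\<in>V. pullback V \<phi> f p + pullback V \<phi> g p)"
        "pullback V \<phi> (\<lambda>q\<in>W. f q * g q) = (\<lambda>p\<in>V. pullback V \<phi> f p * pullback V \<phi> g p)"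
        using \<phi> by (auto simp: pullback_def restrict_def fun_eq_iff)
      then show "\<chi>' (\<lambda>q\<in>W. f q + g q) = \<chi>' f + \<chi>' g" "\<chi>' (\<lambda>q\<in>W. f q * g q) = \<chi>' f * \<chi>' g"
        using \<chi> fg unfolding \<chi>'_def alg_hom_to_complex_def by simp_all
    qed
    from W'[OF this] obtain q where q: "q \<in> W" "\<And>f. f \<in> B \<Longrightarrow> \<chi>' f = f q"
      and uniq: "\<And>q'. q' \<in> W \<Longrightarrow> \<forall>f\<in>B. \<chi>' f = f q' \<Longrightarrow> q' = q" by blast
    obtain p where p: "p \<in> V" "\<phi> p = q" using bij q(1) by (auto simp: bij_betw_def)
    show "\<exists>!p. p \<in> V \<and> (\<forall>f\<in>pullback V \<phi> ` B. \<chi> f = f p)"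
    proof (rule ex1I[of _ p])
      show "p \<in> V \<and> (\<forall>f\<in>pullback V \<phi> ` B. \<chi> f = f p)"
        using p q(2) unfolding \<chi>'_def by (simp add: pullback_def)
      fix p' assume p': "p' \<in> V \<and> (\<forall>f\<in>pullback V \<phi> ` B. \<chi> f = f p')"
      have "\<phi> p' = q"
        by (rule uniq) (use p' \<phi> in \<open>auto simp: \<chi>'_def pullback_def\<close>)
      then show "p' = p" using p p' bij by (auto simp: bij_betw_def dest: inj_onD)
    qed
  qed
  have "pullback W (inv_into V \<phi>) (pullback V \<phi> g) = g" if "g \<in> B" for g
  proof (rule extensionalityI[of _ W])
    show "g \<in> extensional W" using that unfolding G(2) by auto
    fix q assume "q \<in> W"
    then show "pullback W (inv_into V \<phi>) (pullback V \<phi> g) q = g q"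
      using inv bij_betw_inv_into_right[OF bij] by (auto simp: pullback_def)
  qed (simp add: pullback_def)
  then have "pullback W (inv_into V \<phi>) ` pullback V \<phi> ` B \<subseteq> B" by auto
  then show ?thesis
    unfolding variety_iso_def variety_morphism_def using bij W affV \<phi> inv by simp
qed

definition fiber :: "nat \<Rightarrow> complex mat \<Rightarrow> ((nat \<times> nat \<Rightarrow> complex) \<times> complex mat) set" where
  "fiber n x = {z \<in> M_Omega_e n. snd z = x}"

lemma orbit_eq_fiber:
  assumes z: "z \<in> M_Omega_e n"
  shows "orbit (Sigma_grp n) (pt_act n) z = fiber n (snd z)"
proof (intro equalityI subsetI)
  fix w assume "w \<in> orbit (Sigma_grp n) (pt_act n) z"
  then obtain \<sigma> where "\<sigma> \<in> carrier (Sigma_grp n)" "w = act n \<sigma> z"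
    unfolding orbit_def using pt_act_eq[OF z] by auto
  then show "w \<in> fiber n (snd z)" using act_in z unfolding fiber_def by simp
next
  fix w assume "w \<in> fiber n (snd z)"
  then obtain \<sigma> where "\<sigma> \<in> carrier (Sigma_grp n)" "w = act n \<sigma> z"
    using act_transitive[OF z, of w] unfolding fiber_def by auto
  then show "w \<in> orbit (Sigma_grp n) (pt_act n) z" unfolding orbit_def using pt_act_eq[OF z] by auto
qed

lemma orbit_space_eq: "orbit_space n = fiber n ` M_Omega n"
proof (intro equalityI subsetI)
  fix w assume "w \<in> orbit_space n"
  then show "w \<in> fiber n ` M_Omega n"
    unfolding orbit_space_def orbits_def using orbit_eq_fiber M_Omega_eD(5) by auto
next
  fix w assume "w \<in> fiber n ` M_Omega n"
  then obtain x where x: "x \<in> M_Omega n" "w = fiber n x" by blast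
  obtain z where z: "z \<in> M_Omega_e n" "snd z = x" using fiber_nonempty[OF x(1)] .
  then show "w \<in> orbit_space n"
    unfolding orbit_space_def orbits_def x(2) z(2)[symmetric] orbit_eq_fiber[OF z(1), symmetric]
    using z(1) by blast
qed

lemma pi_bar_fiber:
  assumes "x \<in> M_Omega n"
  shows "pi_bar (fiber n x) = x"
proof -
  obtain z where "z \<in> M_Omega_e n" "snd z = x" using fiber_nonempty[OF assms] .
  then have "pi_n ` fiber n x = {x}" unfolding fiber_def pi_n_def by auto
  then show ?thesis unfolding pi_bar_def by simp
qed

lemma bij_pi_bar: "bij_betw pi_bar (orbit_space n) (M_Omega n)"
  unfolding orbit_space_eq
  by (rule bij_betw_byWitness[where f' = "fiber n"]) (auto simp: pi_bar_fiber)

lemma fun_act_eq: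
  assumes "\<sigma> \<in> carrier (Sigma_grp n)"
  shows "fun_act n \<sigma> f = (\<lambda>z\<in>M_Omega_e n. f (act n (inv\<^bsub>Sigma_grp n\<^esub> \<sigma>) z))"
  unfolding fun_act_def by (auto simp: fun_eq_iff pt_act_eq)

lemma O_M_Omega_e_iff: "f \<in> O_M_Omega_e n \<longleftrightarrow> f \<in> extensional (M_Omega_e n) \<and> f \<in> R_e n"
proof
  assume f: "f \<in> O_M_Omega_e n"
  then have "f \<in> extensional (M_Omega_e n)" unfolding O_M_Omega_e_def regular_funs_def by blast
  then show "f \<in> extensional (M_Omega_e n) \<and> f \<in> R_e n" using f unfolding R_e_def by (simp add: extensional_restrict)
next
  assume "f \<in> extensional (M_Omega_e n) \<and> f \<in> R_e n"
  moreover from this have "restrict f (M_Omega_e n) = f" by (intro extensional_restrict) blast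
  ultimately show "f \<in> O_M_Omega_e n" unfolding R_e_def by simp
qed

lemma O_M_Omega_iff: "f \<in> O_M_Omega n \<longleftrightarrow> f \<in> extensional (M_Omega n) \<and> f \<in> R_o n"
proof
  assume f: "f \<in> O_M_Omega n"
  then have "f \<in> extensional (M_Omega n)" unfolding O_M_Omega_def regular_funs_def by blast
  then show "f \<in> extensional (M_Omega n) \<and> f \<in> R_o n" using f unfolding R_o_def by (simp add: extensional_restrict)
next
  assume "f \<in> extensional (M_Omega n) \<and> f \<in> R_o n"
  moreover from this have "restrict f (M_Omega n) = f" by (intro extensional_restrict) blast
  ultimately show "f \<in> O_M_Omega n" unfolding R_o_def by simp
qed

lemma O_invariants_iff:
  "f \<in> O_invariants n \<longleftrightarrow> f \<in> O_M_Omega_e n \<and> (\<forall>\<sigma>\<in>carrier (Sigma_grp n). \<forall>z\<in>M_Omega_e n. f (act n \<sigma> z) = f z)"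
proof -
  interpret group "Sigma_grp n" by (rule group_Sigma_grp)
  have 1: "fun_act n \<sigma> f = f \<longleftrightarrow> (\<forall>z\<in>M_Omega_e n. f (act n (inv\<^bsub>Sigma_grp n\<^esub> \<sigma>) z) = f z)"
    if "f \<in> extensional (M_Omega_e n)" "\<sigma> \<in> carrier (Sigma_grp n)" for \<sigma>
  proof
    assume "fun_act n \<sigma> f = f"
    then show "\<forall>z\<in>M_Omega_e n. f (act n (inv\<^bsub>Sigma_grp n\<^esub> \<sigma>) z) = f z"
      unfolding fun_act_eq[OF that(2)] by (metis restrict_apply')
  next
    assume "\<forall>z\<in>M_Omega_e n. f (act n (inv\<^bsub>Sigma_grp n\<^esub> \<sigma>) z) = f z"
    then show "fun_act n \<sigma> f = f" unfolding fun_act_eq[OF that(2)]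
      using that(1) by (intro extensionalityI[of _ "M_Omega_e n"]) auto
  qed
  have 2: "(\<forall>\<sigma>\<in>carrier (Sigma_grp n). P (inv\<^bsub>Sigma_grp n\<^esub> \<sigma>)) \<longleftrightarrow> (\<forall>\<sigma>\<in>carrier (Sigma_grp n). P \<sigma>)" for P
    by (metis inv_closed inv_inv)
  show ?thesis
  proof (cases "f \<in> O_M_Omega_e n")
    case True
    then have ext: "f \<in> extensional (M_Omega_e n)" using O_M_Omega_e_iff by blast
    have "f \<in> O_invariants n \<longleftrightarrow> (\<forall>\<sigma>\<in>carrier (Sigma_grp n). \<forall>z\<in>M_Omega_e n. f (act n (inv\<^bsub>Sigma_grp n\<^esub> \<sigma>) z) = f z)"
      unfolding O_invariants_def using True 1[OF ext] by simp
    also have "\<dots> \<longleftrightarrow> (\<forall>\<sigma>\<in>carrier (Sigma_grp n). \<forall>z\<in>M_Omega_e n. f (act n \<sigma> z) = f z)" by (rule 2)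
    finally show ?thesis using True by simp
  qed (simp add: O_invariants_def)
qed

text \<open>Identifies the ring of invariants with the pullback of the ring of
  \<open>M_Omega n\<close>; the isomorphism of varieties then needs only that \<open>pi_bar\<close>
  is bijective.\<close>

lemma O_orbit_space_eq: "O_orbit_space n = pullback (orbit_space n) pi_bar ` O_M_Omega n"
proof (intro equalityI subsetI)
  have orb: "orbit (Sigma_grp n) (pt_act n) z \<in> orbit_space n" "pi_bar (orbit (Sigma_grp n) (pt_act n) z) = snd z"
    if "z \<in> M_Omega_e n" for z
    using orbit_eq_fiber[OF that] pi_bar_fiber[OF M_Omega_eD(5)[OF that]] M_Omega_eD(5)[OF that]
    unfolding orbit_space_eq by auto
  {
    fix g assume "g \<in> O_orbit_space n"
    then have g: "g \<in> extensional (orbit_space n)"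
      "pullback (M_Omega_e n) (orbit (Sigma_grp n) (pt_act n)) g \<in> O_invariants n"
      unfolding O_orbit_space_def by auto
    let ?f = "pullback (M_Omega_e n) (orbit (Sigma_grp n) (pt_act n)) g"
    have "?f \<in> R_e n" using g(2) unfolding O_invariants_iff O_M_Omega_e_iff by blast
    moreover have "\<And>\<sigma> z. \<sigma> \<in> carrier (Sigma_grp n) \<Longrightarrow> z \<in> M_Omega_e n \<Longrightarrow> ?f (act n \<sigma> z) = ?f z"
      using g(2) unfolding O_invariants_iff by blast
    ultimately obtain h where h: "h \<in> R_o n" "\<And>z. z \<in> M_Omega_e n \<Longrightarrow> ?f z = h (snd z)"
      using invariant_descends[of ?f n] by metis
    have "g = pullback (orbit_space n) pi_bar (restrict h (M_Omega n))"
    proof (rule extensionalityI[of _ "orbit_space n"])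
      fix \<omega> assume "\<omega> \<in> orbit_space n"
      then obtain z where z: "z \<in> M_Omega_e n" "\<omega> = orbit (Sigma_grp n) (pt_act n) z"
        unfolding orbit_space_def orbits_def by blast
      then have "g \<omega> = h (snd z)" using h(2)[OF z(1)] by (simp add: pullback_def)
      then show "g \<omega> = pullback (orbit_space n) pi_bar (restrict h (M_Omega n)) \<omega>"
        using orb[OF z(1)] z M_Omega_eD(5)[OF z(1)] by (simp add: pullback_def)
    qed (use g in \<open>simp_all add: pullback_def\<close>)
    then show "g \<in> pullback (orbit_space n) pi_bar ` O_M_Omega n" using h(1) unfolding R_o_def by blast
  next
    fix g assume "g \<in> pullback (orbit_space n) pi_bar ` O_M_Omega n"
    then obtain h where h: "h \<in> O_M_Omega n" "g = pullback (orbit_space n) pi_bar h" by blast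
    have "pullback (M_Omega_e n) (orbit (Sigma_grp n) (pt_act n)) g = (\<lambda>z\<in>M_Omega_e n. h (snd z))"
      unfolding h(2) pullback_def using orb by (auto simp: fun_eq_iff)
    moreover have "(\<lambda>z\<in>M_Omega_e n. h (snd z)) \<in> O_M_Omega_e n"
      using R_o_pullback[of h n] h(1) unfolding O_M_Omega_iff R_e_def by simp
    then have "(\<lambda>z\<in>M_Omega_e n. h (snd z)) \<in> O_invariants n"
      unfolding O_invariants_iff using act_in by simp
    ultimately show "g \<in> O_orbit_space n" unfolding O_orbit_space_def h(2) by (simp add: pullback_def)
  }
qed

theorem orbit_space_iso: "variety_iso (orbit_space n) (O_orbit_space n) (M_Omega n) (O_M_Omega n) pi_bar"
  unfolding O_orbit_space_eq O_M_Omega_def by (rule variety_iso_pullback[OF bij_pi_bar Mo.affine])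

section \<open>Interpolation along the fibres and finiteness\<close>

definition same_level :: "nat \<Rightarrow> ((nat \<times> nat) \<times> (nat \<times> nat)) set" where
  "same_level n = {(k, l) \<in> index_set n \<times> index_set n. snd k = snd l \<and> fst k \<noteq> fst l}"

lemma finite_same_level: "finite (same_level n)"
  by (rule finite_subset[OF _ finite_adjacent[of n]]) (auto simp: same_level_def adjacent_def)

lemma same_level_nonzero:
  assumes "z \<in> M_Omega_e n" "p \<in> same_level n"
  shows "fst z (fst p) - fst z (snd p) \<noteq> 0"
  using M_Omega_eD(3)[OF assms(1)] assms(2) unfolding disc_nonzero_iff same_level_def adjacent_def by auto

text \<open>Lagrange interpolation on a fibre.\<close>
lemma fiber_indicator:
  assumes z: "z \<in> M_Omega_e n" and w: "w \<in> M_Omega_e n" and "snd z = snd w"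
  shows "(\<Prod>p\<in>same_level n. (fst z (fst p) - fst w (snd p)) / (fst w (fst p) - fst w (snd p))) = of_bool (z = w)"
proof (cases "z = w")
  case True
  then show ?thesis using same_level_nonzero[OF w] by (simp add: prod.neutral)
next
  case False
  then have "fst z \<noteq> fst w" using assms(3) by (auto intro: prod_eqI)
  then obtain k where k: "k \<in> index_set n" "fst z k \<noteq> fst w k"
    using PiE_ext[OF M_Omega_eD(1)[OF z] M_Omega_eD(1)[OF w]] by blast
  obtain i m where im: "k = (i, m)" "i \<in> {1..m}" "m \<in> {1..n}" using k(1) by (cases k) (auto simp: index_set_iff)
  have "fst z (i, m) \<in> (\<lambda>i. fst w (i, m)) ` {1..m}"
    using has_spectra_spectrum[OF M_Omega_eD(4)[OF z] im(3)] has_spectra_spectrum[OF M_Omega_eD(4)[OF w] im(3)]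
      im(2) assms(3) by auto
  then obtain j where j: "j \<in> {1..m}" "fst z (i, m) = fst w (j, m)" by blast
  then have "i \<noteq> j" using k(2) im(1) by auto
  \<comment> \<open>The spectra agree, so the deviating eigenvalue of \<open>z\<close> at label
    \<open>i\<close> is an eigenvalue of \<open>w\<close> at another label \<open>j\<close>; the
    factor of this pair vanishes.\<close>
  then have "((i, m), (j, m)) \<in> same_level n" using im j unfolding same_level_def by (simp add: index_set_iff)
  moreover have "(fst z (fst ((i, m), (j, m))) - fst w (snd ((i, m), (j, m)))) /
      (fst w (fst ((i, m), (j, m))) - fst w (snd ((i, m), (j, m)))) = 0" using j(2) by simp
  ultimately have "(\<Prod>p\<in>same_level n. (fst z (fst p) - fst w (snd p)) / (fst w (fst p) - fst w (snd p))) = 0"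
    by (intro prod_zero[OF finite_same_level] bexI)
  then show ?thesis using False by simp
qed

text \<open>A monomial in the eigenvalues: the exponent of a label is the number of pairs of
  \<open>S\<close> whose first component it is.\<close>

definition nu_product :: "((nat \<times> nat) \<times> (nat \<times> nat)) set \<Rightarrow> (nat \<times> nat \<Rightarrow> complex) \<times> complex mat \<Rightarrow> complex" where
  "nu_product S z = (\<Prod>p\<in>S. fst z (fst p))"

lemma nu_product_R_e: "S \<subseteq> same_level n \<Longrightarrow> nu_product S \<in> R_e n"
  unfolding nu_product_def[abs_def] by (intro R_e.prod R_e_nu) (auto simp: same_level_def)

text \<open>Expanding the indicator in products of the \<open>\<nu>\<close> expresses \<open>f\<close> through traces over the orbit.\<close>
theorem regular_expansion:
  assumes f: "f \<in> R_e n"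
  obtains c where "\<And>S. c S \<in> R_o n"
    "\<And>z. z \<in> M_Omega_e n \<Longrightarrow> f z = (\<Sum>S\<in>Pow (same_level n). c S (snd z) * nu_product S z)"
proof -
  interpret group "Sigma_grp n" by (rule group_Sigma_grp)
  \<comment> \<open>The coefficient of \<open>nu_product S z\<close> when the product representing
    the indicator of \<open>w\<close> is multiplied out.\<close>
  define L where "L S w = (\<Prod>p\<in>same_level n - S. - fst w (snd p)) * (\<Prod>p\<in>same_level n. inverse (fst w (fst p) - fst w (snd p)))" for S and w :: "(nat \<times> nat \<Rightarrow> complex) \<times> complex mat"
  have L: "L S \<in> R_e n" for S
    unfolding L_def[abs_def]
    by (intro R_e.mult R_e.prod R_e.uminus R_e_inverse R_e.diff R_e_nu same_level_nonzero) (auto simp: same_level_def)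
  have "\<exists>g. g \<in> R_o n \<and> (\<forall>z\<in>M_Omega_e n. (\<Sum>\<sigma>\<in>carrier (Sigma_grp n). f (act n \<sigma> z) * L S (act n \<sigma> z)) = g (snd z))" for S
  proof -
    define h where "h z = f z * L S z" for z
    have "h \<in> R_e n" unfolding h_def[abs_def] by (rule R_e.mult[OF f L])
    then obtain g where "g \<in> R_o n" "\<And>z. z \<in> M_Omega_e n \<Longrightarrow> (\<Sum>\<sigma>\<in>carrier (Sigma_grp n). h (act n \<sigma> z)) = g (snd z)"
      using orbit_sum_descends[of h n] by metis
    then show ?thesis unfolding h_def by blast
  qed
  then have "\<exists>c. \<forall>S. c S \<in> R_o n \<and>
      (\<forall>z\<in>M_Omega_e n. (\<Sum>\<sigma>\<in>carrier (Sigma_grp n). f (act n \<sigma> z) * L S (act n \<sigma> z)) = c S (snd z))"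
    by (intro choice allI)
  then obtain c where c0: "\<forall>S. c S \<in> R_o n \<and>
      (\<forall>z\<in>M_Omega_e n. (\<Sum>\<sigma>\<in>carrier (Sigma_grp n). f (act n \<sigma> z) * L S (act n \<sigma> z)) = c S (snd z))"
    by (rule exE)
  have c: "\<And>S. c S \<in> R_o n"
    "\<And>S z. z \<in> M_Omega_e n \<Longrightarrow> (\<Sum>\<sigma>\<in>carrier (Sigma_grp n). f (act n \<sigma> z) * L S (act n \<sigma> z)) = c S (snd z)"
    using c0 by simp_all
  show ?thesis
  proof (rule that[OF c(1)])
    fix z assume z: "z \<in> M_Omega_e n"
    have ind: "(\<Sum>S\<in>Pow (same_level n). nu_product S z * L S w) = of_bool (z = w)"
      if w: "w \<in> M_Omega_e n" "snd z = snd w" for w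
    proof -
      have "of_bool (z = w) = (\<Prod>p\<in>same_level n. fst z (fst p) + - fst w (snd p)) * (\<Prod>p\<in>same_level n. inverse (fst w (fst p) - fst w (snd p)))"
        unfolding fiber_indicator[OF z w, symmetric] divide_inverse prod.distrib by simp
      also have "(\<Prod>p\<in>same_level n. fst z (fst p) + - fst w (snd p)) =
         (\<Sum>S\<in>Pow (same_level n). (\<Prod>p\<in>S. fst z (fst p)) * (\<Prod>p\<in>same_level n - S. - fst w (snd p)))"
        by (rule prod_add[OF finite_same_level])
      finally show ?thesis unfolding nu_product_def L_def sum_distrib_right by (simp add: mult.assoc)
    qed
    \<comment> \<open>The action is free, so only the identity returns \<open>z\<close> to itself
      and contributes.\<close>
    have "f z = (\<Sum>\<sigma>\<in>carrier (Sigma_grp n). f (act n \<sigma> z) * of_bool (z = act n \<sigma> z))"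
    proof -
      have "(\<Sum>\<sigma>\<in>carrier (Sigma_grp n). f (act n \<sigma> z) * of_bool (z = act n \<sigma> z)) =
         (\<Sum>\<sigma>\<in>carrier (Sigma_grp n). if \<sigma> = \<one>\<^bsub>Sigma_grp n\<^esub> then f z else 0)"
      proof (intro sum.cong refl)
        fix \<sigma> assume \<sigma>: "\<sigma> \<in> carrier (Sigma_grp n)"
        have "act n \<sigma> z \<noteq> z" if "\<sigma> \<noteq> \<one>\<^bsub>Sigma_grp n\<^esub>" using act_free[OF \<sigma> z] that by blast
        then show "f (act n \<sigma> z) * of_bool (z = act n \<sigma> z) = (if \<sigma> = \<one>\<^bsub>Sigma_grp n\<^esub> then f z else 0)"
          using act_one[OF z] by (cases "\<sigma> = \<one>\<^bsub>Sigma_grp n\<^esub>") auto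
      qed
      then show ?thesis using finite_Sigma_grp by simp
    qed
    also have "\<dots> = (\<Sum>\<sigma>\<in>carrier (Sigma_grp n). \<Sum>S\<in>Pow (same_level n). nu_product S z * (f (act n \<sigma> z) * L S (act n \<sigma> z)))"
    proof (intro sum.cong refl)
      fix \<sigma> assume \<sigma>: "\<sigma> \<in> carrier (Sigma_grp n)"
      have "of_bool (z = act n \<sigma> z) = (\<Sum>S\<in>Pow (same_level n). nu_product S z * L S (act n \<sigma> z))"
        using ind[OF act_in[OF \<sigma> z]] by simp
      then show "f (act n \<sigma> z) * of_bool (z = act n \<sigma> z) =
          (\<Sum>S\<in>Pow (same_level n). nu_product S z * (f (act n \<sigma> z) * L S (act n \<sigma> z)))"
        by (simp only: sum_distrib_left mult.left_commute)
    qed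
    also have "\<dots> = (\<Sum>S\<in>Pow (same_level n). nu_product S z * (\<Sum>\<sigma>\<in>carrier (Sigma_grp n). f (act n \<sigma> z) * L S (act n \<sigma> z)))"
      by (subst sum.swap) (simp only: sum_distrib_left)
    also have "\<dots> = (\<Sum>S\<in>Pow (same_level n). c S (snd z) * nu_product S z)"
      unfolding c(2)[OF z] by (simp only: mult.commute)
    finally show "f z = (\<Sum>S\<in>Pow (same_level n). c S (snd z) * nu_product S z)" .
  qed
qed

lemma pullback_pi_n: "g \<in> O_M_Omega n \<Longrightarrow> pullback (M_Omega_e n) pi_n g \<in> O_M_Omega_e n"
  using R_o_pullback[of g n] unfolding pullback_def pi_n_def O_M_Omega_iff R_e_def by simp

theorem finite_morphism_pi_n: "finite_morphism (M_Omega_e n) (O_M_Omega_e n) (M_Omega n) (O_M_Omega n) pi_n"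
  unfolding finite_morphism_def
proof (intro conjI)
  show "variety_morphism (M_Omega_e n) (O_M_Omega_e n) (M_Omega n) (O_M_Omega n) pi_n"
    unfolding variety_morphism_def
  proof (intro conjI)
    show "affine_variety (M_Omega_e n) (O_M_Omega_e n)" unfolding O_M_Omega_e_def by (rule Me.affine)
    show "affine_variety (M_Omega n) (O_M_Omega n)" unfolding O_M_Omega_def by (rule Mo.affine)
    show "pi_n \<in> M_Omega_e n \<rightarrow> M_Omega n" unfolding pi_n_def using M_Omega_eD(5) by auto
    show "pullback (M_Omega_e n) pi_n ` O_M_Omega n \<subseteq> O_M_Omega_e n"
      using pullback_pi_n by blast
  qed
  let ?g = "\<lambda>S. restrict (nu_product S) (M_Omega_e n)"
  let ?G = "?g ` Pow (same_level n)"
  have GA: "?G \<subseteq> O_M_Omega_e n" using nu_product_R_e unfolding R_e_def by blast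
  have "\<exists>c. c \<in> ?G \<rightarrow> O_M_Omega n \<and> f = (\<lambda>p\<in>M_Omega_e n. \<Sum>g\<in>?G. c g (pi_n p) * g p)" if f: "f \<in> O_M_Omega_e n" for f
  proof -
    have fR: "f \<in> R_e n" "f \<in> extensional (M_Omega_e n)" using f O_M_Omega_e_iff by auto
    obtain c where c: "\<And>S. c S \<in> R_o n"
      "\<And>z. z \<in> M_Omega_e n \<Longrightarrow> f z = (\<Sum>S\<in>Pow (same_level n). c S (snd z) * nu_product S z)"
      by (rule regular_expansion[OF fR(1)], rule that) simp_all
    \<comment> \<open>Different sets \<open>S\<close> may give the same function on the cover, so
      their coefficients are collected.\<close>
    define c' where "c' g = (\<lambda>x\<in>M_Omega n. \<Sum>S\<in>{S \<in> Pow (same_level n). ?g S = g}. c S x)" for g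
    have "(\<lambda>x. \<Sum>S\<in>{S \<in> Pow (same_level n). ?g S = g}. c S x) \<in> R_o n" for g
      by (intro R_o.sum c(1))
    then have 1: "c' \<in> ?G \<rightarrow> O_M_Omega n" unfolding c'_def R_o_def by auto
    have "f z = (\<Sum>g\<in>?G. c' g (pi_n z) * g z)" if z: "z \<in> M_Omega_e n" for z
    proof -
      have "f z = (\<Sum>g\<in>?G. \<Sum>S\<in>{S \<in> Pow (same_level n). ?g S = g}. c S (snd z) * nu_product S z)"
        unfolding c(2)[OF z] by (rule sum.image_gen) (simp add: finite_same_level)
      also have "\<dots> = (\<Sum>g\<in>?G. c' g (pi_n z) * g z)"
      proof (intro sum.cong refl)
        fix g
        have "(\<Sum>S\<in>{S \<in> Pow (same_level n). ?g S = g}. c S (snd z) * nu_product S z) =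
           (\<Sum>S\<in>{S \<in> Pow (same_level n). ?g S = g}. c S (snd z) * g z)"
          using z by (intro sum.cong refl) auto
        then show "(\<Sum>S\<in>{S \<in> Pow (same_level n). ?g S = g}. c S (snd z) * nu_product S z) = c' g (pi_n z) * g z"
          unfolding c'_def pi_n_def using M_Omega_eD(5)[OF z] by (simp add: sum_distrib_right)
      qed
      finally show ?thesis .
    qed
    then have "f = (\<lambda>p\<in>M_Omega_e n. \<Sum>g\<in>?G. c' g (pi_n p) * g p)"
      using fR(2) by (intro extensionalityI[of _ "M_Omega_e n"]) auto
    then show ?thesis using 1 by blast
  qed
  then show "\<exists>G. finite G \<and> G \<subseteq> O_M_Omega_e n \<and>
     (\<forall>f\<in>O_M_Omega_e n. \<exists>c. c \<in> G \<rightarrow> O_M_Omega n \<and> f = (\<lambda>p\<in>M_Omega_e n. \<Sum>g\<in>G. c g (pi_n p) * g p))"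
    using GA finite_same_level by (intro exI[of _ ?G]) simp
qed

section \<open>Fraction fields\<close>

context domain
begin

abbreviation "Q \<equiv> quotient_field R"
abbreviation "R0 \<equiv> carrier R - {\<zero>}"

lemma nonzero_mult: "b \<in> R0 \<Longrightarrow> d \<in> R0 \<Longrightarrow> b \<otimes> d \<in> R0"
  using integral by auto

lemma fract_mem: "a \<in> carrier R \<Longrightarrow> b \<in> R0 \<Longrightarrow>
    (c, d) \<in> fract R a b \<longleftrightarrow> c \<in> carrier R \<and> d \<in> R0 \<and> a \<otimes> d = c \<otimes> b"
  unfolding fract_def frac_rel_def by auto

lemma fract_trans:
  assumes "a \<in> carrier R" "b \<in> R0" "c \<in> carrier R" "d \<in> R0" "e \<in> carrier R" "f \<in> R0"
    and "a \<otimes> d = c \<otimes> b" "c \<otimes> f = e \<otimes> d"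
  shows "a \<otimes> f = e \<otimes> b"
proof -
  have car: "a \<in> carrier R" "b \<in> carrier R" "c \<in> carrier R" "d \<in> carrier R" "e \<in> carrier R" "f \<in> carrier R"
    using assms by auto
  have "(a \<otimes> f) \<otimes> d = (a \<otimes> d) \<otimes> f" using car by (simp add: m_ac)
  also have "\<dots> = (c \<otimes> f) \<otimes> b" using car assms(7) by (simp add: m_ac)
  also have "\<dots> = (e \<otimes> b) \<otimes> d" using car assms(8) by (simp add: m_ac)
  finally show ?thesis using m_rcancel[of d "a \<otimes> f" "e \<otimes> b"] assms(4) car by simp
qed

lemma fract_eq_iff:
  assumes "a \<in> carrier R" "b \<in> R0" "c \<in> carrier R" "d \<in> R0"
  shows "fract R a b = fract R c d \<longleftrightarrow> a \<otimes> d = c \<otimes> b"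
proof
  assume "fract R a b = fract R c d"
  then have "(c, d) \<in> fract R a b" using fract_mem[OF assms(3,4)] assms by auto
  then show "a \<otimes> d = c \<otimes> b" using fract_mem[OF assms(1,2)] by simp
next
  assume eq: "a \<otimes> d = c \<otimes> b"
  have "(e, f) \<in> fract R a b \<longleftrightarrow> (e, f) \<in> fract R c d" for e f
    unfolding fract_mem[OF assms(1,2)] fract_mem[OF assms(3,4)]
    using fract_trans[OF assms(3,4,1,2), of e f] fract_trans[OF assms(1,2,3,4), of e f] eq by auto
  then show "fract R a b = fract R c d" by auto
qed

lemma fract_in: "a \<in> carrier R \<Longrightarrow> b \<in> R0 \<Longrightarrow> fract R a b \<in> carrier Q"
  unfolding quotient_field_def by auto

lemma fractE:
  assumes "y \<in> carrier Q"
  obtains a b where "a \<in> carrier R" "b \<in> R0" "y = fract R a b"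
  using assms unfolding quotient_field_def by auto

text \<open>Operations on classes are unions over representatives. If the result does not depend on
  the representative, this is a union of equal sets over a nonempty class.\<close>

lemma UN_fract:
  assumes "a \<in> carrier R" "b \<in> R0"
    and "\<And>a' b'. a' \<in> carrier R \<Longrightarrow> b' \<in> R0 \<Longrightarrow> a \<otimes> b' = a' \<otimes> b \<Longrightarrow> F a' b' = F a b"
  shows "(\<Union>(a', b')\<in>fract R a b. F a' b') = F a b"
proof -
  have "(a, b) \<in> fract R a b" using fract_mem[OF assms(1,2)] assms by simp
  moreover have "F (fst p) (snd p) = F a b" if "p \<in> fract R a b" for p
    using fract_mem[OF assms(1,2), of "fst p" "snd p"] assms(3) that by simp
  ultimately show ?thesis unfolding case_prod_unfold by auto
qed

lemma fract_mult:
  assumes "a \<in> carrier R" "b \<in> R0" "c \<in> carrier R" "d \<in> R0"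
  shows "fract R a b \<otimes>\<^bsub>Q\<^esub> fract R c d = fract R (a \<otimes> c) (b \<otimes> d)"
proof -
  have wd: "fract R (a' \<otimes> c') (b' \<otimes> d') = fract R (a \<otimes> c) (b \<otimes> d)"
    if *: "a' \<in> carrier R" "b' \<in> R0" "a \<otimes> b' = a' \<otimes> b" "c' \<in> carrier R" "d' \<in> R0" "c \<otimes> d' = c' \<otimes> d" for a' b' c' d'
  proof -
    have car: "b \<in> carrier R" "d \<in> carrier R" "b' \<in> carrier R" "d' \<in> carrier R" using * assms by auto
    have "(a' \<otimes> c') \<otimes> (b \<otimes> d) = (a' \<otimes> b) \<otimes> (c' \<otimes> d)" using car assms *(1,2,4,5) by (simp add: m_ac)
    also have "\<dots> = (a \<otimes> b') \<otimes> (c \<otimes> d')" using * by simp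
    also have "\<dots> = (a \<otimes> c) \<otimes> (b' \<otimes> d')" using car assms *(1,2,4,5) by (simp add: m_ac)
    finally have eq: "(a' \<otimes> c') \<otimes> (b \<otimes> d) = (a \<otimes> c) \<otimes> (b' \<otimes> d')" .
    show ?thesis
      by (rule fract_eq_iff[THEN iffD2, OF m_closed[OF *(1,4)] nonzero_mult[OF *(2,5)] m_closed[OF assms(1,3)]
            nonzero_mult[OF assms(2,4)] eq])
  qed
  have "fract R a b \<otimes>\<^bsub>Q\<^esub> fract R c d = (\<Union>(a', b')\<in>fract R a b. \<Union>(c', d')\<in>fract R c d. fract R (a' \<otimes> c') (b' \<otimes> d'))"
    unfolding quotient_field_def by simp
  also have "\<dots> = (\<Union>(c', d')\<in>fract R c d. fract R (a \<otimes> c') (b \<otimes> d'))"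
  proof (rule UN_fract[OF assms(1,2)])
    fix a' b' assume *: "a' \<in> carrier R" "b' \<in> R0" "a \<otimes> b' = a' \<otimes> b"
    have "fract R (a' \<otimes> c') (b' \<otimes> d') = fract R (a \<otimes> c') (b \<otimes> d')" if "(c', d') \<in> fract R c d" for c' d'
      using wd[OF * _ _ ] wd[OF assms(1,2) refl] that fract_mem[OF assms(3,4)] by simp
    then show "(\<Union>(c', d')\<in>fract R c d. fract R (a' \<otimes> c') (b' \<otimes> d')) = (\<Union>(c', d')\<in>fract R c d. fract R (a \<otimes> c') (b \<otimes> d'))"
      by (intro SUP_cong refl) auto
  qed
  also have "\<dots> = fract R (a \<otimes> c) (b \<otimes> d)"
    by (rule UN_fract[OF assms(3,4)]) (rule wd[OF assms(1,2) refl])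
  finally show ?thesis .
qed

lemma fract_add:
  assumes "a \<in> carrier R" "b \<in> R0" "c \<in> carrier R" "d \<in> R0"
  shows "fract R a b \<oplus>\<^bsub>Q\<^esub> fract R c d = fract R (a \<otimes> d \<oplus> c \<otimes> b) (b \<otimes> d)"
proof -
  have wd: "fract R (a' \<otimes> d' \<oplus> c' \<otimes> b') (b' \<otimes> d') = fract R (a \<otimes> d \<oplus> c \<otimes> b) (b \<otimes> d)"
    if *: "a' \<in> carrier R" "b' \<in> R0" "a \<otimes> b' = a' \<otimes> b" "c' \<in> carrier R" "d' \<in> R0" "c \<otimes> d' = c' \<otimes> d" for a' b' c' d'
  proof -
    have car: "b \<in> carrier R" "d \<in> carrier R" "b' \<in> carrier R" "d' \<in> carrier R" using * assms by auto
    have "(a' \<otimes> d' \<oplus> c' \<otimes> b') \<otimes> (b \<otimes> d) = (a' \<otimes> b) \<otimes> (d \<otimes> d') \<oplus> (c' \<otimes> d) \<otimes> (b \<otimes> b')"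
      using car assms *(1,2,4,5) by algebra
    also have "\<dots> = (a \<otimes> b') \<otimes> (d \<otimes> d') \<oplus> (c \<otimes> d') \<otimes> (b \<otimes> b')" using * by simp
    also have "\<dots> = (a \<otimes> d \<oplus> c \<otimes> b) \<otimes> (b' \<otimes> d')" using car assms *(1,2,4,5) by algebra
    finally have eq: "(a' \<otimes> d' \<oplus> c' \<otimes> b') \<otimes> (b \<otimes> d) = (a \<otimes> d \<oplus> c \<otimes> b) \<otimes> (b' \<otimes> d')" .
    have "a' \<otimes> d' \<oplus> c' \<otimes> b' \<in> carrier R" "a \<otimes> d \<oplus> c \<otimes> b \<in> carrier R" using car * assms by auto
    then show ?thesis
      by (rule fract_eq_iff[THEN iffD2, OF _ nonzero_mult[OF *(2,5)] _ nonzero_mult[OF assms(2,4)] eq])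
  qed
  have "fract R a b \<oplus>\<^bsub>Q\<^esub> fract R c d = (\<Union>(a', b')\<in>fract R a b. \<Union>(c', d')\<in>fract R c d. fract R (a' \<otimes> d' \<oplus> c' \<otimes> b') (b' \<otimes> d'))"
    unfolding quotient_field_def by simp
  also have "\<dots> = (\<Union>(c', d')\<in>fract R c d. fract R (a \<otimes> d' \<oplus> c' \<otimes> b) (b \<otimes> d'))"
  proof (rule UN_fract[OF assms(1,2)])
    fix a' b' assume *: "a' \<in> carrier R" "b' \<in> R0" "a \<otimes> b' = a' \<otimes> b"
    have "fract R (a' \<otimes> d' \<oplus> c' \<otimes> b') (b' \<otimes> d') = fract R (a \<otimes> d' \<oplus> c' \<otimes> b) (b \<otimes> d')" if "(c', d') \<in> fract R c d" for c' d'
      using wd[OF * _ _ ] wd[OF assms(1,2) refl] that fract_mem[OF assms(3,4)] by simp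
    then show "(\<Union>(c', d')\<in>fract R c d. fract R (a' \<otimes> d' \<oplus> c' \<otimes> b') (b' \<otimes> d')) = (\<Union>(c', d')\<in>fract R c d. fract R (a \<otimes> d' \<oplus> c' \<otimes> b) (b \<otimes> d'))"
      by (intro SUP_cong refl) auto
  qed
  also have "\<dots> = fract R (a \<otimes> d \<oplus> c \<otimes> b) (b \<otimes> d)"
    by (rule UN_fract[OF assms(3,4)]) (rule wd[OF assms(1,2) refl])
  finally show ?thesis .
qed

lemma one_R0: "\<one> \<in> R0" by simp

lemma one_Q: "\<one>\<^bsub>Q\<^esub> = fract R \<one> \<one>" and zero_Q: "\<zero>\<^bsub>Q\<^esub> = fract R \<zero> \<one>"
  unfolding quotient_field_def by simp_all

lemma fract_eq_zero_iff: "a \<in> carrier R \<Longrightarrow> b \<in> R0 \<Longrightarrow> fract R a b = \<zero>\<^bsub>Q\<^esub> \<longleftrightarrow> a = \<zero>"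
  unfolding zero_Q by (subst fract_eq_iff) auto

lemma quotient_field: "field Q"
proof (rule cring.cring_fieldI2)
  have zm: "b \<otimes> d \<in> carrier R" "b \<otimes> d \<noteq> \<zero>" if "b \<in> R0" "d \<in> R0" for b d
    using nonzero_mult[OF that] by auto
  show "cring Q"
  proof (rule cringI)
    show "abelian_group Q"
    proof (rule abelian_groupI)
      fix x y assume "x \<in> carrier Q" "y \<in> carrier Q"
      then obtain a b c d where *: "a \<in> carrier R" "b \<in> R0" "x = fract R a b" "c \<in> carrier R" "d \<in> R0" "y = fract R c d"
        by (metis fractE)
      show "x \<oplus>\<^bsub>Q\<^esub> y \<in> carrier Q" unfolding * fract_add[OF *(1,2,4,5)]
        using * zm by (intro fract_in) auto
      have "a \<otimes> d \<oplus> c \<otimes> b = c \<otimes> b \<oplus> a \<otimes> d" "b \<otimes> d = d \<otimes> b" using * by (auto simp: a_comm m_comm)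
      then show "x \<oplus>\<^bsub>Q\<^esub> y = y \<oplus>\<^bsub>Q\<^esub> x"
        unfolding * fract_add[OF *(1,2,4,5)] fract_add[OF *(4,5,1,2)] by simp
    next
      fix x y z assume "x \<in> carrier Q" "y \<in> carrier Q" "z \<in> carrier Q"
      then obtain a b c d e f where *: "a \<in> carrier R" "b \<in> R0" "x = fract R a b" "c \<in> carrier R" "d \<in> R0" "y = fract R c d"
        "e \<in> carrier R" "f \<in> R0" "z = fract R e f"
        by (metis fractE)
      have car: "b \<in> carrier R" "d \<in> carrier R" "f \<in> carrier R" using * by auto
      have 1: "a \<otimes> d \<oplus> c \<otimes> b \<in> carrier R" "c \<otimes> f \<oplus> e \<otimes> d \<in> carrier R" using * car by auto
      have 2: "(a \<otimes> d \<oplus> c \<otimes> b) \<otimes> f \<oplus> e \<otimes> (b \<otimes> d) = a \<otimes> (d \<otimes> f) \<oplus> (c \<otimes> f \<oplus> e \<otimes> d) \<otimes> b"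
        using * car by algebra
      have 3: "b \<otimes> d \<otimes> f = b \<otimes> (d \<otimes> f)" using car by (simp add: m_assoc)
      show "x \<oplus>\<^bsub>Q\<^esub> y \<oplus>\<^bsub>Q\<^esub> z = x \<oplus>\<^bsub>Q\<^esub> (y \<oplus>\<^bsub>Q\<^esub> z)"
        unfolding *(3,6,9) fract_add[OF *(1,2,4,5)] fract_add[OF *(4,5,7,8)]
          fract_add[OF 1(1) nonzero_mult[OF *(2,5)] *(7,8)] fract_add[OF *(1,2) 1(2) nonzero_mult[OF *(5,8)]] 2 3 ..
    next
      show "\<zero>\<^bsub>Q\<^esub> \<in> carrier Q" unfolding zero_Q by (rule fract_in) auto
    next
      fix x assume "x \<in> carrier Q"
      then obtain a b where *: "a \<in> carrier R" "b \<in> R0" "x = fract R a b" by (metis fractE)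
      show "\<zero>\<^bsub>Q\<^esub> \<oplus>\<^bsub>Q\<^esub> x = x"
        unfolding *(3) zero_Q fract_add[OF zero_closed one_R0 *(1,2)] using * by simp
      have "fract R (\<ominus> a) b \<oplus>\<^bsub>Q\<^esub> x = fract R (\<ominus> a \<otimes> b \<oplus> a \<otimes> b) (b \<otimes> b)"
        unfolding *(3) by (rule fract_add) (use * in auto)
      also have "\<ominus> a \<otimes> b \<oplus> a \<otimes> b = \<zero>" using * by (simp add: l_minus l_neg)
      finally have "fract R (\<ominus> a) b \<oplus>\<^bsub>Q\<^esub> x = \<zero>\<^bsub>Q\<^esub>"
        using fract_eq_zero_iff[OF zero_closed nonzero_mult[OF *(2,2)]] by simp
      then show "\<exists>y\<in>carrier Q. y \<oplus>\<^bsub>Q\<^esub> x = \<zero>\<^bsub>Q\<^esub>" using fract_in[of "\<ominus> a" b] * by auto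
    qed
    show "comm_monoid Q"
    proof (rule comm_monoidI)
      fix x y assume "x \<in> carrier Q" "y \<in> carrier Q"
      then obtain a b c d where *: "a \<in> carrier R" "b \<in> R0" "x = fract R a b" "c \<in> carrier R" "d \<in> R0" "y = fract R c d"
        by (metis fractE)
      show "x \<otimes>\<^bsub>Q\<^esub> y \<in> carrier Q" unfolding * fract_mult[OF *(1,2,4,5)]
        using * zm by (intro fract_in) auto
      have "a \<otimes> c = c \<otimes> a" "b \<otimes> d = d \<otimes> b" using * by (auto simp: m_comm)
      then show "x \<otimes>\<^bsub>Q\<^esub> y = y \<otimes>\<^bsub>Q\<^esub> x"
        unfolding * fract_mult[OF *(1,2,4,5)] fract_mult[OF *(4,5,1,2)] by simp
    next
      fix x y z assume "x \<in> carrier Q" "y \<in> carrier Q" "z \<in> carrier Q"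
      then obtain a b c d e f where *: "a \<in> carrier R" "b \<in> R0" "x = fract R a b" "c \<in> carrier R" "d \<in> R0" "y = fract R c d"
        "e \<in> carrier R" "f \<in> R0" "z = fract R e f"
        by (metis fractE)
      have 1: "a \<otimes> c \<in> carrier R" "c \<otimes> e \<in> carrier R" using * by auto
      have 2: "a \<otimes> c \<otimes> e = a \<otimes> (c \<otimes> e)" "b \<otimes> d \<otimes> f = b \<otimes> (d \<otimes> f)" using * by (auto simp: m_assoc)
      show "x \<otimes>\<^bsub>Q\<^esub> y \<otimes>\<^bsub>Q\<^esub> z = x \<otimes>\<^bsub>Q\<^esub> (y \<otimes>\<^bsub>Q\<^esub> z)"
        unfolding *(3,6,9) fract_mult[OF *(1,2,4,5)] fract_mult[OF *(4,5,7,8)]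
          fract_mult[OF 1(1) nonzero_mult[OF *(2,5)] *(7,8)] fract_mult[OF *(1,2) 1(2) nonzero_mult[OF *(5,8)]] 2 ..
    next
      show "\<one>\<^bsub>Q\<^esub> \<in> carrier Q" unfolding one_Q by (rule fract_in) auto
    next
      fix x assume "x \<in> carrier Q"
      then obtain a b where *: "a \<in> carrier R" "b \<in> R0" "x = fract R a b" by (metis fractE)
      show "\<one>\<^bsub>Q\<^esub> \<otimes>\<^bsub>Q\<^esub> x = x"
        unfolding *(3) one_Q fract_mult[OF one_closed one_R0 *(1,2)] using * by simp
    qed
    fix x y z assume "x \<in> carrier Q" "y \<in> carrier Q" "z \<in> carrier Q"
    then obtain a b c d e f where *: "a \<in> carrier R" "b \<in> R0" "x = fract R a b" "c \<in> carrier R" "d \<in> R0" "y = fract R c d"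
      "e \<in> carrier R" "f \<in> R0" "z = fract R e f"
      by (metis fractE)
    have car: "b \<in> carrier R" "d \<in> carrier R" "f \<in> carrier R" using * by auto
    have 1: "a \<otimes> d \<oplus> c \<otimes> b \<in> carrier R" "a \<otimes> e \<in> carrier R" "c \<otimes> e \<in> carrier R" using * car by auto
    have nz: "b \<otimes> d \<in> R0" "b \<otimes> f \<in> R0" "d \<otimes> f \<in> R0" using nonzero_mult * by auto
    have 2: "(a \<otimes> d \<oplus> c \<otimes> b) \<otimes> e \<otimes> (b \<otimes> f \<otimes> (d \<otimes> f)) = (a \<otimes> e \<otimes> (d \<otimes> f) \<oplus> c \<otimes> e \<otimes> (b \<otimes> f)) \<otimes> (b \<otimes> d \<otimes> f)"
      using * car by algebra
    show "(x \<oplus>\<^bsub>Q\<^esub> y) \<otimes>\<^bsub>Q\<^esub> z = x \<otimes>\<^bsub>Q\<^esub> z \<oplus>\<^bsub>Q\<^esub> y \<otimes>\<^bsub>Q\<^esub> z"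
      unfolding *(3,6,9) fract_add[OF *(1,2,4,5)] fract_mult[OF *(1,2,7,8)] fract_mult[OF *(4,5,7,8)]
        fract_mult[OF 1(1) nz(1) *(7,8)] fract_add[OF 1(2) nz(2) 1(3) nz(3)]
      by (subst fract_eq_iff) (use 1 2 nz * car nonzero_mult in auto)
  qed
  show "\<zero>\<^bsub>Q\<^esub> \<noteq> \<one>\<^bsub>Q\<^esub>" unfolding one_Q using fract_eq_zero_iff[OF one_closed one_R0] by auto
  fix x assume x: "x \<in> carrier Q" "x \<noteq> \<zero>\<^bsub>Q\<^esub>"
  then obtain a b where *: "a \<in> carrier R" "b \<in> R0" "x = fract R a b" by (metis fractE)
  then have a: "a \<in> R0" using x fract_eq_zero_iff by auto
  have "x \<otimes>\<^bsub>Q\<^esub> fract R b a = fract R (a \<otimes> b) (b \<otimes> a)"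
    unfolding *(3) by (rule fract_mult) (use * a in auto)
  also have "\<dots> = \<one>\<^bsub>Q\<^esub>" unfolding one_Q by (subst fract_eq_iff) (use * a nonzero_mult in \<open>auto simp: m_comm\<close>)
  finally show "\<exists>y\<in>carrier Q. x \<otimes>\<^bsub>Q\<^esub> y = \<one>\<^bsub>Q\<^esub>" using fract_in[of b a] * a by auto
qed

lemma fract_embed_hom: "fract_embed R \<in> Ring.ring_hom R Q"
proof (rule ring_hom_memI)
  fix a c assume "a \<in> carrier R" "c \<in> carrier R"
  then show "fract_embed R (a \<otimes> c) = fract_embed R a \<otimes>\<^bsub>Q\<^esub> fract_embed R c"
    "fract_embed R (a \<oplus> c) = fract_embed R a \<oplus>\<^bsub>Q\<^esub> fract_embed R c"
    unfolding fract_embed_def by (simp_all add: fract_mult fract_add)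
qed (simp_all add: fract_embed_def fract_in one_Q)

end

lemma fract_map_fract:
  assumes "domain R" "domain S" and h: "h \<in> Ring.ring_hom R S" and inj: "inj_on h (carrier R)"
    and a: "a \<in> carrier R" "b \<in> carrier R - {\<zero>\<^bsub>R\<^esub>}"
  shows "fract_map R S h (fract R a b) = fract S (h a) (h b)"
proof -
  interpret R: domain R by fact
  interpret S: domain S by fact
  have hc: "h a \<in> carrier S" if "a \<in> carrier R" for a using ring_hom_closed[OF h that] .
  have hn: "h b \<in> carrier S - {\<zero>\<^bsub>S\<^esub>}" if "b \<in> carrier R - {\<zero>\<^bsub>R\<^esub>}" for b
    using hc that inj_onD[OF inj, of b "\<zero>\<^bsub>R\<^esub>"] ring_hom_zero[OF h R.ring_axioms S.ring_axioms] by auto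
  have "fract_map R S h (fract R a b) = (\<Union>(a, b)\<in>fract R a b. fract S (h a) (h b))"
    unfolding fract_map_def using R.fract_in[OF a] by simp
  also have "\<dots> = fract S (h a) (h b)"
  proof (rule R.UN_fract[OF a])
    fix a' b' assume *: "a' \<in> carrier R" "b' \<in> carrier R - {\<zero>\<^bsub>R\<^esub>}" "a \<otimes>\<^bsub>R\<^esub> b' = a' \<otimes>\<^bsub>R\<^esub> b"
    have "h a \<otimes>\<^bsub>S\<^esub> h b' = h a' \<otimes>\<^bsub>S\<^esub> h b"
      using ring_hom_mult[OF h, of a b'] ring_hom_mult[OF h, of a' b] * a by simp
    then show "fract S (h a') (h b') = fract S (h a) (h b)"
      using S.fract_eq_iff[OF hc[OF *(1)] hn[OF *(2)] hc[OF a(1)] hn[OF a(2)]] by simp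
  qed
  finally show ?thesis .
qed

lemma fract_map_hom:
  assumes "domain R" "domain S" and h: "h \<in> Ring.ring_hom R S" and inj: "inj_on h (carrier R)"
  shows "fract_map R S h \<in> Ring.ring_hom (quotient_field R) (quotient_field S)"
proof -
  interpret R: domain R by fact
  interpret S: domain S by fact
  note fm = fract_map_fract[OF assms]
  have hc: "h a \<in> carrier S" if "a \<in> carrier R" for a using ring_hom_closed[OF h that] .
  have hn: "h b \<in> carrier S - {\<zero>\<^bsub>S\<^esub>}" if "b \<in> carrier R - {\<zero>\<^bsub>R\<^esub>}" for b
    using hc that inj_onD[OF inj, of b "\<zero>\<^bsub>R\<^esub>"] ring_hom_zero[OF h R.ring_axioms S.ring_axioms] by auto
  show ?thesis
  proof (rule ring_hom_memI)
    fix x assume "x \<in> carrier (quotient_field R)"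
    then obtain a b where *: "a \<in> carrier R" "b \<in> carrier R - {\<zero>\<^bsub>R\<^esub>}" "x = fract R a b" by (metis R.fractE)
    show "fract_map R S h x \<in> carrier (quotient_field S)"
      unfolding *(3) fm[OF *(1,2)] by (rule S.fract_in[OF hc[OF *(1)] hn[OF *(2)]])
  next
    fix x y assume "x \<in> carrier (quotient_field R)" "y \<in> carrier (quotient_field R)"
    then obtain a b c d where *: "a \<in> carrier R" "b \<in> carrier R - {\<zero>\<^bsub>R\<^esub>}" "x = fract R a b"
      "c \<in> carrier R" "d \<in> carrier R - {\<zero>\<^bsub>R\<^esub>}" "y = fract R c d" by (metis R.fractE)
    have car: "b \<in> carrier R" "d \<in> carrier R" using * by auto
    have ac: "a \<otimes>\<^bsub>R\<^esub> c \<in> carrier R" "a \<otimes>\<^bsub>R\<^esub> d \<oplus>\<^bsub>R\<^esub> c \<otimes>\<^bsub>R\<^esub> b \<in> carrier R" using * by auto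
    note h' = hc[OF *(1)] hn[OF *(2)] hc[OF *(4)] hn[OF *(5)]
    show "fract_map R S h (x \<otimes>\<^bsub>quotient_field R\<^esub> y) = fract_map R S h x \<otimes>\<^bsub>quotient_field S\<^esub> fract_map R S h y"
      unfolding *(3,6) R.fract_mult[OF *(1,2,4,5)] fm[OF *(1,2)] fm[OF *(4,5)] fm[OF ac(1) R.nonzero_mult[OF *(2,5)]]
        S.fract_mult[OF h'] ring_hom_mult[OF h *(1,4)] ring_hom_mult[OF h car] ..
    show "fract_map R S h (x \<oplus>\<^bsub>quotient_field R\<^esub> y) = fract_map R S h x \<oplus>\<^bsub>quotient_field S\<^esub> fract_map R S h y"
      unfolding *(3,6) R.fract_add[OF *(1,2,4,5)] fm[OF *(1,2)] fm[OF *(4,5)] fm[OF ac(2) R.nonzero_mult[OF *(2,5)]]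
        S.fract_add[OF h'] ring_hom_mult[OF h car]
      using * car by (simp add: ring_hom_add[OF h] ring_hom_mult[OF h])
  next
    show "fract_map R S h \<one>\<^bsub>quotient_field R\<^esub> = \<one>\<^bsub>quotient_field S\<^esub>"
      unfolding R.one_Q S.one_Q fm[OF R.one_closed R.one_R0] ring_hom_one[OF h] ..
  qed
qed

lemma fract_map_inj:
  assumes "domain R" "domain S" and h: "h \<in> Ring.ring_hom R S" and inj: "inj_on h (carrier R)"
  shows "inj_on (fract_map R S h) (carrier (quotient_field R))"
proof -
  interpret R: domain R by fact
  interpret S: domain S by fact
  show ?thesis
    using non_trivial_field_hom_is_inj[OF fract_map_hom[OF assms] R.quotient_field S.quotient_field] by simp
qed

section \<open>Finite groups of field automorphisms\<close>

context domain
begin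

text \<open>Polynomials are coefficient lists with the leading coefficient first, so the list
  \<open>[\<one>, \<ominus> z]\<close> is the linear factor with root \<open>z\<close>.\<close>

definition root_poly :: "'a set \<Rightarrow> 'a list" where
  "root_poly Y = finprod (poly_ring R) (\<lambda>z. [\<one>, \<ominus> z]) Y"

lemma linear_factor: "subring K R \<Longrightarrow> z \<in> K \<Longrightarrow> polynomial K [\<one>, \<ominus> z]"
  using subringE(3,5) by (intro polynomialI) auto

lemma root_poly_empty: "root_poly {} = [\<one>]"
proof -
  interpret UP: cring "poly_ring R" by (rule univ_poly_is_cring[OF carrier_is_subring])
  show ?thesis unfolding root_poly_def by (simp add: univ_poly_one)
qed

lemma root_poly_insert:
  assumes "finite Y" "Y \<subseteq> carrier R" "z \<in> carrier R" "z \<notin> Y"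
  shows "root_poly (insert z Y) = poly_mult [\<one>, \<ominus> z] (root_poly Y)"
proof -
  interpret UP: cring "poly_ring R" by (rule univ_poly_is_cring[OF carrier_is_subring])
  have lin: "[\<one>, \<ominus> z] \<in> carrier (poly_ring R)" if "z \<in> carrier R" for z
    using linear_factor[OF carrier_is_subring that] by (simp add: univ_poly_carrier)
  show ?thesis unfolding root_poly_def
    by (subst UP.finprod_insert) (use assms lin in \<open>auto simp: univ_poly_mult Pi_def\<close>)
qed

text \<open>The subring \<open>K\<close> is kept general so that the same product gives coefficients
  in the whole field or in the embedded affine ring.\<close>

lemma root_poly_monic:
  assumes "subring K R" "finite Y" "Y \<subseteq> K"
  shows "polynomial K (root_poly Y) \<and> root_poly Y \<noteq> [] \<and> hd (root_poly Y) = \<one> \<and> length (root_poly Y) = Suc (card Y)"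
  using assms(2,3)
proof (induction Y rule: finite_induct)
  case empty
  then show ?case using one_is_polynomial[OF assms(1)] by (simp add: root_poly_empty)
next
  case (insert z Y)
  have car: "z \<in> K" "z \<in> carrier R" "Y \<subseteq> carrier R" using insert subringE(1)[OF assms(1)] by auto
  have IH: "polynomial K (root_poly Y)" "root_poly Y \<noteq> []" "hd (root_poly Y) = \<one>" "length (root_poly Y) = Suc (card Y)"
    using insert by auto
  note lin = linear_factor[OF assms(1) car(1)]
  have "poly_mult [\<one>, \<ominus> z] (root_poly Y) \<noteq> []"
    using poly_mult_integral[OF assms(1) lin IH(1)] IH(2) by auto
  moreover have "hd (poly_mult [\<one>, \<ominus> z] (root_poly Y)) = \<one>"
    using poly_mult_lead_coeff[OF assms(1) lin IH(1) _ IH(2)] IH(3) by (simp del: poly_mult.simps)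
  moreover from this have "length (poly_mult [\<one>, \<ominus> z] (root_poly Y)) = Suc (Suc (card Y))"
    using poly_mult_degree_eq[OF assms(1) lin IH(1)] IH(2,4)
    by (cases "poly_mult [\<one>, \<ominus> z] (root_poly Y)") (simp_all del: poly_mult.simps)
  ultimately show ?case
    using poly_mult_closed[OF assms(1) lin IH(1)] insert(1,2)
    unfolding root_poly_insert[OF insert(1) car(3,2) insert(2)] by (simp del: poly_mult.simps)
qed

lemma root_poly_eval:
  assumes "finite Y" "Y \<subseteq> carrier R" "z \<in> Y"
  shows "eval (root_poly Y) z = \<zero>"
proof -
  define T where "T = Y - {z}"
  have T: "finite T" "T \<subseteq> carrier R" "z \<notin> T" "Y = insert z T" and z: "z \<in> carrier R"
    using assms unfolding T_def by auto
  have p: "polynomial (carrier R) (root_poly T)" using root_poly_monic[OF carrier_is_subring T(1,2)] by simp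
  have "eval (root_poly Y) z = eval [\<one>, \<ominus> z] z \<otimes> eval (root_poly T) z"
    unfolding T(4) root_poly_insert[OF T(1,2) z T(3)]
    by (rule eval_poly_mult) (use z polynomial_incl[OF p] in auto)
  also have "eval [\<one>, \<ominus> z] z = \<zero>" using z by (simp add: r_neg)
  finally show ?thesis using eval_poly_in_carrier[OF carrier_is_subring p z] by simp
qed

lemma root_poly_map:
  assumes h: "h \<in> Ring.ring_hom R R" "inj_on h (carrier R)" and Y: "finite Y" "Y \<subseteq> carrier R"
  shows "map h (root_poly Y) = root_poly (h ` Y)"
  using Y
proof (induction Y rule: finite_induct)
  case empty
  then show ?case using ring_hom_one[OF h(1)] by (simp add: root_poly_empty)
next
  case (insert z Y)
  interpret h: ring_hom_ring R R h
    by (rule ring_hom_ringI2[OF ring_axioms ring_axioms h(1)])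
  have car: "z \<in> carrier R" "Y \<subseteq> carrier R" using insert by auto
  have hc: "h z \<in> carrier R" "h ` Y \<subseteq> carrier R" "h z \<notin> h ` Y"
    using car insert(2) inj_on_image_mem_iff[OF h(2) car(1,2)] by auto
  note P = root_poly_monic[OF carrier_is_subring insert(1) car(2)]
  note P' = root_poly_monic[OF carrier_is_subring, of "insert z Y"]
  have "map h (root_poly (insert z Y)) = normalize (map h (root_poly (insert z Y)))"
    using P' insert ring_hom_one[OF h(1)] by (cases "root_poly (insert z Y)") auto
  also have "\<dots> = poly_mult (map h [\<one>, \<ominus> z]) (map h (root_poly Y))"
    unfolding root_poly_insert[OF insert(1) car(2,1) insert(2)]
    by (rule h.poly_mult_hom') (use car P polynomial_incl in auto)
  also have "\<dots> = poly_mult [\<one>, \<ominus> (h z)] (root_poly (h ` Y))"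
    using insert car by (simp add: ring_hom_one[OF h(1)] del: poly_mult.simps)
  also have "\<dots> = root_poly (h ` insert z Y)"
    using root_poly_insert[OF _ hc(2,1,3)] insert(1) by simp
  finally show ?case .
qed

end

section \<open>Artin's argument for a finite group acting on a field\<close>

locale finite_field_action = field L + G: group G for L (structure) and G :: "('g, 'm) monoid_scheme" +
  fixes \<phi> :: "'g \<Rightarrow> 'a \<Rightarrow> 'a"
  assumes finite_G: "finite (carrier G)"
    and act_hom: "g \<in> carrier G \<Longrightarrow> \<phi> g \<in> Ring.ring_hom L L"
    and act_mult: "g \<in> carrier G \<Longrightarrow> h \<in> carrier G \<Longrightarrow> x \<in> carrier L \<Longrightarrow> \<phi> (g \<otimes>\<^bsub>G\<^esub> h) x = \<phi> g (\<phi> h x)"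
    and act_one: "x \<in> carrier L \<Longrightarrow> \<phi> \<one>\<^bsub>G\<^esub> x = x"
begin

definition fixed :: "'a set" where
  "fixed = {x \<in> carrier L. \<forall>g\<in>carrier G. \<phi> g x = x}"

definition orb :: "'a \<Rightarrow> 'a set" where
  "orb x = (\<lambda>g. \<phi> g x) ` carrier G"

lemma act_inj: "g \<in> carrier G \<Longrightarrow> inj_on (\<phi> g) (carrier L)"
  by (rule non_trivial_field_hom_is_inj[OF act_hom field_axioms field_axioms])

lemma fixed_subring: "subring fixed L"
  unfolding fixed_def
proof (rule subringI)
  have "\<phi> g (\<ominus> x) = \<ominus> \<phi> g x" if "g \<in> carrier G" "x \<in> carrier L" for g x
  proof -
    interpret h: ring_hom_ring L L "\<phi> g"
      by (rule ring_hom_ringI2[OF ring_axioms ring_axioms act_hom[OF that(1)]])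
    show ?thesis using that by simp
  qed
  then show "\<ominus> x \<in> {x \<in> carrier L. \<forall>g\<in>carrier G. \<phi> g x = x}"
    if "x \<in> {x \<in> carrier L. \<forall>g\<in>carrier G. \<phi> g x = x}" for x using that by simp
qed (auto simp: ring_hom_one[OF act_hom] ring_hom_mult[OF act_hom] ring_hom_add[OF act_hom])

lemma fixed_subfield: "subfield fixed L"
proof (rule subfieldI'[OF fixed_subring])
  fix x assume "x \<in> fixed - {\<zero>}"
  then have x: "x \<in> carrier L" "x \<noteq> \<zero>" "\<And>g. g \<in> carrier G \<Longrightarrow> \<phi> g x = x" unfolding fixed_def by auto
  then have u: "x \<in> Units L" using field_Units by auto
  have "\<phi> g (inv x) = inv x" if g: "g \<in> carrier G" for g
  proof -
    have "\<phi> g (inv x) \<otimes> x = \<phi> g (inv x \<otimes> x)"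
      using ring_hom_mult[OF act_hom[OF g], of "inv x" x] u x g by simp
    also have "\<dots> = \<one>" using u ring_hom_one[OF act_hom[OF g]] by (simp add: Units_l_inv)
    finally show ?thesis
      using comm_inv_char[of x "\<phi> g (inv x)"] x(1) u ring_hom_closed[OF act_hom[OF g]] m_comm by (metis Units_inv_closed)
  qed
  then show "inv x \<in> fixed" unfolding fixed_def using u by auto
qed

lemma orb_facts:
  assumes "x \<in> carrier L"
  shows "finite (orb x)" "orb x \<subseteq> carrier L" "x \<in> orb x" "g \<in> carrier G \<Longrightarrow> \<phi> g ` orb x = orb x"
proof -
  show "finite (orb x)" unfolding orb_def using finite_G by simp
  show "orb x \<subseteq> carrier L" unfolding orb_def using ring_hom_closed[OF act_hom] assms by auto
  show "x \<in> orb x" unfolding orb_def using act_one[OF assms] by (metis G.one_closed imageI)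
  show "\<phi> g ` orb x = orb x" if g: "g \<in> carrier G"
  proof -
    have "\<phi> g ` orb x = (\<lambda>h. \<phi> h x) ` ((\<lambda>h. g \<otimes>\<^bsub>G\<^esub> h) ` carrier G)"
      unfolding orb_def image_image using act_mult[OF g _ assms] by (intro image_cong) auto
    also have "(\<lambda>h. g \<otimes>\<^bsub>G\<^esub> h) ` carrier G = carrier G" using G.surj_const_mult[OF g] .
    finally show ?thesis unfolding orb_def .
  qed
qed

text \<open>Group elements permute the orbit and hence fix the coefficients of its root polynomial.
  With \<open>A\<close> the whole field this yields normality and separability, with
  \<open>A\<close> the affine ring integrality over the invariants.\<close>

lemma orbit_poly_fixed:
  assumes x: "x \<in> carrier L" and A: "subring A L" "orb x \<subseteq> A"
  shows "root_poly (orb x) \<in> carrier ((A \<inter> fixed)[X])"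
proof -
  note P = root_poly_monic[OF A(1) orb_facts(1)[OF x] A(2)]
  have set: "set (root_poly (orb x)) \<subseteq> A" using P polynomial_incl by auto
  have "c \<in> fixed" if c: "c \<in> set (root_poly (orb x))" for c
  proof -
    have "\<phi> g c = c" if g: "g \<in> carrier G" for g
    proof -
      have "map (\<phi> g) (root_poly (orb x)) = map id (root_poly (orb x))"
        using root_poly_map[OF act_hom[OF g] act_inj[OF g] orb_facts(1,2)[OF x]] orb_facts(4)[OF x g] by simp
      then show ?thesis using c unfolding map_eq_conv by simp
    qed
    then show ?thesis unfolding fixed_def using c set subringE(1)[OF A(1)] by auto
  qed
  then show ?thesis using set P unfolding univ_poly_carrier[symmetric] by (intro polynomialI) auto
qed

text \<open>The minimal polynomial divides the orbit polynomial, and every orbit element is one of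
  its roots; so it has as many distinct roots as its degree allows.\<close>

lemma fixed_Irr:
  assumes x: "x \<in> carrier L"
  shows "splitted (Irr fixed x)" and "alg_mult (Irr fixed x) r \<le> 1"
proof -
  note sub = fixed_subring fixed_subfield
  note P = root_poly_monic[OF carrier_is_subring orb_facts(1,2)[OF x]]
  have K: "carrier L \<inter> fixed = fixed" unfolding fixed_def by auto
  have Q: "root_poly (orb x) \<in> carrier (fixed[X])"
    using orbit_poly_fixed[OF x carrier_is_subring orb_facts(2)[OF x]] unfolding K .
  have ev: "eval (root_poly (orb x)) x = \<zero>" by (rule root_poly_eval[OF orb_facts(1-3)[OF x]])
  have alg: "(algebraic over fixed) x" by (rule algebraicI[OF Q _ ev]) (use P in simp)
  define p where "p = Irr fixed x"
  have p: "p \<in> carrier (fixed[X])" "hd p = \<one>" "eval p x = \<zero>"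
    using IrrE(1,3,4)[OF fixed_subfield x alg] unfolding p_def by auto
  have pn: "p \<noteq> []" using IrrE(2)[OF fixed_subfield x alg] pirreducibleE(1)[OF fixed_subring p(1)] unfolding p_def by simp
  have poly: "polynomial fixed p" using p(1) unfolding univ_poly_carrier .
  have setp: "set p \<subseteq> fixed" using polynomial_incl[OF poly] .
  have car: "p \<in> carrier (poly_ring L)"
    using carrier_polynomial[OF fixed_subring poly] unfolding univ_poly_carrier .
  have le: "length p - 1 \<le> card (orb x)"
    using pdivides_imp_degree_le[OF fixed_subring p(1) Q] P Irr_minimal[OF fixed_subfield x alg Q ev]
    unfolding p_def by simp
  have "orb x \<subseteq> set_mset (roots p)"
  proof
    fix y assume "y \<in> orb x"
    then obtain g where g: "g \<in> carrier G" "y = \<phi> g x" unfolding orb_def by auto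
    interpret h: ring_hom_ring L L "\<phi> g"
      by (rule ring_hom_ringI2[OF ring_axioms ring_axioms act_hom[OF g(1)]])
    have "map (\<phi> g) p = p" using setp g(1) unfolding fixed_def by (intro map_idI) auto
    moreover have "set p \<subseteq> carrier L" using setp unfolding fixed_def by auto
    ultimately have "eval p y = \<zero>"
      using h.eval_hom'[OF x, of p] p(3) h.hom_zero unfolding g(2) by simp
    then show "y \<in> set_mset (roots p)"
      unfolding roots_mem_iff_is_root[OF car] is_root_def
      using pn \<open>y \<in> orb x\<close> orb_facts(2)[OF x] by auto
  qed
  then have "card (orb x) \<le> card (set_mset (roots p))" by (intro card_mono) auto
  moreover have "card (set_mset (roots p)) = size (mset_set (set_mset (roots p)))" by simp
  ultimately have c: "size (roots p) \<le> size (mset_set (set_mset (roots p)))"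
    using size_roots_le_degree[OF car] le by linarith
  \<comment> \<open>The multiset of roots is no larger than the set of distinct roots, so no root is
    repeated.\<close>
  have eq: "mset_set (set_mset (roots p)) = roots p"
    using mset_set_set_mset_msubset[of "roots p"] c by (metis mset_subset_size subset_mset.le_less not_le)
  have "card (orb x) \<le> size (roots p)"
    using \<open>card (orb x) \<le> card (set_mset (roots p))\<close>
      \<open>card (set_mset (roots p)) = size (mset_set (set_mset (roots p)))\<close> unfolding eq by simp
  then show "splitted (Irr fixed x)"
    unfolding splitted_def p_def[symmetric] using size_roots_le_degree[OF car] le by linarith
  have "alg_mult p r = count (mset_set (set_mset (roots p))) r"
    unfolding alg_mult_eq_count_roots[OF car] eq ..
  also have "\<dots> \<le> 1" by (simp add: count_mset_set')
  finally show "alg_mult (Irr fixed x) r \<le> 1" unfolding p_def .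
qed

end

section \<open>Function rings as integral domains\<close>

lemma fun_ring_simps [simp]:
  "carrier (fun_ring V A) = A"
  "f \<otimes>\<^bsub>fun_ring V A\<^esub> g = (\<lambda>p\<in>V. f p * g p)"
  "\<one>\<^bsub>fun_ring V A\<^esub> = (\<lambda>p\<in>V. 1)"
  "\<zero>\<^bsub>fun_ring V A\<^esub> = (\<lambda>p\<in>V. 0)"
  "f \<oplus>\<^bsub>fun_ring V A\<^esub> g = (\<lambda>p\<in>V. f p + g p)"
  unfolding fun_ring_def by simp_all

lemma restrict_const_eq_iff: "(\<lambda>p\<in>V. f p) = (\<lambda>p\<in>V. g p) \<longleftrightarrow> (\<forall>p\<in>V. f p = g p)"
  by (metis restrict_apply' restrict_ext)

lemma extensional_eq_restrict_iff: "f \<in> extensional V \<Longrightarrow> f = (\<lambda>p\<in>V. g p) \<longleftrightarrow> (\<forall>p\<in>V. f p = g p)"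
  by (metis extensional_restrict restrict_const_eq_iff)

lemma fun_ring_cring:
  assumes S: "fun_alg S" and A: "\<And>f. f \<in> A \<longleftrightarrow> f \<in> extensional V \<and> f \<in> S"
    and cong: "\<And>f g. f \<in> S \<Longrightarrow> (\<And>z. z \<in> V \<Longrightarrow> g z = f z) \<Longrightarrow> g \<in> S"
  shows "cring (fun_ring V A)"
proof -
  interpret S: fun_alg S by fact
  have restr: "restrict f V \<in> A" if "f \<in> S" for f
    unfolding A using cong[OF that, of "restrict f V"] by simp
  have ext: "f \<in> S" if "f \<in> A" for f using that unfolding A by simp
  show ?thesis
  proof (rule cringI)
    show "abelian_group (fun_ring V A)"
    proof (rule abelian_groupI)
      fix f assume f: "f \<in> carrier (fun_ring V A)"
      show "\<zero>\<^bsub>fun_ring V A\<^esub> \<oplus>\<^bsub>fun_ring V A\<^esub> f = f"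
        using f unfolding fun_ring_simps A
        by (intro extensional_eq_restrict_iff[THEN iffD2, symmetric]) simp_all
      have "restrict (\<lambda>p. - f p) V \<in> A" using f ext by (intro restr S.uminus) simp
      moreover have "restrict (\<lambda>p. - f p) V \<oplus>\<^bsub>fun_ring V A\<^esub> f = \<zero>\<^bsub>fun_ring V A\<^esub>"
        unfolding fun_ring_simps by (rule restrict_ext) simp
      ultimately show "\<exists>y\<in>carrier (fun_ring V A). y \<oplus>\<^bsub>fun_ring V A\<^esub> f = \<zero>\<^bsub>fun_ring V A\<^esub>"
        unfolding fun_ring_simps(1) by blast
    next
      show "\<zero>\<^bsub>fun_ring V A\<^esub> \<in> carrier (fun_ring V A)" unfolding fun_ring_simps by (intro restr S.const)
    next
      fix f g assume "f \<in> carrier (fun_ring V A)" "g \<in> carrier (fun_ring V A)"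
      then show "f \<oplus>\<^bsub>fun_ring V A\<^esub> g \<in> carrier (fun_ring V A)"
        unfolding fun_ring_simps by (intro restr S.add ext)
    qed (simp_all add: ac_simps cong: restrict_cong)
    show "comm_monoid (fun_ring V A)"
    proof (rule comm_monoidI)
      fix f assume f: "f \<in> carrier (fun_ring V A)"
      show "\<one>\<^bsub>fun_ring V A\<^esub> \<otimes>\<^bsub>fun_ring V A\<^esub> f = f"
        using f unfolding fun_ring_simps A
        by (intro extensional_eq_restrict_iff[THEN iffD2, symmetric]) simp_all
    next
      show "\<one>\<^bsub>fun_ring V A\<^esub> \<in> carrier (fun_ring V A)" unfolding fun_ring_simps by (intro restr S.const)
    next
      fix f g assume "f \<in> carrier (fun_ring V A)" "g \<in> carrier (fun_ring V A)"
      then show "f \<otimes>\<^bsub>fun_ring V A\<^esub> g \<in> carrier (fun_ring V A)"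
        unfolding fun_ring_simps by (intro restr S.mult ext)
    qed (simp_all add: ac_simps cong: restrict_cong)
  qed (simp add: distrib_right cong: restrict_cong)
qed

lemma fun_ring_domain:
  assumes S: "fun_alg S" and A: "\<And>f. f \<in> A \<longleftrightarrow> f \<in> extensional V \<and> f \<in> S"
    and cong: "\<And>f g. f \<in> S \<Longrightarrow> (\<And>z. z \<in> V \<Longrightarrow> g z = f z) \<Longrightarrow> g \<in> S"
    and ne: "V \<noteq> {}"
    and dom: "\<And>f g a b. f \<in> S \<Longrightarrow> g \<in> S \<Longrightarrow> (\<And>z. z \<in> V \<Longrightarrow> f z * g z = 0) \<Longrightarrow> a \<in> V \<Longrightarrow> f a \<noteq> 0 \<Longrightarrow> b \<in> V \<Longrightarrow> g b = 0"
  shows "domain (fun_ring V A)"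
proof (intro domain.intro domain_axioms.intro)
  show "cring (fun_ring V A)" by (rule fun_ring_cring[OF S A cong])
  obtain z where "z \<in> V" using ne by blast
  then show "\<one>\<^bsub>fun_ring V A\<^esub> \<noteq> \<zero>\<^bsub>fun_ring V A\<^esub>" unfolding fun_ring_simps restrict_const_eq_iff by auto
  fix f g assume fg: "f \<otimes>\<^bsub>fun_ring V A\<^esub> g = \<zero>\<^bsub>fun_ring V A\<^esub>" "f \<in> carrier (fun_ring V A)" "g \<in> carrier (fun_ring V A)"
  then have z: "\<And>z. z \<in> V \<Longrightarrow> f z * g z = 0" unfolding fun_ring_simps restrict_const_eq_iff by blast
  have f: "f \<in> extensional V" "f \<in> S" and g: "g \<in> extensional V" "g \<in> S" using fg(2,3) unfolding fun_ring_simps A by auto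
  show "f = \<zero>\<^bsub>fun_ring V A\<^esub> \<or> g = \<zero>\<^bsub>fun_ring V A\<^esub>"
    unfolding fun_ring_simps extensional_eq_restrict_iff[OF f(1)] extensional_eq_restrict_iff[OF g(1)]
    using dom[OF f(2) g(2) z] by blast
qed

interpretation Ms: affine_locus "carrier_mat n n" "mat_coords n" "{}" "\<lambda>_. 1" "carrier_mat n n" for n
  using affine_locus_mat[OF poly_funs.const[of 1], of n] by simp

text \<open>The whole matrix space is the locus with \<open>d = 1\<close>; the adjoined reciprocal
  is a constant, so regular functions are the polynomials.\<close>

lemma Ms_regular_iff: "f \<in> Ms.regular n \<longleftrightarrow> (\<exists>F\<in>poly_funs (mat_coords n). \<forall>x\<in>carrier_mat n n. f x = F x)"
proof -
  have "F \<in> poly_funs (mat_coords n)" if "F \<in> poly_funs (insert (\<lambda>p. 1 / 1) (mat_coords n))" for F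
    using that
  proof (induction rule: poly_funs.induct)
    case (gen f)
    then show ?case
    proof
      assume "f = (\<lambda>p. 1 / 1)"
      then show ?thesis using poly_funs.const by simp
    qed (rule poly_funs.gen)
  qed (rule poly_funs.intros; assumption?)+
  moreover have "F \<in> poly_funs (insert (\<lambda>p. 1 / 1) (mat_coords n))" if "F \<in> poly_funs (mat_coords n)" for F
    using poly_funs_mono[OF that] by blast
  ultimately show ?thesis unfolding Ms.regular_iff by blast
qed

lemma O_M_iff: "f \<in> O_M n \<longleftrightarrow> f \<in> extensional (M_space n) \<and> f \<in> Ms.regular n"
proof (cases "f \<in> extensional (M_space n)")
  case True
  then show ?thesis unfolding O_M_def M_space_def Ms.regular_def by (simp add: extensional_restrict)
next
  case False
  then show ?thesis unfolding O_M_def regular_funs_def by simp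
qed

lemma mat_poly_domain:
  assumes F: "F \<in> poly_funs (mat_coords n)" and G: "G \<in> poly_funs (mat_coords n)"
    and FG: "\<And>x. x \<in> carrier_mat n n \<Longrightarrow> F x * G x = 0"
    and a: "a \<in> carrier_mat n n" "F a \<noteq> 0" and b: "b \<in> carrier_mat n n"
  shows "G b = 0"
proof -
  define K where "K = {..<n} \<times> {..<n}"
  define \<mu> where "\<mu> q = mat n n q" for q :: "nat \<times> nat \<Rightarrow> complex"
  interpret P: fun_alg "poly_funs (coord_funs K)" by (rule fun_alg_poly_funs)
  have comp: "(\<lambda>q. H (\<mu> q)) \<in> poly_funs (coord_funs K)" if "H \<in> poly_funs (mat_coords n)" for H
  proof (rule P.poly_funs_comp[OF that])
    fix c assume "c \<in> mat_coords n"
    then obtain i j where c: "c = (\<lambda>x. x $$ (i, j))" "i < n" "j < n" unfolding mat_coords_def by blast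
    have "(\<lambda>q. c (\<mu> q)) = (\<lambda>q. q (i, j))" unfolding c(1) \<mu>_def using c(2,3) by simp
    then show "(\<lambda>q. c (\<mu> q)) \<in> poly_funs (coord_funs K)" using coord_in[of "(i, j)" K] c(2,3) unfolding K_def by simp
  qed
  have \<mu>: "\<mu> (($$) x) = x" if "x \<in> carrier_mat n n" for x using that unfolding \<mu>_def by (intro eq_matI) auto
  have car: "\<mu> q \<in> carrier_mat n n" for q unfolding \<mu>_def by simp
  have "F (\<mu> (($$) a)) \<noteq> 0" using \<mu>[OF a(1)] a(2) by simp
  from poly_funs_domain[OF comp[OF F] comp[OF G] FG[OF car] this]
  have "G (\<mu> (($$) b)) = 0" .
  then show ?thesis using \<mu>[OF b] by simp
qed

interpretation ring_e: domain "ring_M_Omega_e n" for n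
proof (rule fun_ring_domain[where S = "R_e n"])
  show "fun_alg (R_e n)" by (rule R_e.fun_alg_axioms)
  show "f \<in> O_M_Omega_e n \<longleftrightarrow> f \<in> extensional (M_Omega_e n) \<and> f \<in> R_e n" for f by (rule O_M_Omega_e_iff)
  show "f \<in> R_e n \<Longrightarrow> (\<And>z. z \<in> M_Omega_e n \<Longrightarrow> g z = f z) \<Longrightarrow> g \<in> R_e n" for f g by (rule R_e_cong)
  show "M_Omega_e n \<noteq> {}" by (rule M_Omega_e_nonempty)
  show "f \<in> R_e n \<Longrightarrow> g \<in> R_e n \<Longrightarrow> (\<And>z. z \<in> M_Omega_e n \<Longrightarrow> f z * g z = 0) \<Longrightarrow>
    a \<in> M_Omega_e n \<Longrightarrow> f a \<noteq> 0 \<Longrightarrow> b \<in> M_Omega_e n \<Longrightarrow> g b = 0" for f g a b by (rule R_e_domain)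
qed

interpretation ring_m: domain "ring_M n" for n
proof (rule fun_ring_domain[OF Ms.regular_fun_alg O_M_iff])
  show "M_space n \<noteq> {}" unfolding M_space_def by (metis empty_iff zero_carrier_mat)
  show "g \<in> Ms.regular n" if "f \<in> Ms.regular n" "\<And>z. z \<in> M_space n \<Longrightarrow> g z = f z" for f g
    using Ms.regular_cong[OF that(1)] that(2) unfolding M_space_def by blast
  fix f g a b assume fg: "f \<in> Ms.regular n" "g \<in> Ms.regular n" and 0: "\<And>z. z \<in> M_space n \<Longrightarrow> f z * g z = 0"
    and ab: "a \<in> M_space n" "f a \<noteq> 0" "b \<in> M_space n"
  obtain F G where F: "F \<in> poly_funs (mat_coords n)" "\<And>x. x \<in> carrier_mat n n \<Longrightarrow> f x = F x"
    and G: "G \<in> poly_funs (mat_coords n)" "\<And>x. x \<in> carrier_mat n n \<Longrightarrow> g x = G x"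
    using fg unfolding Ms_regular_iff by metis
  show "g b = 0"
    using mat_poly_domain[OF F(1) G(1), of a b] 0 ab F(2) G(2) unfolding M_space_def by simp
qed

section \<open>The function fields\<close>

text \<open>Admissible denominators: nonzero somewhere, which for a domain is the same as being a
  nonzero element; zeros are allowed.\<close>

definition nz :: "nat \<Rightarrow> ((nat \<times> nat \<Rightarrow> complex) \<times> complex mat \<Rightarrow> complex) set" where
  "nz n = {g \<in> R_e n. \<exists>z\<in>M_Omega_e n. g z \<noteq> 0}"

text \<open>Fractions written with total functions as representatives.\<close>

definition ratio where
  "ratio n f g = fract (ring_M_Omega_e n) (restrict f (M_Omega_e n)) (restrict g (M_Omega_e n))"

lemma restrict_R_e: "f \<in> R_e n \<Longrightarrow> restrict f (M_Omega_e n) \<in> carrier (ring_M_Omega_e n)"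
  unfolding fun_ring_simps R_e_def by simp

lemma restrict_nz: "g \<in> nz n \<Longrightarrow> restrict g (M_Omega_e n) \<in> carrier (ring_M_Omega_e n) - {\<zero>\<^bsub>ring_M_Omega_e n\<^esub>}"
  using restrict_R_e[of g n] unfolding nz_def fun_ring_simps restrict_const_eq_iff[symmetric] by (auto simp: restrict_const_eq_iff)

lemma nz_mult: "f \<in> nz n \<Longrightarrow> g \<in> nz n \<Longrightarrow> (\<lambda>z. f z * g z) \<in> nz n"
  unfolding nz_def using R_e.mult R_e_domain[of f n g] by blast

lemma nz_const: "c \<noteq> 0 \<Longrightarrow> (\<lambda>_. c) \<in> nz n"
  unfolding nz_def using R_e.const M_Omega_e_nonempty[of n] by blast

lemma nz_R_e: "g \<in> nz n \<Longrightarrow> g \<in> R_e n" unfolding nz_def by simp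

lemma field_F_ne: "field (F_ne n)" unfolding F_ne_def by (rule ring_e.quotient_field)

lemma ratio_in: "f \<in> R_e n \<Longrightarrow> g \<in> nz n \<Longrightarrow> ratio n f g \<in> carrier (F_ne n)"
  unfolding ratio_def F_ne_def by (rule ring_e.fract_in[OF restrict_R_e restrict_nz])

lemma ratioE:
  assumes "y \<in> carrier (F_ne n)"
  obtains f g where "f \<in> R_e n" "g \<in> nz n" "y = ratio n f g"
proof -
  obtain a b where ab: "a \<in> carrier (ring_M_Omega_e n)" "b \<in> carrier (ring_M_Omega_e n) - {\<zero>\<^bsub>ring_M_Omega_e n\<^esub>}"
    "y = fract (ring_M_Omega_e n) a b"
    using assms unfolding F_ne_def by (rule ring_e.fractE)
  have a: "a \<in> extensional (M_Omega_e n)" "a \<in> R_e n" and b: "b \<in> extensional (M_Omega_e n)" "b \<in> R_e n"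
    using ab(1,2) unfolding fun_ring_simps Diff_iff O_M_Omega_e_iff by auto
  have "b \<in> nz n" unfolding nz_def using b(2) ab(2) extensional_eq_restrict_iff[OF b(1), of "\<lambda>_. 0"] by auto
  then show ?thesis
    using that[of a b] a ab(3) b(1) unfolding ratio_def by (simp add: extensional_restrict)
qed

lemma ratio_eq_iff:
  assumes "f \<in> R_e n" "g \<in> nz n" "f' \<in> R_e n" "g' \<in> nz n"
  shows "ratio n f g = ratio n f' g' \<longleftrightarrow> (\<forall>z\<in>M_Omega_e n. f z * g' z = f' z * g z)"
  unfolding ratio_def
    ring_e.fract_eq_iff[OF restrict_R_e[OF assms(1)] restrict_nz[OF assms(2)] restrict_R_e[OF assms(3)] restrict_nz[OF assms(4)]]
  unfolding fun_ring_simps restrict_const_eq_iff by simp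

lemma ratio_cong: "(\<And>z. z \<in> M_Omega_e n \<Longrightarrow> f z = f' z) \<Longrightarrow> (\<And>z. z \<in> M_Omega_e n \<Longrightarrow> g z = g' z) \<Longrightarrow> ratio n f g = ratio n f' g'"
  unfolding ratio_def by (simp cong: restrict_cong)

lemma ratio_mult:
  assumes "f \<in> R_e n" "g \<in> nz n" "f' \<in> R_e n" "g' \<in> nz n"
  shows "ratio n f g \<otimes>\<^bsub>F_ne n\<^esub> ratio n f' g' = ratio n (\<lambda>z. f z * f' z) (\<lambda>z. g z * g' z)"
  unfolding ratio_def F_ne_def
    ring_e.fract_mult[OF restrict_R_e[OF assms(1)] restrict_nz[OF assms(2)] restrict_R_e[OF assms(3)] restrict_nz[OF assms(4)]]
  by (simp cong: restrict_cong)

lemma ratio_add: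
  assumes "f \<in> R_e n" "g \<in> nz n" "f' \<in> R_e n" "g' \<in> nz n"
  shows "ratio n f g \<oplus>\<^bsub>F_ne n\<^esub> ratio n f' g' = ratio n (\<lambda>z. f z * g' z + f' z * g z) (\<lambda>z. g z * g' z)"
  unfolding ratio_def F_ne_def
    ring_e.fract_add[OF restrict_R_e[OF assms(1)] restrict_nz[OF assms(2)] restrict_R_e[OF assms(3)] restrict_nz[OF assms(4)]]
  by (simp cong: restrict_cong)

lemma ratio_one: "\<one>\<^bsub>F_ne n\<^esub> = ratio n (\<lambda>_. 1) (\<lambda>_. 1)" and ratio_zero: "\<zero>\<^bsub>F_ne n\<^esub> = ratio n (\<lambda>_. 0) (\<lambda>_. 1)"
  unfolding F_ne_def ring_e.one_Q ring_e.zero_Q ratio_def fun_ring_simps by simp_all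

lemma fract_embed_ratio: "fract_embed (ring_M_Omega_e n) (restrict f (M_Omega_e n)) = ratio n f (\<lambda>_. 1)"
  unfolding fract_embed_def ratio_def by simp

lemma fract_embed_image: "fract_embed (ring_M_Omega_e n) ` O_M_Omega_e n = (\<lambda>f. ratio n f (\<lambda>_. 1)) ` R_e n"
proof -
  have "f \<in> O_M_Omega_e n \<longleftrightarrow> f \<in> (\<lambda>f. restrict f (M_Omega_e n)) ` R_e n" for f
  proof
    assume "f \<in> O_M_Omega_e n"
    then have "f \<in> R_e n" "restrict f (M_Omega_e n) = f" unfolding O_M_Omega_e_iff by (simp_all add: extensional_restrict)
    then show "f \<in> (\<lambda>f. restrict f (M_Omega_e n)) ` R_e n" by (intro image_eqI[of _ _ f]) simp_all
  next
    assume "f \<in> (\<lambda>f. restrict f (M_Omega_e n)) ` R_e n"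
    then show "f \<in> O_M_Omega_e n" using restrict_R_e by auto
  qed
  then have eq: "O_M_Omega_e n = (\<lambda>f. restrict f (M_Omega_e n)) ` R_e n" by blast
  have "fract_embed (ring_M_Omega_e n) ` (\<lambda>f. restrict f (M_Omega_e n)) ` R_e n = (\<lambda>f. ratio n f (\<lambda>_. 1)) ` R_e n"
    unfolding image_image fract_embed_ratio ..
  then show ?thesis unfolding eq[symmetric] .
qed

section \<open>Invariants and the pullback of function fields\<close>

lemma fun_act_hom:
  assumes \<sigma>: "\<sigma> \<in> carrier (Sigma_grp n)"
  shows "fun_act n \<sigma> \<in> Ring.ring_hom (ring_M_Omega_e n) (ring_M_Omega_e n)"
    and "inj_on (fun_act n \<sigma>) (carrier (ring_M_Omega_e n))"
proof -
  interpret \<Sigma>: group "Sigma_grp n" by (rule group_Sigma_grp)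
  note inv = \<Sigma>.inv_closed[OF \<sigma>]
  have act: "act n (inv\<^bsub>Sigma_grp n\<^esub> \<sigma>) z \<in> M_Omega_e n" if "z \<in> M_Omega_e n" for z by (rule act_in[OF inv that])
  show "fun_act n \<sigma> \<in> Ring.ring_hom (ring_M_Omega_e n) (ring_M_Omega_e n)"
  proof (rule ring_hom_memI)
    fix f assume "f \<in> carrier (ring_M_Omega_e n)"
    then have "f \<in> R_e n" using O_M_Omega_e_iff by simp
    from restrict_R_e[OF R_e_act[OF this inv]] show "fun_act n \<sigma> f \<in> carrier (ring_M_Omega_e n)"
      unfolding fun_act_eq[OF \<sigma>] .
  qed (unfold fun_act_eq[OF \<sigma>] fun_ring_simps restrict_const_eq_iff, use act in simp_all)
  show "inj_on (fun_act n \<sigma>) (carrier (ring_M_Omega_e n))"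
  proof (rule inj_onI)
    fix f g assume fg: "f \<in> carrier (ring_M_Omega_e n)" "g \<in> carrier (ring_M_Omega_e n)" "fun_act n \<sigma> f = fun_act n \<sigma> g"
    have "f z = g z" if z: "z \<in> M_Omega_e n" for z
    proof -
      have "act n (inv\<^bsub>Sigma_grp n\<^esub> \<sigma>) (act n \<sigma> z) = z"
        unfolding act_act[OF inv \<sigma>] \<Sigma>.l_inv[OF \<sigma>] by (rule act_one[OF z])
      then show ?thesis
        using fg(3) act_in[OF \<sigma> z] unfolding fun_act_eq[OF \<sigma>] restrict_const_eq_iff by metis
    qed
    then show "f = g" using fg(1,2) unfolding fun_ring_simps O_M_Omega_e_iff by (intro extensionalityI[of f _ g]) auto
  qed
qed

lemma nz_act: "g \<in> nz n \<Longrightarrow> \<sigma> \<in> carrier (Sigma_grp n) \<Longrightarrow> (\<lambda>z. g (act n \<sigma> z)) \<in> nz n"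
proof -
  assume g: "g \<in> nz n" and \<sigma>: "\<sigma> \<in> carrier (Sigma_grp n)"
  interpret \<Sigma>: group "Sigma_grp n" by (rule group_Sigma_grp)
  note inv = \<Sigma>.inv_closed[OF \<sigma>]
  obtain z where z: "z \<in> M_Omega_e n" "g z \<noteq> 0" using g unfolding nz_def by blast
  have "act n \<sigma> (act n (inv\<^bsub>Sigma_grp n\<^esub> \<sigma>) z) = z"
    unfolding act_act[OF \<sigma> inv] \<Sigma>.r_inv[OF \<sigma>] by (rule act_one[OF z(1)])
  then show ?thesis
    using R_e_act[OF nz_R_e[OF g] \<sigma>] act_in[OF inv z(1)] z(2) unfolding nz_def by force
qed

lemma field_act_ratio:
  assumes \<sigma>: "\<sigma> \<in> carrier (Sigma_grp n)" and "f \<in> R_e n" "g \<in> nz n"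
  shows "field_act n \<sigma> (ratio n f g) =
    ratio n (\<lambda>z. f (act n (inv\<^bsub>Sigma_grp n\<^esub> \<sigma>) z)) (\<lambda>z. g (act n (inv\<^bsub>Sigma_grp n\<^esub> \<sigma>) z))"
proof -
  interpret \<Sigma>: group "Sigma_grp n" by (rule group_Sigma_grp)
  have restr: "fun_act n \<sigma> (restrict f (M_Omega_e n)) = restrict (\<lambda>z. f (act n (inv\<^bsub>Sigma_grp n\<^esub> \<sigma>) z)) (M_Omega_e n)" for f
    unfolding fun_act_eq[OF \<sigma>] restrict_const_eq_iff using act_in[OF \<Sigma>.inv_closed[OF \<sigma>]] by simp
  show ?thesis
    unfolding field_act_def ratio_def
      fract_map_fract[OF ring_e.domain_axioms ring_e.domain_axioms fun_act_hom[OF \<sigma>] restrict_R_e[OF assms(2)] restrict_nz[OF assms(3)]]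
      restr ..
qed

text \<open>Injectivity expresses that \<open>M_Omega n\<close> is dense: a polynomial vanishing on
  it gives zero everywhere after multiplication by \<open>delta\<close>, and there are no zero
  divisors.\<close>

lemma pull_hom:
  shows "pullback (M_Omega_e n) pi_n \<in> Ring.ring_hom (ring_M n) (ring_M_Omega_e n)"
    and "inj_on (pullback (M_Omega_e n) pi_n) (carrier (ring_M n))"
proof -
  have sp: "snd z \<in> M_space n" if "z \<in> M_Omega_e n" for z using M_Omega_eD(2)[OF that] unfolding M_space_def .
  have R: "(\<lambda>z. f (snd z)) \<in> R_e n" if f: "f \<in> O_M n" for f
  proof -
    obtain F where F: "F \<in> poly_funs (mat_coords n)" "\<And>x. x \<in> carrier_mat n n \<Longrightarrow> f x = F x"
      using f unfolding O_M_iff Ms_regular_iff by blast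
    show ?thesis
      by (rule R_e_cong[OF R_e_poly[OF snd_pair_coords[OF F(1)]]]) (use F(2) M_Omega_eD(2) in auto)
  qed
  show "pullback (M_Omega_e n) pi_n \<in> Ring.ring_hom (ring_M n) (ring_M_Omega_e n)"
  proof (rule ring_hom_memI)
    fix f assume "f \<in> carrier (ring_M n)"
    then show "pullback (M_Omega_e n) pi_n f \<in> carrier (ring_M_Omega_e n)"
      unfolding pullback_def pi_n_def using restrict_R_e[OF R] by simp
  qed (unfold pullback_def pi_n_def fun_ring_simps restrict_const_eq_iff, use sp in simp_all)
  show "inj_on (pullback (M_Omega_e n) pi_n) (carrier (ring_M n))"
  proof (rule inj_onI)
    fix f g assume fg: "f \<in> carrier (ring_M n)" "g \<in> carrier (ring_M n)"
      "pullback (M_Omega_e n) pi_n f = pullback (M_Omega_e n) pi_n g"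
    obtain F where F: "F \<in> poly_funs (mat_coords n)" "\<And>x. x \<in> carrier_mat n n \<Longrightarrow> f x = F x"
      using fg(1) unfolding fun_ring_simps O_M_iff Ms_regular_iff by blast
    obtain G where G: "G \<in> poly_funs (mat_coords n)" "\<And>x. x \<in> carrier_mat n n \<Longrightarrow> g x = G x"
      using fg(2) unfolding fun_ring_simps O_M_iff Ms_regular_iff by blast
    have eq: "f x = g x" if x: "x \<in> M_Omega n" for x
    proof -
      obtain z where "z \<in> M_Omega_e n" "snd z = x" using fiber_nonempty[OF x] .
      then show ?thesis using fg(3) unfolding pullback_def pi_n_def restrict_const_eq_iff by auto
    qed
    obtain z where z: "z \<in> M_Omega_e n" using M_Omega_e_nonempty by blast
    have d: "snd z \<in> carrier_mat n n" "delta n (snd z) \<noteq> 0" using M_Omega_eD(5)[OF z] unfolding M_Omega_eq by auto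
    interpret P: fun_alg "poly_funs (mat_coords n)" by (rule fun_alg_poly_funs)
    have 0: "delta n x * (F x - G x) = 0" if x: "x \<in> carrier_mat n n" for x
      using eq[of x] F(2)[OF x] G(2)[OF x] x unfolding M_Omega_eq by auto
    have "F x - G x = 0" if "x \<in> carrier_mat n n" for x
      by (rule mat_poly_domain[OF delta(1) P.diff[OF F(1) G(1)] 0 d that])
    then have "f x = g x" if "x \<in> M_space n" for x using F(2) G(2) that unfolding M_space_def by simp
    then show "f = g" using fg(1,2) unfolding fun_ring_simps O_M_iff by (intro extensionalityI[of f _ g]) auto
  qed
qed

lemma field_pullback_fract:
  assumes "a \<in> O_M n" "b \<in> O_M n - {\<zero>\<^bsub>ring_M n\<^esub>}"
  shows "(\<lambda>z. a (snd z)) \<in> R_e n" "(\<lambda>z. b (snd z)) \<in> nz n"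
    "field_pullback n (fract (ring_M n) a b) = ratio n (\<lambda>z. a (snd z)) (\<lambda>z. b (snd z))"
proof -
  have a: "a \<in> carrier (ring_M n)" and b: "b \<in> carrier (ring_M n) - {\<zero>\<^bsub>ring_M n\<^esub>}" using assms by auto
  have R: "(\<lambda>z. a (snd z)) \<in> R_e n" if "a \<in> carrier (ring_M n)" for a
    using ring_hom_closed[OF pull_hom(1) that]
    unfolding pullback_def pi_n_def fun_ring_simps R_e_def by simp
  show "(\<lambda>z. a (snd z)) \<in> R_e n" by (rule R[OF a])
  have "pullback (M_Omega_e n) pi_n b \<noteq> \<zero>\<^bsub>ring_M_Omega_e n\<^esub>"
    using inj_onD[OF pull_hom(2)[of n], of b "\<zero>\<^bsub>ring_M n\<^esub>"] b ring_m.zero_closed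
      ring_hom_zero[OF pull_hom(1)[of n] ring_m.ring_axioms ring_e.ring_axioms] by auto
  then show "(\<lambda>z. b (snd z)) \<in> nz n"
    unfolding nz_def pullback_def pi_n_def fun_ring_simps restrict_const_eq_iff using R[of b] b by auto
  show "field_pullback n (fract (ring_M n) a b) = ratio n (\<lambda>z. a (snd z)) (\<lambda>z. b (snd z))"
    unfolding field_pullback_def
      fract_map_fract[OF ring_m.domain_axioms ring_e.domain_axioms pull_hom a b]
    unfolding ratio_def pullback_def pi_n_def ..
qed

lemma poly_funs_clear_denominator:
  assumes "f \<in> poly_funs (insert (\<lambda>p. 1 / d p) C)" and d: "d \<in> poly_funs C"
  shows "\<exists>N. \<exists>P\<in>poly_funs C. \<forall>p. d p \<noteq> 0 \<longrightarrow> f p * d p ^ N = P p"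
  using assms(1)
proof (induction rule: poly_funs.induct)
  case (const c)
  show ?case by (rule exI[of _ 0]) (auto intro: bexI[OF _ poly_funs.const[of c]])
next
  case (gen f)
  then consider "f = (\<lambda>p. 1 / d p)" | "f \<in> C" by blast
  then show ?case
  proof cases
    case 1
    then show ?thesis by (intro exI[of _ "Suc 0"]) (auto intro: bexI[OF _ poly_funs.const[of 1]])
  next
    case 2
    then show ?thesis by (intro exI[of _ 0]) (auto intro: bexI[OF _ poly_funs.gen])
  qed
next
  case (add f g)
  interpret P: fun_alg "poly_funs C" by (rule fun_alg_poly_funs)
  obtain M P where P: "P \<in> poly_funs C" "\<And>p. d p \<noteq> 0 \<Longrightarrow> f p * d p ^ M = P p" using add.IH(1) by blast
  obtain N Q where Q: "Q \<in> poly_funs C" "\<And>p. d p \<noteq> 0 \<Longrightarrow> g p * d p ^ N = Q p" using add.IH(2) by blast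
  have "(f p + g p) * d p ^ (M + N) = P p * d p ^ N + Q p * d p ^ M" if "d p \<noteq> 0" for p
    using P(2)[OF that, symmetric] Q(2)[OF that, symmetric] by (simp add: algebra_simps power_add)
  moreover have "(\<lambda>p. P p * d p ^ N + Q p * d p ^ M) \<in> poly_funs C" by (intro P.add P.mult P.power P(1) Q(1) d)
  ultimately show ?case by (intro exI[of _ "M + N"]) (rule bexI, auto)
next
  case (mult f g)
  interpret P: fun_alg "poly_funs C" by (rule fun_alg_poly_funs)
  obtain M P where P: "P \<in> poly_funs C" "\<And>p. d p \<noteq> 0 \<Longrightarrow> f p * d p ^ M = P p" using mult.IH(1) by blast
  obtain N Q where Q: "Q \<in> poly_funs C" "\<And>p. d p \<noteq> 0 \<Longrightarrow> g p * d p ^ N = Q p" using mult.IH(2) by blast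
  have "(f p * g p) * d p ^ (M + N) = P p * Q p" if "d p \<noteq> 0" for p
    using P(2)[OF that, symmetric] Q(2)[OF that, symmetric] by (simp add: algebra_simps power_add)
  moreover have "(\<lambda>p. P p * Q p) \<in> poly_funs C" by (intro P.mult P(1) Q(1))
  ultimately show ?case by (intro exI[of _ "M + N"]) (rule bexI, auto)
qed

lemma restrict_poly_O_M: "P \<in> poly_funs (mat_coords n) \<Longrightarrow> restrict P (M_space n) \<in> O_M n"
  unfolding O_M_iff Ms_regular_iff M_space_def by auto

text \<open>F(n) consists of quotients of polynomials on all matrices. With
  \<open>g = P / delta^N\<close> and \<open>h = Q / delta^M\<close>, the quotient equals
  \<open>(P delta^M) / (Q delta^N)\<close>.\<close>

lemma ratio_in_pullback_image:
  assumes g: "g \<in> R_o n" and h: "h \<in> R_o n" "(\<lambda>z. h (snd z)) \<in> nz n"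
  shows "ratio n (\<lambda>z. g (snd z)) (\<lambda>z. h (snd z)) \<in> field_pullback n ` carrier (F_n n)"
proof -
  interpret P: fun_alg "poly_funs (mat_coords n)" by (rule fun_alg_poly_funs)
  have clear: "\<exists>N. \<exists>P\<in>poly_funs (mat_coords n). \<forall>x\<in>M_Omega n. g x * delta n x ^ N = P x" if gR: "g \<in> R_o n" for g
  proof -
    obtain F where F: "F \<in> poly_funs (insert (\<lambda>p. 1 / delta n p) (mat_coords n))" "\<And>x. x \<in> M_Omega n \<Longrightarrow> g x = F x"
      using gR unfolding R_o_iff by blast
    obtain N P where P: "P \<in> poly_funs (mat_coords n)" "\<And>x. delta n x \<noteq> 0 \<Longrightarrow> F x * delta n x ^ N = P x"
      using poly_funs_clear_denominator[OF F(1) delta(1)] by blast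
    have "g x * delta n x ^ N = P x" if "x \<in> M_Omega n" for x
      using that F(2)[OF that] P(2)[of x] unfolding M_Omega_eq by simp
    then show ?thesis using P(1) by blast
  qed
  obtain N P where P: "P \<in> poly_funs (mat_coords n)" "\<And>x. x \<in> M_Omega n \<Longrightarrow> g x * delta n x ^ N = P x" using clear[OF g] by blast
  obtain M Q where Q: "Q \<in> poly_funs (mat_coords n)" "\<And>x. x \<in> M_Omega n \<Longrightarrow> h x * delta n x ^ M = Q x" using clear[OF h(1)] by blast
  define a where "a = restrict (\<lambda>x. P x * delta n x ^ M) (M_space n)"
  define b where "b = restrict (\<lambda>x. Q x * delta n x ^ N) (M_space n)"
  have O: "a \<in> O_M n" "b \<in> O_M n" unfolding a_def b_def by (intro restrict_poly_O_M P.mult P.power P(1) Q(1) delta(1))+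
  have x: "snd z \<in> M_Omega n" "snd z \<in> M_space n" "delta n (snd z) \<noteq> 0" if "z \<in> M_Omega_e n" for z
    using M_Omega_eD(5)[OF that] unfolding M_Omega_eq M_space_def by auto
  have bz: "b (snd z) = h (snd z) * delta n (snd z) ^ M * delta n (snd z) ^ N"
    and az: "a (snd z) = g (snd z) * delta n (snd z) ^ N * delta n (snd z) ^ M" if "z \<in> M_Omega_e n" for z
    using x[OF that] P(2) Q(2) unfolding a_def b_def by simp_all
  obtain w where w: "w \<in> M_Omega_e n" "h (snd w) \<noteq> 0" using h(2) unfolding nz_def by blast
  then have "b (snd w) \<noteq> 0" using bz x by simp
  then have b: "b \<in> O_M n - {\<zero>\<^bsub>ring_M n\<^esub>}" using O(2) x(2)[OF w(1)] by auto
  note fp = field_pullback_fract[OF O(1) b]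
  have "ratio n (\<lambda>z. g (snd z)) (\<lambda>z. h (snd z)) = ratio n (\<lambda>z. a (snd z)) (\<lambda>z. b (snd z))"
    unfolding ratio_eq_iff[OF R_o_pullback[OF g] h(2) fp(1,2)] using az bz by simp
  also have "\<dots> = field_pullback n (fract (ring_M n) a b)" using fp(3) ..
  finally show ?thesis unfolding F_n_def using ring_m.fract_in[of a n b] O(1) b by simp
qed

text \<open>Numerator and denominator are multiplied by the other conjugates of \<open>g\<close>;
  the new denominator is the norm of \<open>g\<close>, which is invariant and so depends on the
  matrix only.\<close>

lemma norm_denominator:
  assumes f: "f \<in> R_e n" and g: "g \<in> nz n"
  obtains c d where "c \<in> R_e n" "d \<in> R_o n" "(\<lambda>z. d (snd z)) \<in> nz n" "ratio n f g = ratio n c (\<lambda>z. d (snd z))"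
proof -
  interpret \<Sigma>: group "Sigma_grp n" by (rule group_Sigma_grp)
  let ?G = "carrier (Sigma_grp n)"
  note fin = finite_Sigma_grp[of n]
  have prod_nz: "(\<lambda>z. \<Prod>\<sigma>\<in>T. g (act n \<sigma> z)) \<in> nz n" if "T \<subseteq> ?G" for T
    using finite_subset[OF that fin] that
  proof (induction T rule: finite_induct)
    case (insert \<sigma> T)
    then show ?case using nz_mult[OF nz_act[OF g, of \<sigma>], of "\<lambda>z. \<Prod>\<sigma>\<in>T. g (act n \<sigma> z)"] by simp
  qed (simp add: nz_const)
  have R: "(\<lambda>z. \<Prod>\<sigma>\<in>T. g (act n \<sigma> z)) \<in> R_e n" if "T \<subseteq> ?G" for T using nz_R_e[OF prod_nz[OF that]] .
  define D where "D = (\<lambda>z. \<Prod>\<sigma>\<in>?G. g (act n \<sigma> z))"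
  define E where "E = (\<lambda>z. \<Prod>\<sigma>\<in>?G - {\<one>\<^bsub>Sigma_grp n\<^esub>}. g (act n \<sigma> z))"
  have "D (act n \<tau> z) = D z" if \<tau>: "\<tau> \<in> ?G" and z: "z \<in> M_Omega_e n" for \<tau> z
  proof -
    have "bij_betw (\<lambda>\<sigma>. \<sigma> \<otimes>\<^bsub>Sigma_grp n\<^esub> \<tau>) ?G ?G"
      using endo_inj_surj[OF fin _ \<Sigma>.inj_on_multc[OF \<tau>]] \<Sigma>.inj_on_multc[OF \<tau>] \<Sigma>.m_closed[OF _ \<tau>]
      unfolding bij_betw_def by (simp add: image_subset_iff)
    from prod.reindex_bij_betw[OF this, of "\<lambda>\<sigma>. g (act n \<sigma> z)"]
    show ?thesis unfolding D_def using act_act[OF _ \<tau>] by (simp cong: prod.cong)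
  qed
  then obtain d where d: "d \<in> R_o n" "\<And>z. z \<in> M_Omega_e n \<Longrightarrow> D z = d (snd z)"
    using invariant_descends[of D n] R[OF subset_refl] unfolding D_def by metis
  have DE: "d (snd z) = g z * E z" if "z \<in> M_Omega_e n" for z
    using d(2)[OF that] act_one[OF that] prod.remove[OF fin \<Sigma>.one_closed, of "\<lambda>\<sigma>. g (act n \<sigma> z)"]
    unfolding D_def E_def by simp
  have "D \<in> nz n" unfolding D_def by (rule prod_nz) simp
  then have dnz: "(\<lambda>z. d (snd z)) \<in> nz n" using R_o_pullback[OF d(1)] d(2) unfolding nz_def by auto
  have E: "E \<in> R_e n" unfolding E_def by (rule R) auto
  show ?thesis
  proof (rule that[OF R_e.mult[OF f E] d(1) dnz])
    show "ratio n f g = ratio n (\<lambda>z. f z * E z) (\<lambda>z. d (snd z))"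
      unfolding ratio_eq_iff[OF f g R_e.mult[OF f E] dnz] using DE by simp
  qed
qed

text \<open>An invariant denominator cancels, so a fraction is invariant exactly when its numerator
  is.\<close>

lemma ratio_invariant_iff:
  assumes c: "c \<in> R_e n" and d: "d \<in> R_o n" "(\<lambda>z. d (snd z)) \<in> nz n"
  shows "ratio n c (\<lambda>z. d (snd z)) \<in> F_ne_invariants n \<longleftrightarrow>
    (\<exists>g\<in>R_o n. \<forall>z\<in>M_Omega_e n. c z = g (snd z))"
proof -
  interpret \<Sigma>: group "Sigma_grp n" by (rule group_Sigma_grp)
  let ?G = "carrier (Sigma_grp n)"
  have fa: "field_act n \<sigma> (ratio n c (\<lambda>z. d (snd z))) = ratio n c (\<lambda>z. d (snd z)) \<longleftrightarrow>
      (\<forall>z\<in>M_Omega_e n. c (act n (inv\<^bsub>Sigma_grp n\<^esub> \<sigma>) z) = c z)" (is "?l \<longleftrightarrow> ?r") if \<sigma>: "\<sigma> \<in> ?G" for \<sigma>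
  proof
    note cs = R_e_act[OF c \<Sigma>.inv_closed[OF \<sigma>]]
    assume ?l
    then have 0: "(c (act n (inv\<^bsub>Sigma_grp n\<^esub> \<sigma>) z) - c z) * d (snd z) = 0" if "z \<in> M_Omega_e n" for z
      unfolding field_act_ratio[OF \<sigma> c d(2)] snd_act ratio_eq_iff[OF cs d(2) c d(2)] using that by (simp add: algebra_simps)
    obtain w where w: "w \<in> M_Omega_e n" "d (snd w) \<noteq> 0" using d(2) unfolding nz_def by blast
    have "c (act n (inv\<^bsub>Sigma_grp n\<^esub> \<sigma>) z) - c z = 0" if "z \<in> M_Omega_e n" for z
      by (rule R_e_domain[OF nz_R_e[OF d(2)] R_e.diff[OF cs c] _ w that]) (use 0 in \<open>simp add: mult.commute\<close>)
    then show ?r by simp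
  next
    assume ?r
    then show ?l unfolding field_act_ratio[OF \<sigma> c d(2)] snd_act by (intro ratio_cong) auto
  qed
  have "ratio n c (\<lambda>z. d (snd z)) \<in> F_ne_invariants n \<longleftrightarrow>
      (\<forall>\<sigma>\<in>?G. \<forall>z\<in>M_Omega_e n. c (act n (inv\<^bsub>Sigma_grp n\<^esub> \<sigma>) z) = c z)"
    unfolding F_ne_invariants_def using ratio_in[OF c d(2)] fa by simp
  also have "\<dots> \<longleftrightarrow> (\<forall>\<sigma>\<in>?G. \<forall>z\<in>M_Omega_e n. c (act n \<sigma> z) = c z)"
  proof (intro iffI ballI)
    fix \<sigma> z assume *: "\<forall>\<sigma>\<in>?G. \<forall>z\<in>M_Omega_e n. c (act n (inv\<^bsub>Sigma_grp n\<^esub> \<sigma>) z) = c z" "\<sigma> \<in> ?G" "z \<in> M_Omega_e n"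
    show "c (act n \<sigma> z) = c z"
      using bspec[OF bspec[OF *(1) \<Sigma>.inv_closed[OF *(2)]] *(3)] \<Sigma>.inv_inv[OF *(2)] by simp
  next
    fix \<sigma> z assume *: "\<forall>\<sigma>\<in>?G. \<forall>z\<in>M_Omega_e n. c (act n \<sigma> z) = c z" "\<sigma> \<in> ?G" "z \<in> M_Omega_e n"
    show "c (act n (inv\<^bsub>Sigma_grp n\<^esub> \<sigma>) z) = c z"
      by (rule bspec[OF bspec[OF *(1) \<Sigma>.inv_closed[OF *(2)]] *(3)])
  qed
  also have "\<dots> \<longleftrightarrow> (\<exists>g\<in>R_o n. \<forall>z\<in>M_Omega_e n. c z = g (snd z))"
  proof
    assume "\<forall>\<sigma>\<in>?G. \<forall>z\<in>M_Omega_e n. c (act n \<sigma> z) = c z"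
    then obtain g where "g \<in> R_o n" "\<And>z. z \<in> M_Omega_e n \<Longrightarrow> c z = g (snd z)"
      using invariant_descends[OF c] by blast
    then show "\<exists>g\<in>R_o n. \<forall>z\<in>M_Omega_e n. c z = g (snd z)" by blast
  next
    assume "\<exists>g\<in>R_o n. \<forall>z\<in>M_Omega_e n. c z = g (snd z)"
    then show "\<forall>\<sigma>\<in>?G. \<forall>z\<in>M_Omega_e n. c (act n \<sigma> z) = c z" using act_in by fastforce
  qed
  finally show ?thesis .
qed

lemma invariants_eq: "F_ne_invariants n = field_pullback n ` carrier (F_n n)"
proof
  show "F_ne_invariants n \<subseteq> field_pullback n ` carrier (F_n n)"
  proof
    fix y assume y: "y \<in> F_ne_invariants n"
    then have "y \<in> carrier (F_ne n)" unfolding F_ne_invariants_def by simp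
    then obtain f g where fg: "f \<in> R_e n" "g \<in> nz n" "y = ratio n f g" by (rule ratioE)
    obtain c d where cd: "c \<in> R_e n" "d \<in> R_o n" "(\<lambda>z. d (snd z)) \<in> nz n" "ratio n f g = ratio n c (\<lambda>z. d (snd z))"
      using norm_denominator[OF fg(1,2)] .
    obtain e where e: "e \<in> R_o n" "\<And>z. z \<in> M_Omega_e n \<Longrightarrow> c z = e (snd z)"
      using y unfolding fg(3) cd(4) ratio_invariant_iff[OF cd(1-3)] by blast
    have "y = ratio n (\<lambda>z. e (snd z)) (\<lambda>z. d (snd z))" unfolding fg(3) cd(4) by (rule ratio_cong) (use e(2) in auto)
    then show "y \<in> field_pullback n ` carrier (F_n n)" using ratio_in_pullback_image[OF e(1) cd(2,3)] by simp
  qed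
  show "field_pullback n ` carrier (F_n n) \<subseteq> F_ne_invariants n"
  proof
    fix y assume "y \<in> field_pullback n ` carrier (F_n n)"
    then obtain x where x: "x \<in> carrier (quotient_field (ring_M n))" "y = field_pullback n x" unfolding F_n_def by blast
    obtain a b where ab: "a \<in> carrier (ring_M n)" "b \<in> carrier (ring_M n) - {\<zero>\<^bsub>ring_M n\<^esub>}" "x = fract (ring_M n) a b"
      using x(1) by (rule ring_m.fractE)
    note fp = field_pullback_fract[OF ab(1,2)[unfolded fun_ring_simps(1)]]
    interpret \<Sigma>: group "Sigma_grp n" by (rule group_Sigma_grp)
    show "y \<in> F_ne_invariants n"
      unfolding x(2) ab(3) fp(3) F_ne_invariants_def
      using ratio_in[OF fp(1,2)] field_act_ratio[OF _ fp(1,2)] by simp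
  qed
qed

theorem field_pullback_iso:
  "field_pullback n \<in> ring_iso (F_n n) ((F_ne n)\<lparr>carrier := F_ne_invariants n\<rparr>)"
proof -
  have hom: "field_pullback n \<in> Ring.ring_hom (F_n n) (F_ne n)"
    unfolding field_pullback_def F_n_def F_ne_def
    by (rule fract_map_hom[OF ring_m.domain_axioms ring_e.domain_axioms pull_hom])
  have inj: "inj_on (field_pullback n) (carrier (F_n n))"
    unfolding field_pullback_def F_n_def
    by (rule fract_map_inj[OF ring_m.domain_axioms ring_e.domain_axioms pull_hom])
  have "field_pullback n \<in> Ring.ring_hom (F_n n) ((F_ne n)\<lparr>carrier := F_ne_invariants n\<rparr>)"
    using ring_hom_memE[OF hom] invariants_eq[of n] by (intro ring_hom_memI) auto
  then show ?thesis
    unfolding ring_iso_def bij_betw_def using inj invariants_eq[of n] by simp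
qed

section \<open>The Galois group\<close>

lemma (in domain) root_poly_eval_zero:
  assumes "finite Y" "Y \<subseteq> carrier R" "z \<in> carrier R" "eval (root_poly Y) z = \<zero>"
  shows "z \<in> Y"
  using assms(1,2,4)
proof (induction Y rule: finite_induct)
  case empty
  then show ?case using assms(3) by (simp add: root_poly_empty)
next
  case (insert y Y)
  have car: "y \<in> carrier R" "Y \<subseteq> carrier R" using insert by auto
  have p: "polynomial (carrier R) (root_poly Y)" using root_poly_monic[OF carrier_is_subring insert(1) car(2)] by simp
  have "eval (root_poly (insert y Y)) z = eval [\<one>, \<ominus> y] z \<otimes> eval (root_poly Y) z"
    unfolding root_poly_insert[OF insert(1) car(2,1) insert(2)]
    by (rule eval_poly_mult) (use car assms(3) polynomial_incl[OF p] in auto)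
  moreover have "eval [\<one>, \<ominus> y] z = z \<ominus> y" using car assms(3) by (simp add: minus_eq)
  ultimately have "(z \<ominus> y) \<otimes> eval (root_poly Y) z = \<zero>" using insert.prems(2) by simp
  then have "z \<ominus> y = \<zero> \<or> eval (root_poly Y) z = \<zero>"
    by (rule integral[OF _ minus_closed[OF assms(3) car(1)] eval_poly_in_carrier[OF carrier_is_subring p assms(3)]])
  then show ?case using insert.IH[OF car(2)] r_right_minus_eq[OF assms(3) car(1)] by auto
qed

text \<open>\<open>h\<close> fixes the coefficients of the orbit polynomial and thus maps its root
  \<open>x\<close> to a root, which lies in the orbit.\<close>

lemma (in finite_field_action) automorphism_in_orb:
  assumes h: "h \<in> Ring.ring_hom L L" "\<And>a. a \<in> fixed \<Longrightarrow> h a = a" and x: "x \<in> carrier L"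
  shows "h x \<in> orb x"
proof -
  interpret h: ring_hom_ring L L h by (rule ring_hom_ringI2[OF ring_axioms ring_axioms h(1)])
  have "root_poly (orb x) \<in> carrier ((carrier L \<inter> fixed)[X])"
    by (rule orbit_poly_fixed[OF x carrier_is_subring orb_facts(2)[OF x]])
  then have "set (root_poly (orb x)) \<subseteq> carrier L \<inter> fixed"
    unfolding univ_poly_carrier[symmetric] by (rule polynomial_incl)
  then have set: "set (root_poly (orb x)) \<subseteq> carrier L" "map h (root_poly (orb x)) = root_poly (orb x)"
    using h(2) by (auto intro: map_idI)
  have "eval (root_poly (orb x)) (h x) = \<zero>"
    using h.eval_hom'[OF x set(1)] root_poly_eval[OF orb_facts(1-3)[OF x]] h.hom_zero unfolding set(2) by simp
  then show ?thesis
    by (rule root_poly_eval_zero[OF orb_facts(1,2)[OF x] ring_hom_closed[OF h(1) x]])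
qed

lemma field_act_hom: "\<sigma> \<in> carrier (Sigma_grp n) \<Longrightarrow> field_act n \<sigma> \<in> Ring.ring_hom (F_ne n) (F_ne n)"
  unfolding field_act_def F_ne_def
  by (rule fract_map_hom[OF ring_e.domain_axioms ring_e.domain_axioms fun_act_hom])

lemma field_act_mult:
  assumes "\<sigma> \<in> carrier (Sigma_grp n)" "\<tau> \<in> carrier (Sigma_grp n)" "y \<in> carrier (F_ne n)"
  shows "field_act n (\<sigma> \<otimes>\<^bsub>Sigma_grp n\<^esub> \<tau>) y = field_act n \<sigma> (field_act n \<tau> y)"
proof -
  interpret \<Sigma>: group "Sigma_grp n" by (rule group_Sigma_grp)
  obtain f g where fg: "f \<in> R_e n" "g \<in> nz n" "y = ratio n f g" using assms(3) by (rule ratioE)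
  note inv = \<Sigma>.inv_closed[OF assms(1)] \<Sigma>.inv_closed[OF assms(2)]
  show ?thesis
    unfolding fg(3) field_act_ratio[OF \<Sigma>.m_closed[OF assms(1,2)] fg(1,2)] field_act_ratio[OF assms(2) fg(1,2)]
      field_act_ratio[OF assms(1) R_e_act[OF fg(1) inv(2)] nz_act[OF fg(2) inv(2)]]
      \<Sigma>.inv_mult_group[OF assms(1,2)] act_act[OF inv(2,1)] ..
qed

lemma field_act_one: "y \<in> carrier (F_ne n) \<Longrightarrow> field_act n \<one>\<^bsub>Sigma_grp n\<^esub> y = y"
proof -
  interpret \<Sigma>: group "Sigma_grp n" by (rule group_Sigma_grp)
  assume "y \<in> carrier (F_ne n)"
  then obtain f g where fg: "f \<in> R_e n" "g \<in> nz n" "y = ratio n f g" by (rule ratioE)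
  show ?thesis
    unfolding fg(3) field_act_ratio[OF \<Sigma>.one_closed fg(1,2)] \<Sigma>.inv_one by (rule ratio_cong) (simp_all add: act_one)
qed

lemma field_action: "finite_field_action (F_ne n) (Sigma_grp n) (field_act n)"
  by (intro finite_field_action.intro finite_field_action_axioms.intro field_F_ne group_Sigma_grp finite_Sigma_grp
      field_act_hom field_act_mult field_act_one)

lemma fixed_eq: "finite_field_action.fixed (F_ne n) (Sigma_grp n) (field_act n) = F_ne_invariants n"
  unfolding finite_field_action.fixed_def[OF field_action] F_ne_invariants_def ..

lemma ratio_embed_invariant:
  assumes "g \<in> R_o n"
  shows "ratio n (\<lambda>z. g (snd z)) (\<lambda>_. 1) \<in> F_ne_invariants n"
  unfolding invariants_eq using ratio_in_pullback_image[OF assms R_o.const nz_const[of 1]] by simp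

lemma nz_one: "(\<lambda>_. 1) \<in> nz n" by (rule nz_const) simp

text \<open>The eigenvalue monomials of the regular expansion span the field over the invariants;
  normality and separability come from the orbit polynomial.\<close>

theorem galois_extension_F_ne: "galois_extension (F_ne n) (F_ne_invariants n)"
proof -
  interpret A: finite_field_action "F_ne n" "Sigma_grp n" "field_act n" by (rule field_action)
  note sub = A.fixed_subfield[unfolded fixed_eq]
  obtain Ss where Ss: "set Ss = Pow (same_level n)" using finite_list[of "Pow (same_level n)"] finite_same_level by auto
  define Us where "Us = map (\<lambda>S. ratio n (nu_product S) (\<lambda>_. 1)) Ss"
  have Us: "set Us \<subseteq> carrier (F_ne n)"
    unfolding Us_def using ratio_in[OF nu_product_R_e nz_one] Ss by auto
  note Span = A.Span_subgroup_props[OF sub Us] A.Span_smult_closed[OF sub Us] A.Span_base_incl[OF sub Us]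
  have sum: "ratio n (\<lambda>z. \<Sum>S\<in>T. c S (snd z) * nu_product S z) (\<lambda>_. 1) \<in> A.Span (F_ne_invariants n) Us"
    if c: "\<And>S. c S \<in> R_o n" and T: "finite T" "T \<subseteq> Pow (same_level n)" for c T
    using T
  proof (induction T rule: finite_induct)
    case empty
    then show ?case using Span(2) ratio_zero by simp
  next
    case (insert S T)
    have nu: "nu_product S \<in> R_e n" using insert.prems by (intro nu_product_R_e) auto
    have "ratio n (nu_product S) (\<lambda>_. 1) \<in> A.Span (F_ne_invariants n) Us"
      using Span(6) insert.prems Ss unfolding Us_def by auto
    then have "ratio n (\<lambda>z. c S (snd z)) (\<lambda>_. 1) \<otimes>\<^bsub>F_ne n\<^esub> ratio n (nu_product S) (\<lambda>_. 1) \<in> A.Span (F_ne_invariants n) Us"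
      by (rule Span(5)[OF ratio_embed_invariant[OF c]])
    then have 1: "ratio n (\<lambda>z. c S (snd z) * nu_product S z) (\<lambda>_. 1) \<in> A.Span (F_ne_invariants n) Us"
      unfolding ratio_mult[OF R_o_pullback[OF c] nz_one nu nz_one] by simp
    have R: "(\<lambda>z. c S (snd z) * nu_product S z) \<in> R_e n" "(\<lambda>z. \<Sum>S\<in>T. c S (snd z) * nu_product S z) \<in> R_e n"
      using insert.prems by (intro R_e.sum R_e.mult R_o_pullback c nu_product_R_e; auto)+
    from Span(3)[OF 1 insert.IH] insert show ?case
      unfolding ratio_add[OF R(1) nz_one R(2) nz_one] by simp
  qed
  have "y \<in> A.Span (F_ne_invariants n) Us" if y: "y \<in> carrier (F_ne n)" for y
  proof -
    obtain f g where fg: "f \<in> R_e n" "g \<in> nz n" "y = ratio n f g" using y by (rule ratioE)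
    obtain c d where cd: "c \<in> R_e n" "d \<in> R_o n" "(\<lambda>z. d (snd z)) \<in> nz n" "ratio n f g = ratio n c (\<lambda>z. d (snd z))"
      using norm_denominator[OF fg(1,2)] .
    obtain e where e: "\<And>S. e S \<in> R_o n" "\<And>z. z \<in> M_Omega_e n \<Longrightarrow> c z = (\<Sum>S\<in>Pow (same_level n). e S (snd z) * nu_product S z)"
      by (rule regular_expansion[OF cd(1)], rule that) simp_all
    have "ratio n c (\<lambda>_. 1) = ratio n (\<lambda>z. \<Sum>S\<in>Pow (same_level n). e S (snd z) * nu_product S z) (\<lambda>_. 1)"
      by (rule ratio_cong) (use e(2) in auto)
    then have 1: "ratio n c (\<lambda>_. 1) \<in> A.Span (F_ne_invariants n) Us"
      using sum[of e "Pow (same_level n)", OF e(1)] finite_same_level by simp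
    \<comment> \<open>After passing to an invariant denominator its reciprocal is a scalar of the
      base field, so only the numerator has to be expanded.\<close>
    have 2: "ratio n (\<lambda>_. 1) (\<lambda>z. d (snd z)) \<in> F_ne_invariants n"
      unfolding invariants_eq by (rule ratio_in_pullback_image[OF R_o.const cd(2,3)])
    from Span(5)[OF 2 1] show ?thesis
      unfolding fg(3) cd(4) ratio_mult[OF R_e.const cd(3,1) nz_one] by simp
  qed
  then have "carrier (F_ne n) = A.Span (F_ne_invariants n) Us" using Span(1) by auto
  then have "A.finite_dimension (F_ne_invariants n) (carrier (F_ne n))"
    using A.Span_finite_dimension[OF sub Us] by simp
  then show ?thesis
    unfolding galois_extension_def using field_F_ne sub A.fixed_Irr[unfolded fixed_eq] by blast
qed

lemma field_act_Bij:
  assumes \<sigma>: "\<sigma> \<in> carrier (Sigma_grp n)"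
  shows "field_act n \<sigma> \<in> Bij (carrier (F_ne n))"
proof -
  interpret A: finite_field_action "F_ne n" "Sigma_grp n" "field_act n" by (rule field_action)
  have "field_act n \<sigma> \<in> extensional (carrier (F_ne n))"
    unfolding field_act_def fract_map_def F_ne_def by simp
  moreover have "y \<in> field_act n \<sigma> ` carrier (F_ne n)" if y: "y \<in> carrier (F_ne n)" for y
  proof (rule image_eqI)
    have inv: "inv\<^bsub>Sigma_grp n\<^esub> \<sigma> \<in> carrier (Sigma_grp n)" using \<sigma> by simp
    show "field_act n (inv\<^bsub>Sigma_grp n\<^esub> \<sigma>) y \<in> carrier (F_ne n)" using ring_hom_closed[OF field_act_hom[OF inv] y] .
    show "y = field_act n \<sigma> (field_act n (inv\<^bsub>Sigma_grp n\<^esub> \<sigma>) y)"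
      unfolding field_act_mult[OF \<sigma> inv y, symmetric] A.G.r_inv[OF \<sigma>] field_act_one[OF y] ..
  qed
  ultimately show ?thesis
    unfolding Bij_def bij_betw_def using A.act_inj[OF \<sigma>] ring_hom_closed[OF field_act_hom[OF \<sigma>]] by auto
qed

lemma carrier_galois_group:
  "carrier (galois_group L k) = {\<phi> \<in> Bij (carrier L). \<phi> \<in> Ring.ring_hom L L \<and> (\<forall>a\<in>k. \<phi> a = a)}"
  unfolding galois_group_def by simp

lemma field_act_galois: "\<sigma> \<in> carrier (Sigma_grp n) \<Longrightarrow> field_act n \<sigma> \<in> carrier (galois_group (F_ne n) (F_ne_invariants n))"
  unfolding carrier_galois_group using field_act_Bij field_act_hom by (simp add: F_ne_invariants_def)

definition nu_elt where "nu_elt n k = ratio n (\<lambda>z. fst z k) (\<lambda>_. 1)"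

lemma nu_elt_in: "k \<in> index_set n \<Longrightarrow> nu_elt n k \<in> carrier (F_ne n)"
  unfolding nu_elt_def by (rule ratio_in[OF R_e_nu nz_one])

lemma nu_elt_eq_iff:
  assumes "(i, m) \<in> index_set n" "(j, m) \<in> index_set n"
  shows "nu_elt n (i, m) = nu_elt n (j, m) \<longleftrightarrow> i = j"
proof
  assume "nu_elt n (i, m) = nu_elt n (j, m)"
  then have eq: "fst z (i, m) = fst z (j, m)" if "z \<in> M_Omega_e n" for z
    unfolding nu_elt_def ratio_eq_iff[OF R_e_nu[OF assms(1)] nz_one R_e_nu[OF assms(2)] nz_one] using that by simp
  obtain z where z: "z \<in> M_Omega_e n" using M_Omega_e_nonempty by blast
  show "i = j"
    using inj_onD[OF disc_inj[OF M_Omega_eD(3)[OF z]] eq[OF z]] assms unfolding index_set_iff by blast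
qed simp

text \<open>The inverse in the action on functions and the one in the action on eigenvalues cancel,
  so the label is moved by the permutation itself.\<close>

lemma field_act_nu_elt:
  assumes \<sigma>: "\<sigma> \<in> carrier (Sigma_grp n)" and k: "(i, m) \<in> index_set n"
  shows "field_act n \<sigma> (nu_elt n (i, m)) = nu_elt n (\<sigma> m i, m)" "(\<sigma> m i, m) \<in> index_set n"
proof -
  have "fst (act n (inv\<^bsub>Sigma_grp n\<^esub> \<sigma>) z) (i, m) = fst z (\<sigma> m i, m)" for z
    unfolding act_def using nu_act_eq_perm(1)[OF \<sigma>] k by (simp add: nu_perm_def)
  then show "field_act n \<sigma> (nu_elt n (i, m)) = nu_elt n (\<sigma> m i, m)"
    unfolding nu_elt_def field_act_ratio[OF \<sigma> R_e_nu[OF k] nz_one] by simp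
  show "(\<sigma> m i, m) \<in> index_set n" using index_perm_in[OF \<sigma> k] unfolding index_perm_def by simp
qed

text \<open>Every regular function is a polynomial in the eigenvalue functions with invariant coefficients.\<close>
lemma endomorphisms_eq:
  assumes \<phi>: "\<phi> \<in> Ring.ring_hom (F_ne n) (F_ne n)" and \<psi>: "\<psi> \<in> Ring.ring_hom (F_ne n) (F_ne n)"
    and fixed: "\<And>a. a \<in> F_ne_invariants n \<Longrightarrow> \<phi> a = \<psi> a"
    and nu: "\<And>k. k \<in> index_set n \<Longrightarrow> \<phi> (nu_elt n k) = \<psi> (nu_elt n k)" and y: "y \<in> carrier (F_ne n)"
  shows "\<phi> y = \<psi> y"
proof -
  interpret F: field "F_ne n" by (rule field_F_ne)
  \<comment> \<open>The functions on which both endomorphisms agree form an algebra containing the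
    invariants and the eigenvalues, hence everything the expansion produces.\<close>
  define E where "E = {f \<in> R_e n. \<phi> (ratio n f (\<lambda>_. 1)) = \<psi> (ratio n f (\<lambda>_. 1))}"
  have emb: "ratio n f (\<lambda>_. 1) \<in> carrier (F_ne n)" if "f \<in> R_e n" for f by (rule ratio_in[OF that nz_one])
  have pull: "(\<lambda>z. g (snd z)) \<in> E" if "g \<in> R_o n" for g
    unfolding E_def using R_o_pullback[OF that] fixed[OF ratio_embed_invariant[OF that]] by simp
  interpret E: fun_alg E
  proof
    show "(\<lambda>_. c) \<in> E" for c by (rule pull[OF R_o.const])
    fix f g assume "f \<in> E" "g \<in> E"
    then have f: "f \<in> R_e n" "\<phi> (ratio n f (\<lambda>_. 1)) = \<psi> (ratio n f (\<lambda>_. 1))"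
      and g: "g \<in> R_e n" "\<phi> (ratio n g (\<lambda>_. 1)) = \<psi> (ratio n g (\<lambda>_. 1))" unfolding E_def by auto
    have "ratio n (\<lambda>z. f z + g z) (\<lambda>_. 1) = ratio n f (\<lambda>_. 1) \<oplus>\<^bsub>F_ne n\<^esub> ratio n g (\<lambda>_. 1)"
      unfolding ratio_add[OF f(1) nz_one g(1) nz_one] by simp
    then show "(\<lambda>z. f z + g z) \<in> E"
      unfolding E_def using R_e.add[OF f(1) g(1)] f g
      by (simp add: ring_hom_add[OF \<phi> emb emb] ring_hom_add[OF \<psi> emb emb])
    have "ratio n (\<lambda>z. f z * g z) (\<lambda>_. 1) = ratio n f (\<lambda>_. 1) \<otimes>\<^bsub>F_ne n\<^esub> ratio n g (\<lambda>_. 1)"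
      unfolding ratio_mult[OF f(1) nz_one g(1) nz_one] by simp
    then show "(\<lambda>z. f z * g z) \<in> E"
      unfolding E_def using R_e.mult[OF f(1) g(1)] f g
      by (simp add: ring_hom_mult[OF \<phi> emb emb] ring_hom_mult[OF \<psi> emb emb])
  qed
  have nuE: "(\<lambda>z. fst z k) \<in> E" if "k \<in> index_set n" for k
    unfolding E_def using R_e_nu[OF that] nu[OF that] unfolding nu_elt_def by simp
  have RE: "\<phi> (ratio n f (\<lambda>_. 1)) = \<psi> (ratio n f (\<lambda>_. 1))" if f: "f \<in> R_e n" for f
  proof -
    obtain c where c: "\<And>S. c S \<in> R_o n" "\<And>z. z \<in> M_Omega_e n \<Longrightarrow> f z = (\<Sum>S\<in>Pow (same_level n). c S (snd z) * nu_product S z)"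
      by (rule regular_expansion[OF f], rule that) simp_all
    have "(\<lambda>z. nu_product S z) \<in> E" if "S \<in> Pow (same_level n)" for S
      unfolding nu_product_def using that by (intro E.prod nuE) (auto simp: same_level_def)
    then have "(\<lambda>z. \<Sum>S\<in>Pow (same_level n). c S (snd z) * nu_product S z) \<in> E"
      by (intro E.sum E.mult pull c(1))
    moreover have "ratio n f (\<lambda>_. 1) = ratio n (\<lambda>z. \<Sum>S\<in>Pow (same_level n). c S (snd z) * nu_product S z) (\<lambda>_. 1)"
      by (rule ratio_cong) (use c(2) in auto)
    ultimately show ?thesis unfolding E_def by simp
  qed
  obtain f g where fg: "f \<in> R_e n" "g \<in> nz n" "y = ratio n f g" using y by (rule ratioE)
  have g: "g \<in> R_e n" using nz_R_e[OF fg(2)] .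
  have yg: "y \<otimes>\<^bsub>F_ne n\<^esub> ratio n g (\<lambda>_. 1) = ratio n f (\<lambda>_. 1)"
    unfolding fg(3) ratio_mult[OF fg(1,2) g nz_one]
      ratio_eq_iff[OF R_e.mult[OF fg(1) g] nz_mult[OF fg(2) nz_one] fg(1) nz_one] by simp
  have nz: "ratio n g (\<lambda>_. 1) \<noteq> \<zero>\<^bsub>F_ne n\<^esub>"
    unfolding ratio_zero ratio_eq_iff[OF g nz_one R_e.const nz_one] using fg(2) unfolding nz_def by auto
  have "\<phi> (ratio n g (\<lambda>_. 1)) \<noteq> \<zero>\<^bsub>F_ne n\<^esub>"
    using inj_onD[OF non_trivial_field_hom_is_inj[OF \<phi> field_F_ne field_F_ne] _ emb[OF g] F.zero_closed] nz
      ring_hom_zero[OF \<phi> F.ring_axioms F.ring_axioms] by auto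
  moreover have "\<phi> y \<otimes>\<^bsub>F_ne n\<^esub> \<phi> (ratio n g (\<lambda>_. 1)) = \<psi> y \<otimes>\<^bsub>F_ne n\<^esub> \<phi> (ratio n g (\<lambda>_. 1))"
    using ring_hom_mult[OF \<phi> y emb[OF g]] ring_hom_mult[OF \<psi> y emb[OF g]] RE[OF fg(1)] RE[OF g] unfolding yg by simp
  ultimately show ?thesis
    using F.m_rcancel[of "\<phi> (ratio n g (\<lambda>_. 1))" "\<phi> y" "\<psi> y"] ring_hom_closed[OF \<phi>] ring_hom_closed[OF \<psi>] y emb[OF g] by simp
qed

text \<open>An automorphism sends each eigenvalue function into its orbit, which stays on the same
  level; by injectivity it permutes each level, and it is determined by these values.\<close>

lemma galois_group_automorphism:
  assumes "\<phi> \<in> carrier (galois_group (F_ne n) (F_ne_invariants n))"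
  obtains \<sigma> where "\<sigma> \<in> carrier (Sigma_grp n)" "\<phi> = field_act n \<sigma>"
proof -
  interpret A: finite_field_action "F_ne n" "Sigma_grp n" "field_act n" by (rule field_action)
  have \<phi>: "\<phi> \<in> Bij (carrier (F_ne n))" "\<phi> \<in> Ring.ring_hom (F_ne n) (F_ne n)" "\<And>a. a \<in> F_ne_invariants n \<Longrightarrow> \<phi> a = a"
    using assms unfolding carrier_galois_group by auto
  have ex: "\<exists>j. (j, m) \<in> index_set n \<and> \<phi> (nu_elt n (i, m)) = nu_elt n (j, m)" if k: "(i, m) \<in> index_set n" for i m
  proof -
    have "\<phi> (nu_elt n (i, m)) \<in> A.orb (nu_elt n (i, m))"
      by (rule A.automorphism_in_orb[OF \<phi>(2) _ nu_elt_in[OF k]]) (simp add: fixed_eq \<phi>(3))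
    then obtain \<sigma> where \<sigma>: "\<sigma> \<in> carrier (Sigma_grp n)" "\<phi> (nu_elt n (i, m)) = field_act n \<sigma> (nu_elt n (i, m))"
      unfolding A.orb_def by blast
    then show ?thesis
      using field_act_nu_elt[OF \<sigma>(1) k] by (intro exI[of _ "\<sigma> m i"]) simp
  qed
  \<comment> \<open>Set to the identity outside the level, as required of a permutation of
    \<open>{1..m}\<close>.\<close>
  define t where "t m i = (if i \<in> {1..m} then SOME j. (j, m) \<in> index_set n \<and> \<phi> (nu_elt n (i, m)) = nu_elt n (j, m) else i)" for m i
  have t: "(t m i, m) \<in> index_set n \<and> \<phi> (nu_elt n (i, m)) = nu_elt n (t m i, m)" if k: "(i, m) \<in> index_set n" for i m
  proof -
    have i: "i \<in> {1..m}" using k unfolding index_set_iff by simp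
    show ?thesis unfolding t_def if_P[OF i] by (rule someI_ex[OF ex[OF k]])
  qed
  have inj: "inj_on \<phi> (carrier (F_ne n))" using \<phi>(1) unfolding Bij_def bij_betw_def by simp
  define \<sigma> where "\<sigma> = (\<lambda>m\<in>{1..n}. t m)"
  have "t m permutes {1..m}" if m: "m \<in> {1..n}" for m
  proof (rule bij_imp_permutes)
    have sub: "t m ` {1..m} \<subseteq> {1..m}" using t m unfolding index_set_iff by blast
    have "inj_on (t m) {1..m}"
    proof (rule inj_onI)
      fix i j assume ij: "i \<in> {1..m}" "j \<in> {1..m}" "t m i = t m j"
      then have k: "(i, m) \<in> index_set n" "(j, m) \<in> index_set n" using m unfolding index_set_iff by auto
      have "nu_elt n (i, m) = nu_elt n (j, m)"
        using inj_onD[OF inj _ nu_elt_in[OF k(1)] nu_elt_in[OF k(2)]] t[OF k(1)] t[OF k(2)] ij(3) by simp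
      then show "i = j" unfolding nu_elt_eq_iff[OF k] .
    qed
    then show "bij_betw (t m) {1..m} {1..m}" using endo_inj_surj[OF _ sub] unfolding bij_betw_def by simp
    show "t m i = i" if "i \<notin> {1..m}" for i unfolding t_def if_not_P[OF that] ..
  qed
  then have \<sigma>: "\<sigma> \<in> carrier (Sigma_grp n)" unfolding carrier_Sigma_grp \<sigma>_def by auto
  have "\<phi> y = field_act n \<sigma> y" if y: "y \<in> carrier (F_ne n)" for y
  proof (rule endomorphisms_eq[OF \<phi>(2) field_act_hom[OF \<sigma>] _ _ y])
    show "\<phi> a = field_act n \<sigma> a" if "a \<in> F_ne_invariants n" for a
      using \<phi>(3)[OF that] that \<sigma> unfolding F_ne_invariants_def by simp
    fix k assume k: "k \<in> index_set n"
    obtain i m where im: "k = (i, m)" by (cases k)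
    then have "\<sigma> m = t m" using k unfolding \<sigma>_def im index_set_iff by simp
    then show "\<phi> (nu_elt n k) = field_act n \<sigma> (nu_elt n k)"
      using t k field_act_nu_elt(1)[OF \<sigma>] unfolding im by simp
  qed
  then have "\<phi> = field_act n \<sigma>"
    using \<phi>(1) field_act_Bij[OF \<sigma>] by (intro extensionalityI[of \<phi> "carrier (F_ne n)"]) (auto simp: Bij_def)
  then show ?thesis using that[OF \<sigma>] by simp
qed

theorem field_act_iso: "field_act n \<in> iso (Sigma_grp n) (galois_group (F_ne n) (F_ne_invariants n))"
proof -
  interpret A: finite_field_action "F_ne n" "Sigma_grp n" "field_act n" by (rule field_action)
  have "field_act n \<in> hom (Sigma_grp n) (galois_group (F_ne n) (F_ne_invariants n))"
  proof (rule homI[OF field_act_galois])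
    fix \<sigma> \<tau> assume st: "\<sigma> \<in> carrier (Sigma_grp n)" "\<tau> \<in> carrier (Sigma_grp n)"
    have "field_act n (\<sigma> \<otimes>\<^bsub>Sigma_grp n\<^esub> \<tau>) = compose (carrier (F_ne n)) (field_act n \<sigma>) (field_act n \<tau>)"
    proof (rule extensionalityI[where A = "carrier (F_ne n)"])
      show "field_act n (\<sigma> \<otimes>\<^bsub>Sigma_grp n\<^esub> \<tau>) \<in> extensional (carrier (F_ne n))"
        by (rule Bij_imp_extensional[OF field_act_Bij[OF A.G.m_closed[OF st]]])
    qed (simp_all add: compose_eq field_act_mult[OF st])
    then show "field_act n (\<sigma> \<otimes>\<^bsub>Sigma_grp n\<^esub> \<tau>)
        = field_act n \<sigma> \<otimes>\<^bsub>galois_group (F_ne n) (F_ne_invariants n)\<^esub> field_act n \<tau>"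
      unfolding galois_group_def BijGroup_def using field_act_Bij[OF st(1)] field_act_Bij[OF st(2)] by simp
  qed
  moreover have "inj_on (field_act n) (carrier (Sigma_grp n))"
  proof (rule inj_onI)
    fix \<sigma> \<tau> assume st: "\<sigma> \<in> carrier (Sigma_grp n)" "\<tau> \<in> carrier (Sigma_grp n)" "field_act n \<sigma> = field_act n \<tau>"
    have eq: "\<sigma> m i = \<tau> m i" if "m \<in> {1..n}" "i \<in> {1..m}" for m i
    proof -
      have k: "(i, m) \<in> index_set n" using that unfolding index_set_iff by simp
      have "nu_elt n (\<sigma> m i, m) = nu_elt n (\<tau> m i, m)"
        using field_act_nu_elt(1)[OF st(1) k] field_act_nu_elt(1)[OF st(2) k] st(3) by simp
      then show ?thesis
        unfolding nu_elt_eq_iff[OF field_act_nu_elt(2)[OF st(1) k] field_act_nu_elt(2)[OF st(2) k]] .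
    qed
    show "\<sigma> = \<tau>"
    proof (rule extensionalityI[where A = "{1..n}"])
      show "\<sigma> \<in> extensional {1..n}" "\<tau> \<in> extensional {1..n}" using st(1,2) unfolding carrier_Sigma_grp PiE_def by auto
      fix m assume m: "m \<in> {1..n}"
      have "\<sigma> m i = \<tau> m i" for i
        using eq[OF m, of i] permutes_not_in[OF Sigma_grp_permutes[OF st(1) m], of i]
          permutes_not_in[OF Sigma_grp_permutes[OF st(2) m], of i] by (cases "i \<in> {1..m}") auto
      then show "\<sigma> m = \<tau> m" by (rule ext)
    qed
  qed
  moreover have "\<phi> \<in> field_act n ` carrier (Sigma_grp n)"
    if \<phi>: "\<phi> \<in> carrier (galois_group (F_ne n) (F_ne_invariants n))" for \<phi>
    using galois_group_automorphism[OF \<phi>] by blast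
  ultimately show ?thesis
    unfolding iso_def bij_betw_def using field_act_galois by blast
qed

section \<open>Integral closure\<close>

lemma ratio_pow:
  assumes "f \<in> R_e n" "g \<in> nz n"
  shows "ratio n f g [^]\<^bsub>F_ne n\<^esub> (l::nat) = ratio n (\<lambda>z. f z ^ l) (\<lambda>z. g z ^ l) \<and> (\<lambda>z. g z ^ l) \<in> nz n"
proof (induction l)
  case 0
  interpret F: field "F_ne n" by (rule field_F_ne)
  show ?case using ratio_one nz_one by simp
next
  case (Suc l)
  interpret F: field "F_ne n" by (rule field_F_ne)
  have nz: "(\<lambda>z. g z ^ Suc l) \<in> nz n" using nz_mult[OF assms(2), of "\<lambda>z. g z ^ l"] Suc by simp
  have "ratio n f g [^]\<^bsub>F_ne n\<^esub> Suc l = ratio n (\<lambda>z. f z ^ l) (\<lambda>z. g z ^ l) \<otimes>\<^bsub>F_ne n\<^esub> ratio n f g"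
    using Suc by simp
  also have "\<dots> = ratio n (\<lambda>z. f z ^ Suc l) (\<lambda>z. g z ^ Suc l)"
    unfolding ratio_mult[OF R_e.power[OF assms(1)] conjunct2[OF Suc] assms] by (simp add: mult.commute)
  finally show ?case using nz by simp
qed

text \<open>\<open>rev\<close> is needed because lists start with the leading coefficient. The power
  \<open>g ^ length ps\<close>, one above the degree, lets the induction start at the empty list and
  leaves one surplus factor \<open>g\<close> in every term.\<close>

lemma ratio_eval:
  assumes f: "f \<in> R_e n" and g: "g \<in> nz n" and ps: "set ps \<subseteq> R_e n"
  shows "ring.eval (F_ne n) (map (\<lambda>c. ratio n c (\<lambda>_. 1)) ps) (ratio n f g) =
    ratio n (\<lambda>z. \<Sum>j<length ps. (rev ps ! j) z * f z ^ j * g z ^ (length ps - j)) (\<lambda>z. g z ^ length ps)"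
  using ps
proof (induction ps)
  case Nil
  interpret F: field "F_ne n" by (rule field_F_ne)
  show ?case by (simp add: ratio_zero)
next
  case (Cons x ps)
  interpret F: field "F_ne n" by (rule field_F_ne)
  let ?l = "length ps"
  define K where "K = (\<lambda>z. \<Sum>j<?l. (rev ps ! j) z * f z ^ j * g z ^ (?l - j))"
  have x: "x \<in> R_e n" using Cons.prems by simp
  have "rev ps ! j \<in> R_e n" if "j < ?l" for j
    using nth_mem[of j "rev ps"] that Cons.prems by auto
  then have K: "K \<in> R_e n" unfolding K_def
    by (intro R_e.sum R_e.mult R_e.power f nz_R_e[OF g]) auto
  note pw = ratio_pow[OF f g, THEN conjunct1] and gz = ratio_pow[OF f g, THEN conjunct2]
  have K': "(\<Sum>j<Suc ?l. (rev (x # ps) ! j) z * f z ^ j * g z ^ (Suc ?l - j)) = g z * K z + x z * f z ^ ?l * g z" for z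
  proof -
    have "(\<Sum>j<?l. (rev (x # ps) ! j) z * f z ^ j * g z ^ (Suc ?l - j)) = g z * K z"
      unfolding K_def sum_distrib_left by (rule sum.cong) (auto simp: nth_append Suc_diff_le)
    then show ?thesis by (simp add: nth_append Suc_diff_le)
  qed
  have R: "(\<lambda>z. x z * f z ^ ?l) \<in> R_e n" by (intro R_e.mult x R_e.power f)
  have R': "(\<lambda>z. x z * f z ^ ?l * g z ^ ?l + K z * g z ^ ?l) \<in> R_e n"
    "(\<lambda>z. g z * K z + x z * f z ^ ?l * g z) \<in> R_e n"
    by (intro R_e.add R_e.mult x R_e.power f nz_R_e[OF g] K)+
  have "ring.eval (F_ne n) (map (\<lambda>c. ratio n c (\<lambda>_. 1)) (x # ps)) (ratio n f g) =
      ratio n x (\<lambda>_. 1) \<otimes>\<^bsub>F_ne n\<^esub> ratio n (\<lambda>z. f z ^ ?l) (\<lambda>z. g z ^ ?l) \<oplus>\<^bsub>F_ne n\<^esub> ratio n K (\<lambda>z. g z ^ ?l)"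
    using Cons.IH Cons.prems pw unfolding K_def by simp
  also have "\<dots> = ratio n (\<lambda>z. x z * f z ^ ?l * g z ^ ?l + K z * g z ^ ?l) (\<lambda>z. g z ^ ?l * g z ^ ?l)"
    using ratio_mult[OF x nz_one R_e.power[OF f] gz, of ?l ?l] ratio_add[OF R gz K gz, of ?l ?l] by simp
  also have "\<dots> = ratio n (\<lambda>z. g z * K z + x z * f z ^ ?l * g z) (\<lambda>z. g z ^ Suc ?l)"
    unfolding ratio_eq_iff[OF R'(1) nz_mult[OF gz gz] R'(2) gz] by (simp add: algebra_simps)
  also have "\<dots> = ratio n (\<lambda>z. \<Sum>j<length (x # ps). (rev (x # ps) ! j) z * f z ^ j * g z ^ (length (x # ps) - j))
      (\<lambda>z. g z ^ length (x # ps))"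
    unfolding length_Cons K' ..
  finally show ?case .
qed

text \<open>Clearing denominators turns a monic equation for the fraction into the homogeneous
  equation of \<open>R_e_integrally_closed\<close>, whose conclusion says that \<open>g\<close>
  divides \<open>f\<close>.\<close>

lemma integral_imp_regular:
  assumes f: "f \<in> R_e n" and g: "g \<in> nz n" and ps: "set ps \<subseteq> R_e n" "ps \<noteq> []"
    and monic: "\<And>z. z \<in> M_Omega_e n \<Longrightarrow> hd ps z = 1"
    and root: "ring.eval (F_ne n) (map (\<lambda>c. ratio n c (\<lambda>_. 1)) ps) (ratio n f g) = \<zero>\<^bsub>F_ne n\<^esub>"
  obtains h where "h \<in> R_e n" "ratio n f g = ratio n h (\<lambda>_. 1)"
proof -
  obtain x qs where xq: "ps = x # qs" using ps(2) by (cases ps) auto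
  define d where "d = length qs"
  define c where "c j = rev qs ! j" for j
  have c: "c j \<in> R_e n" if "j < d" for j
    using nth_mem[of j "rev qs"] that ps(1) unfolding c_def d_def xq by auto
  have rev: "rev ps ! j \<in> R_e n" if "j < length ps" for j
    using nth_mem[of j "rev ps"] that ps(1) by auto
  define H where "H = (\<lambda>z. f z ^ d + (\<Sum>j<d. c j z * f z ^ j * g z ^ (d - j)))"
  have H: "H \<in> R_e n" unfolding H_def
    by (intro R_e.add R_e.sum R_e.mult R_e.power f nz_R_e[OF g]) (use c in auto)
  \<comment> \<open>Splits off the surplus factor \<open>g\<close> left by
    \<open>ratio_eval\<close>; it cancels because the ring is a domain.\<close>
  have gH: "(\<Sum>j<length ps. (rev ps ! j) z * f z ^ j * g z ^ (length ps - j)) = g z * H z" if "z \<in> M_Omega_e n" for z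
  proof -
    have "(\<Sum>j<d. (rev ps ! j) z * f z ^ j * g z ^ (Suc d - j)) = (\<Sum>j<d. g z * (c j z * f z ^ j * g z ^ (d - j)))"
      by (rule sum.cong) (auto simp: nth_append Suc_diff_le xq c_def d_def)
    moreover have "length ps = Suc d" "(rev ps ! d) z = 1" using monic[OF that] by (auto simp: xq d_def nth_append)
    ultimately show ?thesis unfolding H_def by (simp add: sum_distrib_left algebra_simps Suc_diff_le)
  qed
  have "(\<lambda>z. \<Sum>j<length ps. (rev ps ! j) z * f z ^ j * g z ^ (length ps - j)) \<in> R_e n"
    by (intro R_e.sum R_e.mult R_e.power f nz_R_e[OF g]) (use rev in auto)
  from root[unfolded ratio_eval[OF f g ps(1)] ratio_zero
      ratio_eq_iff[OF this ratio_pow[OF f g, THEN conjunct2] R_e.const nz_one]]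
  have 0: "g z * H z = 0" if "z \<in> M_Omega_e n" for z using gH[OF that] that by simp
  obtain w where w: "w \<in> M_Omega_e n" "g w \<noteq> 0" using g unfolding nz_def by blast
  have "H z = 0" if "z \<in> M_Omega_e n" for z by (rule R_e_domain[OF nz_R_e[OF g] H 0 w that])
  then have eq: "f z ^ d + (\<Sum>j<d. c j z * f z ^ j * g z ^ (d - j)) = 0" if "z \<in> M_Omega_e n" for z
    using that unfolding H_def by blast
  have "\<exists>h\<in>R_e n. \<forall>z\<in>M_Omega_e n. f z = h z * g z"
  proof (rule R_e_integrally_closed[where c = c and d = d])
    show "c j \<in> R_e n" if "j < d" for j by (rule c[OF that])
    show "f z ^ d + (\<Sum>j<d. c j z * f z ^ j * g z ^ (d - j)) = 0" if "z \<in> M_Omega_e n" for z by (rule eq[OF that])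
    show "\<exists>h\<in>R_e n. \<forall>z\<in>M_Omega_e n. f z = h z * g z"
      if "h \<in> R_e n" "\<And>z. z \<in> M_Omega_e n \<Longrightarrow> f z = h z * g z" for h
      using that by blast
  qed (fact f nz_R_e[OF g] w)+
  then obtain h where h: "h \<in> R_e n" "\<And>z. z \<in> M_Omega_e n \<Longrightarrow> f z = h z * g z" by blast
  show ?thesis
    by (rule that[OF h(1)]) (use ratio_eq_iff[OF f g h(1) nz_one] h(2) in simp)
qed

text \<open>The embedded ring of \<open>M_Omega n\<close> is the part of the embedded ring of the
  cover lying in the fixed field; this is where the coefficients of orbit polynomials of regular
  functions belong.\<close>

lemma embedded_invariants:
  "fract_embed (ring_M_Omega_e n) ` pullback (M_Omega_e n) pi_n ` O_M_Omega n =
    (\<lambda>f. ratio n f (\<lambda>_. 1)) ` R_e n \<inter> F_ne_invariants n" (is "?A = ?B")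
proof
  show "?A \<subseteq> ?B"
  proof
    fix y assume "y \<in> ?A"
    then obtain g where g: "g \<in> O_M_Omega n" "y = fract_embed (ring_M_Omega_e n) (pullback (M_Omega_e n) pi_n g)" by blast
    then have R: "g \<in> R_o n" unfolding O_M_Omega_iff by simp
    have "y = ratio n (\<lambda>z. g (snd z)) (\<lambda>_. 1)"
      unfolding g(2) pullback_def pi_n_def by (rule fract_embed_ratio)
    then show "y \<in> ?B" using R_o_pullback[OF R] ratio_embed_invariant[OF R] by blast
  qed
  show "?B \<subseteq> ?A"
  proof
    fix y assume y: "y \<in> ?B"
    then obtain f where f: "f \<in> R_e n" "y = ratio n f (\<lambda>_. 1)" by blast
    obtain g where g: "g \<in> R_o n" "\<And>z. z \<in> M_Omega_e n \<Longrightarrow> f z = g (snd z)"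
      using y ratio_invariant_iff[OF f(1) R_o.const[of 1] nz_one] unfolding f(2) by blast
    have O: "restrict g (M_Omega n) \<in> O_M_Omega n" using g(1) unfolding R_o_def by simp
    have "restrict f (M_Omega_e n) = pullback (M_Omega_e n) pi_n (restrict g (M_Omega n))"
      unfolding pullback_def pi_n_def restrict_const_eq_iff using g(2) M_Omega_eD(5) by simp
    then have "y = fract_embed (ring_M_Omega_e n) (pullback (M_Omega_e n) pi_n (restrict g (M_Omega n)))"
      unfolding f(2) fract_embed_ratio[symmetric] by simp
    then show "y \<in> ?A" using O by blast
  qed
qed

text \<open>A regular function is a root of its orbit polynomial, whose coefficients are regular and
  invariant. Conversely, an element integral over the invariants is integral over the ring of the
  cover, which is integrally closed.\<close>

theorem integral_closure_invariants:
  "integral_closure (F_ne n) (fract_embed (ring_M_Omega_e n) ` pullback (M_Omega_e n) pi_n ` O_M_Omega n) =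
    fract_embed (ring_M_Omega_e n) ` O_M_Omega_e n" (is "?I = ?E")
proof -
  interpret A: finite_field_action "F_ne n" "Sigma_grp n" "field_act n" by (rule field_action)
  let ?B = "(\<lambda>f. ratio n f (\<lambda>_. 1)) ` R_e n"
  have E: "?E = ?B" by (rule fract_embed_image)
  have emb: "ratio n f (\<lambda>_. 1) \<in> carrier (F_ne n)" if "f \<in> R_e n" for f by (rule ratio_in[OF that nz_one])
  interpret h: ring_hom_ring "ring_M_Omega_e n" "F_ne n" "fract_embed (ring_M_Omega_e n)"
    by (rule ring_hom_ringI2[OF ring_e.ring_axioms A.ring_axioms]) (use ring_e.fract_embed_hom in \<open>simp add: F_ne_def\<close>)
  have subring: "subring ?B (F_ne n)"
    using h.img_is_subring[OF ring_e.carrier_is_subring] E by simp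
  show ?thesis
  proof
    show "?E \<subseteq> ?I"
    proof
      fix y assume "y \<in> ?E"
      then obtain f where f: "f \<in> R_e n" "y = ratio n f (\<lambda>_. 1)" unfolding E by blast
      have y: "y \<in> carrier (F_ne n)" unfolding f(2) by (rule emb[OF f(1)])
      have orb: "A.orb y \<subseteq> ?B"
      proof
        fix x assume "x \<in> A.orb y"
        then obtain \<sigma> where \<sigma>: "\<sigma> \<in> carrier (Sigma_grp n)" "x = field_act n \<sigma> y" unfolding A.orb_def by blast
        show "x \<in> ?B"
          unfolding \<sigma>(2) f(2) field_act_ratio[OF \<sigma>(1) f(1) nz_one]
          using R_e_act[OF f(1) A.G.inv_closed[OF \<sigma>(1)]] by blast
      qed
      note P = A.root_poly_monic[OF A.carrier_is_subring A.orb_facts(1,2)[OF y]]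
      have "A.root_poly (A.orb y) \<in> carrier (univ_poly (F_ne n) (?B \<inter> F_ne_invariants n))"
        using A.orbit_poly_fixed[OF y subring orb] unfolding fixed_eq .
      then show "y \<in> ?I"
        unfolding integral_closure_def embedded_invariants
        using y P A.root_poly_eval[OF A.orb_facts(1-3)[OF y]] by blast
    qed
    show "?I \<subseteq> ?E"
    proof
      fix y assume "y \<in> ?I"
      then obtain p where y: "y \<in> carrier (F_ne n)"
        and p: "p \<in> carrier (univ_poly (F_ne n) (?B \<inter> F_ne_invariants n))" "p \<noteq> []" "hd p = \<one>\<^bsub>F_ne n\<^esub>" "A.eval p y = \<zero>\<^bsub>F_ne n\<^esub>"
        unfolding integral_closure_def embedded_invariants by blast
      have "set p \<subseteq> ?B" using A.polynomial_incl[OF p(1)[folded univ_poly_carrier]] by blast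
      then have "p \<in> lists ?B" by auto
      then obtain ps where ps: "set ps \<subseteq> R_e n" "p = map (\<lambda>f. ratio n f (\<lambda>_. 1)) ps"
        unfolding lists_image by auto
      have ne: "ps \<noteq> []" using p(2) ps(2) by simp
      obtain f g where fg: "f \<in> R_e n" "g \<in> nz n" "y = ratio n f g" using y by (rule ratioE)
      have hd: "hd ps \<in> R_e n" using ps(1) ne by (cases ps) auto
      have "ratio n (hd ps) (\<lambda>_. 1) = ratio n (\<lambda>_. 1) (\<lambda>_. 1)"
        using p(3) ps(2) ne ratio_one by (cases ps) auto
      then have monic: "hd ps z = 1" if "z \<in> M_Omega_e n" for z
        unfolding ratio_eq_iff[OF hd nz_one R_e.const nz_one] using that by simp
      obtain h where "h \<in> R_e n" "ratio n f g = ratio n h (\<lambda>_. 1)"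
        using integral_imp_regular[OF fg(1,2) ps(1) ne monic] p(4) unfolding ps(2) fg(3) by blast
      then show "y \<in> ?E" unfolding E fg(3) by blast
    qed
  qed
qed

theorem proposition4p12:
  fixes n :: nat
  assumes "n \<ge> 1"
  shows
    "variety_iso (orbit_space n) (O_orbit_space n) (M_Omega n) (O_M_Omega n) pi_bar \<and>
     finite_morphism (M_Omega_e n) (O_M_Omega_e n) (M_Omega n) (O_M_Omega n) pi_n \<and>
     field_pullback n \<in> ring_iso (F_n n) ((F_ne n)\<lparr>carrier := F_ne_invariants n\<rparr>) \<and>
     galois_extension (F_ne n) (field_pullback n ` carrier (F_n n)) \<and>
     field_act n \<in> iso (Sigma_grp n)
           (galois_group (F_ne n) (field_pullback n ` carrier (F_n n))) \<and>
     integral_closure (F_ne n)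
           (fract_embed (ring_M_Omega_e n) ` pullback (M_Omega_e n) pi_n ` O_M_Omega n)
         = fract_embed (ring_M_Omega_e n) ` O_M_Omega_e n"
  using orbit_space_iso[of n] finite_morphism_pi_n[of n] field_pullback_iso[of n]
    galois_extension_F_ne[of n] field_act_iso[of n] integral_closure_invariants[of n]
  \<comment> \<open>The Galois results are stated over the fixed field; this identifies it with the
    image of F(n).\<close>
  unfolding invariants_eq by blast

end
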